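(* Let $J=\begin{pmatrix}0&0&1\\0&1&0\\1&0&0\end{pmatrix}$, $\mathbb{K}=\mathbb{Q}(i\sqrt7)$, $\mathcal{O}_7$ its ring of integers, $\tau=\frac{1+i\sqrt7}{2}$, and $\Gamma=PU(J,\mathcal{O}_7)$. The following elements are representatives of the conjugacy classes in $\Gamma$ of torsion elements with an isolated fixed point in $H^2_{\mathbb{C}}$. In each case we list the matrix, a primitive vector $v$ representing its fixed point and $\langle v,v\rangle$ (or the fact that the fixed point is not represented by a vector in $\mathbb{K}^3$), the order $s$ of the stabilizer of the fixed point in $\Gamma$, and the numbers $n_1,n_2$ of $1$-lines and of $2$-lines through the fixed point. Order 2: (2a) $\begin{pmatrix}i\sqrt7&0&4\\0&1&0\\2&0&-i\sqrt7\end{pmatrix}$, $v=(-\bar\tau,0,1)$, $\langle v,v\rangle=-1$, $s=8$, $n_1=2$, $n_2=2$. (2b) $\begin{pmatrix}0&0&1\\0&1&0\\1&0&0\end{pmatrix}$, $v=(-1,0,1)$, $\langle v,v\rangle=-2$, $s=4$, $n_1=1$, $n_2=1$. (2c) $\begin{pmatrix}-\bar\tau&\tau&2\\\tau&2&\bar\tau\\2&\bar\tau&-\tau\end{pmatrix}$, $v=(\tau,1,\bar\tau)$, $\langle v,v\rangle=-2$, $s=8$, $n_1=0$, $n_2=4$. Order 3: (3a) $\begin{pmatrix}-1&\tau&1\\-\bar\tau&1&0\\1&0&0\end{pmatrix}$, $v=(\tau,1,-\tau)$, $\langle v,v\rangle=-3$, $s=6$, $n_1=0$, $n_2=3$. (3b)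 $\begin{pmatrix}-1&-\bar\tau&1\\\tau&1&0\\1&0&0\end{pmatrix}$, $v=(-\bar\tau,1,\bar\tau)$, $\langle v,v\rangle=-3$, $s=6$, $n_1=0$, $n_2=3$. (3c) $\begin{pmatrix}5&0&-3i\sqrt7\\0&-1&0\\-i\sqrt7&0&-4\end{pmatrix}$, fixed point not represented in $\mathbb{K}^3$, $s=6$, $n_1=1$, $n_2=0$. Order 4: (4a) $\begin{pmatrix}0&0&1\\0&1&2\\1&-2&-2\end{pmatrix}$, $v=(-1,-1,1)$, $\langle v,v\rangle=-1$, $s=8$, $n_1=2$, $n_2=2$. (4b) $\begin{pmatrix}0&0&1\\0&1&1+\bar\tau\\1&-1-\tau&-2\end{pmatrix}$, $v=(\bar\tau,-\tau,-\bar\tau)$, $\langle v,v\rangle=-2$, $s=8$, $n_1=0$, $n_2=2+2$, meaning that there are four $2$-lines through the fixed point, which come in two distinct orbits under the action of the stabilizer. Order 6: (6) $\begin{pmatrix}-5&0&3i\sqrt7\\0&-1&0\\i\sqrt7&0&4\end{pmatrix}$, fixed point not represented in $\mathbb{K}^3$, $s=6$, $n_1=1$, $n_2=0$. Order 7: (7) $\begin{pmatrix}0&0&1\\0&1&1\\1&-1&-\bar\tau\end{pmatrix}$, fixed point not represented in $\mathbb{K}^3$, $s=7$, $n_1=0$, $n_2=0$.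
   Context: Write $\langle v,w\rangle=w^*Jv$ for $v,w\in\mathbb{C}^3$; this Hermitian form has signature $(2,1)$. $U(J)$ is the group of complex $3\times 3$ matrices preserving this form, $U(J,\mathcal{O}_7)=U(J)\cap GL(3,\mathcal{O}_7)$, and $PU(J,\mathcal{O}_7)=U(J,\mathcal{O}_7)/\{\pm Id\}$; its elements are denoted by matrix representatives, and orders are orders in $PU(J,\mathcal{O}_7)$. The complex hyperbolic plane $H^2_{\mathbb{C}}$ is the set of complex lines in $\mathbb{C}^3$ spanned by vectors $v$ with $\langle v,v\rangle<0$, with the projective action of $\Gamma$. A vector in $\mathcal{O}_7^3$ is primitive if the greatest common divisor of its entries is $1$. For $j=1,2$, a $j$-line is a complex line of $H^2_{\mathbb{C}}$ polar to $v$, i.e. the set of points of $H^2_{\mathbb{C}}$ represented by vectors of $v^\perp$, where $v\in\mathcal{O}_7^3$ is primitive with $\langle v,v\rangle=j$.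
   Formalization: As stated, the claim on conjugacy classes fails for (3c), (6), (7): the stabilizers are cyclic, so distinct generators are never conjugate. Classes are taken up to conjugacy of the generated cyclic subgroups; for the other seven rows conjugacy of elements is also proved. *)

theory Defs
  imports "HOL-Analysis.Analysis" "HOL-Algebra.Multiplicative_Group" "HOL-Algebra.Generated_Groups"
begin

section \<open>The field, its ring of integers, and the Hermitian form\<close>

definition i_sqrt7 :: complex where
  "i_sqrt7 = \<i> * complex_of_real (sqrt 7)"

definition \<tau> :: complex where
  "\<tau> = (1 + i_sqrt7) / 2"

definition K :: "complex set" where
  "K = {of_rat a + of_rat b * i_sqrt7 | a b. True}"

definition O7 :: "complex set" where
  "O7 = {x \<in> K. algebraic_int x}"

definition J :: "complex^3^3" where
  "J = vector [vector [0, 0, 1], vector [0, 1, 0], vector [1, 0, 0]]"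

text \<open>The form \<open>w\<^sup>* J v\<close>: linear in the first argument, conjugate-linear in the second.\<close>

definition herm :: "complex^3 \<Rightarrow> complex^3 \<Rightarrow> complex" where
  "herm v w = (\<Sum>i\<in>UNIV. cnj (w $ i) * (J *v v) $ i)"

definition primitive :: "complex^3 \<Rightarrow> bool" where
  "primitive v \<longleftrightarrow> (\<forall>i. v $ i \<in> O7) \<and>
     (\<forall>d\<in>O7. (\<forall>i. \<exists>c\<in>O7. v $ i = d * c) \<longrightarrow> (\<exists>c\<in>O7. d * c = 1))"


section \<open>The Picard modular group\<close>

definition U_J :: "(complex^3^3) set" where
  "U_J = {A. \<forall>v w. herm (A *v v) (A *v w) = herm v w}"

definition mats_O7 :: "(complex^3^3) set" where
  "mats_O7 = {A. \<forall>i j. A $ i $ j \<in> O7}"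

definition GL3_O7 :: "(complex^3^3) set" where
  "GL3_O7 = {A \<in> mats_O7. \<exists>B\<in>mats_O7. A ** B = mat 1 \<and> B ** A = mat 1}"

definition UJO7 :: "(complex^3^3) monoid" where
  "UJO7 = \<lparr>carrier = U_J \<inter> GL3_O7, mult = (**), one = mat 1\<rparr>"

definition \<Gamma> :: "(complex^3^3) set monoid" where
  "\<Gamma> = UJO7 Mod {mat 1, - mat 1}"

text \<open>The element of \<open>\<Gamma>\<close> represented by a matrix.\<close>

definition cls :: "complex^3^3 \<Rightarrow> (complex^3^3) set" where
  "cls A = {mat 1, - mat 1} #>\<^bsub>UJO7\<^esub> A"

definition torsion :: "(complex^3^3) set \<Rightarrow> bool" where
  "torsion X \<longleftrightarrow> X \<in> carrier \<Gamma> \<and> (\<exists>n::nat. n > 0 \<and> X [^]\<^bsub>\<Gamma>\<^esub> n = \<one>\<^bsub>\<Gamma>\<^esub>)"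

definition conj_elements :: "(complex^3^3) set \<Rightarrow> (complex^3^3) set \<Rightarrow> bool" where
  "conj_elements X Y \<longleftrightarrow>
     (\<exists>H\<in>carrier \<Gamma>. H \<otimes>\<^bsub>\<Gamma>\<^esub> X \<otimes>\<^bsub>\<Gamma>\<^esub> inv\<^bsub>\<Gamma>\<^esub> H = Y)"

text \<open>The cyclic subgroups generated by \<open>X\<close> and \<open>Y\<close> are conjugate; equivalently, \<open>Y\<close> is conjugate
  to an element generating the same cyclic subgroup as \<open>X\<close>. The classification is up to this
  relation because conjugacy of elements is too fine: the stabilizers of the fixed points of
  \<open>E3c\<close>, \<open>E6\<close>, \<open>E7\<close> below are cyclic, so the different generators of the cyclic group generated
  by such an element are never conjugate in \<open>\<Gamma>\<close>, and only one of them is listed.\<close>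

definition conj_cyclic :: "(complex^3^3) set \<Rightarrow> (complex^3^3) set \<Rightarrow> bool" where
  "conj_cyclic X Y \<longleftrightarrow>
     (\<exists>H\<in>carrier \<Gamma>.
        (\<lambda>Z. H \<otimes>\<^bsub>\<Gamma>\<^esub> Z \<otimes>\<^bsub>\<Gamma>\<^esub> inv\<^bsub>\<Gamma>\<^esub> H) ` generate \<Gamma> {X} = generate \<Gamma> {Y})"


section \<open>The complex hyperbolic plane\<close>

definition cline :: "complex^3 \<Rightarrow> (complex^3) set" where
  "cline v = range (\<lambda>c. c *s v)"

text \<open>\<open>herm v v\<close> is always real, so \<open>\<langle>v,v\<rangle> < 0\<close> is a condition on its real part.\<close>

definition negative :: "(complex^3) set" where
  "negative = {v. Re (herm v v) < 0}"

definition H2 :: "(complex^3) set set" where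
  "H2 = cline ` negative"

text \<open>The topology of \<open>H2\<close> as an open subset of the projective plane, i.e. the quotient topology
  of the open cone of negative vectors.\<close>

definition H2_top :: "(complex^3) set topology" where
  "H2_top = topology (\<lambda>U. U \<subseteq> H2 \<and> open {v \<in> negative. cline v \<in> U})"

text \<open>Both matrices in a coset map a line to the same line, so the union below is a single line.\<close>

definition act :: "(complex^3^3) set \<Rightarrow> (complex^3) set \<Rightarrow> (complex^3) set" where
  "act X p = (\<Union>A\<in>X. (*v) A ` p)"

definition fixed_points :: "(complex^3^3) set \<Rightarrow> (complex^3) set set" where
  "fixed_points X = {p \<in> H2. act X p = p}"

definition isolated_fixed_point :: "(complex^3^3) set \<Rightarrow> (complex^3) set \<Rightarrow> bool" where
  "isolated_fixed_point X p \<longleftrightarrow>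
     p \<in> fixed_points X \<and> p \<notin> H2_top derived_set_of fixed_points X"

definition stabilizer :: "(complex^3) set \<Rightarrow> (complex^3^3) set set" where
  "stabilizer p = {X \<in> carrier \<Gamma>. act X p = p}"

definition polar_line :: "complex^3 \<Rightarrow> (complex^3) set set" where
  "polar_line v = {p \<in> H2. \<forall>w\<in>p. herm w v = 0}"

definition j_lines :: "nat \<Rightarrow> (complex^3) set set set" where
  "j_lines j = {polar_line v | v. primitive v \<and> herm v v = of_nat j}"

definition j_lines_through :: "nat \<Rightarrow> (complex^3) set \<Rightarrow> (complex^3) set set set" where
  "j_lines_through j p = {L \<in> j_lines j. p \<in> L}"

definition j_line_orbits :: "nat \<Rightarrow> (complex^3) set \<Rightarrow> (complex^3) set set set set" where
  "j_line_orbits j p = (\<lambda>L. (\<lambda>X. act X ` L) ` stabilizer p) ` j_lines_through j p"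

lemma istopology_H2: "istopology (\<lambda>U. U \<subseteq> H2 \<and> open {v \<in> negative. cline v \<in> U})"
proof -
  have "open {v \<in> negative. cline v \<in> S \<inter> T}"
    if "open {v \<in> negative. cline v \<in> S}" "open {v \<in> negative. cline v \<in> T}" for S T
  proof -
    have "{v \<in> negative. cline v \<in> S \<inter> T}
        = {v \<in> negative. cline v \<in> S} \<inter> {v \<in> negative. cline v \<in> T}" by blast
    then show ?thesis using that by (simp add: open_Int)
  qed
  moreover have "open {v \<in> negative. cline v \<in> \<Union>\<K>}"
    if "\<forall>S\<in>\<K>. open {v \<in> negative. cline v \<in> S}" for \<K>
  proof -
    have "{v \<in> negative. cline v \<in> \<Union>\<K>} = (\<Union>S\<in>\<K>. {v \<in> negative. cline v \<in> S})" by blast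
    then show ?thesis using that by (simp add: open_UN)
  qed
  ultimately show ?thesis
    unfolding istopology_def by blast
qed

lemma openin_H2_top:
  "openin H2_top U \<longleftrightarrow> U \<subseteq> H2 \<and> open {v \<in> negative. cline v \<in> U}"
  by (simp add: H2_top_def topology_inverse' [OF istopology_H2])


section \<open>The representatives\<close>

datatype label = E2a | E2b | E2c | E3a | E3b | E3c | E4a | E4b | E6 | E7

fun rep :: "label \<Rightarrow> complex^3^3" where
  "rep E2a = vector [vector [i_sqrt7, 0, 4], vector [0, 1, 0], vector [2, 0, - i_sqrt7]]"
| "rep E2b = vector [vector [0, 0, 1], vector [0, 1, 0], vector [1, 0, 0]]"
| "rep E2c = vector [vector [- cnj \<tau>, \<tau>, 2], vector [\<tau>, 2, cnj \<tau>], vector [2, cnj \<tau>, - \<tau>]]"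
| "rep E3a = vector [vector [-1, \<tau>, 1], vector [- cnj \<tau>, 1, 0], vector [1, 0, 0]]"
| "rep E3b = vector [vector [-1, - cnj \<tau>, 1], vector [\<tau>, 1, 0], vector [1, 0, 0]]"
| "rep E3c = vector [vector [5, 0, - 3 * i_sqrt7], vector [0, -1, 0], vector [- i_sqrt7, 0, -4]]"
| "rep E4a = vector [vector [0, 0, 1], vector [0, 1, 2], vector [1, -2, -2]]"
| "rep E4b = vector [vector [0, 0, 1], vector [0, 1, 1 + cnj \<tau>], vector [1, - 1 - \<tau>, -2]]"
| "rep E6 = vector [vector [-5, 0, 3 * i_sqrt7], vector [0, -1, 0], vector [i_sqrt7, 0, 4]]"
| "rep E7 = vector [vector [0, 0, 1], vector [0, 1, 1], vector [1, -1, - cnj \<tau>]]"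

text \<open>\<open>fixed_point_data i r p s n1 n2\<close>: the element \<open>i\<close> has order \<open>r\<close>, \<open>p\<close> is its (only) fixed
  point, \<open>s\<close> is the order of the stabilizer of \<open>p\<close>, and \<open>n1\<close>, \<open>n2\<close> count the 1-lines and 2-lines
  through \<open>p\<close>. Finiteness is explicit because \<open>card\<close> is 0 on infinite sets.\<close>

definition fixed_point_data ::
    "label \<Rightarrow> nat \<Rightarrow> (complex^3) set \<Rightarrow> nat \<Rightarrow> nat \<Rightarrow> nat \<Rightarrow> bool" where
  "fixed_point_data i r p s n1 n2 \<longleftrightarrow>
     group.ord \<Gamma> (cls (rep i)) = r \<and>
     isolated_fixed_point (cls (rep i)) p \<and> fixed_points (cls (rep i)) = {p} \<and>
     finite (stabilizer p) \<and> card (stabilizer p) = s \<and>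
     finite (j_lines_through 1 p) \<and> card (j_lines_through 1 p) = n1 \<and>
     finite (j_lines_through 2 p) \<and> card (j_lines_through 2 p) = n2"

definition K_row ::
    "label \<Rightarrow> nat \<Rightarrow> complex^3 \<Rightarrow> complex \<Rightarrow> nat \<Rightarrow> nat \<Rightarrow> nat \<Rightarrow> bool" where
  "K_row i r v q s n1 n2 \<longleftrightarrow>
     primitive v \<and> herm v v = q \<and> fixed_point_data i r (cline v) s n1 n2"

definition non_K_row :: "label \<Rightarrow> nat \<Rightarrow> nat \<Rightarrow> nat \<Rightarrow> nat \<Rightarrow> bool" where
  "non_K_row i r s n1 n2 \<longleftrightarrow>
     (\<exists>p. fixed_point_data i r p s n1 n2 \<and> \<not> (\<exists>v. (\<forall>k. v $ k \<in> K) \<and> p = cline v))"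

end

theory Submission
  imports Defs "HOL-Computational_Algebra.Polynomial"
begin

text \<open>
  An element of finite order with an isolated fixed point has a trace in \<open>O7\<close> bounded by 3 together with the
  trace of its square, so its trace is one of \<open>-1, 0, 1, 2, -\<tau>, \<tau> - 1\<close> after normalising the determinant to 1.
  If the trace is rational, the element fixes a lattice vector; reducing the positive definite forms that arise from
  the Hermitian form by a sign change on a negative line bounds the Gram matrix of the orbit of a short vector, and
  a lattice together with an isometry is determined by such a Gram matrix and the glue between the vector and its
  complement. For trace \<open>-\<tau>\<close> a short vector is cyclic and its Gram determinant is a cubic form to be equal to \<open>-1\<close>.

  The stabilizer of a fixed point over \<open>K\<close> consists of the isometries of a binary lattice that preserve the
  glue, and the lines through the point come from its vectors of norm 1 and 2. Over larger fields the stabilizers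
  are cyclic, as follows from the arithmetic of the commuting matrices (orders 3 and 6) or from the possible
  traces (order 7).
\<close>

hide_const (open) UnivPoly.coeff UnivPoly.monom up_ring.coeff up_ring.monom

section \<open>Arithmetic of the ring of integers\<close>

text \<open>The constant 4/7 is the squared covering radius of \<open>O7\<close>. Being below 1 it
  makes \<open>O7\<close> Euclidean, and every size reduction loses a factor 1 - 4/7 = 3/7, which is
  where the bounds with 7/3 come from; they are small enough to leave finite checks. The listed
  matrices all have determinant -1. Since -1 acts trivially, elements are represented with
  determinant 1, so the classification compares them with \<open>- rep i\<close>, and
  \<open>rep i\<close> has eigenvalue -1 on a fixed line over \<open>K\<close>. With determinant 1
  the characteristic polynomial X^3 - t X^2 + cnj t X - 1 depends on the trace t alone. For rational
  t it has the root 1, which splits the lattice up to finite index; for t = -\<tau> it is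
  irreducible over \<open>K\<close>, there is no such vector, and a cubic form replaces the
  splitting. Isolation enters as simplicity of the eigenvalue on the fixed line: it excludes the
  identity and, for trace -1, the complex reflections of order 2.\<close>

lemma i_sqrt7_tau: "i_sqrt7 = 2 * \<tau> - 1"
  by (simp add: \<tau>_def field_simps)

lemma i_sqrt7_sq: "i_sqrt7 * i_sqrt7 = - 7"
proof -
  have "complex_of_real (sqrt 7) * complex_of_real (sqrt 7) = 7"
    by (metis abs_numeral of_real_mult of_real_numeral real_sqrt_mult_self)
  then show ?thesis
    by (simp add: i_sqrt7_def algebra_simps)
qed

lemma cnj_tau: "cnj \<tau> = 1 - \<tau>"
  by (simp add: \<tau>_def i_sqrt7_def complex_eq_iff field_simps)

lemma tau_sq: "\<tau> * \<tau> = \<tau> - 2"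
proof -
  have "(2 * \<tau> - 1) * (2 * \<tau> - 1) = - 7"
    using i_sqrt7_sq by (simp add: i_sqrt7_tau)
  then have "4 * (\<tau> * \<tau>) = 4 * (\<tau> - 2)" by (simp add: algebra_simps)
  then show ?thesis by (simp only: mult_cancel_left) simp
qed

lemma tau_sq': "\<tau> * (\<tau> * x) = \<tau> * x - 2 * x"
  by (metis (no_types, lifting) mult.assoc left_diff_distrib tau_sq)

lemma Re_tau [simp]: "Re \<tau> = 1/2" and Im_tau [simp]: "Im \<tau> = sqrt 7 / 2"
  by (simp_all add: \<tau>_def i_sqrt7_def)

lemmas tau_simps = i_sqrt7_tau cnj_tau tau_sq tau_sq'

lemma sqrt7_sq: "sqrt 7 * sqrt 7 = (7::real)" "sqrt 7 * (sqrt 7 * x) = 7 * (x::real)"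
  by (simp_all flip: mult.assoc)

lemma sqrt7_bounds: "sqrt 7 > 2" "sqrt 7 < (3::real)"
  by (simp_all add: real_less_rsqrt real_less_lsqrt)

lemma lin_tau_eq_iff:
  "complex_of_real a + of_real b * \<tau> = of_real c + of_real d * \<tau> \<longleftrightarrow> a = c \<and> b = d"
  by (auto simp: complex_eq_iff)

lemma tau_coords: obtains s t :: real where "z = of_real s + of_real t * \<tau>"
proof
  show "z = of_real (Re z - Im z / sqrt 7) + of_real (2 * Im z / sqrt 7) * \<tau>"
    by (simp add: complex_eq_iff)
qed

lemma cmod_lin_tau: "(cmod (of_real s + of_real t * \<tau>))\<^sup>2 = s\<^sup>2 + s * t + 2 * t\<^sup>2"
  by (simp add: cmod_power2) (simp add: power2_eq_square algebra_simps sqrt7_sq)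

section \<open>The integral closure of the integers in \<open>K\<close>\<close>

lemma algebraic_int_lin_tau: "algebraic_int (of_int x + of_int y * \<tau>)"
proof -
  define z where "z = of_int x + of_int y * \<tau>"
  define p :: "int poly" where "p = [:x*x + x*y + 2*y*y, - (2*x+y), 1:]"
  have "z * z = of_int (2*x+y) * z - of_int (x*x+x*y+2*y*y)"
    by (simp add: z_def algebra_simps tau_simps)
  then have "poly (map_poly of_int p) z = 0"
    by (simp add: p_def map_poly_pCons algebra_simps)
  moreover have "lead_coeff p = 1"
    by (simp add: p_def)
  ultimately show ?thesis unfolding z_def[symmetric] algebraic_int_altdef_ipoly by blast
qed

text \<open>Writing r = p/q in lowest terms, q^k divides D for every k; since 2^D > D this forces q
  = 1.\<close>

lemma rat_integral_if_bounded_denominator: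
  fixes r :: rat and D :: int
  assumes "D > 0" "\<And>k. of_int D * r ^ k \<in> \<int>"
  shows "r \<in> \<int>"
proof -
  obtain p q where r: "r = Fract p q" "q > 0" "coprime p q" by (cases r) auto
  have "q ^ k dvd D" for k
  proof -
    obtain m where "of_int D * r ^ k = of_int m" using assms(2)[of k] by (auto elim: Ints_cases)
    then have "of_int D * of_int p ^ k = (of_int m * of_int q ^ k :: rat)"
      using r by (simp add: Fract_of_int_quotient power_divide field_simps)
    then have "D * p ^ k = m * q ^ k" by (metis of_int_eq_iff of_int_mult of_int_power)
    then have "q ^ k dvd D * p ^ k" by simp
    moreover have "coprime (q ^ k) (p ^ k)"
      using r(3) by (metis coprime_commute coprime_power_left_iff coprime_power_right_iff)
    ultimately show ?thesis using coprime_dvd_mult_left_iff by blast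
  qed
  then have "q ^ nat D \<le> D" using assms(1) by (simp add: zdvd_imp_le)
  have "q = 1"
  proof (rule ccontr)
    assume "q \<noteq> 1"
    then have "2 \<le> q" using r(2) by simp
    then have "2 ^ nat D \<le> q ^ nat D" by (intro power_mono) auto
    moreover have "int (nat D) < 2 ^ nat D" by (metis of_nat_less_two_power)
    ultimately show False using \<open>q ^ nat D \<le> D\<close> assms(1) by simp
  qed
  then show ?thesis using r by (simp add: Fract_of_int_quotient)
qed

text \<open>The order \<open>\<int>[i\<surd>7]\<close>; powers of an algebraic integer of \<open>K\<close> have bounded denominators with
  respect to it.\<close>

definition ord7 :: "complex set" where
  "ord7 = {of_int x + of_int y * i_sqrt7 | x y. True}"

lemma ord7_add: "u \<in> ord7 \<Longrightarrow> v \<in> ord7 \<Longrightarrow> u + v \<in> ord7"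
proof -
  assume "u \<in> ord7" "v \<in> ord7"
  then obtain x y x' y' where "u = of_int x + of_int y * i_sqrt7" "v = of_int x' + of_int y' * i_sqrt7"
    unfolding ord7_def by blast
  then have "u + v = of_int (x + x') + of_int (y + y') * i_sqrt7" by (simp add: algebra_simps)
  then show ?thesis unfolding ord7_def by blast
qed

lemma ord7_mult: "u \<in> ord7 \<Longrightarrow> v \<in> ord7 \<Longrightarrow> u * v \<in> ord7"
proof -
  assume "u \<in> ord7" "v \<in> ord7"
  then obtain x y x' y' where "u = of_int x + of_int y * i_sqrt7" "v = of_int x' + of_int y' * i_sqrt7"
    unfolding ord7_def by blast
  then have "u * v = of_int (x * x' - 7 * y * y') + of_int (x * y' + x' * y) * i_sqrt7"
    using i_sqrt7_sq by (simp add: algebra_simps) (simp flip: mult.assoc)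
  then show ?thesis unfolding ord7_def by blast
qed

lemma ord7_of_int: "of_int n \<in> ord7"
proof -
  have "of_int n = of_int n + of_int 0 * i_sqrt7" by simp
  then show ?thesis unfolding ord7_def by blast
qed

lemma ord7_sum: "finite A \<Longrightarrow> (\<And>i. i \<in> A \<Longrightarrow> f i \<in> ord7) \<Longrightarrow> sum f A \<in> ord7"
  by (induction A rule: finite_induct) (use ord7_of_int[of 0] in \<open>auto intro: ord7_add\<close>)

lemma ord7_power: "u \<in> ord7 \<Longrightarrow> u ^ n \<in> ord7"
  by (induction n) (use ord7_of_int[of 1] in \<open>auto intro: ord7_mult\<close>)

lemma K_denominator:
  assumes "z \<in> K" obtains e :: int where "e > 0" "of_int e * z \<in> ord7"
proof -
  obtain a b where z: "z = of_rat a + of_rat b * i_sqrt7" using assms unfolding K_def by blast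
  obtain p q where a: "a = Fract p q" "q > 0" by (cases a) auto
  obtain p' q' where b: "b = Fract p' q'" "q' > 0" by (cases b) auto
  have "of_int (q * q') * z = of_int (p * q') + of_int (p' * q) * i_sqrt7"
    using a b by (simp add: z of_rat_rat field_simps)
  then have "of_int (q * q') * z \<in> ord7" unfolding ord7_def by blast
  then show ?thesis using that[of "q * q'"] a b by simp
qed

text \<open>The monic relation of degree n writes high powers of z as integral combinations of lower
  ones, so the factor e^n that clears the first n powers clears all of them.\<close>

lemma algebraic_int_bounded_denominator:
  assumes "algebraic_int z" "z \<in> K"
  obtains D :: int where "D > 0" "\<And>k. of_int D * z ^ k \<in> ord7"
proof -
  obtain p :: "int poly" where p: "poly (map_poly of_int p) z = 0" "lead_coeff p = 1"
    using assms(1) unfolding algebraic_int_altdef_ipoly by blast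
  obtain e :: int where e: "e > 0" "of_int e * z \<in> ord7" using K_denominator[OF assms(2)] .
  define n where "n = degree p"
  have red: "z ^ n = (\<Sum>i<n. of_int (- coeff p i) * z ^ i)"
  proof -
    have "degree (map_poly of_int p :: complex poly) = n" by (simp add: n_def degree_map_poly)
    then have "(\<Sum>i\<le>n. of_int (coeff p i) * z ^ i) = 0"
      using p(1) by (simp add: poly_altdef coeff_map_poly)
    moreover have "{..n} = insert n {..<n}" by auto
    ultimately show ?thesis using p(2)
      by (simp add: n_def sum_negf eq_neg_iff_add_eq_0)
  qed
  have "of_int (e ^ n) * z ^ k \<in> ord7" for k
  proof (induction k rule: less_induct)
    case (less k)
    show ?case
    proof (cases "k < n")
      case True
      then have "of_int (e ^ n) * z ^ k = of_int (e ^ (n - k)) * (of_int e * z) ^ k"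
        by (simp add: power_mult_distrib flip: power_add mult.assoc)
      then show ?thesis using e(2) by (metis ord7_mult ord7_of_int ord7_power)
    next
      case False
      then have "z ^ k = z ^ n * z ^ (k - n)" by (simp flip: power_add)
      also have "\<dots> = (\<Sum>i<n. of_int (- coeff p i) * z ^ (i + (k - n)))"
        by (subst red) (simp add: sum_distrib_right power_add mult.assoc)
      finally have "of_int (e ^ n) * z ^ k
          = (\<Sum>i<n. of_int (- coeff p i) * (of_int (e ^ n) * z ^ (i + (k - n))))"
        by (simp add: sum_distrib_left algebra_simps)
      also have "\<dots> \<in> ord7"
        using False by (intro ord7_sum ord7_mult ord7_of_int less) auto
      finally show ?thesis .
    qed
  qed
  then show ?thesis using that[of "e ^ n"] e(1) by simp
qed

text \<open>The squared modulus of D z^k is D^2 N^k with N the norm of z, and also an integer of the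
  form x^2 + 7 y^2; so the powers of N have bounded denominators.\<close>

lemma norm_integral_if_bounded_denominator:
  assumes "D > 0" "\<And>k. of_int D * (of_rat a + of_rat b * i_sqrt7) ^ k \<in> ord7"
  shows "a\<^sup>2 + 7 * b\<^sup>2 \<in> \<int>"
proof (rule rat_integral_if_bounded_denominator)
  show "D * D > 0" using assms(1) by simp
  have re: "complex_of_rat q = of_real (real_of_rat q)" for q
    by (cases q) (simp add: of_rat_rat)
  have n: "(cmod (of_real x + of_real y * i_sqrt7))\<^sup>2 = x\<^sup>2 + 7 * y\<^sup>2" for x y
    by (simp add: i_sqrt7_def cmod_power2 power_mult_distrib)
  fix k
  obtain x y where "of_int D * (of_rat a + of_rat b * i_sqrt7) ^ k
      = of_real (of_int x) + of_real (of_int y) * i_sqrt7"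
    using assms(2)[of k] unfolding ord7_def by auto
  then have "(cmod (of_int D * (of_rat a + of_rat b * i_sqrt7) ^ k))\<^sup>2
      = (of_int x)\<^sup>2 + 7 * (of_int y)\<^sup>2" by (simp only: n)
  moreover have "(cmod (of_int D * (of_rat a + of_rat b * i_sqrt7) ^ k))\<^sup>2
     = (of_int D)\<^sup>2 * ((cmod (of_rat a + of_rat b * i_sqrt7))\<^sup>2) ^ k"
    by (simp add: norm_mult norm_power power_mult_distrib mult.commute flip: power_mult)
  ultimately have "real_of_rat (of_int (D * D) * (a\<^sup>2 + 7 * b\<^sup>2) ^ k)
      = real_of_rat (of_int (x * x + 7 * (y * y)))"
    by (simp only: re n) (simp add: of_rat_mult of_rat_add of_rat_power power2_eq_square)
  then have "of_int (D * D) * (a\<^sup>2 + 7 * b\<^sup>2) ^ k = of_int (x * x + 7 * (y * y))"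
    by (simp only: of_rat_eq_iff)
  then show "of_int (D * D) * (a\<^sup>2 + 7 * b\<^sup>2) ^ k \<in> \<int>" by (metis Ints_of_int)
qed

text \<open>The trace is obtained from two norms: N(z + 1) - N(z) - 1 = 2 a, and the powers of z + 1
  have bounded denominators by the binomial theorem.\<close>

lemma algebraic_int_trace_norm:
  assumes "algebraic_int z" "z = of_rat a + of_rat b * i_sqrt7"
  shows "2 * a \<in> \<int>" "a\<^sup>2 + 7 * b\<^sup>2 \<in> \<int>"
proof -
  have "z \<in> K" using assms(2) unfolding K_def by blast
  then obtain D :: int where D: "D > 0" "\<And>k. of_int D * z ^ k \<in> ord7"
    using algebraic_int_bounded_denominator[OF assms(1)] by blast
  have 1: "a\<^sup>2 + 7 * b\<^sup>2 \<in> \<int>"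
    using norm_integral_if_bounded_denominator[OF D(1)] D(2) assms(2) by blast
  have "of_int D * (of_rat (a + 1) + of_rat b * i_sqrt7) ^ k \<in> ord7" for k
  proof -
    have "of_rat (a + 1) + of_rat b * i_sqrt7 = z + 1" by (simp add: assms(2) of_rat_add)
    moreover have "of_int D * (z + 1) ^ k = (\<Sum>i\<le>k. of_int (int (k choose i)) * (of_int D * z ^ i))"
      by (subst binomial_ring) (simp add: sum_distrib_left algebra_simps)
    moreover have "\<dots> \<in> ord7" by (intro ord7_sum ord7_mult ord7_of_int D) simp
    ultimately show ?thesis by simp
  qed
  from norm_integral_if_bounded_denominator[OF D(1) this]
  have "(a + 1)\<^sup>2 + 7 * b\<^sup>2 - (a\<^sup>2 + 7 * b\<^sup>2) - 1 \<in> \<int>" using 1 by (intro Ints_diff Ints_1)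
  then show "2 * a \<in> \<int>" by (simp add: power2_eq_square algebra_simps)
  show "a\<^sup>2 + 7 * b\<^sup>2 \<in> \<int>" by fact
qed

lemma of_rat_eq_of_int [simp]: "complex_of_rat (of_int n) = of_int n"
  by simp

text \<open>With m = 2 a and n the norm, 7 (2 b)^2 = 4 n - m^2 shows that the square of the
  denominator of b divides 28, so it is 1 or 2. With k = 2 b, the equation m^2 + 7 k^2 = 4 n then
  makes m - k even, which is integrality with respect to 1 and \<tau>.\<close>

lemma O7_iff: "z \<in> O7 \<longleftrightarrow> (\<exists>x y::int. z = of_int x + of_int y * \<tau>)"
proof
  assume "\<exists>x y::int. z = of_int x + of_int y * \<tau>"
  then obtain x y :: int where z: "z = of_int x + of_int y * \<tau>" by blast
  have "z = of_rat (of_int x + of_int y / 2) + of_rat (of_int y / 2) * i_sqrt7"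
    by (simp add: z \<tau>_def of_rat_add of_rat_divide add_divide_distrib algebra_simps)
  then show "z \<in> O7"
    using algebraic_int_lin_tau[of x y] z unfolding O7_def K_def mem_Collect_eq by metis
next
  assume "z \<in> O7"
  then obtain a b where z: "z = of_rat a + of_rat b * i_sqrt7" and "algebraic_int z"
    unfolding O7_def K_def by blast
  then have 1: "2 * a \<in> \<int>" "a\<^sup>2 + 7 * b\<^sup>2 \<in> \<int>"
    using algebraic_int_trace_norm by blast+
  then obtain m n :: int where m: "2 * a = of_int m" and n: "a\<^sup>2 + 7 * b\<^sup>2 = of_int n"
    by (auto elim!: Ints_cases)
  obtain p q where b: "b = Fract p q" "q > 0" "coprime p q" by (cases b) auto
  have "7 * (2 * b)\<^sup>2 = of_int (4 * n - m * m)"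
    using n by (simp add: power2_eq_square algebra_simps flip: m)
  then have "(of_int (28 * p * p) :: rat) = of_int ((4 * n - m * m) * (q * q))"
    using b by (simp add: Fract_of_int_quotient power2_eq_square field_simps)
  then have *: "28 * p * p = (4 * n - m * m) * (q * q)" by (simp only: of_int_eq_iff)
  then have "q * q dvd 28 * p * p" by simp
  moreover have "coprime (q * q) (p * p)" using b(3) by (simp add: coprime_commute)
  ultimately have "q * q dvd 28" by (metis coprime_dvd_mult_left_iff mult.assoc)
  moreover have "q < 6"
  proof (rule ccontr)
    assume "\<not> q < 6"
    then have "6 * 6 \<le> q * q" by (intro mult_mono) auto
    with zdvd_imp_le[OF \<open>q * q dvd 28\<close>] show False by simp
  qed
  then have "q \<in> {1, 2, 3, 4, 5}" using b(2) by auto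
  ultimately have q: "q = 1 \<or> q = 2" by auto
  have "2 * b = of_int (2 * p) \<or> 2 * b = of_int p"
    using q b by (auto simp: Fract_of_int_quotient)
  then obtain k :: int where k: "2 * b = of_int k" by blast
  have "(of_int (m * m + 7 * (k * k)) :: rat) = of_int (4 * n)"
    by (simp add: power2_eq_square algebra_simps flip: n k m)
  then have "m * m + 7 * (k * k) = 4 * n" by (simp only: of_int_eq_iff)
  then have "even (m * m + 7 * (k * k))" by simp
  then have "even (m - k)" by auto
  then obtain x where x: "m = k + 2 * x" by (metis add.commute diff_add_cancel dvdE)
  have ab: "a = of_int x + of_int k / 2" "b = of_int k / 2"
    using m k x by auto
  have "z = of_int x + of_int k * \<tau>"
    unfolding z ab by (simp add: \<tau>_def of_rat_add of_rat_divide add_divide_distrib algebra_simps)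
  then show "\<exists>x y::int. z = of_int x + of_int y * \<tau>" by blast
qed

lemma O7_lin [simp]: "of_int x + of_int y * \<tau> \<in> O7"
  using O7_iff by blast

lemma O7E:
  assumes "z \<in> O7" obtains x y :: int where "z = of_int x + of_int y * \<tau>"
  using assms O7_iff by blast

lemma O7_of_int [simp]: "of_int n \<in> O7"
  using O7_lin[of n 0] by simp

lemma O7_0 [simp]: "0 \<in> O7" and O7_1 [simp]: "1 \<in> O7" and O7_numeral [simp]: "numeral k \<in> O7"
  using O7_of_int[of 0] O7_of_int[of 1] O7_of_int[of "numeral k"] by simp_all

lemma O7_tau [simp]: "\<tau> \<in> O7"
  using O7_lin[of 0 1] by simp

lemma O7_add [simp]: "u \<in> O7 \<Longrightarrow> v \<in> O7 \<Longrightarrow> u + v \<in> O7"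
proof (elim O7E)
  fix x y x' y' assume "u = of_int x + of_int y * \<tau>" "v = of_int x' + of_int y' * \<tau>"
  then have "u + v = of_int (x + x') + of_int (y + y') * \<tau>" by (simp add: algebra_simps)
  then show ?thesis by (simp only: O7_lin)
qed

lemma O7_mult [simp]: "u \<in> O7 \<Longrightarrow> v \<in> O7 \<Longrightarrow> u * v \<in> O7"
proof (elim O7E)
  fix x y x' y' assume "u = of_int x + of_int y * \<tau>" "v = of_int x' + of_int y' * \<tau>"
  then have "u * v = of_int (x * x' - 2 * y * y') + of_int (x * y' + x' * y + y * y') * \<tau>"
    by (simp add: algebra_simps tau_simps)
  then show ?thesis by (simp only: O7_lin)
qed

lemma O7_uminus [simp]: "u \<in> O7 \<Longrightarrow> - u \<in> O7"
  using O7_mult[of "of_int (- 1)" u] O7_of_int[of "- 1"] by simp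

lemma O7_diff [simp]: "u \<in> O7 \<Longrightarrow> v \<in> O7 \<Longrightarrow> u - v \<in> O7"
  using O7_add[of u "- v"] by simp

lemma O7_cnj [simp]: "u \<in> O7 \<Longrightarrow> cnj u \<in> O7"
  by (elim O7E) (simp add: cnj_tau)

lemma O7_i_sqrt7 [simp]: "i_sqrt7 \<in> O7"
  by (simp add: i_sqrt7_tau)

lemma cmod_lin_tau_int:
  "(cmod (of_int x + of_int y * \<tau>))\<^sup>2 = of_int (x * x + x * y + 2 * (y * y))"
  using cmod_lin_tau[of "of_int x" "of_int y"] by (simp add: power2_eq_square)

lemma O7_norm_Ints: "z \<in> O7 \<Longrightarrow> (cmod z)\<^sup>2 \<in> \<int>"
  by (elim O7E) (simp only: cmod_lin_tau_int Ints_of_int)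

lemma O7_norm_ge_1: "z \<in> O7 \<Longrightarrow> z \<noteq> 0 \<Longrightarrow> (cmod z)\<^sup>2 \<ge> 1"
proof -
  assume "z \<in> O7" "z \<noteq> 0"
  then obtain n :: int where n: "(cmod z)\<^sup>2 = of_int n" using O7_norm_Ints by (auto elim: Ints_cases)
  moreover have "(cmod z)\<^sup>2 > 0" using \<open>z \<noteq> 0\<close> by simp
  ultimately show ?thesis by simp
qed

lemma O7_real: "z \<in> O7 \<Longrightarrow> Im z = 0 \<Longrightarrow> \<exists>n. z = of_int n"
  by (elim O7E) auto

lemma int_sq_le_cases:
  fixes x :: int
  assumes "x * x \<le> n" "n < (k + 1) * (k + 1)" "k \<ge> 0" shows "- k \<le> x \<and> x \<le> k"
proof (rule ccontr)
  assume "\<not> ?thesis"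
  then have "k + 1 \<le> \<bar>x\<bar>" by auto
  then have "(k + 1) * (k + 1) \<le> \<bar>x\<bar> * \<bar>x\<bar>" using assms(3) by (intro mult_mono) auto
  with assms show False by simp
qed

text \<open>Both coordinates are bounded by completing squares: 4 N = (2 x + y)^2 + 7 y^2 and 8 N =
  (x + 4 y)^2 + 7 x^2. The value 3 is not taken, which later excludes a determinant of squared
  modulus 3.\<close>

lemma O7_norm_le_5:
  assumes "z \<in> O7" "(cmod z)\<^sup>2 \<le> 5"
  shows "z \<in> {0, 1, -1, \<tau>, -\<tau>, 1 - \<tau>, \<tau> - 1, 2, -2, \<tau> - 2, 2 - \<tau>, 1 + \<tau>, - 1 - \<tau>}"
proof -
  obtain x y :: int where z: "z = of_int x + of_int y * \<tau>" using assms(1) by (rule O7E)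
  then have le: "x * x + x * y + 2 * (y * y) \<le> 5"
    using assms(2) by (simp only: cmod_lin_tau_int)
  have "0 \<le> (2 * x + y) * (2 * x + y)" "0 \<le> (x + 4 * y) * (x + 4 * y)" "0 \<le> x * x" "0 \<le> y * y"
    by simp_all
  then have "y * y \<le> 2" "x * x \<le> 5" using le by (auto simp: algebra_simps)
  then have "- 1 \<le> y \<and> y \<le> 1" "- 2 \<le> x \<and> x \<le> 2"
    using int_sq_le_cases[of y 2 1] int_sq_le_cases[of x 5 2] by auto
  then have "y \<in> {-1, 0, 1}" "x \<in> {-2, -1, 0, 1, 2}" by auto
  with le show ?thesis unfolding z by (auto simp: algebra_simps)
qed

lemma cmod_sq_simps:
  "(cmod 0)\<^sup>2 = 0" "(cmod 1)\<^sup>2 = 1" "(cmod 2)\<^sup>2 = 4"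
  "(cmod \<tau>)\<^sup>2 = 2" "(cmod (1 - \<tau>))\<^sup>2 = 2" "(cmod (\<tau> - 1))\<^sup>2 = 2"
  "(cmod (\<tau> - 2))\<^sup>2 = 4" "(cmod (2 - \<tau>))\<^sup>2 = 4" "(cmod (1 + \<tau>))\<^sup>2 = 4" "(cmod (- 1 - \<tau>))\<^sup>2 = 4"
  using cmod_lin_tau_int[of 0 1] cmod_lin_tau_int[of 1 "-1"] cmod_lin_tau_int[of "-1" 1]
    cmod_lin_tau_int[of "-2" 1] cmod_lin_tau_int[of 2 "-1"] cmod_lin_tau_int[of 1 1]
    cmod_lin_tau_int[of "-1" "-1"] by simp_all

lemma O7_norm_2: "z \<in> O7 \<Longrightarrow> (cmod z)\<^sup>2 = 2 \<Longrightarrow> z \<in> {\<tau>, -\<tau>, 1 - \<tau>, \<tau> - 1}"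
  using O7_norm_le_5[of z] cmod_sq_simps by auto

lemma O7_norm_1: "z \<in> O7 \<Longrightarrow> (cmod z)\<^sup>2 = 1 \<Longrightarrow> z = 1 \<or> z = -1"
  using O7_norm_le_5[of z] cmod_sq_simps by auto

lemma O7_unit: "z \<in> O7 \<Longrightarrow> cmod z = 1 \<Longrightarrow> z = 1 \<or> z = -1"
  using O7_norm_1 by simp

lemma O7_norm_neq_3: "z \<in> O7 \<Longrightarrow> (cmod z)\<^sup>2 \<noteq> 3"
  using O7_norm_le_5[of z] cmod_sq_simps by auto

lemma O7_unit_mult: "z \<in> O7 \<Longrightarrow> c \<in> O7 \<Longrightarrow> z * c = 1 \<Longrightarrow> z = 1 \<or> z = -1"
proof -
  assume z: "z \<in> O7" "c \<in> O7" "z * c = 1"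
  then have "z \<noteq> 0" "c \<noteq> 0" by auto
  with z have "(cmod z)\<^sup>2 \<ge> 1" "(cmod c)\<^sup>2 \<ge> 1" by (auto intro: O7_norm_ge_1)
  moreover have "cmod z * cmod c = 1" by (metis norm_mult norm_one z(3))
  ultimately have "cmod z = 1"
    using power2_le_imp_le[of 1 "cmod z"] power2_le_imp_le[of 1 "cmod c"] mult_left_mono[of 1 "cmod c" "cmod z"]
    by auto
  then show ?thesis using O7_unit z by blast
qed

lemma finite_O7_bounded: "finite {z \<in> O7. cmod z \<le> B}"
proof -
  define n where "n = \<lceil>8 * B\<^sup>2 + 1\<rceil>"
  have "{z \<in> O7. cmod z \<le> B} \<subseteq> (\<lambda>(x, y). of_int x + of_int y * \<tau>) ` ({-n..n} \<times> {-n..n})"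
  proof
    fix z assume "z \<in> {z \<in> O7. cmod z \<le> B}"
    then have z: "z \<in> O7" "cmod z \<le> B" by auto
    obtain x y :: int where xy: "z = of_int x + of_int y * \<tau>" using z(1) by (rule O7E)
    have "(cmod z)\<^sup>2 \<le> B\<^sup>2" using z(2) by (simp add: power_mono)
    then have "of_int (x * x + x * y + 2 * (y * y)) \<le> B\<^sup>2" by (simp only: xy cmod_lin_tau_int)
    then have "of_int (8 * (x * x + x * y + 2 * (y * y))) \<le> 8 * B\<^sup>2 + 1" by simp
    then have "of_int (8 * (x * x + x * y + 2 * (y * y))) \<le> (of_int n :: real)"
      unfolding n_def by linarith
    then have le: "8 * (x * x + x * y + 2 * (y * y)) \<le> n" by (simp only: of_int_le_iff)
    have "0 \<le> (2 * x + y) * (2 * x + y)" "0 \<le> (x + 4 * y) * (x + 4 * y)" "0 \<le> x * x" "0 \<le> y * y"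
      by simp_all
    moreover have "(2 * x + y) * (2 * x + y) = 4 * (x * x) + 4 * (x * y) + y * y"
      "(x + 4 * y) * (x + 4 * y) = x * x + 8 * (x * y) + 16 * (y * y)"
      by (simp_all add: algebra_simps)
    moreover have "8 * (x * x) + 8 * (x * y) + 16 * (y * y) \<le> n" using le by (simp add: algebra_simps)
    moreover have "Y \<le> n \<and> X \<le> n" if "0 \<le> 4 * X + 4 * Z + Y" "0 \<le> X + 8 * Z + 16 * Y"
      "0 \<le> X" "0 \<le> Y" "8 * X + 8 * Z + 16 * Y \<le> n" for X Y Z
      using that by linarith
    ultimately have "y * y \<le> n \<and> x * x \<le> n" by metis
    then have "y * y \<le> n" "x * x \<le> n" by simp_all
    moreover have "\<bar>k\<bar> \<le> k * k" for k :: int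
      by (cases "k = 0") (use mult_right_mono[of 1 "\<bar>k\<bar>" "\<bar>k\<bar>"] in simp_all)
    ultimately have "\<bar>x\<bar> \<le> n" "\<bar>y\<bar> \<le> n" by (meson order_trans)+
    then show "z \<in> (\<lambda>(x, y). of_int x + of_int y * \<tau>) ` ({-n..n} \<times> {-n..n})"
      using xy by (auto intro!: image_eqI[of _ _ "(x, y)"])
  qed
  then show ?thesis by (rule finite_subset) auto
qed

text \<open>The covering radius of \<open>O7\<close>: the vertices of the Voronoi cell have norm \<open>4/7\<close>.\<close>

lemma O7_covering: "\<exists>q\<in>O7. (cmod (z - q))\<^sup>2 \<le> 4/7"
proof -
  obtain s t :: real where z: "z = of_real s + of_real t * \<tau>" by (rule tau_coords)
  define y0 where "y0 = \<lfloor>t\<rfloor>"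
  define v where "v = t - of_int y0"
  have v: "0 \<le> v" "v < 1" unfolding v_def y0_def by linarith+
  define x0 where "x0 = round (s + v / 2)"
  define u where "u = s + v / 2 - of_int x0"
  have u: "\<bar>u\<bar> \<le> 1/2" unfolding u_def x0_def using of_int_round_abs_le[of "s + v/2"]
    by (simp add: abs_minus_commute)
  have nrm: "(cmod (z - (of_int x + of_int y * \<tau>)))\<^sup>2
      = (u + of_int (x0 - x) + (of_int (y0 - y)) / 2)\<^sup>2 + 7/4 * (v + of_int (y0 - y))\<^sup>2" for x y
  proof -
    have "z - (of_int x + of_int y * \<tau>) = of_real (s - of_int x) + of_real (t - of_int y) * \<tau>"
      by (simp add: z algebra_simps)
    then have "(cmod (z - (of_int x + of_int y * \<tau>)))\<^sup>2
       = (s - of_int x)\<^sup>2 + (s - of_int x) * (t - of_int y) + 2 * (t - of_int y)\<^sup>2"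
      by (simp only: cmod_lin_tau)
    then show ?thesis unfolding u_def v_def by (simp add: power2_eq_square field_simps)
  qed
  \<comment> \<open>The line r + 7/2 w = 2 is the perpendicular bisector of 0 and \<tau>, which has
    r = 1/2 and w = 1 in these coordinates. Below it the maximum 4/7 is attained at its ends r = 0
    and r = 1/2.\<close>
  have bnd: "r\<^sup>2 + 7/4 * w\<^sup>2 \<le> 4/7" if "0 \<le> w" "r + 7/2 * w \<le> 2" "0 \<le> r" "r \<le> 1/2" for r w :: real
  proof -
    have "w \<le> 2/7 * (2 - r)" using that by simp
    then have "w\<^sup>2 \<le> (2/7 * (2 - r))\<^sup>2" using that by (intro power_mono) auto
    moreover have "r * r \<le> r * (1/2)" using that by (intro mult_left_mono) auto
    ultimately show ?thesis by (simp add: power2_eq_square algebra_simps)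
  qed
  show ?thesis
  proof (cases "\<bar>u\<bar> + 7/2 * v \<le> 2")
    case True
    then have "u\<^sup>2 + 7/4 * v\<^sup>2 \<le> 4/7" using bnd[of v "\<bar>u\<bar>"] v u by simp
    then have "(cmod (z - (of_int x0 + of_int y0 * \<tau>)))\<^sup>2 \<le> 4/7" by (simp add: nrm)
    then show ?thesis using O7_lin by blast
  next
    case False
    \<comment> \<open>The next row is shifted by 1/2, so its nearest point is at horizontal distance
      \<open>1/2 - \<bar>u\<bar>\<close>, and the point reflected through the middle of the bisector
      is below the bisector again.\<close>
    define x where "x = (if u \<ge> 0 then x0 else x0 - 1)"
    have "(1/2 - \<bar>u\<bar>)\<^sup>2 + 7/4 * (1 - v)\<^sup>2 \<le> 4/7"
    proof (rule bnd)
      have "2 < \<bar>u\<bar> + 7/2 * v" using False by (simp only: not_le)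
      moreover have "7/2 * (1 - v) = 7/2 - 7/2 * v" by (simp add: field_simps)
      ultimately show "1/2 - \<bar>u\<bar> + 7/2 * (1 - v) \<le> 2" by linarith
      show "0 \<le> 1 - v" "0 \<le> 1/2 - \<bar>u\<bar>" using u v by simp_all
      show "1/2 - \<bar>u\<bar> \<le> 1/2" by linarith
    qed
    moreover have "(cmod (z - (of_int x + of_int (y0 + 1) * \<tau>)))\<^sup>2 = (1/2 - \<bar>u\<bar>)\<^sup>2 + 7/4 * (1 - v)\<^sup>2"
      unfolding nrm x_def by (simp add: power2_eq_square algebra_simps)
    ultimately show ?thesis using O7_lin by metis
  qed
qed

text \<open>The Euclidean algorithm in matrix form: a matrix of determinant 1 annihilates the second
  entry of (a, b). The recursion terminates because the covering radius leaves a remainder of norm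
  at most 4/7 of that of b.\<close>

lemma O7_bezout:
  assumes "a \<in> O7" "b \<in> O7"
  shows "\<exists>p\<in>O7. \<exists>q\<in>O7. \<exists>r\<in>O7. \<exists>s\<in>O7. p * s - q * r = 1 \<and> r * a + s * b = 0"
  using assms
proof (induction "nat \<lfloor>(cmod b)\<^sup>2\<rfloor>" arbitrary: a b rule: less_induct)
  case less
  show ?case
  proof (cases "b = 0")
    case True
    show ?thesis
      by (intro bexI[of _ 1] bexI[of _ 0]) (auto simp: True)
  next
    case False
    obtain q where q: "q \<in> O7" "(cmod (a / b - q))\<^sup>2 \<le> 4/7" using O7_covering by blast
    define c where "c = a - q * b"
    have "c = (a / b - q) * b" using False by (simp add: c_def field_simps)
    then have "(cmod c)\<^sup>2 = (cmod (a / b - q))\<^sup>2 * (cmod b)\<^sup>2"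
      by (simp add: norm_mult power_mult_distrib)
    also have "\<dots> \<le> 4/7 * (cmod b)\<^sup>2" by (rule mult_right_mono[OF q(2)]) simp
    also have "\<dots> < (cmod b)\<^sup>2" using False by simp
    finally have lt: "(cmod c)\<^sup>2 < (cmod b)\<^sup>2" .
    have c: "c \<in> O7" using less.prems q by (simp add: c_def)
    obtain m n where "(cmod c)\<^sup>2 = of_int m" "(cmod b)\<^sup>2 = of_int n"
      using O7_norm_Ints[OF c] O7_norm_Ints[OF less.prems(2)] by (auto elim!: Ints_cases)
    moreover have "(cmod c)\<^sup>2 \<ge> 0" by simp
    ultimately have "nat \<lfloor>(cmod c)\<^sup>2\<rfloor> < nat \<lfloor>(cmod b)\<^sup>2\<rfloor>" using lt by simp
    from less.hyps[OF this less.prems(2) c] obtain p' q' r' s'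
      where *: "p' \<in> O7" "q' \<in> O7" "r' \<in> O7" "s' \<in> O7" "p' * s' - q' * r' = 1" "r' * b + s' * c = 0"
      by blast
    have "- q' * (r' - q * s') - (q * q' - p') * s' = p' * s' - q' * r'"
      by (simp add: algebra_simps)
    moreover have "s' * a + (r' - q * s') * b = r' * b + s' * c"
      by (simp add: c_def algebra_simps)
    ultimately have "- q' * (r' - q * s') - (q * q' - p') * s' = 1 \<and> s' * a + (r' - q * s') * b = 0"
      using * by simp
    moreover have "- q' \<in> O7" "q * q' - p' \<in> O7" "s' \<in> O7" "r' - q * s' \<in> O7"
      using * q by simp_all
    ultimately show ?thesis by blast
  qed
qed

section \<open>Reduction of positive definite Hermitian forms over the ring of integers\<close>

text \<open>The sesquilinear form with Gram matrix (h11, h12; cnj h12, h22), evaluated at the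
  coordinate pairs (a, b) and (c, d).\<close>

definition bf :: "real \<Rightarrow> complex \<Rightarrow> real \<Rightarrow> complex \<Rightarrow> complex \<Rightarrow> complex \<Rightarrow> complex \<Rightarrow> complex" where
  "bf h11 h12 h22 a b c d =
     of_real h11 * a * cnj c + h12 * a * cnj d + cnj h12 * b * cnj c + of_real h22 * b * cnj d"

lemma bf_real: "bf h11 h12 h22 a b a b = of_real (Re (bf h11 h12 h22 a b a b))"
  by (simp add: bf_def complex_eq_iff algebra_simps)

lemma bf_gram:
  "bf h11 h12 h22 a b a b * bf h11 h12 h22 c d c d - bf h11 h12 h22 a b c d * bf h11 h12 h22 c d a b
    = (of_real h11 * of_real h22 - h12 * cnj h12) * ((a * d - b * c) * cnj (a * d - b * c))"
  by (simp add: bf_def algebra_simps)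

lemma bf_cnj: "cnj (bf h11 h12 h22 a b c d) = bf h11 h12 h22 c d a b"
  by (simp add: bf_def algebra_simps)

lemma bf_complete_square:
  "h11 * Re (bf h11 h12 h22 a b a b)
    = (cmod (of_real h11 * a + cnj h12 * b))\<^sup>2 + (h11 * h22 - (cmod h12)\<^sup>2) * (cmod b)\<^sup>2"
  "h22 * Re (bf h11 h12 h22 a b a b)
    = (cmod (of_real h22 * b + h12 * a))\<^sup>2 + (h11 * h22 - (cmod h12)\<^sup>2) * (cmod a)\<^sup>2"
  unfolding bf_def cmod_power2 by (simp_all add: power2_eq_square algebra_simps)

text \<open>The pair (a, b) minimises the form among pairs that extend to a matrix of determinant 1;
  the second pair is shifted by a multiple of it until the mixed product has squared modulus at most
  4/7 m^2, where m is the minimum. Minimality gives m^2 <= D + 4/7 m^2, the last bound.\<close>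

lemma bf_reduction:
  fixes h12 :: complex
  assumes pos: "h11 > 0" and D: "h11 * h22 - (cmod h12)\<^sup>2 = D" "D > 0"
  obtains a b c d where "a \<in> O7" "b \<in> O7" "c \<in> O7" "d \<in> O7" "a * d - b * c = 1"
    "(cmod (bf h11 h12 h22 c d a b))\<^sup>2 \<le> 4/7 * (Re (bf h11 h12 h22 a b a b))\<^sup>2"
    "Re (bf h11 h12 h22 a b a b) \<le> Re (bf h11 h12 h22 c d c d)"
    "Re (bf h11 h12 h22 a b a b) > 0"
    "(Re (bf h11 h12 h22 a b a b))\<^sup>2 \<le> 7/3 * D"
proof -
  let ?bf = "bf h11 h12 h22"
  define q where "q = (\<lambda>(a, b). Re (?bf a b a b))"
  define S where "S = {(a, b). a \<in> O7 \<and> b \<in> O7 \<and> (\<exists>c\<in>O7. \<exists>d\<in>O7. a * d - b * c = 1)}"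
  have "h11 * h22 > 0" using D by (smt (verit) zero_le_power2)
  then have pos2: "h22 > 0" using pos by (simp add: zero_less_mult_iff)
  \<comment> \<open>Completing squares bounds the squared moduli of the coordinates by
    \<open>B\<close>; the summand 1 gives B >= 1, so they are also at most B^2 and the moduli at
    most \<open>B\<close>.\<close>
  define B where "B = h11 * h11 / D + h11 * h22 / D + 1"
  have B: "B \<ge> 1" "h11 * h11 / D \<le> B" "h11 * h22 / D \<le> B"
    unfolding B_def using pos pos2 D(2) by simp_all
  have bd: "cmod a \<le> B \<and> cmod b \<le> B" if "q (a, b) \<le> h11" for a b
  proof -
    have "D * (cmod b)\<^sup>2 \<le> h11 * q (a, b)" "D * (cmod a)\<^sup>2 \<le> h22 * q (a, b)"
      unfolding q_def using bf_complete_square(1)[of h11 h12 h22 a b] bf_complete_square(2)[of h22 h11 h12 a b] D(1) by simp_all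
    moreover have "h11 * q (a, b) \<le> h11 * h11" "h22 * q (a, b) \<le> h22 * h11"
      using that pos pos2 by simp_all
    moreover have "h11 * h11 \<le> D * B" "h22 * h11 \<le> D * B"
      using B D(2) by (simp_all add: field_simps)
    ultimately have "D * (cmod b)\<^sup>2 \<le> D * B" "D * (cmod a)\<^sup>2 \<le> D * B" by linarith+
    then have "(cmod b)\<^sup>2 \<le> B" "(cmod a)\<^sup>2 \<le> B" using D(2) by simp_all
    moreover have "B \<le> B\<^sup>2" using B(1) by (simp add: power2_eq_square)
    ultimately have "(cmod b)\<^sup>2 \<le> B\<^sup>2" "(cmod a)\<^sup>2 \<le> B\<^sup>2" by linarith+
    then show ?thesis using B(1) by (auto intro: power2_le_imp_le)
  qed
  have "(1, 0) \<in> S" unfolding S_def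
    using O7_0 O7_1 by (simp add: bexI[of _ 1]) (use O7_0 in blast)
  have q10: "q (1, 0) = h11" by (simp add: q_def bf_def)
  define F where "F = {p \<in> S. q p \<le> h11}"
  have "F \<subseteq> {z \<in> O7. cmod z \<le> B} \<times> {z \<in> O7. cmod z \<le> B}"
    unfolding F_def S_def using bd by auto
  then have "finite F" by (rule finite_subset) (simp add: finite_O7_bounded)
  moreover have "F \<noteq> {}" unfolding F_def using \<open>(1, 0) \<in> S\<close> q10 by auto
  ultimately obtain p where p: "p \<in> F" "\<And>p'. p' \<in> F \<Longrightarrow> q p \<le> q p'"
    by (metis arg_min_if_finite(1) arg_min_least)
  then have min: "q p \<le> q p'" if "p' \<in> S" for p'
    using that unfolding F_def by fastforce
  obtain a b where ab: "p = (a, b)" by (cases p)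
  obtain c d where cd: "a \<in> O7" "b \<in> O7" "c \<in> O7" "d \<in> O7" "a * d - b * c = 1"
    using p(1) ab unfolding F_def S_def by auto
  define m where "m = Re (?bf a b a b)"
  have "m > 0"
  proof -
    have "h11 * m = (cmod (of_real h11 * a + cnj h12 * b))\<^sup>2 + D * (cmod b)\<^sup>2"
      unfolding m_def bf_complete_square D(1) by simp
    moreover have "\<dots> > 0"
    proof (cases "b = 0")
      case True
      then have "a \<noteq> 0" using cd by auto
      then show ?thesis using True pos by simp
    next
      case False
      then show ?thesis using D(2) by (simp add: add_nonneg_pos)
    qed
    ultimately have "0 < h11 * m" by linarith
    then show ?thesis using pos by (simp add: zero_less_mult_iff)
  qed
  obtain t where t: "t \<in> O7" "(cmod (?bf c d a b / of_real m - t))\<^sup>2 \<le> 4/7"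
    using O7_covering by blast
  define c' d' where "c' = c - t * a" and "d' = d - t * b"
  have cd': "c' \<in> O7" "d' \<in> O7" "a * d' - b * c' = 1"
    using cd t by (simp_all add: c'_def d'_def algebra_simps)
  have "(c', d') \<in> S"
  proof -
    have "c' * (- b) - d' * (- a) = 1" using cd' by (simp add: algebra_simps)
    moreover have "- a \<in> O7" "- b \<in> O7" using cd by simp_all
    ultimately show ?thesis unfolding S_def using cd' by blast
  qed
  then have le: "m \<le> Re (?bf c' d' c' d')" using min[of "(c', d')"] ab by (simp add: q_def m_def)
  have e: "?bf a b a b = of_real m" unfolding m_def by (rule bf_real)
  have "?bf c' d' a b = ?bf c d a b - t * ?bf a b a b"
    by (simp add: bf_def c'_def d'_def algebra_simps)
  also have "\<dots> = of_real m * (?bf c d a b / of_real m - t)"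
    using \<open>m > 0\<close> by (simp add: e field_simps)
  finally have "(cmod (?bf c' d' a b))\<^sup>2 = m\<^sup>2 * (cmod (?bf c d a b / of_real m - t))\<^sup>2"
    by (simp add: norm_mult power_mult_distrib)
  then have off: "(cmod (?bf c' d' a b))\<^sup>2 \<le> 4/7 * m\<^sup>2"
    using mult_left_mono[OF t(2), of "m\<^sup>2"] by simp
  have "?bf a b a b * ?bf c' d' c' d' - ?bf a b c' d' * cnj (?bf a b c' d') = of_real D"
    unfolding bf_cnj bf_gram cd'(3) D(1)[symmetric] by (simp flip: complex_norm_square)
  then have "of_real (m * Re (?bf c' d' c' d') - (cmod (?bf a b c' d'))\<^sup>2) = complex_of_real D"
    unfolding e by (subst (asm) bf_real) (simp flip: complex_norm_square)
  then have "m * Re (?bf c' d' c' d') - (cmod (?bf a b c' d'))\<^sup>2 = D" by (simp only: of_real_eq_iff)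
  moreover have "cmod (?bf a b c' d') = cmod (?bf c' d' a b)" by (metis bf_cnj complex_mod_cnj)
  moreover have "m * m \<le> m * Re (?bf c' d' c' d')" using le \<open>m > 0\<close> by simp
  ultimately have "m\<^sup>2 \<le> 7/3 * D" using off by (simp add: power2_eq_square)
  with that[OF cd(1,2) cd'] off le \<open>m > 0\<close> show ?thesis unfolding m_def by blast
qed

section \<open>The Hermitian form and its unitary group\<close>

definition vec3 :: "complex \<Rightarrow> complex \<Rightarrow> complex \<Rightarrow> complex^3" where
  "vec3 a b c = vector [a, b, c]"

definition cols :: "complex^3 \<Rightarrow> complex^3 \<Rightarrow> complex^3 \<Rightarrow> complex^3^3" where
  "cols a b c = (\<chi> i j. if j = 1 then a $ i else if j = 2 then b $ i else c $ i)"

definition hadj :: "complex^3^3 \<Rightarrow> complex^3^3" where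
  "hadj A = (\<chi> i j. cnj (A $ j $ i))"

definition cip :: "complex^3 \<Rightarrow> complex^3 \<Rightarrow> complex" where
  "cip x y = (\<Sum>i\<in>UNIV. x $ i * cnj (y $ i))"

lemma vec3_nth [simp]: "vec3 a b c $ 1 = a" "vec3 a b c $ 2 = b" "vec3 a b c $ 3 = c"
  by (simp_all add: vec3_def vector_3)

lemma cols_nth [simp]: "cols a b c $ i $ 1 = a $ i" "cols a b c $ i $ 2 = b $ i" "cols a b c $ i $ 3 = c $ i"
  by (simp_all add: cols_def)

lemma hadj_nth [simp]: "hadj A $ i $ j = cnj (A $ j $ i)"
  by (simp add: hadj_def)

lemma J_nth [simp]:
  "J $ 1 $ 1 = 0" "J $ 1 $ 2 = 0" "J $ 1 $ 3 = 1" "J $ 2 $ 1 = 0" "J $ 2 $ 2 = 1" "J $ 2 $ 3 = 0"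
  "J $ 3 $ 1 = 1" "J $ 3 $ 2 = 0" "J $ 3 $ 3 = 0"
  by (simp_all add: J_def vector_3)

lemma mat_1_nth [simp]: "(mat 1 :: complex^3^3) $ i $ j = (if i = j then 1 else 0)"
  by (simp add: mat_def)

lemmas mv3 = matrix_vector_mult_def sum_3
lemmas mm3 = matrix_matrix_mult_def sum_3
lemmas veq3 = vec_eq_iff forall_3

lemma vec3_eta: "v = vec3 (v $ 1) (v $ 2) (v $ 3)"
  by (simp add: veq3)

lemma mv_nth: "(A *v v) $ i = A $ i $ 1 * v $ 1 + A $ i $ 2 * v $ 2 + A $ i $ 3 * (v::complex^3) $ 3"
  by (simp add: mv3)

lemma mm_nth: "(A ** B) $ i $ j = A $ i $ 1 * B $ 1 $ j + A $ i $ 2 * B $ 2 $ j + A $ i $ 3 * (B::complex^3^3) $ 3 $ j"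
  by (simp add: mm3)

lemma mult_cols: "A ** cols a b c = cols (A *v a) (A *v b) (A *v c)"
  by (simp add: veq3 mm_nth mv_nth)

lemma cols_eq_iff: "cols a b c = cols a' b' c' \<longleftrightarrow> a = a' \<and> b = b' \<and> c = c'"
  by (auto simp: veq3)

lemma cols_vec: "cols a b c *v x = x $ 1 *s a + x $ 2 *s b + x $ 3 *s c"
  by (simp add: veq3 mv_nth algebra_simps)

lemma herm_expand: "herm v w = v $ 3 * cnj (w $ 1) + v $ 2 * cnj (w $ 2) + v $ 1 * cnj (w $ 3)"
  by (simp add: herm_def sum_3 mv3)

lemma herm_add_left: "herm (u + v) w = herm u w + herm v w"
  and herm_add_right: "herm u (v + w) = herm u v + herm u w"
  and herm_diff_left: "herm (u - v) w = herm u w - herm v w"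
  and herm_diff_right: "herm u (v - w) = herm u v - herm u w"
  and herm_scale_left: "herm (c *s u) v = c * herm u v"
  and herm_scale_right: "herm u (c *s v) = cnj c * herm u v"
  and herm_minus_left: "herm (- u) v = - herm u v"
  and herm_minus_right: "herm u (- v) = - herm u v"
  and herm_zero_left: "herm 0 v = 0"
  and herm_zero_right: "herm v 0 = 0"
  by (simp_all add: herm_expand algebra_simps)

lemmas herm_simps [simp] = herm_add_left herm_add_right herm_diff_left herm_diff_right
  herm_scale_left herm_scale_right herm_minus_left herm_minus_right herm_zero_left herm_zero_right

lemma herm_cnj: "cnj (herm v w) = herm w v"
  by (simp add: herm_expand algebra_simps)

lemma herm_real: "herm v v = of_real (Re (herm v v))"
  by (simp add: herm_expand complex_eq_iff algebra_simps)

lemma herm_cip: "herm v w = cip (J *v v) w"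
  by (simp add: herm_def cip_def mult.commute)

lemma cip_hadj: "cip (A *v x) y = cip x (hadj A *v y)"
  by (simp add: cip_def sum_3 mv_nth algebra_simps)

lemma hadj_hadj [simp]: "hadj (hadj A) = A"
  by (simp add: veq3)

lemma hadj_mult: "hadj (A ** B) = hadj B ** hadj A"
  by (simp add: veq3 mm_nth algebra_simps)

lemma hadj_J [simp]: "hadj J = J" and J_J [simp]: "J ** J = mat 1"
  by (simp_all add: veq3 mm_nth)

lemma gram_nth: "(hadj A ** J ** A) $ i $ j = herm (column j A) (column i A)"
  by (simp add: mm_nth herm_expand column_def algebra_simps)

lemma column_cols [simp]: "column 1 (cols a b c) = a" "column 2 (cols a b c) = b" "column 3 (cols a b c) = c"
  by (simp_all add: column_def veq3)

lemma mv_axis: "A *v axis j 1 = column j (A :: complex^3^3)"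
  using exhaust_3[of j] by (auto simp: veq3 mv_nth axis_def column_def)

lemma U_J_iff: "A \<in> U_J \<longleftrightarrow> hadj A ** J ** A = J"
proof
  assume A: "A \<in> U_J"
  have "(hadj A ** J ** A) $ i $ j = J $ i $ j" for i j
  proof -
    have "herm (A *v axis j 1) (A *v axis i 1) = herm (axis j 1) (axis i 1)"
      using A unfolding U_J_def by blast
    then have "herm (column j A) (column i A) = herm (axis j 1) (axis i 1)"
      by (simp only: mv_axis)
    moreover have "herm (axis j 1) (axis i 1) = J $ i $ j"
      using exhaust_3[of i] exhaust_3[of j] by (auto simp: herm_expand axis_def)
    ultimately show ?thesis by (simp add: gram_nth)
  qed
  then show "hadj A ** J ** A = J" by (simp add: vec_eq_iff)
next
  assume A: "hadj A ** J ** A = J"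
  have "herm (A *v v) (A *v w) = herm v w" for v w
  proof -
    have "herm (A *v v) (A *v w) = cip (J *v (A *v v)) (hadj (hadj A) *v w)"
      by (simp add: herm_cip)
    also have "\<dots> = cip (hadj A *v (J *v (A *v v))) w" by (rule cip_hadj[symmetric])
    also have "\<dots> = cip ((hadj A ** J ** A) *v v) w"
      by (simp only: matrix_vector_mul_assoc matrix_mul_assoc)
    finally show ?thesis by (simp add: A herm_cip)
  qed
  then show "A \<in> U_J" by (simp add: U_J_def)
qed

lemma U_J_herm: "A \<in> U_J \<Longrightarrow> herm (A *v v) (A *v w) = herm v w"
  by (simp add: U_J_def)

text \<open>The inverse of an isometry, read off from \<open>hadj A ** J ** A = J\<close> because
  \<open>J\<close> is its own inverse.\<close>

definition uinv :: "complex^3^3 \<Rightarrow> complex^3^3" where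
  "uinv A = J ** hadj A ** J"

lemma uinv_left: "A \<in> U_J \<Longrightarrow> uinv A ** A = mat 1"
proof -
  assume "A \<in> U_J"
  then have "J ** (hadj A ** J ** A) = J ** J" by (simp only: U_J_iff)
  then show ?thesis by (simp add: uinv_def matrix_mul_assoc)
qed

lemma uinv_right: "A \<in> U_J \<Longrightarrow> A ** uinv A = mat 1"
  using uinv_left matrix_left_right_inverse by blast

lemma uinv_vec: "A \<in> U_J \<Longrightarrow> uinv A *v (A *v x) = x" "A \<in> U_J \<Longrightarrow> A *v (uinv A *v x) = x"
  by (simp_all add: matrix_vector_mul_assoc uinv_left uinv_right)

lemma U_J_mult: "A \<in> U_J \<Longrightarrow> B \<in> U_J \<Longrightarrow> A ** B \<in> U_J"
  by (simp add: U_J_def flip: matrix_vector_mul_assoc)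

lemma U_J_uinv: "A \<in> U_J \<Longrightarrow> uinv A \<in> U_J"
proof -
  assume A: "A \<in> U_J"
  have "herm (uinv A *v v) (uinv A *v w) = herm v w" for v w
    using U_J_herm[OF A, of "uinv A *v v" "uinv A *v w"] by (simp only: uinv_vec(2)[OF A])
  then show ?thesis by (simp add: U_J_def)
qed

lemma U_J_one [simp]: "mat 1 \<in> U_J"
  by (simp add: U_J_def)

lemma minus_mult [simp]:
  fixes A B :: "complex^3^3"
  shows "(- A) ** B = - (A ** B)" "A ** (- B) = - (A ** B)"
  by (simp_all add: veq3 mm_nth)

lemma minus_mv [simp]: "(- A) *v x = - (A *v (x::complex^3))"
  by (simp add: veq3 mv_nth)

lemma U_J_minus: "A \<in> U_J \<Longrightarrow> - A \<in> U_J"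
  by (simp add: U_J_def)

lemma uinv_minus: "uinv (- A) = - uinv A"
  by (simp add: uinv_def veq3 mm_nth)

lemma mats_O7_mult: "A \<in> mats_O7 \<Longrightarrow> B \<in> mats_O7 \<Longrightarrow> A ** B \<in> mats_O7"
  by (simp add: mats_O7_def mm_nth)

lemma mats_O7_minus: "A \<in> mats_O7 \<Longrightarrow> - A \<in> mats_O7"
  by (simp add: mats_O7_def)

lemma mats_O7_one: "mat 1 \<in> mats_O7"
  by (simp add: mats_O7_def)

lemma mats_O7_J: "J \<in> mats_O7"
  by (simp add: mats_O7_def forall_3)

lemma mats_O7_hadj: "A \<in> mats_O7 \<Longrightarrow> hadj A \<in> mats_O7"
  by (simp add: mats_O7_def)

lemma mats_O7_uinv: "A \<in> mats_O7 \<Longrightarrow> uinv A \<in> mats_O7"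
  by (simp add: uinv_def mats_O7_mult mats_O7_J mats_O7_hadj)

definition UO :: "(complex^3^3) set" where "UO = U_J \<inter> mats_O7"

lemma UO_D: "A \<in> UO \<Longrightarrow> A \<in> U_J" "A \<in> UO \<Longrightarrow> A \<in> mats_O7"
  by (simp_all add: UO_def)

text \<open>The condition of membership in \<open>GL3_O7\<close> is automatic: the formula for
  \<open>uinv A\<close> shows that the inverse of an integral isometry is integral.\<close>

lemma carrier_UJO7: "carrier UJO7 = UO"
  unfolding UJO7_def UO_def GL3_O7_def using uinv_left uinv_right mats_O7_uinv by auto

lemma UO_mult: "A \<in> UO \<Longrightarrow> B \<in> UO \<Longrightarrow> A ** B \<in> UO"
  by (simp add: UO_def U_J_mult mats_O7_mult)

lemma UO_uinv: "A \<in> UO \<Longrightarrow> uinv A \<in> UO"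
  by (simp add: UO_def U_J_uinv mats_O7_uinv)

lemma UO_minus: "A \<in> UO \<Longrightarrow> - A \<in> UO"
  by (simp add: UO_def U_J_minus mats_O7_minus)

lemma UO_one [simp]: "mat 1 \<in> UO"
  by (simp add: UO_def mats_O7_one)

lemma UO_I: "hadj A ** J ** A = J \<Longrightarrow> (\<And>i j. A $ i $ j \<in> O7) \<Longrightarrow> A \<in> UO"
  by (simp add: UO_def U_J_iff mats_O7_def)

definition O7v :: "(complex^3) set" where "O7v = {v. \<forall>i. v $ i \<in> O7}"

lemma O7v_iff: "v \<in> O7v \<longleftrightarrow> v $ 1 \<in> O7 \<and> v $ 2 \<in> O7 \<and> v $ 3 \<in> O7"
  by (simp add: O7v_def forall_3)

lemma O7v_nth: "v \<in> O7v \<Longrightarrow> v $ i \<in> O7"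
  by (simp add: O7v_def)

lemma O7v_closed [simp]:
  "u \<in> O7v \<Longrightarrow> v \<in> O7v \<Longrightarrow> u + v \<in> O7v" "u \<in> O7v \<Longrightarrow> v \<in> O7v \<Longrightarrow> u - v \<in> O7v"
  "u \<in> O7v \<Longrightarrow> - u \<in> O7v" "c \<in> O7 \<Longrightarrow> u \<in> O7v \<Longrightarrow> c *s u \<in> O7v"
  by (simp_all add: O7v_def)

lemma O7v_mv: "A \<in> mats_O7 \<Longrightarrow> v \<in> O7v \<Longrightarrow> A *v v \<in> O7v"
  by (simp add: O7v_def mats_O7_def mv_nth)

lemma O7v_herm: "u \<in> O7v \<Longrightarrow> v \<in> O7v \<Longrightarrow> herm u v \<in> O7"
  by (simp add: O7v_def herm_expand)

lemma O7v_vec3 [simp]: "vec3 a b c \<in> O7v \<longleftrightarrow> a \<in> O7 \<and> b \<in> O7 \<and> c \<in> O7"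
  by (simp add: O7v_iff)

lemma cols_mats_O7: "cols a b c \<in> mats_O7 \<longleftrightarrow> a \<in> O7v \<and> b \<in> O7v \<and> c \<in> O7v"
  by (auto simp: mats_O7_def O7v_def forall_3)

lemma mats_O7_column: "A \<in> mats_O7 \<Longrightarrow> column j A \<in> O7v"
  by (simp add: mats_O7_def O7v_def column_def)

lemma cols_columns: "cols (column 1 A) (column 2 A) (column 3 A) = A"
  by (simp add: veq3 column_def)

subsection \<open>The group\<close>

lemma mult_UJO7 [simp]: "A \<otimes>\<^bsub>UJO7\<^esub> B = A ** B" and one_UJO7 [simp]: "\<one>\<^bsub>UJO7\<^esub> = mat 1"
  by (simp_all add: UJO7_def)

lemma group_UJO7: "group UJO7"
proof (rule groupI)
  show "\<exists>y\<in>carrier UJO7. y \<otimes>\<^bsub>UJO7\<^esub> x = \<one>\<^bsub>UJO7\<^esub>" if "x \<in> carrier UJO7" for x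
    using that unfolding carrier_UJO7
    by (intro bexI[of _ "uinv x"]) (simp_all add: uinv_left UO_uinv UO_D)
qed (simp_all add: carrier_UJO7 UO_mult matrix_mul_assoc)

lemma inv_UJO7: "A \<in> UO \<Longrightarrow> inv\<^bsub>UJO7\<^esub> A = uinv A"
  using group.inv_equality[OF group_UJO7, of "uinv A" A]
  by (simp add: carrier_UJO7 UO_uinv uinv_left UO_D)

lemma cls_eq: "cls A = {A, - A}"
  unfolding cls_def r_coset_def by (auto simp: UJO7_def)

lemma normal_pm1: "{mat 1, - mat 1} \<lhd> UJO7"
proof -
  interpret group UJO7 by (rule group_UJO7)
  have "subgroup {mat 1, - mat 1} UJO7"
  proof (rule subgroupI)
    show "{mat 1, - mat 1} \<subseteq> carrier UJO7" by (simp add: carrier_UJO7 UO_minus)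
    show "inv\<^bsub>UJO7\<^esub> a \<in> {mat 1, - mat 1}" if "a \<in> {mat 1, - mat 1}" for a
    proof -
      have "uinv (mat 1) = mat 1" using uinv_left[of "mat 1"] by simp
      then show ?thesis using that by (auto simp: inv_UJO7 UO_minus uinv_minus)
    qed
  qed auto
  then show ?thesis
  proof (rule normalI[rule_format])
    show "{mat 1, - mat 1} #>\<^bsub>UJO7\<^esub> x = x <#\<^bsub>UJO7\<^esub> {mat 1, - mat 1}" if "x \<in> carrier UJO7" for x
      by (auto simp: r_coset_def l_coset_def)
  qed
qed

lemma group_Gamma: "group \<Gamma>"
  unfolding \<Gamma>_def by (rule normal.factorgroup_is_group[OF normal_pm1])

lemma carrier_Gamma: "carrier \<Gamma> = cls ` UO"
  unfolding \<Gamma>_def carrier_FactGroup carrier_UJO7 cls_def by simp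

lemma cls_in [simp]: "A \<in> UO \<Longrightarrow> cls A \<in> carrier \<Gamma>"
  by (simp add: carrier_Gamma)

lemma cls_mult: "A \<in> UO \<Longrightarrow> B \<in> UO \<Longrightarrow> cls A \<otimes>\<^bsub>\<Gamma>\<^esub> cls B = cls (A ** B)"
  unfolding \<Gamma>_def FactGroup_def cls_def
  using normal.rcos_sum[OF normal_pm1, of A B] by (simp add: carrier_UJO7)

lemma cls_one: "\<one>\<^bsub>\<Gamma>\<^esub> = cls (mat 1)"
  unfolding \<Gamma>_def FactGroup_def by (auto simp: cls_eq)

lemma cls_inv: "A \<in> UO \<Longrightarrow> inv\<^bsub>\<Gamma>\<^esub> (cls A) = cls (uinv A)"
  using group.inv_equality[OF group_Gamma, of "cls (uinv A)" "cls A"]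
  by (simp add: UO_uinv cls_mult cls_one uinv_left UO_D)

lemma cls_eq_iff: "cls A = cls B \<longleftrightarrow> A = B \<or> A = - B"
  by (auto simp: cls_eq doubleton_eq_iff)

lemma cls_minus: "cls (- A) = cls A"
  by (auto simp: cls_eq)

primrec mpow :: "complex^3^3 \<Rightarrow> nat \<Rightarrow> complex^3^3" where
  "mpow A 0 = mat 1"
| "mpow A (Suc n) = mpow A n ** A"

lemma mpow_UO: "A \<in> UO \<Longrightarrow> mpow A n \<in> UO"
  by (induction n) (auto simp: UO_mult)

lemma cls_pow: "A \<in> UO \<Longrightarrow> cls A [^]\<^bsub>\<Gamma>\<^esub> n = cls (mpow A n)"
  by (induction n) (auto simp: cls_one cls_mult mpow_UO)

subsection \<open>Complex lines\<close>

lemma cline_scale: "c \<noteq> 0 \<Longrightarrow> cline (c *s v) = cline v"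
proof -
  assume "c \<noteq> 0"
  then have *: "d *s v = (d / c) *s (c *s v)" "d *s (c *s v) = (d * c) *s v" for d by simp_all
  show ?thesis unfolding cline_def
  proof (intro subset_antisym subsetI; elim rangeE)
    show "x \<in> range (\<lambda>d. d *s v)" if "x = d *s (c *s v)" for x d
      unfolding that *(2) by (rule rangeI)
    show "x \<in> range (\<lambda>d. d *s (c *s v))" if "x = d *s v" for x d
      unfolding that *(1)[of d] by (rule rangeI)
  qed
qed

lemma cline_eq_iff: "w \<noteq> 0 \<Longrightarrow> cline v = cline w \<longleftrightarrow> (\<exists>c. c \<noteq> 0 \<and> w = c *s v)"
proof
  assume "w \<noteq> 0" "cline v = cline w"
  have "w = 1 *s w" by simp
  then have "w \<in> cline w" unfolding cline_def by blast
  then obtain c where "w = c *s v" using \<open>cline v = cline w\<close> unfolding cline_def by auto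
  with \<open>w \<noteq> 0\<close> show "\<exists>c. c \<noteq> 0 \<and> w = c *s v" by (intro exI[of _ c]) auto
qed (auto simp: cline_scale)

lemma cline_minus: "cline (- v) = cline v"
  using cline_scale[of "-1" v] by simp

lemma mv_scale: "A *v (c *s v) = c *s (A *v (v::complex^3))"
  by (simp add: veq3 mv_nth algebra_simps)

lemma act_cls: "act (cls A) (cline v) = cline (A *v v)"
proof -
  have "(*v) A ` cline v = cline (A *v v)" for A
    unfolding cline_def by (simp add: image_image mv_scale)
  then show ?thesis by (simp add: act_def cls_eq cline_minus)
qed

lemma negative_nonzero: "v \<in> negative \<Longrightarrow> v \<noteq> 0"
  by (auto simp: negative_def)

lemma H2_E: assumes "p \<in> H2" obtains v where "v \<in> negative" "p = cline v"
  using assms by (auto simp: H2_def)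

lemma act_fixes_iff: "v \<in> negative \<Longrightarrow> A \<in> U_J \<Longrightarrow> act (cls A) (cline v) = cline v \<longleftrightarrow> (\<exists>c. cmod c = 1 \<and> A *v v = c *s v)"
proof -
  assume v: "v \<in> negative" and A: "A \<in> U_J"
  have "A *v v \<noteq> 0" using v A U_J_herm[OF A, of v v] by (auto simp: negative_def)
  have "cmod c = 1" if "A *v v = c *s v" for c
  proof -
    have "c * cnj c * herm v v = herm v v"
      using U_J_herm[OF A, of v v] that by (simp add: mult_ac)
    moreover have "herm v v \<noteq> 0" using v by (auto simp: negative_def)
    ultimately have "c * cnj c = 1" by simp
    then have "of_real ((cmod c)\<^sup>2) = complex_of_real 1" by (simp only: complex_norm_square of_real_1)
    then have "(cmod c)\<^sup>2 = 1" by (simp only: of_real_eq_iff)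
    then show ?thesis using power2_eq_iff_nonneg[of "cmod c" 1] by simp
  qed
  moreover have "act (cls A) (cline v) = cline v \<longleftrightarrow> (\<exists>c. c \<noteq> 0 \<and> A *v v = c *s v)"
    unfolding act_cls using cline_eq_iff[OF \<open>A *v v \<noteq> 0\<close>, of v] by metis
  ultimately show ?thesis by force
qed

section \<open>Bases of the lattice\<close>

text \<open>The adjugate. It inverts unimodular matrices over \<open>O7\<close>, and its trace is
  the second coefficient of the characteristic polynomial.\<close>

definition adj3 :: "complex^3^3 \<Rightarrow> complex^3^3" where
  "adj3 A = cols
     (vec3 (A$2$2 * A$3$3 - A$2$3 * A$3$2) (A$2$3 * A$3$1 - A$2$1 * A$3$3) (A$2$1 * A$3$2 - A$2$2 * A$3$1))
     (vec3 (A$1$3 * A$3$2 - A$1$2 * A$3$3) (A$1$1 * A$3$3 - A$1$3 * A$3$1) (A$1$2 * A$3$1 - A$1$1 * A$3$2))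
     (vec3 (A$1$2 * A$2$3 - A$1$3 * A$2$2) (A$1$3 * A$2$1 - A$1$1 * A$2$3) (A$1$1 * A$2$2 - A$1$2 * A$2$1))"

lemma adj3_left: "adj3 A ** A = mat (det A)"
  by (simp add: veq3 mm_nth adj3_def det_3 mat_def) (simp add: algebra_simps)

lemma adj3_right: "A ** adj3 A = mat (det A)"
  by (simp add: veq3 mm_nth adj3_def det_3 mat_def) (simp add: algebra_simps)

lemma adj3_mats_O7: "A \<in> mats_O7 \<Longrightarrow> adj3 A \<in> mats_O7"
  by (simp add: adj3_def cols_mats_O7) (simp add: mats_O7_def)

lemma det_O7: "A \<in> mats_O7 \<Longrightarrow> det A \<in> O7"
  by (simp add: det_3 mats_O7_def)

lemma det_hadj: "det (hadj A) = cnj (det A)"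
  by (simp add: det_3 algebra_simps)

lemma det_J: "det J = - 1"
  by (simp add: det_3)

lemma det_minus3: "det (- A) = - det (A :: complex^3^3)"
  by (simp add: det_3 algebra_simps)

lemma det_U_J: "A \<in> U_J \<Longrightarrow> cmod (det A) = 1"
proof -
  assume "A \<in> U_J"
  then have "cnj (det A) * det J * det A = det J"
    by (metis U_J_iff det_hadj det_mul)
  then have "of_real ((cmod (det A))\<^sup>2) = complex_of_real 1"
    by (simp only: complex_norm_square det_J) (simp add: mult.commute)
  then have "(cmod (det A))\<^sup>2 = 1" by (simp only: of_real_eq_iff)
  then show ?thesis using power2_eq_iff_nonneg[of "cmod (det A)" 1] by simp
qed

lemma det_UO: "A \<in> UO \<Longrightarrow> det A = 1 \<or> det A = - 1"
  using det_O7 det_U_J O7_unit by (auto simp: UO_def)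

lemma unimodular_inverse:
  assumes "Q \<in> mats_O7" "cmod (det Q) = 1"
  obtains Q' where "Q' \<in> mats_O7" "Q' ** Q = mat 1" "Q ** Q' = mat 1"
proof -
  have "det Q = 1 \<or> det Q = - 1" using assms det_O7 O7_unit by blast
  then show ?thesis
  proof
    assume "det Q = 1"
    then show ?thesis using that[of "adj3 Q"] adj3_left[of Q] adj3_right[of Q] adj3_mats_O7[OF assms(1)] by simp
  next
    assume "det Q = - 1"
    moreover have "- mat (- 1) = (mat 1 :: complex^3^3)" by (simp add: veq3 mat_def)
    ultimately show ?thesis
      using that[of "- adj3 Q"] adj3_left[of Q] adj3_right[of Q] mats_O7_minus[OF adj3_mats_O7[OF assms(1)]] by simp
  qed
qed

lemma gram_det:
  "det (hadj Q ** J ** Q) = - of_real ((cmod (det Q))\<^sup>2)"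
  by (simp only: det_mul det_hadj det_J complex_norm_square) simp

text \<open>Unimodularity of three lattice vectors can thus be read off from their products: a Gram
  determinant -1 makes them a basis.\<close>

lemma det_cols_gram:
  "herm a a * (herm b b * herm c c - herm b c * herm c b)
     - herm a b * (herm b a * herm c c - herm b c * herm c a)
     + herm a c * (herm b a * herm c b - herm b b * herm c a)
   = - of_real ((cmod (det (cols a b c)))\<^sup>2)"
proof -
  define G where "G = hadj (cols a b c) ** J ** cols a b c"
  have "det G = herm a a * (herm b b * herm c c - herm b c * herm c b)
     - herm a b * (herm b a * herm c c - herm b c * herm c a)
     + herm a c * (herm b a * herm c b - herm b b * herm c a)"
    unfolding det_3 by (simp add: G_def gram_nth algebra_simps)
  then show ?thesis by (simp add: G_def gram_det)
qed

text \<open>Take H = Q' Q^-1: it is integral as Q is unimodular, an isometry as the Gram matrices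
  agree, and intertwining as A and A' have the same matrix C in the two bases. Every comparison with
  a representative in the classification goes through this.\<close>

lemma conjugating_isometry:
  assumes Q: "Q \<in> mats_O7" "cmod (det Q) = 1" and Q': "Q' \<in> mats_O7"
    and gram: "hadj Q ** J ** Q = hadj Q' ** J ** Q'"
    and A: "A ** Q = Q ** C" "A' ** Q' = Q' ** C"
  obtains H where "H \<in> UO" "H ** A = A' ** H" "H ** Q = Q'"
proof -
  obtain P where P: "P \<in> mats_O7" "P ** Q = mat 1" "Q ** P = mat 1"
    using unimodular_inverse[OF Q] .
  define H where "H = Q' ** P"
  have HQ: "H ** Q = Q'" by (simp add: H_def P(2) flip: matrix_mul_assoc)
  have PP: "hadj P ** hadj Q = mat 1" using P(3) by (metis hadj_mult P(3) hadj_hadj matrix_mul_lid matrix_mul_rid)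
  have "hadj H ** J ** H = hadj P ** (hadj Q' ** J ** Q') ** P"
    by (simp add: H_def hadj_mult matrix_mul_assoc)
  also have "\<dots> = (hadj P ** hadj Q) ** J ** (Q ** P)" by (simp add: gram[symmetric] matrix_mul_assoc)
  also have "\<dots> = J" by (simp add: PP P(3))
  finally have "H \<in> UO" using Q' P(1) by (simp add: UO_def U_J_iff H_def mats_O7_mult)
  moreover have "H ** A = A' ** H"
  proof -
    have "H ** A ** Q = A' ** H ** Q"
      by (metis A HQ matrix_mul_assoc)
    then have "H ** A ** (Q ** P) = A' ** H ** (Q ** P)" by (metis matrix_mul_assoc)
    then show ?thesis by (simp add: P(3))
  qed
  ultimately show ?thesis using that HQ by blast
qed

lemma conjugating_isometry_basis:
  assumes "a1 \<in> O7v" "a2 \<in> O7v" "a3 \<in> O7v" "b1 \<in> O7v" "b2 \<in> O7v" "b3 \<in> O7v"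
    and "cmod (det (cols a1 a2 a3)) = 1"
    and "herm a1 a1 = herm b1 b1" "herm a1 a2 = herm b1 b2" "herm a1 a3 = herm b1 b3"
      "herm a2 a2 = herm b2 b2" "herm a2 a3 = herm b2 b3" "herm a3 a3 = herm b3 b3"
    and "A *v a1 = c11 *s a1 + c21 *s a2 + c31 *s a3" "A' *v b1 = c11 *s b1 + c21 *s b2 + c31 *s b3"
    and "A *v a2 = c12 *s a1 + c22 *s a2 + c32 *s a3" "A' *v b2 = c12 *s b1 + c22 *s b2 + c32 *s b3"
    and "A *v a3 = c13 *s a1 + c23 *s a2 + c33 *s a3" "A' *v b3 = c13 *s b1 + c23 *s b2 + c33 *s b3"
  obtains H where "H \<in> UO" "H ** A = A' ** H" "H *v a1 = b1" "H *v a2 = b2" "H *v a3 = b3"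
proof -
  have sym: "herm a2 a1 = herm b2 b1" "herm a3 a1 = herm b3 b1" "herm a3 a2 = herm b3 b2"
    using assms(9,10,12) by (metis herm_cnj)+
  obtain H where "H \<in> UO" "H ** A = A' ** H" "H ** cols a1 a2 a3 = cols b1 b2 b3"
  proof (rule conjugating_isometry)
    show "cols a1 a2 a3 \<in> mats_O7" "cols b1 b2 b3 \<in> mats_O7" "cmod (det (cols a1 a2 a3)) = 1"
      using assms by (simp_all add: cols_mats_O7)
    show "hadj (cols a1 a2 a3) ** J ** cols a1 a2 a3 = hadj (cols b1 b2 b3) ** J ** cols b1 b2 b3"
      by (simp only: veq3 gram_nth column_cols assms sym simp_thms)
    let ?C = "cols (vec3 c11 c21 c31) (vec3 c12 c22 c32) (vec3 c13 c23 c33)"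
    show "A ** cols a1 a2 a3 = cols a1 a2 a3 ** ?C"
      by (simp only: mult_cols cols_vec vec3_nth assms)
    show "A' ** cols b1 b2 b3 = cols b1 b2 b3 ** ?C"
      by (simp only: mult_cols cols_vec vec3_nth assms)
  qed
  then show ?thesis using that by (simp add: mult_cols cols_eq_iff)
qed

lemma span_cols:
  assumes "det (cols a b c) \<noteq> 0" obtains p q r where "x = p *s a + q *s b + r *s c"
proof -
  let ?Q = "cols a b c"
  define y where "y = (1 / det ?Q) *s (adj3 ?Q *v x)"
  have "?Q *v y = x"
    unfolding y_def mv_scale matrix_vector_mul_assoc adj3_right using assms
    by (simp add: veq3 mv_nth mat_def)
  then show ?thesis using that[of "y $ 1" "y $ 2" "y $ 3"] by (simp add: cols_vec)
qed

lemma span_cols_O7: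
  assumes "cols a b c \<in> mats_O7" "cmod (det (cols a b c)) = 1" "x \<in> O7v"
  obtains p q r where "p \<in> O7" "q \<in> O7" "r \<in> O7" "x = p *s a + q *s b + r *s c"
proof -
  obtain P where P: "P \<in> mats_O7" "cols a b c ** P = mat 1"
    using unimodular_inverse[OF assms(1,2)] by metis
  define y where "y = P *v x"
  have "y \<in> O7v" using P(1) assms(3) by (simp add: y_def O7v_mv)
  moreover have "cols a b c *v y = x" by (simp add: y_def matrix_vector_mul_assoc P(2))
  ultimately show ?thesis using that[of "y $ 1" "y $ 2" "y $ 3"] by (simp add: cols_vec O7v_iff)
qed

lemma det_cols_lin:
  "det (cols (p *s a + q *s b + r *s c) b c) = p * det (cols a b c)"
  "det (cols a (p *s b + q *s c) (r *s b + s *s c)) = (p * s - q * r) * det (cols a b c)"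
  by (simp_all add: det_3 algebra_simps)

text \<open>Two Bezout steps: one clears the third coordinate against the second, the next clears
  the second against the first.\<close>

lemma unimodular_reduction:
  assumes "u \<in> O7v"
  obtains N g where "N \<in> mats_O7" "det N = 1" "g \<in> O7" "N *v u = vec3 g 0 0"
proof -
  have u: "u $ 1 \<in> O7" "u $ 2 \<in> O7" "u $ 3 \<in> O7" using assms by (simp_all add: O7v_iff)
  obtain p q r s where 1: "p \<in> O7" "q \<in> O7" "r \<in> O7" "s \<in> O7" "p * s - q * r = 1"
    "r * u $ 2 + s * u $ 3 = 0" using O7_bezout[OF u(2,3)] by blast
  define h where "h = p * u $ 2 + q * u $ 3"
  have "h \<in> O7" using 1 u by (simp add: h_def)
  obtain p' q' r' s' where 2: "p' \<in> O7" "q' \<in> O7" "r' \<in> O7" "s' \<in> O7" "p' * s' - q' * r' = 1"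
    "r' * u $ 1 + s' * h = 0" using O7_bezout[OF u(1) \<open>h \<in> O7\<close>] by blast
  define M where "M = cols (vec3 1 0 0) (vec3 0 p r) (vec3 0 q s)"
  define M' where "M' = cols (vec3 p' r' 0) (vec3 q' s' 0) (vec3 0 0 1)"
  have "M *v u = vec3 (u $ 1) h 0"
    using 1(6) by (simp add: M_def cols_vec veq3 h_def mult.commute add.commute)
  then have "(M' ** M) *v u = vec3 (p' * u $ 1 + q' * h) 0 0"
    using 2(6) by (simp add: M'_def cols_vec veq3 algebra_simps flip: matrix_vector_mul_assoc)
  moreover have "det M = 1" "det M' = 1"
    using 1(5) 2(5) by (simp_all add: M_def M'_def det_3 mult.commute)
  then have "det (M' ** M) = 1" by (simp only: det_mul) simp
  moreover have "M' ** M \<in> mats_O7"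
    using 1 2 by (intro mats_O7_mult) (simp_all add: M_def M'_def cols_mats_O7)
  moreover have "p' * u $ 1 + q' * h \<in> O7" using 2 u \<open>h \<in> O7\<close> by simp
  ultimately show ?thesis using that by blast
qed

text \<open>Over the principal ideal domain \<open>O7\<close> primitive vectors are the unimodular ones; the latter
  property is the one used here.\<close>

definition uni :: "complex^3 \<Rightarrow> bool" where
  "uni w \<longleftrightarrow> w \<in> O7v \<and> (\<exists>x\<in>O7v. herm x w = 1)"

lemma uni_O7v: "uni w \<Longrightarrow> w \<in> O7v"
  by (simp add: uni_def)

lemma uni_imp_primitive: "uni w \<Longrightarrow> primitive w"
  unfolding primitive_def
proof (intro conjI ballI impI)
  assume "uni w"
  then obtain x where w: "w \<in> O7v" and x: "x \<in> O7v" "herm x w = 1" unfolding uni_def by blast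
  show "\<forall>i. w $ i \<in> O7" using w by (simp add: O7v_def)
  fix d assume d: "d \<in> O7" "\<forall>i. \<exists>c\<in>O7. w $ i = d * c"
  then obtain f where f: "\<And>i. f i \<in> O7" "\<And>i. w $ i = d * f i" by metis
  have "1 = cnj d * (x $ 3 * cnj (f 1) + x $ 2 * cnj (f 2) + x $ 1 * cnj (f 3))"
    using x(2) by (simp add: herm_expand f(2) algebra_simps)
  then have "d * cnj (x $ 3 * cnj (f 1) + x $ 2 * cnj (f 2) + x $ 1 * cnj (f 3)) = cnj 1"
    by (metis complex_cnj_cnj complex_cnj_mult)
  then show "\<exists>c\<in>O7. d * c = 1"
    using x f by (intro bexI[of _ "cnj (x $ 3 * cnj (f 1) + x $ 2 * cnj (f 2) + x $ 1 * cnj (f 3))"]) (auto simp: O7v_iff)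
qed

lemma exists_uni_multiple:
  assumes "u \<in> O7v" obtains g w where "g \<in> O7" "uni w" "u = g *s w"
proof -
  obtain N g where N: "N \<in> mats_O7" "det N = 1" "g \<in> O7" "N *v u = vec3 g 0 0"
    using unimodular_reduction[OF assms] .
  have inv: "adj3 N ** N = mat 1" "N ** adj3 N = mat 1" using N(2) adj3_left adj3_right by metis+
  define w where "w = adj3 N *v vec3 1 0 0"
  have "w \<in> O7v" using N by (simp add: w_def O7v_mv adj3_mats_O7)
  have Nw: "N *v w = vec3 1 0 0" by (simp add: w_def matrix_vector_mul_assoc inv)
  have "u = adj3 N *v (N *v u)" by (simp add: matrix_vector_mul_assoc inv)
  also have "\<dots> = adj3 N *v (g *s vec3 1 0 0)" unfolding N(4) by (simp add: veq3 mv_nth)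
  also have "\<dots> = g *s w" by (simp only: w_def mv_scale)
  finally have "u = g *s w" .
  \<comment> \<open>\<open>J\<close> reverses the coordinates, so the first row of N, conjugated and
    reversed, is the vector whose product with w is the conjugate of the first entry of N w.\<close>
  define x where "x = vec3 (cnj (N$1$3)) (cnj (N$1$2)) (cnj (N$1$1))"
  have "herm x w = cnj ((N *v w) $ 1)" by (simp add: herm_expand x_def mv_nth)
  then have "herm x w = 1" by (simp add: Nw)
  moreover have "x \<in> O7v" using N(1) by (simp add: x_def mats_O7_def)
  ultimately have "uni w" using \<open>w \<in> O7v\<close> by (auto simp: uni_def)
  then show ?thesis using that N(3) \<open>u = g *s w\<close> by blast
qed

lemma uni_scale_O7: "uni w \<Longrightarrow> c *s w \<in> O7v \<Longrightarrow> c \<in> O7"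
proof -
  assume "uni w" "c *s w \<in> O7v"
  then obtain x where x: "x \<in> O7v" "herm x w = 1" by (auto simp: uni_def)
  then have "herm (c *s w) x \<in> O7" using \<open>c *s w \<in> O7v\<close> by (intro O7v_herm)
  moreover have "herm w x = 1" using x(2) herm_cnj[of x w] by simp
  ultimately show ?thesis by simp
qed

text \<open>Pairing with w is given by a row vector, which N turns into (g, 0, 0). So the second and
  third rows of N span the complement of w, and g is a unit because some lattice vector has product
  1 with w.\<close>

lemma uni_complement_basis:
  assumes "uni w"
  obtains x b c where "x \<in> O7v" "b \<in> O7v" "c \<in> O7v" "herm x w = 1" "herm b w = 0" "herm c w = 0"
    "cmod (det (cols x b c)) = 1"
proof -
  have w: "w \<in> O7v" using assms by (simp add: uni_def)
  obtain y where y: "y \<in> O7v" "herm y w = 1" using assms by (auto simp: uni_def)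
  define \<rho> where "\<rho> = vec3 (cnj (w $ 3)) (cnj (w $ 2)) (cnj (w $ 1))"
  have "\<rho> \<in> O7v" using w by (simp add: \<rho>_def O7v_iff)
  then obtain N g where N: "N \<in> mats_O7" "det N = 1" "g \<in> O7" "N *v \<rho> = vec3 g 0 0"
    using unimodular_reduction by metis
  have h: "herm (row i N) w = (N *v \<rho>) $ i" for i
    by (simp add: herm_expand \<rho>_def mv_nth row_def algebra_simps)
  have r: "row i N \<in> O7v" for i using N(1) by (simp add: row_def O7v_def mats_O7_def)
  have cd: "det (cols (row 1 N) (row 2 N) (row 3 N)) = 1"
    using N(2) by (simp add: det_3 row_def algebra_simps)
  obtain p q s where p: "p \<in> O7" "y = p *s row 1 N + q *s row 2 N + s *s row 3 N"
  proof -
    have "cols (row 1 N) (row 2 N) (row 3 N) \<in> mats_O7" "cmod (det (cols (row 1 N) (row 2 N) (row 3 N))) = 1"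
      using r cd by (simp_all add: cols_mats_O7)
    from span_cols_O7[OF this y(1)] show ?thesis using that by metis
  qed
  have "herm y w = p * g" unfolding p(2) by (simp add: h N(4))
  then have "g * p = 1" using y(2) by (simp add: mult.commute)
  then have g: "g = 1 \<or> g = - 1" using O7_unit_mult N(3) p(1) by blast
  show ?thesis
  proof (rule that[of "g *s row 1 N" "row 2 N" "row 3 N"])
    show "herm (g *s row 1 N) w = 1" using g by (auto simp: h N(4))
    have "det (cols (g *s row 1 N) (row 2 N) (row 3 N)) = g"
      using det_cols_lin(1)[of g "row 1 N" 0 "row 2 N" 0 "row 3 N"] cd by simp
    then show "cmod (det (cols (g *s row 1 N) (row 2 N) (row 3 N))) = 1" using g by auto
  qed (use r N(3) in \<open>simp_all add: h N(4)\<close>)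
qed

section \<open>Elliptic isometries\<close>

text \<open>An eigenvector of \<open>J\<close> for the eigenvalue -1. Its norm is -2, so that adding
  \<open>herm x opt * herm opt y\<close>, with no extra factor, flips the sign of the form on this
  line.\<close>

definition opt :: "complex^3" where "opt = vec3 (- 1) 0 1"

lemma cip_herm_opt: "cip x y = herm x y + herm x opt * herm opt y"
  by (simp add: cip_def sum_3 herm_expand opt_def algebra_simps)

lemma cip_self: "cip x x = of_real ((cmod (x$1))\<^sup>2 + (cmod (x$2))\<^sup>2 + (cmod (x$3))\<^sup>2)"
  by (simp only: cip_def sum_3 of_real_add complex_norm_square)

text \<open>Horospherical coordinates: after scaling v to (z, \<zeta>, 1), a dilation followed by a
  Heisenberg translation moves \<open>opt\<close> to the line of v. Their product is the triangular
  matrix \<open>P\<close>.\<close>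

lemma opt_transitive:
  assumes "v \<in> negative" obtains R c where "R \<in> U_J" "c \<noteq> 0" "R *v v = c *s opt"
proof -
  have neg: "2 * Re (v$1 * cnj (v$3)) + (cmod (v$2))\<^sup>2 < 0"
    using assms unfolding cmod_power2 by (simp add: negative_def herm_expand power2_eq_square algebra_simps)
  then have v3: "v$3 \<noteq> 0" by (auto simp: not_less)
  define z where "z = v$1 / v$3"
  define \<zeta> where "\<zeta> = v$2 / v$3"
  define u where "u = - (2 * Re z + (cmod \<zeta>)\<^sup>2)"
  have "v$1 * cnj (v$3) = z * (of_real ((cmod (v$3))\<^sup>2))" "v$2 = \<zeta> * v$3"
    unfolding complex_norm_square using v3 by (simp_all add: z_def \<zeta>_def)
  then have "2 * Re (v$1 * cnj (v$3)) + (cmod (v$2))\<^sup>2 = - u * (cmod (v$3))\<^sup>2"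
    unfolding u_def by (simp add: norm_mult power_mult_distrib algebra_simps)
  then have "0 < u * (cmod (v$3))\<^sup>2" using neg by simp
  then have u: "u > 0" using v3 by (simp add: zero_less_mult_iff)
  \<comment> \<open>The vector (z, \<zeta>, 1) has norm -u and \<open>opt\<close> has norm -2, so
    the dilation factor must satisfy \<delta>^2 = u / 2.\<close>
  define \<delta> where "\<delta> = sqrt (u / 2)"
  have d: "\<delta> > 0" "\<delta> * \<delta> = u / 2" using u by (simp_all add: \<delta>_def)
  define dc where "dc = complex_of_real \<delta>"
  have dc: "dc \<noteq> 0" "cnj dc = dc" "dc * dc = of_real u / 2"
    using d(1) by (simp_all add: dc_def) (simp only: d(2) of_real_mult[symmetric] of_real_divide of_real_numeral, simp)
  define P where "P = cols (vec3 dc 0 0) (vec3 (- cnj \<zeta>) 1 0) (vec3 ((z + dc * dc) / dc) (\<zeta> / dc) (1 / dc))"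
  have rel: "z + cnj z + \<zeta> * cnj \<zeta> + of_real u = 0"
    unfolding u_def cmod_power2 by (simp add: complex_eq_iff power2_eq_square)

  have P: "P \<in> U_J"
    unfolding U_J_iff using dc arg_cong[OF rel, of "(*) dc"]
    by (simp add: veq3 mm_nth P_def field_simps)
  have "P *v opt = (1 / dc) *s vec3 z \<zeta> 1"
    using dc(1) by (simp add: P_def opt_def cols_vec veq3 field_simps)
  also have "vec3 z \<zeta> 1 = (1 / v$3) *s v" using v3 by (simp add: veq3 z_def \<zeta>_def)
  finally have "P *v opt = (1 / (dc * v$3)) *s v" by simp
  then have "v = (dc * v$3) *s (P *v opt)" using dc(1) v3 by simp
  then have "uinv P *v v = (dc * v$3) *s opt"
    by (metis P mv_scale uinv_vec(1))
  then show ?thesis using that[of "uinv P" "dc * v$3"] P U_J_uinv dc(1) v3 by simp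
qed

text \<open>A negative line is spanned by a vector of norm \<open>-2\<close>, and changing the sign of the form on this
  line yields a positive definite form, the standard one in suitable coordinates.\<close>

definition maj :: "complex^3 \<Rightarrow> complex^3 \<Rightarrow> complex^3 \<Rightarrow> complex" where
  "maj v x y = herm x y + herm x v * herm v y"

lemma normalize_negative:
  assumes "v \<in> negative"
  obtains R v0 c where "R \<in> U_J" "R *v v0 = opt" "c \<noteq> 0" "v = c *s v0" "herm v0 v0 = - 2"
    "\<And>x y. maj v0 x y = cip (R *v x) (R *v y)"
proof -
  obtain R c where R: "R \<in> U_J" "c \<noteq> 0" "R *v v = c *s opt" using opt_transitive[OF assms] .
  define v0 where "v0 = uinv R *v opt"
  have Rv0: "R *v v0 = opt" by (simp add: v0_def uinv_vec R(1))
  moreover have "v = c *s v0" by (metis R(1,3) mv_scale uinv_vec(1) v0_def)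
  moreover have "herm v0 v0 = - 2"
    using U_J_herm[OF R(1), of v0 v0] Rv0 by (simp add: herm_expand opt_def)
  moreover have "maj v0 x y = cip (R *v x) (R *v y)" for x y
    unfolding maj_def cip_herm_opt U_J_herm[OF R(1)]
    using U_J_herm[OF R(1), of x v0] U_J_herm[OF R(1), of v0 y] by (simp add: Rv0)
  ultimately show ?thesis using that R by blast
qed

lemma R_nonzero: "R \<in> U_J \<Longrightarrow> R *v x = 0 \<Longrightarrow> x = 0"
  by (metis uinv_vec(1) matrix_vector_mult_0_right)

lemma cip_pos: "x \<noteq> 0 \<Longrightarrow> Re (cip x x) > 0"
  unfolding cip_self by (simp add: veq3) (smt (verit) norm_eq_zero zero_le_power2 zero_less_power2)

text \<open>On the complement of a negative vector the form agrees with the positive definite one;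
  this is how the signature (2,1) is used.\<close>

lemma perp_negative_pos:
  assumes "v \<in> negative" "herm x v = 0" "x \<noteq> 0" shows "Re (herm x x) > 0"
proof -
  obtain R v0 c where R: "R \<in> U_J" "R *v v0 = opt" "c \<noteq> 0" "v = c *s v0"
    "\<And>x y. maj v0 x y = cip (R *v x) (R *v y)"
    using normalize_negative[OF assms(1)] by metis
  have "herm x v0 = 0" using assms(2) R(3,4) by simp
  then have "herm x x = cip (R *v x) (R *v x)" using R(5)[of x x] by (simp add: maj_def)
  moreover have "R *v x \<noteq> 0" using R_nonzero[OF R(1)] assms(3) by blast
  ultimately show ?thesis using cip_pos by simp
qed

lemma negative_not_perp: "v \<in> negative \<Longrightarrow> w \<in> negative \<Longrightarrow> herm v w \<noteq> 0"
  using perp_negative_pos[of w v] negative_nonzero[of v] by (auto simp: negative_def)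

text \<open>An isometry that preserves a negative line also preserves the form with the sign changed
  there, so it becomes unitary for the standard product in suitable coordinates.\<close>

lemma elliptic_unitary:
  assumes "A \<in> U_J" "v \<in> negative" "A *v v = c *s v" "cmod c = 1"
  obtains R where "R \<in> U_J" "\<And>x. cip ((R ** A ** uinv R) *v x) ((R ** A ** uinv R) *v x) = cip x x"
proof -
  obtain R v0 d where R: "R \<in> U_J" "R *v v0 = opt" "d \<noteq> 0" "v = d *s v0"
    "\<And>x y. maj v0 x y = cip (R *v x) (R *v y)"
    using normalize_negative[OF assms(2)] by metis
  have Av0: "A *v v0 = c *s v0"
  proof -
    have "d *s (A *v v0) = d *s (c *s v0)"
      using assms(3) unfolding R(4) mv_scale by (simp add: mult.commute)
    then show ?thesis using R(3) by (simp add: veq3)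
  qed
  have cc: "cnj c * c = 1" using assms(4) by (simp add: complex_norm_square[symmetric] mult.commute)
  have "maj v0 (A *v y) (A *v y) = maj v0 y y" for y
  proof -
    have "c * herm v0 (A *v y) = herm v0 y" "cnj c * herm (A *v y) v0 = herm y v0"
      using U_J_herm[OF assms(1), of v0 y] U_J_herm[OF assms(1), of y v0] by (simp_all add: Av0)
    moreover have "herm (A *v y) v0 * herm v0 (A *v y) = (cnj c * c) * (herm (A *v y) v0 * herm v0 (A *v y))"
      by (simp add: cc)
    ultimately have "herm (A *v y) v0 * herm v0 (A *v y) = herm y v0 * herm v0 y"
      by (metis (no_types, lifting) mult.assoc mult.left_commute)
    then show ?thesis unfolding maj_def U_J_herm[OF assms(1)] by simp
  qed
  then have "cip (R *v (A *v y)) (R *v (A *v y)) = cip (R *v y) (R *v y)" for y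
    unfolding R(5)[symmetric] by simp
  from this[of "uinv R *v _"] have "cip ((R ** A ** uinv R) *v x) ((R ** A ** uinv R) *v x) = cip x x" for x
    by (simp add: uinv_vec[OF R(1)] flip: matrix_vector_mul_assoc)
  with that R(1) show ?thesis by blast
qed

section \<open>Traces and characteristic polynomials of elliptic isometries\<close>

lemma trace3: "trace A = A$1$1 + A$2$2 + A$3$3" for A :: "complex^3^3"
  by (simp add: trace_def sum_3)

lemma trace_conj: "R \<in> U_J \<Longrightarrow> trace (R ** A ** uinv R) = trace A"
  by (metis matrix_mul_assoc matrix_mul_lid trace_mul_sym uinv_left)

lemma isometry_columns:
  assumes "\<And>x. cip (U *v x) (U *v x) = cip x x"
  shows "(cmod (U$1$j))\<^sup>2 + (cmod (U$2$j))\<^sup>2 + (cmod (U$3$j))\<^sup>2 = 1"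
proof -
  have "cip (U *v axis j 1) (U *v axis j 1) = cip (axis j 1) (axis j 1)" by (rule assms)
  moreover have "cip (axis j 1) (axis j 1) = 1"
    using exhaust_3[of j] by (auto simp: cip_self axis_def)
  ultimately have "cip (column j U) (column j U) = of_real 1" by (simp add: mv_axis)
  then show ?thesis unfolding cip_self of_real_eq_iff by (simp add: column_def)
qed

lemma elliptic_trace_le:
  assumes "A \<in> U_J" "v \<in> negative" "A *v v = c *s v" "cmod c = 1"
  shows "cmod (trace A) \<le> 3"
proof -
  obtain R where R: "R \<in> U_J" "\<And>x. cip ((R ** A ** uinv R) *v x) ((R ** A ** uinv R) *v x) = cip x x"
    using elliptic_unitary[OF assms] by metis
  define U where "U = R ** A ** uinv R"
  have "(cmod (U$1$j))\<^sup>2 + (cmod (U$2$j))\<^sup>2 + (cmod (U$3$j))\<^sup>2 = 1" for j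
    using isometry_columns R(2) unfolding U_def by blast
  then have "(cmod (U$1$j))\<^sup>2 \<le> 1 \<and> (cmod (U$2$j))\<^sup>2 \<le> 1 \<and> (cmod (U$3$j))\<^sup>2 \<le> 1" for j
    by (smt (verit) zero_le_power2)
  then have "cmod (U$1$1) \<le> 1" "cmod (U$2$2) \<le> 1" "cmod (U$3$3) \<le> 1"
    by (simp_all add: abs_square_le_1)
  then have "cmod (trace U) \<le> 3"
    unfolding trace3 by (smt (verit) norm_triangle_ineq)
  then show ?thesis by (simp add: U_def trace_conj R(1))
qed

text \<open>The equality case of the trace bound: the diagonal entries of the conjugated unitary
  matrix have real part 1 and modulus at most 1, hence are 1, and columns of length 1 leave room for
  nothing else.\<close>

lemma elliptic_trace_3:
  assumes "A \<in> U_J" "v \<in> negative" "A *v v = c *s v" "cmod c = 1" "trace A = 3"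
  shows "A = mat 1"
proof -
  obtain R where R: "R \<in> U_J" "\<And>x. cip ((R ** A ** uinv R) *v x) ((R ** A ** uinv R) *v x) = cip x x"
    using elliptic_unitary[OF assms(1-4)] by metis
  define U where "U = R ** A ** uinv R"
  have col: "(cmod (U$1$j))\<^sup>2 + (cmod (U$2$j))\<^sup>2 + (cmod (U$3$j))\<^sup>2 = 1" for j
    using isometry_columns R(2) unfolding U_def by blast
  then have "(cmod (U$1$j))\<^sup>2 \<le> 1 \<and> (cmod (U$2$j))\<^sup>2 \<le> 1 \<and> (cmod (U$3$j))\<^sup>2 \<le> 1" for j
    by (smt (verit) zero_le_power2)
  then have le: "cmod (U$1$1) \<le> 1" "cmod (U$2$2) \<le> 1" "cmod (U$3$3) \<le> 1"
    by (simp_all add: abs_square_le_1)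
  have "U$1$1 + U$2$2 + U$3$3 = 3"
    using trace_conj[OF R(1), of A] assms(5) by (simp add: U_def trace3)
  then have "Re (U$1$1) + Re (U$2$2) + Re (U$3$3) = 3" by (metis Re_complex_of_real of_real_numeral plus_complex.simps(1))
  then have re: "Re (U$1$1) = 1" "Re (U$2$2) = 1" "Re (U$3$3) = 1"
    using le complex_Re_le_cmod[of "U$1$1"] complex_Re_le_cmod[of "U$2$2"] complex_Re_le_cmod[of "U$3$3"]
    by linarith+
  have one: "u = 1" if "Re u = 1" "cmod u \<le> 1" for u
  proof -
    have "(cmod u)\<^sup>2 \<le> 1" using that(2) by (simp add: abs_square_le_1)
    then have "(Im u)\<^sup>2 \<le> 0" using that(1) by (simp add: cmod_power2)
    then show ?thesis using that(1) by (simp add: complex_eq_iff)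
  qed
  have "U$1$1 = 1" "U$2$2 = 1" "U$3$3 = 1" using one re le by blast+
  with col[of 1] col[of 2] col[of 3] have "U = mat 1" by (simp add: veq3 sum_power2_eq_zero_iff)
  then have "uinv R ** U ** R = mat 1" by (simp add: uinv_left R(1))
  moreover have "uinv R ** U ** R = (uinv R ** R) ** A ** (uinv R ** R)"
    by (simp add: U_def matrix_mul_assoc)
  ultimately show ?thesis by (simp add: uinv_left R(1))
qed

lemma cayley_hamilton3:
  "A *v (A *v (A *v x)) = trace A *s (A *v (A *v x)) - trace (adj3 A) *s (A *v x) + det A *s x"
  by (simp add: veq3 mv_nth trace3 adj3_def det_3) (simp add: algebra_simps)

lemma trace_square: "trace (A ** A) = (trace A)\<^sup>2 - 2 * trace (adj3 A)"
  by (simp add: trace3 mm_nth adj3_def power2_eq_square algebra_simps)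

lemma trace_uinv: "trace (uinv A) = cnj (trace A)"
  by (simp add: uinv_def trace3 mm_nth)

lemma uinv_adj3: "A \<in> U_J \<Longrightarrow> det A = 1 \<Longrightarrow> adj3 A = uinv A"
  by (metis adj3_left matrix_mul_assoc matrix_mul_lid matrix_mul_rid uinv_right)

text \<open>For determinant 1 the adjugate is the inverse, whose trace is the conjugate of the
  trace; so the trace determines the whole characteristic polynomial.\<close>

lemma char_poly_unitary:
  assumes "A \<in> U_J" "det A = 1"
  shows "A *v (A *v (A *v x)) = trace A *s (A *v (A *v x)) - cnj (trace A) *s (A *v x) + x"
    "trace (A ** A) = (trace A)\<^sup>2 - 2 * cnj (trace A)"
  using cayley_hamilton3[of A x] trace_square[of A] trace_uinv[of A] uinv_adj3[OF assms] assms(2)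
  by simp_all

text \<open>In the basis u, w, z the matrix A is triangular with diagonal 1, 1, r, and the
  determinant gives r = 1.\<close>

lemma fixed_plane_trace:
  assumes "det A = 1" "A *v u = u" "A *v w = w" "u \<noteq> 0" "herm u w = 0" "herm w w \<noteq> 0"
  shows "trace A = 3"
proof -
  \<comment> \<open>The conjugated cross product, for which the determinant of u, w, z is the sum of
    the squared moduli of its entries. It vanishes only if u and w are dependent, which
    \<open>herm u w = 0\<close> and \<open>herm w w \<noteq> 0\<close> exclude.\<close>
  define z where "z = vec3 (cnj (u$2 * w$3 - u$3 * w$2)) (cnj (u$3 * w$1 - u$1 * w$3)) (cnj (u$1 * w$2 - u$2 * w$1))"
  define Q where "Q = cols u w z"
  have "det Q = z$1 * cnj (z$1) + z$2 * cnj (z$2) + z$3 * cnj (z$3)"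
    by (simp add: Q_def det_3 z_def algebra_simps)
  also have "\<dots> = of_real ((cmod (z$1))\<^sup>2 + (cmod (z$2))\<^sup>2 + (cmod (z$3))\<^sup>2)"
    by (simp only: of_real_add complex_norm_square)
  finally have dQ: "det Q = of_real ((cmod (z$1))\<^sup>2 + (cmod (z$2))\<^sup>2 + (cmod (z$3))\<^sup>2)" .
  have "det Q \<noteq> 0"
  proof
    assume "det Q = 0"
    then have "(cmod (z$1))\<^sup>2 + (cmod (z$2))\<^sup>2 + (cmod (z$3))\<^sup>2 = 0" unfolding dQ by (simp only: of_real_eq_0_iff)
    then have "(cmod (z$1))\<^sup>2 = 0 \<and> (cmod (z$2))\<^sup>2 = 0 \<and> (cmod (z$3))\<^sup>2 = 0"
      by (smt (verit) zero_le_power2)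
    then have 0: "u$2 * w$3 = u$3 * w$2" "u$3 * w$1 = u$1 * w$3" "u$1 * w$2 = u$2 * w$1"
      by (simp_all add: z_def flip: complex_cnj_mult)
    have "herm w w *s u = herm u w *s w"
    proof -
      have "(w$3 * a + w$2 * b + w$1 * c) * u$1 = (u$3 * a + u$2 * b + u$1 * c) * w$1"
        "(w$3 * a + w$2 * b + w$1 * c) * u$2 = (u$3 * a + u$2 * b + u$1 * c) * w$2"
        "(w$3 * a + w$2 * b + w$1 * c) * u$3 = (u$3 * a + u$2 * b + u$1 * c) * w$3" for a b c
      proof -
        have "(w$3 * a + w$2 * b + w$1 * c) * u$1 - (u$3 * a + u$2 * b + u$1 * c) * w$1
          = a * (u$1 * w$3 - u$3 * w$1) + b * (u$1 * w$2 - u$2 * w$1)"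
          "(w$3 * a + w$2 * b + w$1 * c) * u$2 - (u$3 * a + u$2 * b + u$1 * c) * w$2
          = a * (u$2 * w$3 - u$3 * w$2) - c * (u$1 * w$2 - u$2 * w$1)"
          "(w$3 * a + w$2 * b + w$1 * c) * u$3 - (u$3 * a + u$2 * b + u$1 * c) * w$3
          = c * (u$3 * w$1 - u$1 * w$3) - b * (u$2 * w$3 - u$3 * w$2)"
          by (simp_all add: algebra_simps)
        then show "(w$3 * a + w$2 * b + w$1 * c) * u$1 = (u$3 * a + u$2 * b + u$1 * c) * w$1"
          "(w$3 * a + w$2 * b + w$1 * c) * u$2 = (u$3 * a + u$2 * b + u$1 * c) * w$2"
          "(w$3 * a + w$2 * b + w$1 * c) * u$3 = (u$3 * a + u$2 * b + u$1 * c) * w$3"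
          unfolding 0 by simp_all
      qed
      then show ?thesis by (simp only: veq3 herm_expand vector_smult_component simp_thms)
    qed
    then have "herm w w *s u = 0" by (simp add: assms(5))
    then show False using assms(4,6) by (auto simp: veq3)
  qed
  obtain p q r where pqr: "A *v z = p *s u + q *s w + r *s z"
    using span_cols[of u w z] \<open>det Q \<noteq> 0\<close> unfolding Q_def by metis
  define C where "C = cols (vec3 1 0 0) (vec3 0 1 0) (vec3 p q r)"
  have AQ: "A ** Q = Q ** C"
    by (simp add: Q_def C_def mult_cols cols_vec assms pqr)
  then have "det A * det Q = det Q * det C" by (metis det_mul)
  then have "det C = 1" using \<open>det Q \<noteq> 0\<close> assms(1) by simp
  then have "r = 1" by (simp add: C_def det_3)
  obtain Q' where Q': "Q ** Q' = mat 1" "Q' ** Q = mat 1"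
    using \<open>det Q \<noteq> 0\<close> by (metis invertible_def invertible_det_nz)
  have "A = Q ** (C ** Q')" using AQ Q'(1) by (metis matrix_mul_assoc matrix_mul_rid)
  then have "trace A = trace C" using Q'(2) by (metis matrix_mul_assoc matrix_mul_rid trace_mul_sym)
  then show ?thesis using \<open>r = 1\<close> by (simp add: C_def trace3)
qed

section \<open>The positive definite form attached to a negative vector\<close>

lemma maj_bilinear [simp]:
  "maj v (x + y) z = maj v x z + maj v y z" "maj v x (y + z) = maj v x y + maj v x z"
  "maj v (x - y) z = maj v x z - maj v y z" "maj v x (y - z) = maj v x y - maj v x z"
  "maj v (c *s x) z = c * maj v x z" "maj v x (c *s z) = cnj c * maj v x z"
  "maj v (- x) z = - maj v x z" "maj v x (- z) = - maj v x z"
  by (simp_all add: maj_def algebra_simps)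

lemma maj_cnj: "cnj (maj v x y) = maj v y x"
  by (simp add: maj_def herm_cnj)

lemma maj_real: "maj v x x = of_real (Re (maj v x x))"
  by (metis Reals_cnj_iff complex_is_Real_iff maj_cnj of_real_Re)

text \<open>Split x along v: the part orthogonal to v contributes equally to both forms, the part
  along v with opposite signs.\<close>

lemma maj_ge_herm: "\<bar>Re (herm x x)\<bar> \<le> Re (maj v x x)" if "herm v v = - 2" "v \<in> negative"
proof -
  have sq: "herm x v * herm v x = of_real ((cmod (herm x v))\<^sup>2)"
    by (simp only: complex_norm_square herm_cnj)
  have 1: "Re (maj v x x) = Re (herm x x) + (cmod (herm x v))\<^sup>2"
    by (simp only: maj_def sq plus_complex.simps Re_complex_of_real)
  define y where "y = x + (herm x v / 2) *s v"
  have "herm y v = 0" by (simp add: y_def that)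
  then have "Re (herm y y) \<ge> 0" using perp_negative_pos[OF that(2), of y] by (cases "y = 0") auto
  moreover have "herm y y = herm x x + of_real ((cmod (herm x v))\<^sup>2) / 2"
    unfolding sq[symmetric] by (simp add: y_def that herm_cnj algebra_simps)
  then have "Re (herm y y) = Re (herm x x) + (cmod (herm x v))\<^sup>2 / 2" by simp
  ultimately show ?thesis using 1 by (simp add: abs_le_iff)
qed

lemma maj_pos: "v \<in> negative \<Longrightarrow> herm v v = - 2 \<Longrightarrow> x \<noteq> 0 \<Longrightarrow> Re (maj v x x) > 0"
proof -
  assume v: "v \<in> negative" "herm v v = - 2" and x: "x \<noteq> 0"
  have sq: "herm x v * herm v x = of_real ((cmod (herm x v))\<^sup>2)"
    by (simp only: complex_norm_square herm_cnj)
  have 1: "Re (maj v x x) = Re (herm x x) + (cmod (herm x v))\<^sup>2"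
    by (simp only: maj_def sq plus_complex.simps Re_complex_of_real)
  show ?thesis
  proof (cases "herm x v = 0")
    case True
    then show ?thesis using perp_negative_pos[OF v(1) True x] 1 by simp
  next
    case False
    then have "(cmod (herm x v))\<^sup>2 > 0" by simp
    then show ?thesis using maj_ge_herm[OF v(2,1), of x] 1 by linarith
  qed
qed

lemma maj_invariant:
  assumes "A \<in> U_J" "A *v v = c *s v" "cmod c = 1"
  shows "maj v (A *v x) (A *v y) = maj v x y"
proof -
  have cc: "cnj c * c = 1" using assms(3) by (simp add: complex_norm_square[symmetric] mult.commute)
  have "c * herm v (A *v y) = herm v y" "cnj c * herm (A *v x) v = herm x v"
    using U_J_herm[OF assms(1), of v y] U_J_herm[OF assms(1), of x v] by (simp_all add: assms(2))
  then have "herm x v * herm v y = (cnj c * c) * (herm (A *v x) v * herm v (A *v y))"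
    by (metis (no_types, lifting) mult.assoc mult.left_commute)
  then show ?thesis by (simp add: maj_def U_J_herm[OF assms(1)] cc)
qed

text \<open>The determinant of the positive definite form on the complement of \<open>w\<close> is
  \<open>\<bar>\<langle>w,w\<rangle>\<bar>\<close>: on the complement the form itself has determinant \<open>- \<langle>w,w\<rangle>\<close>, and passing to
  \<^term>\<open>maj v\<close> changes the sign exactly when \<open>v\<close> lies in the complement.\<close>

lemma complement_gram:
  assumes "herm x w = 1" "herm b w = 0" "herm c w = 0" "cmod (det (cols x b c)) = 1" "herm w w \<noteq> 0"
  shows "herm b b * herm c c - herm b c * herm c b = - herm w w"
proof -
  have d: "det (cols x b c) \<noteq> 0" using assms(4) by auto
  obtain p q r where w: "w = p *s x + q *s b + r *s c" using span_cols[OF d] by metis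
  have wb: "herm w b = 0" "herm w c = 0" "herm w x = 1"
    using assms(1-3) herm_cnj by (metis complex_cnj_zero complex_cnj_one)+
  have "herm w w = p" using assms(1-3) arg_cong[OF w, of "\<lambda>u. herm u w"] by simp
  then have "p = herm w w" by simp
  then have "det (cols w b c) = herm w w * det (cols x b c)"
    using w det_cols_lin(1)[of p x q b r c] by simp
  then have "cmod (det (cols w b c)) = cmod (herm w w)" by (simp add: norm_mult assms(4))
  then have "herm w w * (herm b b * herm c c - herm b c * herm c b) = - of_real ((cmod (herm w w))\<^sup>2)"
    using wb det_cols_gram[of w b c] by simp
  also have "\<dots> = herm w w * (- herm w w)"
    by (simp only: complex_norm_square herm_cnj) simp
  finally show ?thesis using assms(5) unfolding mult_cancel_left by blast
qed

lemma complement_maj_gram: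
  assumes b: "herm x w = 1" "herm b w = 0" "herm c w = 0" "cmod (det (cols x b c)) = 1" "herm w w \<noteq> 0"
    and v: "v \<in> negative" "herm v v = - 2" "herm w v = 0 \<or> (\<exists>d. v = d *s w)"
  shows "Re (maj v b b) * Re (maj v c c) - (cmod (maj v b c))\<^sup>2 = \<bar>Re (herm w w)\<bar>"
proof -
  note G = complement_gram[OF b]
  have *: "of_real (Re (maj v b b) * Re (maj v c c) - (cmod (maj v b c))\<^sup>2)
      = maj v b b * maj v c c - maj v b c * maj v c b"
    by (subst (3 4) maj_real) (simp only: of_real_diff of_real_mult complex_norm_square maj_cnj)
  have "maj v b b * maj v c c - maj v b c * maj v c b = of_real \<bar>Re (herm w w)\<bar>"
  proof (cases "\<exists>d. v = d *s w")
    case True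
    then obtain d where d: "v = d *s w" by blast
    have "herm b v = 0" "herm c v = 0" using b by (simp_all add: d)
    then have "maj v b b * maj v c c - maj v b c * maj v c b = - herm w w" using G by (simp add: maj_def)
    moreover have "Re (herm w w) < 0"
    proof -
      have "herm v v = of_real ((cmod d)\<^sup>2) * herm w w"
        unfolding complex_norm_square by (simp add: d)
      then have "(cmod d)\<^sup>2 * Re (herm w w) = - 2" using v(2) by (metis Re_complex_of_real Re_divide_numeral herm_real mult.commute of_real_mult of_real_eq_iff of_real_minus of_real_numeral)
      then show ?thesis by (smt (verit) mult_nonneg_nonneg zero_le_power2)
    qed
    ultimately show ?thesis by (subst (asm) herm_real) simp
  next
    case False
    then have wv: "herm w v = 0" using v by blast
    then have vw: "herm v w = 0" by (metis herm_cnj complex_cnj_zero)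
    have d: "det (cols x b c) \<noteq> 0" using b(4) by auto
    obtain p q r where pqr: "v = p *s x + q *s b + r *s c" using span_cols[OF d] by metis
    have "p = 0" using vw b unfolding pqr by simp
    then have vq: "v = q *s b + r *s c" using pqr by simp
    define g11 g12 g21 g22 where "g11 = herm b b" and "g12 = herm b c" and "g21 = herm c b" and "g22 = herm c c"
    have f: "herm b v = cnj q * g11 + cnj r * g12" "herm c v = cnj q * g21 + cnj r * g22"
      "herm v b = q * g11 + r * g21" "herm v c = q * g12 + r * g22"
      by (simp_all add: vq g11_def g12_def g21_def g22_def)
    have n: "q * (cnj q * g11 + cnj r * g12) + r * (cnj q * g21 + cnj r * g22) = - 2"
      using v(2) by (subst (asm) (1) vq) (simp add: f)
    \<comment> \<open>Adding the rank one term multiplies the binary determinant by 1 +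
      \<open>herm v v\<close> = -1.\<close>
    have "maj v b b * maj v c c - maj v b c * maj v c b
      = (g11 * g22 - g12 * g21)
        * (1 + (q * (cnj q * g11 + cnj r * g12) + r * (cnj q * g21 + cnj r * g22)))"
      unfolding maj_def f g11_def[symmetric] g12_def[symmetric] g21_def[symmetric] g22_def[symmetric]
      by (simp add: algebra_simps)
    also have "\<dots> = herm w w" unfolding n using G by (simp add: g11_def g12_def g21_def g22_def)
    finally have "maj v b b * maj v c c - maj v b c * maj v c b = herm w w" .
    moreover have "Re (herm w w) > 0" using perp_negative_pos[OF v(1) wv] b(5) by (cases "w = 0") auto
    ultimately show ?thesis by (subst (asm) herm_real) simp
  qed
  with * show ?thesis by (simp only: of_real_eq_iff)
qed

lemma reduced_complement_basis:
  assumes w: "uni w" "herm w w \<noteq> 0"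
    and v: "v \<in> negative" "herm v v = - 2" "herm w v = 0 \<or> (\<exists>d. v = d *s w)"
  obtains x b c where "x \<in> O7v" "b \<in> O7v" "c \<in> O7v" "herm x w = 1" "herm b w = 0" "herm c w = 0"
    "cmod (det (cols x b c)) = 1"
    "(cmod (maj v c b))\<^sup>2 \<le> 4/7 * (Re (maj v b b))\<^sup>2" "Re (maj v b b) \<le> Re (maj v c c)"
    "Re (maj v b b) > 0" "(Re (maj v b b))\<^sup>2 \<le> 7/3 * \<bar>Re (herm w w)\<bar>"
proof -
  obtain x b1 b2 where b: "x \<in> O7v" "b1 \<in> O7v" "b2 \<in> O7v" "herm x w = 1" "herm b1 w = 0" "herm b2 w = 0"
    "cmod (det (cols x b1 b2)) = 1" using uni_complement_basis[OF w(1)] .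
  have D: "Re (maj v b1 b1) * Re (maj v b2 b2) - (cmod (maj v b1 b2))\<^sup>2 = \<bar>Re (herm w w)\<bar>"
    using complement_maj_gram b w v by blast
  have "Re (herm w w) \<noteq> 0" using w(2) herm_real[of w] by auto
  moreover have "b1 \<noteq> 0" using b(7) by (auto simp: det_3)
  then have "Re (maj v b1 b1) > 0" using maj_pos v by blast
  ultimately obtain p q r s where pq: "p \<in> O7" "q \<in> O7" "r \<in> O7" "s \<in> O7" "p * s - q * r = 1"
    "(cmod (bf (Re (maj v b1 b1)) (maj v b1 b2) (Re (maj v b2 b2)) r s p q))\<^sup>2
      \<le> 4/7 * (Re (bf (Re (maj v b1 b1)) (maj v b1 b2) (Re (maj v b2 b2)) p q p q))\<^sup>2"
    "Re (bf (Re (maj v b1 b1)) (maj v b1 b2) (Re (maj v b2 b2)) p q p q)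
      \<le> Re (bf (Re (maj v b1 b1)) (maj v b1 b2) (Re (maj v b2 b2)) r s r s)"
    "Re (bf (Re (maj v b1 b1)) (maj v b1 b2) (Re (maj v b2 b2)) p q p q) > 0"
    "(Re (bf (Re (maj v b1 b1)) (maj v b1 b2) (Re (maj v b2 b2)) p q p q))\<^sup>2 \<le> 7/3 * \<bar>Re (herm w w)\<bar>"
    using bf_reduction[OF _ D] zero_less_abs_iff by metis
  have bf: "maj v (p *s b1 + q *s b2) (r *s b1 + s *s b2)
    = bf (Re (maj v b1 b1)) (maj v b1 b2) (Re (maj v b2 b2)) p q r s" for p q r s
    unfolding bf_def maj_real[symmetric] maj_cnj by (simp add: algebra_simps)
  show ?thesis
  proof (rule that[of x "p *s b1 + q *s b2" "r *s b1 + s *s b2"])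
    show "cmod (det (cols x (p *s b1 + q *s b2) (r *s b1 + s *s b2))) = 1"
      by (simp add: det_cols_lin(2) pq(5) b(7))
    show "p *s b1 + q *s b2 \<in> O7v" "r *s b1 + s *s b2 \<in> O7v" using b pq by simp_all
    show "herm (p *s b1 + q *s b2) w = 0" "herm (r *s b1 + s *s b2) w = 0" using b by simp_all
  qed (simp_all only: bf b pq)
qed

section \<open>Short vectors in the whole lattice\<close>

lemma finite_O7v_bounded: "finite {x \<in> O7v. \<forall>i. cmod (x $ i) \<le> B}"
proof -
  let ?S = "{z \<in> O7. cmod z \<le> B}"
  have "{x \<in> O7v. \<forall>i. cmod (x $ i) \<le> B} \<subseteq> (\<lambda>(a, b, c). vec3 a b c) ` (?S \<times> ?S \<times> ?S)"
  proof
    fix x assume "x \<in> {x \<in> O7v. \<forall>i. cmod (x $ i) \<le> B}"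
    then show "x \<in> (\<lambda>(a, b, c). vec3 a b c) ` (?S \<times> ?S \<times> ?S)"
      by (intro image_eqI[of _ _ "(x$1, x$2, x$3)"]) (auto simp: O7v_def veq3)
  qed
  then show ?thesis by (rule finite_subset) (simp add: finite_O7_bounded)
qed

text \<open>Hermite's bound in rank 3: a lattice vector realising the minimum of the positive definite form
  has norm at most \<open>7/3\<close>.\<close>

lemma minimal_vector:
  assumes v: "v \<in> negative" "herm v v = - 2"
  obtains a where "uni a" "\<And>y. uni y \<Longrightarrow> Re (maj v a a) \<le> Re (maj v y y)"
proof -
  obtain R v0 c where R: "R \<in> U_J" "R *v v0 = opt" "c \<noteq> 0" "v = c *s v0" "herm v0 v0 = - 2"
    "\<And>x y. maj v0 x y = cip (R *v x) (R *v y)"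
    using normalize_negative[OF v(1)] by metis
  have cc: "c * cnj c = 1" using v(2) R(5) unfolding R(4) by (simp add: mult.commute)
  have mv: "maj v x y = cip (R *v x) (R *v y)" for x y
  proof -
    have "maj v x y = herm x y + (c * cnj c) * (herm x v0 * herm v0 y)"
      by (simp add: maj_def R(4) mult_ac)
    then show ?thesis unfolding cc R(6)[symmetric] maj_def by simp
  qed
  define q where "q x = Re (maj v x x)" for x
  define e where "e = vec3 1 0 0"
  have e: "uni e" unfolding uni_def
    by (auto simp: e_def herm_expand intro!: bexI[of _ "vec3 0 0 1"])
  \<comment> \<open>The entries of the inverse of R bound the coordinates of x by those of R x, so
    only finitely many lattice vectors have bounded value.\<close>
  define L where "L = (\<Sum>i\<in>UNIV. \<Sum>j\<in>UNIV. cmod (uinv R $ i $ j))"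
  have Lij: "cmod (uinv R $ i $ j) \<le> L" for i j
  proof -
    have "cmod (uinv R $ i $ j) \<le> (\<Sum>j\<in>UNIV. cmod (uinv R $ i $ j))"
      by (rule member_le_sum) auto
    also have "\<dots> \<le> L" unfolding L_def
      by (rule member_le_sum[of i UNIV "\<lambda>i. \<Sum>j\<in>UNIV. cmod (uinv R $ i $ j)"]) (auto intro: sum_nonneg)
    finally show ?thesis .
  qed
  define B where "B = 3 * L * sqrt (q e)"
  have bd: "cmod (x $ i) \<le> B" if "q x \<le> q e" for x i
  proof -
    define y where "y = R *v x"
    have "(cmod (y$1))\<^sup>2 + (cmod (y$2))\<^sup>2 + (cmod (y$3))\<^sup>2 \<le> q e"
      using that unfolding q_def mv y_def[symmetric] cip_self by simp
    then have "(cmod (y$1))\<^sup>2 \<le> q e" "(cmod (y$2))\<^sup>2 \<le> q e" "(cmod (y$3))\<^sup>2 \<le> q e"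
      by (smt (verit) zero_le_power2)+
    then have y: "cmod (y$1) \<le> sqrt (q e)" "cmod (y$2) \<le> sqrt (q e)" "cmod (y$3) \<le> sqrt (q e)"
      by (auto intro: real_le_rsqrt)
    have "x = uinv R *v y" by (simp add: y_def uinv_vec R(1))
    then have "cmod (x $ i) \<le> cmod (uinv R $ i $ 1 * y$1) + cmod (uinv R $ i $ 2 * y$2) + cmod (uinv R $ i $ 3 * y$3)"
      by (simp only: mv_nth) (meson norm_triangle_ineq order_trans add_right_mono)
    also have "\<dots> \<le> L * sqrt (q e) + L * sqrt (q e) + L * sqrt (q e)"
      unfolding norm_mult using Lij y by (intro add_mono mult_mono) (auto intro: order_trans[OF _ Lij])
    finally show ?thesis by (simp add: B_def)
  qed
  define F where "F = {x. uni x \<and> q x \<le> q e}"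
  have "F \<subseteq> {x \<in> O7v. \<forall>i. cmod (x $ i) \<le> B}" unfolding F_def using bd by (auto simp: uni_def)
  then have "finite F" using finite_O7v_bounded finite_subset by blast
  moreover have "F \<noteq> {}" using e by (auto simp: F_def)
  ultimately obtain a where a: "a \<in> F" "\<And>y. y \<in> F \<Longrightarrow> q a \<le> q y"
    by (metis arg_min_if_finite(1) arg_min_least)
  then have "q a \<le> q y" if "uni y" for y using that unfolding F_def by fastforce
  then show ?thesis using that a(1) unfolding F_def q_def by blast
qed

lemma cols_uni:
  assumes "cols a b c \<in> mats_O7" "cmod (det (cols a b c)) = 1" shows "uni a"
proof -
  obtain P where P: "P \<in> mats_O7" "P ** cols a b c = mat 1"
    using unimodular_inverse[OF assms] by metis
  define x where "x = vec3 (cnj (P$1$3)) (cnj (P$1$2)) (cnj (P$1$1))"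
  have "herm x a = cnj ((P ** cols a b c) $ 1 $ 1)"
    by (simp add: x_def herm_expand mm_nth)
  then have "herm x a = 1" by (simp add: P(2))
  moreover have "x \<in> O7v" using P(1) by (simp add: x_def mats_O7_def)
  ultimately show ?thesis using assms(1) unfolding uni_def by (auto simp: cols_mats_O7)
qed

lemma uni_extend_basis:
  assumes "uni a"
  obtains b c where "b \<in> O7v" "c \<in> O7v" "cmod (det (cols a b c)) = 1"
proof -
  obtain N g where N: "N \<in> mats_O7" "det N = 1" "g \<in> O7" "N *v a = vec3 g 0 0"
    using unimodular_reduction[OF uni_O7v[OF assms]] .
  have inv: "adj3 N ** N = mat 1" "N ** adj3 N = mat 1" using N(2) adj3_left adj3_right by metis+
  have dA: "det (adj3 N) = 1" using arg_cong[OF inv(1), of det] N(2) by (simp add: det_mul)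
  define w where "w = column 1 (adj3 N)"
  have "a = adj3 N *v (N *v a)" by (simp add: matrix_vector_mul_assoc inv)
  also have "\<dots> = g *s w" unfolding N(4) by (simp add: veq3 mv_nth w_def column_def mult.commute)
  finally have a: "a = g *s w" .
  obtain x where "x \<in> O7v" "herm x a = 1" using assms by (auto simp: uni_def)
  then have "cnj g * herm x w = 1" by (simp add: a)
  moreover have "w \<in> O7v" using N(1) by (simp add: w_def mats_O7_column adj3_mats_O7)
  ultimately have "cnj g = 1 \<or> cnj g = - 1"
    using O7_unit_mult[of "cnj g" "herm x w"] N(3) \<open>x \<in> O7v\<close> O7v_herm by simp
  then have "cmod g = 1" by (metis complex_mod_cnj norm_minus_cancel norm_one)
  have "det (cols a (column 2 (adj3 N)) (column 3 (adj3 N))) = g * det (adj3 N)"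
    using det_cols_lin(1)[of g w 0 "column 2 (adj3 N)" 0 "column 3 (adj3 N)"]
    by (simp add: a w_def cols_columns)
  then have "cmod (det (cols a (column 2 (adj3 N)) (column 3 (adj3 N)))) = 1"
    by (simp add: dA \<open>cmod g = 1\<close>)
  then show ?thesis using that[of "column 2 (adj3 N)" "column 3 (adj3 N)"] N(1)
    by (simp add: mats_O7_column adj3_mats_O7)
qed

text \<open>The coordinate change to the standard product is an isometry of \<open>J\<close>, so its
  determinant has modulus 1 and the Gram determinant is unchanged.\<close>

lemma maj_gram_det:
  assumes v: "v \<in> negative" "herm v v = - 2"
  shows "maj v a a * (maj v b b * maj v c c - maj v b c * maj v c b)
     - maj v a b * (maj v b a * maj v c c - maj v b c * maj v c a)
     + maj v a c * (maj v b a * maj v c b - maj v b b * maj v c a)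
   = of_real ((cmod (det (cols a b c)))\<^sup>2)"
proof -
  obtain R v0 d where R: "R \<in> U_J" "R *v v0 = opt" "d \<noteq> 0" "v = d *s v0" "herm v0 v0 = - 2"
    "\<And>x y. maj v0 x y = cip (R *v x) (R *v y)"
    using normalize_negative[OF v(1)] by metis
  have cc: "d * cnj d = 1" using v(2) R(5) unfolding R(4) by (simp add: mult.commute)
  have mv: "maj v x y = cip (R *v x) (R *v y)" for x y
  proof -
    have "maj v x y = herm x y + (d * cnj d) * (herm x v0 * herm v0 y)"
      by (simp add: maj_def R(4) mult_ac)
    then show ?thesis unfolding cc R(6)[symmetric] maj_def by simp
  qed
  define Q where "Q = R ** cols a b c"
  have Q: "Q = cols (R *v a) (R *v b) (R *v c)" by (simp add: Q_def mult_cols)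
  define G where "G = hadj Q ** Q"
  have G: "G $ i $ j = cip (column j Q) (column i Q)" for i j
    by (simp add: G_def mm_nth cip_def sum_3 column_def mult.commute)
  have "det G = maj v a a * (maj v b b * maj v c c - maj v b c * maj v c b)
     - maj v a b * (maj v b a * maj v c c - maj v b c * maj v c a)
     + maj v a c * (maj v b a * maj v c b - maj v b b * maj v c a)"
    unfolding det_3 mv by (simp add: G Q algebra_simps)
  moreover have "det G = of_real ((cmod (det Q))\<^sup>2)"
    unfolding G_def det_mul det_hadj complex_norm_square by simp
  moreover have "cmod (det Q) = cmod (det (cols a b c))"
    using det_U_J[OF R(1)] by (simp add: Q_def det_mul norm_mult)
  ultimately show ?thesis by simp
qed

text \<open>\<open>h\<close> is the form on the projections orthogonal to a. Its binary determinant
  is that of the Schur complement of the ternary Gram matrix.\<close>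

lemma projected_form:
  assumes v: "v \<in> negative" "herm v v = - 2" and a: "a \<noteq> 0"
  defines "m \<equiv> Re (maj v a a)"
    and "h \<equiv> (\<lambda>x y. maj v x y - maj v x a * maj v a y / of_real (Re (maj v a a)))"
  shows "Re (h b b) * Re (h c c) - (cmod (h b c))\<^sup>2 = (cmod (det (cols a b c)))\<^sup>2 / m"
    and "Re (h b b) = Re (maj v b b) - (cmod (maj v b a))\<^sup>2 / m"
proof -
  have m: "m > 0" unfolding m_def by (rule maj_pos[OF v a])
  have ma: "maj v a a = of_real m" unfolding m_def by (rule maj_real)
  have sq: "maj v x a * maj v a x = of_real ((cmod (maj v x a))\<^sup>2)" for x
    by (simp only: complex_norm_square maj_cnj)
  have hr: "h x x = of_real (Re (maj v x x) - (cmod (maj v x a))\<^sup>2 / m)" for x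
    unfolding h_def m_def[symmetric] sq by (subst maj_real) simp
  then show "Re (h b b) = Re (maj v b b) - (cmod (maj v b a))\<^sup>2 / m" by simp
  have hrr: "of_real (Re (h x x)) = h x x" for x using hr by simp
  have hc: "cnj (h b c) = h c b" by (simp add: h_def maj_cnj mult.commute)
  have "of_real (Re (h b b) * Re (h c c) - (cmod (h b c))\<^sup>2) = h b b * h c c - h b c * h c b"
    by (simp only: of_real_diff of_real_mult hrr complex_norm_square hc)
  also have "\<dots> = (maj v a a * (maj v b b * maj v c c - maj v b c * maj v c b)
     - maj v a b * (maj v b a * maj v c c - maj v b c * maj v c a)
     + maj v a c * (maj v b a * maj v c b - maj v b b * maj v c a)) / of_real m"
    unfolding h_def m_def[symmetric] ma using m by (simp add: field_simps)
  also have "\<dots> = of_real ((cmod (det (cols a b c)))\<^sup>2 / m)"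
    unfolding maj_gram_det[OF v] by simp
  finally show "Re (h b b) * Re (h c c) - (cmod (h b c))\<^sup>2 = (cmod (det (cols a b c)))\<^sup>2 / m"
    by (simp only: of_real_eq_iff)
qed

lemma hadamard3:
  assumes v: "v \<in> negative" "herm v v = - 2" and a: "a \<noteq> 0"
  shows "(cmod (det (cols a b c)))\<^sup>2 \<le> Re (maj v a a) * Re (maj v b b) * Re (maj v c c)"
proof -
  define m where "m = Re (maj v a a)"
  define h where "h = (\<lambda>x y. maj v x y - maj v x a * maj v a y / of_real (Re (maj v a a)))"
  have p1: "Re (h b b) * Re (h c c) - (cmod (h b c))\<^sup>2 = (cmod (det (cols a b c)))\<^sup>2 / m" for b c
    unfolding h_def m_def by (rule projected_form(1)[OF v a])
  have p2: "Re (h b b) = Re (maj v b b) - (cmod (maj v b a))\<^sup>2 / m" for b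
    unfolding h_def m_def by (rule projected_form(2)[OF v a])
  have m: "m > 0" unfolding m_def by (rule maj_pos[OF v a])
  have pos: "Re (h x x) \<ge> 0" for x
  proof -
    define y where "y = x - (maj v x a / of_real m) *s a"
    have "maj v y y = h x x"
      unfolding y_def h_def m_def[symmetric] using m maj_real[of v a, folded m_def]
      by (simp add: maj_cnj field_simps)
    moreover have "Re (maj v y y) \<ge> 0" using maj_pos[OF v, of y] by (cases "y = 0") (auto simp: maj_def)
    ultimately show ?thesis by simp
  qed
  have le: "Re (h x x) \<le> Re (maj v x x)" for x unfolding p2 using m by simp
  have "(cmod (det (cols a b c)))\<^sup>2 / m \<le> Re (h b b) * Re (h c c)" unfolding p1[symmetric] by simp
  also have "\<dots> \<le> Re (maj v b b) * Re (maj v c c)"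
    using le pos by (intro mult_mono) (auto intro: order_trans[OF pos le])
  finally show ?thesis unfolding m_def[symmetric] using m by (simp add: field_simps)
qed

text \<open>Hermite's induction: project along a minimal vector a of value m, take a short vector of
  the resulting binary form of determinant 1/m, with value k satisfying k^2 <= 7/3 * 1/m, and lift
  it within the covering radius. Minimality gives m <= k + 4/7 m, hence m^3 <= (7/3)^3.\<close>

lemma hermite_rank3:
  assumes v: "v \<in> negative" "herm v v = - 2"
  obtains a where "uni a" "Re (maj v a a) \<le> 7/3"
proof -
  obtain a where a: "uni a" "\<And>y. uni y \<Longrightarrow> Re (maj v a a) \<le> Re (maj v y y)"
    using minimal_vector[OF v] by metis
  obtain b c where bc: "b \<in> O7v" "c \<in> O7v" "cmod (det (cols a b c)) = 1"
    using uni_extend_basis[OF a(1)] .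
  have a0: "a \<noteq> 0" using bc(3) by (auto simp: det_3)
  define m where "m = Re (maj v a a)"
  define h where "h = (\<lambda>x y. maj v x y - maj v x a * maj v a y / of_real (Re (maj v a a)))"
  have p1: "Re (h b b) * Re (h c c) - (cmod (h b c))\<^sup>2 = (cmod (det (cols a b c)))\<^sup>2 / m" for b c
    unfolding h_def m_def by (rule projected_form(1)[OF v a0])
  have p2: "Re (h b b) = Re (maj v b b) - (cmod (maj v b a))\<^sup>2 / m" for b
    unfolding h_def m_def by (rule projected_form(2)[OF v a0])
  have m: "m > 0" unfolding m_def by (rule maj_pos[OF v a0])
  have ma: "maj v a a = of_real m" unfolding m_def by (rule maj_real)
  have D: "Re (h b b) * Re (h c c) - (cmod (h b c))\<^sup>2 = 1 / m" using bc(3) by (simp add: p1)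
  have hb: "h (p *s b + q *s c) (r *s b + s *s c) = bf (Re (h b b)) (h b c) (Re (h c c)) p q r s" for p q r s
  proof -
    have "cnj (h x x) = h x x" for x by (simp add: h_def maj_cnj mult.commute)
    then have "h x x = of_real (Re (h x x))" for x by (metis Reals_cnj_iff of_real_Re)
    moreover have "cnj (h b c) = h c b" by (simp add: h_def maj_cnj mult.commute)
    ultimately have "bf (Re (h b b)) (h b c) (Re (h c c)) p q r s
      = h b b * p * cnj r + h b c * p * cnj s + h c b * q * cnj r + h c c * q * cnj s"
      unfolding bf_def by metis
    then show ?thesis by (simp add: h_def add_divide_distrib algebra_simps)
  qed
  have "Re (h b b) > 0"
  proof -
    have "det (cols a (t *s a) c) = 0" for t by (simp add: det_3 algebra_simps)
    then have "b \<noteq> (maj v b a / of_real m) *s a" using bc(3) by (metis norm_zero zero_neq_one)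
    then have "b - (maj v b a / of_real m) *s a \<noteq> 0" by simp
    then have "Re (maj v (b - (maj v b a / of_real m) *s a) (b - (maj v b a / of_real m) *s a)) > 0"
      by (rule maj_pos[OF v])
    moreover have "maj v (b - (maj v b a / of_real m) *s a) (b - (maj v b a / of_real m) *s a) = h b b"
      unfolding h_def m_def[symmetric] using m by (simp add: ma maj_cnj field_simps)
    ultimately show ?thesis by (simp only:)
  qed
  from bf_reduction[OF this D] m obtain p q r s where pq: "p \<in> O7" "q \<in> O7" "r \<in> O7" "s \<in> O7" "p * s - q * r = 1"
    "Re (bf (Re (h b b)) (h b c) (Re (h c c)) p q p q) > 0"
    "(Re (bf (Re (h b b)) (h b c) (Re (h c c)) p q p q))\<^sup>2 \<le> 7/3 * (1 / m)" by (metis zero_less_divide_1_iff)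
  define x where "x = p *s b + q *s c"
  define k where "k = Re (h x x)"
  have k: "k > 0" "k\<^sup>2 \<le> 7/3 * (1 / m)" using pq(6,7) by (simp_all add: k_def x_def hb)
  obtain t where t: "t \<in> O7" "(cmod (maj v x a / of_real m - t))\<^sup>2 \<le> 4/7" using O7_covering by blast
  define y where "y = x - t *s a"
  have "uni y"
  proof (rule cols_uni)
    have O: "y \<in> O7v" "r *s b + s *s c \<in> O7v" using pq bc t a(1) by (simp_all add: y_def x_def uni_def)
    show "cols y (r *s b + s *s c) a \<in> mats_O7" using O a(1) by (simp add: cols_mats_O7 uni_def)
    have "det (cols y (r *s b + s *s c) a) = (p * s - q * r) * det (cols a b c)"
      by (simp add: det_3 y_def x_def algebra_simps)
    then show "cmod (det (cols y (r *s b + s *s c) a)) = 1" by (simp add: pq(5) bc(3))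
  qed
  then have "m \<le> Re (maj v y y)" using a(2) by (simp add: m_def)
  also have "maj v y y = h x x + of_real m * ((maj v x a / of_real m - t) * cnj (maj v x a / of_real m - t))"
    unfolding y_def h_def m_def[symmetric] using m by (simp add: ma maj_cnj field_simps)
  then have "Re (maj v y y) = k + m * (cmod (maj v x a / of_real m - t))\<^sup>2"
    unfolding complex_norm_square[symmetric] k_def of_real_mult[symmetric] plus_complex.simps Re_complex_of_real by simp
  also have "\<dots> \<le> k + m * (4/7)" using t(2) m by simp
  finally have "3/7 * m \<le> k" by simp
  then have "(3/7 * m)\<^sup>2 \<le> k\<^sup>2" using m by (intro power_mono) auto
  then have "(3/7 * m)\<^sup>2 \<le> 7/3 * (1 / m)" using k(2) by (rule order_trans)
  then have "(3/7 * m)\<^sup>2 * m \<le> 7/3" using m by (simp add: field_simps)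
  then have "m ^ 3 \<le> (7/3) ^ 3" by (simp add: power2_eq_square power3_eq_cube)
  then have "m \<le> 7/3" using m by (simp add: power_mono_iff)
  then show ?thesis using that a(1) by (simp add: m_def)
qed

section \<open>Lattices with an elliptic isometry\<close>

definition sim :: "complex^3^3 \<Rightarrow> complex^3^3 \<Rightarrow> bool" where
  "sim A B \<longleftrightarrow> (\<exists>H\<in>UO. H ** A = B ** H)"

lemma unit_sq: "cmod c = 1 \<Longrightarrow> c * cnj c = 1"
  by (simp add: complex_norm_square[symmetric])

text \<open>For determinant 1, t^2 - 2 cnj t is the trace of the square. The surviving value 3
  belongs to the identity, -1, 0, 1, 2 to orders 2, 3, 4, 6, and the conjugates -\<tau> and \<tau> -
  1 to order 7.\<close>

lemma trace_filter:
  assumes "t \<in> O7" "cmod t \<le> 3" "cmod (t\<^sup>2 - 2 * cnj t) \<le> 3"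
  shows "t \<in> {3, - 1, 0, 1, 2, - \<tau>, \<tau> - 1}"
proof -
  obtain x y :: int where t: "t = of_int x + of_int y * \<tau>" using assms(1) by (rule O7E)
  define X Y where "X = x * x - 2 * (y * y) - 2 * x - 2 * y" and "Y = 2 * (x * y) + y * y + 2 * y"
  have t2: "t\<^sup>2 - 2 * cnj t = of_int X + of_int Y * \<tau>"
    by (simp add: t X_def Y_def power2_eq_square algebra_simps tau_simps)
  have sq: "(cmod z)\<^sup>2 \<le> 9" if "cmod z \<le> 3" for z
    using power_mono[OF that, of 2] by simp
  have "real_of_int (x * x + x * y + 2 * (y * y)) \<le> 9" "real_of_int (X * X + X * Y + 2 * (Y * Y)) \<le> 9"
    using sq[OF assms(2), unfolded t] sq[OF assms(3), unfolded t2] by (simp_all only: cmod_lin_tau_int)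
  then have le: "x * x + x * y + 2 * (y * y) \<le> 9" "X * X + X * Y + 2 * (Y * Y) \<le> 9" by linarith+
  have "0 \<le> (2 * x + y) * (2 * x + y)" "0 \<le> (x + 4 * y) * (x + 4 * y)" by simp_all
  then have "y * y \<le> 5" "x * x \<le> 10" using le(1) by (auto simp: algebra_simps)
  then have "- 2 \<le> y \<and> y \<le> 2" "- 3 \<le> x \<and> x \<le> 3"
    using int_sq_le_cases[of y 5 2] int_sq_le_cases[of x 10 3] by auto
  then have "y \<in> {-2, -1, 0, 1, 2}" "x \<in> {-3, -2, -1, 0, 1, 2, 3}" by auto
  then show ?thesis using le(2) unfolding t X_def Y_def by auto
qed

section \<open>Residues modulo 2, modulo 3 and modulo the primes above 2\<close>

lemma O7_mod_2: "p \<in> O7 \<Longrightarrow> \<exists>q\<in>O7. \<exists>r\<in>{0, 1, \<tau>, 1 + \<tau>}. p = r + 2 * q"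
proof (elim O7E)
  fix x y :: int assume p: "p = of_int x + of_int y * \<tau>"
  have "p = (of_int (x mod 2) + of_int (y mod 2) * \<tau>) + 2 * (of_int (x div 2) + of_int (y div 2) * \<tau>)"
  proof -
    have "of_int x = of_int (x mod 2) + 2 * (of_int (x div 2) :: complex)" for x
      by (metis add.commute mult_div_mod_eq of_int_add of_int_mult of_int_numeral)
    from this[of x] this[of y] show ?thesis unfolding p by (simp add: algebra_simps)
  qed
  moreover have "of_int (x mod 2) + of_int (y mod 2) * \<tau> \<in> {0, 1, \<tau>, 1 + \<tau>}"
    using mod2_eq_if[of x] mod2_eq_if[of y] by auto
  ultimately show ?thesis using O7_lin by blast
qed

lemma O7_mod_3: "p \<in> O7 \<Longrightarrow> \<exists>q\<in>O7. \<exists>r\<in>{0, 1, -1, \<tau>, -\<tau>, 1 - \<tau>, \<tau> - 1, 1 + \<tau>, - 1 - \<tau>}. p = r + 3 * q"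
proof (elim O7E)
  fix x y :: int assume p: "p = of_int x + of_int y * \<tau>"
  have three: "\<exists>q r. x = r + 3 * q \<and> r \<in> {-1, 0, 1}" for x :: int
  proof -
    have "\<exists>q r. x = r + 3 * q \<and> (r = -1 \<or> r = 0 \<or> r = 1)" by presburger
    then show ?thesis by simp
  qed
  obtain q r where x: "x = r + 3 * q" "r \<in> {-1, 0, 1}" using three by blast
  obtain q' r' where y: "y = r' + 3 * q'" "r' \<in> {-1, 0, 1}" using three by blast
  have "p = (of_int r + of_int r' * \<tau>) + 3 * (of_int q + of_int q' * \<tau>)"
    unfolding p x(1) y(1) by (simp add: algebra_simps)
  moreover have "of_int r + of_int r' * \<tau> \<in> {0, 1, -1, \<tau>, -\<tau>, 1 - \<tau>, \<tau> - 1, 1 + \<tau>, - 1 - \<tau>}"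
    using x(2) y(2) by auto
  ultimately show ?thesis using O7_lin by blast
qed

text \<open>Since 2 is the product of \<tau> and its conjugate, each of the two primes has a residue
  field of two elements; the residues modulo 2 are reduced further.\<close>

lemma O7_mod_tau:
  assumes "p \<in> O7" "d \<in> {\<tau>, 1 - \<tau>}" shows "\<exists>q\<in>O7. p = d * q \<or> p = 1 + d * q"
proof -
  obtain q r where qr: "q \<in> O7" "r \<in> {0, 1, \<tau>, 1 + \<tau>}" "p = r + 2 * q" using O7_mod_2[OF assms(1)] by blast
  have 2: "2 = d * cnj d" using assms(2) by (elim insertE emptyE; hypsubst; simp add: tau_simps algebra_simps)
  have dO: "cnj d \<in> O7" using assms(2) by auto
  have "\<exists>s\<in>O7. r = d * s \<or> r = 1 + d * s"
  proof -
    have "0 = d * 0" "1 = 1 + d * 0" by simp_all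
    moreover have "d = \<tau> \<Longrightarrow> \<tau> = d * 1" "d = \<tau> \<Longrightarrow> 1 + \<tau> = 1 + d * 1" by simp_all
    moreover have "d = 1 - \<tau> \<Longrightarrow> \<tau> = 1 + d * (- 1)" "d = 1 - \<tau> \<Longrightarrow> 1 + \<tau> = d * (\<tau> - 1)"
      by (simp_all only:) (simp_all add: algebra_simps tau_simps)
    moreover have "(0::complex) \<in> O7" "(1::complex) \<in> O7" "(- 1::complex) \<in> O7" "\<tau> - 1 \<in> O7" by simp_all
    ultimately show ?thesis using qr(2) assms(2) by (metis empty_iff insert_iff)
  qed
  then obtain s where "s \<in> O7" "r = d * s \<or> r = 1 + d * s" by blast
  then have "p = d * (s + cnj d * q) \<or> p = 1 + d * (s + cnj d * q)"
    unfolding qr(3) 2 by (auto simp: algebra_simps)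
  moreover have "s + cnj d * q \<in> O7" using \<open>s \<in> O7\<close> qr(1) dO by simp
  ultimately show ?thesis by blast
qed

lemma fixed_multiple:
  assumes "det A = 1" "trace A \<noteq> 3" "A *v u = u" "A *v w = w" "herm w w \<noteq> 0"
  shows "u = (herm u w / herm w w) *s w"
proof (rule ccontr)
  let ?u = "u - (herm u w / herm w w) *s w"
  assume "\<not> ?thesis"
  then have "?u \<noteq> 0" by simp
  moreover have "A *v ?u = ?u"
    using assms(3,4) by (simp add: mv_scale matrix_vector_mult_diff_distrib)
  moreover have "herm ?u w = 0" using assms(5) by simp
  ultimately show False using fixed_plane_trace[OF assms(1) _ assms(4) _ _ assms(5)] assms(2) by blast
qed

lemma herm_self_int: "w \<in> O7v \<Longrightarrow> \<exists>k::int. herm w w = of_int k"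
  using O7_real[of "herm w w"] O7v_herm[of w w] herm_real[of w] by (metis Im_complex_of_real)

lemma O7_dvd_int:
  assumes "c \<in> O7" "c * of_int k = of_int n" "k \<noteq> 0" shows "k dvd n"
proof -
  have "Im c * of_int k = 0" using arg_cong[OF assms(2), of Im] by simp
  then have "Im c = 0" using assms(3) by simp
  then obtain j where "c = of_int j" using O7_real assms(1) by blast
  then have "of_int (j * k) = (of_int n :: complex)" using assms(2) by simp
  then have "j * k = n" by (simp only: of_int_eq_iff)
  then show ?thesis by auto
qed

text \<open>For integral t the characteristic polynomial is (X - 1)(X^2 + (1 - t) X + 1).
  \<open>E\<close> is the quadratic factor at A, so its values are fixed by A and it vanishes on the
  complement of w. Pairing \<open>E x\<close> with w multiplies \<open>herm x w\<close> by 3 - t,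
  whence k divides 3 - t.\<close>

lemma elliptic_fixed_vector:
  assumes A: "A \<in> UO" "det A = 1" and v: "v \<in> negative" "A *v v = c *s v"
    and t: "trace A = of_int t" "t \<in> {0, 1, 2}"
  obtains w k where "uni w" "A *v w = w" "herm w w = of_int k" "k \<noteq> 0" "k dvd 3 - t"
    "herm w v = 0 \<or> (\<exists>d. v = d *s w)"
    "\<And>y. herm y w = 0 \<Longrightarrow> A *v (A *v y) = of_int (t - 1) *s (A *v y) - y"
proof -
  have AU: "A \<in> U_J" "A \<in> mats_O7" using A(1) by (simp_all add: UO_def)
  have t3: "trace A \<noteq> 3" using t by auto
  define E where "E x = A *v (A *v x) + of_int (1 - t) *s (A *v x) + x" for x
  have AE: "A *v E x = E x" for x
    using char_poly_unitary(1)[OF AU(1) A(2), of x]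
    by (simp add: E_def t matrix_vector_right_distrib mv_scale veq3 algebra_simps)
  have EO: "E x \<in> O7v" if "x \<in> O7v" for x using that AU(2) by (simp add: E_def O7v_mv)
  have Ew: "herm (E x) w = of_int (3 - t) * herm x w" if "A *v w = w" for x w
  proof -
    have "herm (A *v x) w = herm x w" "herm (A *v (A *v x)) w = herm x w" for x
      using U_J_herm[OF AU(1)] that by metis+
    then show ?thesis by (simp add: E_def algebra_simps)
  qed
  \<comment> \<open>The trace of \<open>E\<close> is 3 - t, which is not 0, so \<open>E\<close> does
    not vanish on the standard basis.\<close>
  obtain i where i: "E (axis i 1) \<noteq> 0"
  proof -
    have "E (axis 1 1) $ 1 + E (axis 2 1) $ 2 + E (axis 3 1) $ 3
        = trace (A ** A) + of_int (1 - t) * trace A + 3"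
      by (simp add: E_def mv_axis trace3 mm_nth mv_nth column_def algebra_simps)
    also have "\<dots> = of_int (3 - t)"
      unfolding char_poly_unitary(2)[OF AU(1) A(2)] t(1) by (simp add: power2_eq_square algebra_simps)
    also have "\<dots> \<noteq> 0" using t(2) by auto
    finally show ?thesis using that by fastforce
  qed
  have "axis i 1 \<in> O7v" by (simp add: O7v_def axis_def)
  then obtain g w where gw: "g \<in> O7" "uni w" "E (axis i 1) = g *s w"
    using exists_uni_multiple[OF EO] by metis
  have "g \<noteq> 0" using gw(3) i by auto
  have "g *s (A *v w) = g *s w" using AE[of "axis i 1"] unfolding gw(3) mv_scale .
  then have Aw: "A *v w = w" using \<open>g \<noteq> 0\<close> by (simp add: veq3)
  have w0: "w \<noteq> 0" using gw(3) i by auto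
  have vn: "herm v v \<noteq> 0" using v(1) by (auto simp: negative_def)
  \<comment> \<open>Eigenvectors for the distinct eigenvalues 1 and c are orthogonal; if c = 1, the
    fixed space is a line and v is proportional to w.\<close>
  have wv: "herm w v = 0 \<or> (\<exists>d. v = d *s w)"
  proof (cases "c = 1")
    case True
    then have "w = (herm w v / herm v v) *s v"
      using fixed_multiple[OF A(2) t3 Aw _ vn] v(2) by simp
    then obtain m where m: "w = m *s v" by blast
    then have "m \<noteq> 0" using w0 by auto
    then have "v = (1 / m) *s w" unfolding m by simp
    then show ?thesis by blast
  next
    case False
    have "herm w v = cnj c * herm w v" using U_J_herm[OF AU(1), of w v] by (simp add: Aw v(2))
    then have "(1 - cnj c) * herm w v = 0" by (simp add: algebra_simps)
    moreover have "1 - cnj c \<noteq> 0" using False by (metis complex_cnj_cnj complex_cnj_one eq_iff_diff_eq_0)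
    ultimately show ?thesis by simp
  qed
  have ww: "herm w w \<noteq> 0"
  proof (cases "herm w v = 0")
    case True
    then show ?thesis using perp_negative_pos[OF v(1) True w0] by auto
  next
    case False
    then obtain d where "v = d *s w" using wv by blast
    then show ?thesis using vn by auto
  qed
  obtain k where k: "herm w w = of_int k" using herm_self_int gw(2) by (auto simp: uni_def)
  have k0: "k \<noteq> 0" using ww k by auto
  obtain x where x: "x \<in> O7v" "herm x w = 1" using gw(2) by (auto simp: uni_def)
  define e where "e = herm (E x) w / herm w w"
  have "E x = e *s w" unfolding e_def by (rule fixed_multiple[OF A(2) t3 AE Aw ww])
  then have "e \<in> O7" using uni_scale_O7[OF gw(2), of e] EO[OF x(1)] by simp
  moreover have "e * of_int k = of_int (3 - t)" using Ew[OF Aw, of x] x(2) ww k by (simp add: e_def)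
  ultimately have dv: "k dvd 3 - t" using O7_dvd_int k0 by blast
  have rel: "A *v (A *v y) = of_int (t - 1) *s (A *v y) - y" if "herm y w = 0" for y
  proof -
    have "E y = (herm (E y) w / herm w w) *s w" by (rule fixed_multiple[OF A(2) t3 AE Aw ww])
    then have "E y = 0" using Ew[OF Aw, of y] that by simp
    then show ?thesis by (simp add: E_def veq3 algebra_simps eq_neg_iff_add_eq_0)
  qed
  show ?thesis using that gw(2) Aw k k0 dv wv rel by blast
qed

lemma span_complement:
  assumes "x \<in> O7v" "b \<in> O7v" "y \<in> O7v" "herm x w = 1" "herm b w = 0" "herm y w = 0"
    "cmod (det (cols x b y)) = 1" "z \<in> O7v" "herm z w = 0"
  obtains p q where "p \<in> O7" "q \<in> O7" "z = p *s b + q *s y"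
proof -
  have "cols x b y \<in> mats_O7" using assms by (simp add: cols_mats_O7)
  from span_cols_O7[OF this assms(7,8)] obtain e p q where
    e: "p \<in> O7" "q \<in> O7" "z = e *s x + p *s b + q *s y" by metis
  have "e = 0" using assms(4-6,9) unfolding e(3) by simp
  then show ?thesis using that e by simp
qed

lemma trace_coords:
  assumes "\<beta> \<in> O7" "\<beta> + cnj \<beta> = of_int a"
  obtains e :: int where "4 * (cmod \<beta>)\<^sup>2 = of_int (a * a + 7 * (e * e))" "2 * \<beta> = of_int a + of_int e * i_sqrt7"
proof -
  obtain x y :: int where b: "\<beta> = of_int x + of_int y * \<tau>" using assms(1) by (rule O7E)
  have "complex_of_int (2 * x + y) = of_int a" using assms(2) by (simp add: b tau_simps algebra_simps)
  then have a: "a = 2 * x + y" by (simp only: of_int_eq_iff)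
  have "2 * \<beta> = of_int a + of_int y * i_sqrt7" by (simp add: b a tau_simps algebra_simps)

  moreover have "(cmod \<beta>)\<^sup>2 = of_int (x * x + x * y + 2 * (y * y))" unfolding b by (rule cmod_lin_tau_int)
  then have "4 * (cmod \<beta>)\<^sup>2 = of_int (a * a + 7 * (y * y))" by (simp add: a algebra_simps)
  ultimately show ?thesis using that by blast
qed

lemma O7_norm_int: "z \<in> O7 \<Longrightarrow> \<exists>n::int. (cmod z)\<^sup>2 = of_int n"
  using O7_norm_Ints by (auto elim: Ints_cases)

text \<open>The short vector b and its image A b span a sublattice of the complement with transition
  determinant d, of squared modulus N. The relation A^2 b = (t - 1) A b - b fixes the real part of
  their product in both forms. For the positive definite one this yields 12 N <= 7 (4 - (t - 1)^2),
  for the Hermitian one the Diophantine equation in \<alpha>, e, k and N.\<close>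

lemma elliptic_lattice:
  assumes A: "A \<in> UO" "det A = 1" and v: "v \<in> negative" "A *v v = c *s v" "cmod c = 1" "herm v v = - 2"
    and t: "trace A = of_int t" "t \<in> {0, 1, 2}"
  obtains w k x b y p d \<alpha> e N where "uni w" "A *v w = w" "herm w w = of_int k" "k \<noteq> 0" "k dvd 3 - t"
    "x \<in> O7v" "b \<in> O7v" "y \<in> O7v" "herm x w = 1" "herm b w = 0" "herm y w = 0" "cmod (det (cols x b y)) = 1"
    "herm b b = of_int \<alpha>" "3 * (\<alpha> * \<alpha>) \<le> 7 * \<bar>k\<bar>" "k < 0 \<Longrightarrow> \<alpha> > 0"
    "2 * herm b (A *v b) = of_int ((t - 1) * \<alpha>) + of_int e * i_sqrt7"
    "p \<in> O7" "d \<in> O7" "A *v b = p *s b + d *s y" "(cmod d)\<^sup>2 = of_int N" "N = 1 \<or> N = 2 \<and> t = 1"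
    "4 * (\<alpha> * \<alpha>) - (t - 1) * (t - 1) * (\<alpha> * \<alpha>) - 7 * (e * e) = - 4 * (k * N)"
    "A *v (A *v b) = of_int (t - 1) *s (A *v b) - b"
proof -
  have AU: "A \<in> U_J" "A \<in> mats_O7" using A(1) by (simp_all add: UO_def)
  obtain w k where w: "uni w" "A *v w = w" "herm w w = of_int k" "k \<noteq> 0" "k dvd 3 - t"
    "herm w v = 0 \<or> (\<exists>d. v = d *s w)"
    "\<And>y. herm y w = 0 \<Longrightarrow> A *v (A *v y) = of_int (t - 1) *s (A *v y) - y"
    using elliptic_fixed_vector[OF A v(1,2) t] by metis
  have "herm w w \<noteq> 0" using w(3,4) by simp
  from reduced_complement_basis[OF w(1) this v(1,4) w(6)] obtain x b y where
    b: "x \<in> O7v" "b \<in> O7v" "y \<in> O7v" "herm x w = 1" "herm b w = 0" "herm y w = 0" "cmod (det (cols x b y)) = 1"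
    and red: "Re (maj v b b) > 0" "(Re (maj v b b))\<^sup>2 \<le> 7/3 * \<bar>Re (herm w w)\<bar>" by metis
  define m where "m = Re (maj v b b)"
  have m: "m > 0" "m\<^sup>2 \<le> 7/3 * of_int \<bar>k\<bar>" using red by (simp_all add: m_def w(3))
  obtain \<alpha> where \<alpha>: "herm b b = of_int \<alpha>" using herm_self_int b(2) by blast
  have "\<bar>of_int \<alpha>\<bar> \<le> m" using maj_ge_herm[OF v(4,1), of b] by (simp add: \<alpha> m_def)
  then have "(of_int \<alpha>)\<^sup>2 \<le> m\<^sup>2" using power_mono[of "\<bar>of_int \<alpha>\<bar>" m 2] by simp
  then have "real_of_int (3 * (\<alpha> * \<alpha>)) \<le> of_int (7 * \<bar>k\<bar>)" using m(2) by (simp add: power2_eq_square)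
  then have \<alpha>le: "3 * (\<alpha> * \<alpha>) \<le> 7 * \<bar>k\<bar>" by (simp only: of_int_le_iff)
  have \<alpha>pos: "\<alpha> > 0" if "k < 0"
  proof -
    have "herm w v \<noteq> 0"
    proof
      assume wv0: "herm w v = 0"
      have "w \<noteq> 0" using b(4) by auto
      then have "Re (herm w w) > 0" by (rule perp_negative_pos[OF v(1) wv0])
      then show False using that w(3) by simp
    qed
    then obtain d where "v = d *s w" using w(6) by blast
    then have "herm b v = 0" by (simp add: b(5))
    then have "maj v b b = herm b b" by (simp add: maj_def)
    then show ?thesis using m(1) by (simp add: m_def \<alpha>)
  qed
  define jb where "jb = A *v b"
  have jjb: "A *v jb = of_int (t - 1) *s jb - b" unfolding jb_def by (rule w(7)[OF b(5)])
  have jw: "herm jb w = 0" using U_J_herm[OF AU(1), of b w] by (simp add: jb_def w(2) b(5))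
  have jO: "jb \<in> O7v" using AU(2) b(2) by (simp add: jb_def O7v_mv)
  obtain p d where pd: "p \<in> O7" "d \<in> O7" "jb = p *s b + d *s y"
    using span_complement[OF b jO jw] .
  have jj: "herm jb jb = herm b b" unfolding jb_def by (rule U_J_herm[OF AU(1)])
  define \<beta> where "\<beta> = herm b jb"
  have \<beta>O: "\<beta> \<in> O7" using b(2) jO by (simp add: \<beta>_def O7v_herm)
  have "herm jb (A *v jb) = \<beta>" unfolding \<beta>_def by (subst (1) jb_def) (rule U_J_herm[OF AU(1)])
  then have "\<beta> + cnj \<beta> = of_int ((t - 1) * \<alpha>)"
    unfolding jjb by (simp add: jj \<alpha> \<beta>_def herm_cnj algebra_simps)
  from trace_coords[OF \<beta>O this] obtain e where e: "2 * \<beta> = of_int ((t - 1) * \<alpha>) + of_int e * i_sqrt7"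
    "4 * (cmod \<beta>)\<^sup>2 = of_int ((t - 1) * \<alpha> * ((t - 1) * \<alpha>) + 7 * (e * e))" by metis
  obtain N where N: "(cmod d)\<^sup>2 = of_int N" using O7_norm_int pd(2) by blast
  have G: "herm b b * herm y y - herm b y * herm y b = - of_int k"
    using complement_gram[OF b(4-7)] w(3,4) by simp
  have "herm b b * herm jb jb - herm b jb * herm jb b = (d * cnj d) * (herm b b * herm y y - herm b y * herm y b)"
    unfolding pd(3) by (simp add: algebra_simps)
  then have "of_int \<alpha> * of_int \<alpha> - \<beta> * cnj \<beta> = - (d * cnj d) * of_int k"
    unfolding G unfolding jj \<alpha> by (simp add: \<beta>_def herm_cnj)
  then have "complex_of_real (of_int \<alpha> * of_int \<alpha> - (cmod \<beta>)\<^sup>2) = of_real (- (cmod d)\<^sup>2 * of_int k)"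
    by (simp only: of_real_diff of_real_mult of_real_minus complex_norm_square of_real_of_int_eq)
  then have eq: "of_int \<alpha> * of_int \<alpha> - (cmod \<beta>)\<^sup>2 = - of_int N * of_int k"
    unfolding N by (simp only: of_real_eq_iff)
  then have "real_of_int (4 * (\<alpha> * \<alpha>) - (t - 1) * (t - 1) * (\<alpha> * \<alpha>) - 7 * (e * e)) = of_int (- 4 * (k * N))"
    using e(2) by (simp add: algebra_simps)
  then have E: "4 * (\<alpha> * \<alpha>) - (t - 1) * (t - 1) * (\<alpha> * \<alpha>) - 7 * (e * e) = - 4 * (k * N)" by (simp only: of_int_eq_iff)
  \<comment> \<open>Otherwise b would be an eigenvector with eigenvalue p in \<open>O7\<close>, a
    root of X^2 - (t - 1) X + 1; but the units of \<open>O7\<close> are 1 and -1.\<close>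
  have d0: "d \<noteq> 0"
  proof
    assume "d = 0"
    then have jp: "jb = p *s b" using pd by simp
    then have "A *v jb = (p * p) *s b" unfolding jp mv_scale by (simp add: jb_def[symmetric] jp)
    then have "(p * p) *s b = (of_int (t - 1) * p - 1) *s b" using jjb unfolding jp by (simp add: veq3 algebra_simps)
    moreover have "b \<noteq> 0" using m(1) by (auto simp: m_def maj_def)
    ultimately have pp: "p * p = of_int (t - 1) * p - 1" unfolding vector_mul_rcancel by blast
    then have "p * (of_int (t - 1) - p) = 1" by (simp add: algebra_simps)
    then have "p = 1 \<or> p = - 1" using O7_unit_mult[of p "of_int (t - 1) - p"] pd(1) by simp
    then show False using pp t(2) by auto
  qed
  have N1: "N \<ge> 1" using O7_norm_ge_1[OF pd(2) d0] unfolding N by simp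
  define B where "B = maj v b jb"
  have mb: "maj v b b = of_real m" unfolding m_def by (rule maj_real)
  have mj: "maj v jb jb = maj v b b" unfolding jb_def by (rule maj_invariant[OF AU(1) v(2,3)])
  have "maj v jb (A *v jb) = B" unfolding B_def by (subst (1) jb_def) (rule maj_invariant[OF AU(1) v(2,3)])
  then have "B + cnj B = of_int (t - 1) * of_real m"
    unfolding jjb by (simp add: mj mb B_def maj_cnj algebra_simps)
  then have "Re (B + cnj B) = of_int (t - 1) * m" by simp
  then have "2 * Re B = of_int (t - 1) * m" by simp
  then have "4 * (Re B)\<^sup>2 = (of_int (t - 1) * m)\<^sup>2" by (metis power2_eq_square mult_2 power_mult_distrib four_x_squared)
  moreover have "(Re B)\<^sup>2 \<le> (cmod B)\<^sup>2" by (simp add: cmod_power2)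
  ultimately have Bge: "(of_int (t - 1))\<^sup>2 * m\<^sup>2 \<le> 4 * (cmod B)\<^sup>2" by (simp add: power_mult_distrib)
  have "maj v b b * maj v jb jb - B * cnj B = (d * cnj d) * (maj v b b * maj v y y - maj v b y * maj v y b)"
    unfolding B_def maj_cnj unfolding pd(3) by (simp add: algebra_simps)
  also have "maj v b b * maj v y y - maj v b y * maj v y b
     = of_real (Re (maj v b b) * Re (maj v y y) - (cmod (maj v b y))\<^sup>2)"
    by (subst (1 2) maj_real) (simp only: of_real_diff of_real_mult complex_norm_square maj_cnj)
  also have "\<dots> = of_real (of_int \<bar>k\<bar>)"
    using complement_maj_gram[OF b(4-7) _ v(1,4) w(6)] w(3,4) by simp
  finally have "of_real (m * m - (cmod B)\<^sup>2) = complex_of_real ((cmod d)\<^sup>2 * of_int \<bar>k\<bar>)"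
    by (simp only: of_real_diff of_real_mult complex_norm_square mj mb)
  then have "m * m - (cmod B)\<^sup>2 = of_int N * of_int \<bar>k\<bar>" unfolding N by (simp only: of_real_eq_iff)
  then have "4 * (of_int N * of_int \<bar>k\<bar>) \<le> (4 - (of_int (t - 1))\<^sup>2) * m\<^sup>2"
    using Bge by (simp add: algebra_simps power2_eq_square)
  also have "\<dots> \<le> (4 - (of_int (t - 1))\<^sup>2) * (7/3 * of_int \<bar>k\<bar>)"
    using m(2) t(2) by (intro mult_left_mono) auto
  finally have "12 * of_int N * real_of_int \<bar>k\<bar> \<le> 7 * (4 - (of_int (t - 1))\<^sup>2) * of_int \<bar>k\<bar>"
    by (simp add: mult_ac)
  then have "12 * real_of_int N \<le> 7 * (4 - (of_int (t - 1))\<^sup>2)"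
    using w(4) by (simp add: mult_le_cancel_right)
  then have N2: "N = 1 \<or> N = 2 \<and> t = 1" using N1 t(2) by auto
  show ?thesis
    by (rule that[of w k x b y \<alpha> e p d N])
      (use w b \<alpha> \<alpha>le \<alpha>pos e(1) pd N N2 E jjb in \<open>simp_all add: \<beta>_def jb_def\<close>)
qed

section \<open>Classification of the elements of order 2, 3, 4 and 6\<close>

lemmas rep_mv = veq3 mv_nth vector_3

lemma herm_vec3: "herm (vec3 a b c) (vec3 d e f) = c * cnj d + b * cnj e + a * cnj f"
  by (simp add: herm_expand)

lemma vec3_add: "vec3 a b c + vec3 d e f = vec3 (a + d) (b + e) (c + f)"
  and vec3_minus: "- vec3 a b c = vec3 (- a) (- b) (- c)"
  and vec3_diff: "vec3 a b c - vec3 d e f = vec3 (a - d) (b - e) (c - f)"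
  and vec3_scale: "k *s vec3 a b c = vec3 (k * a) (k * b) (k * c)"
  by (simp_all add: veq3)

lemma vec3_eq_iff: "vec3 a b c = vec3 d e f \<longleftrightarrow> a = d \<and> b = e \<and> c = f"
  by (simp add: veq3)

lemma rep_vec3:
  "rep E2a *v vec3 a b c = vec3 (i_sqrt7 * a + 4 * c) b (2 * a - i_sqrt7 * c)"
  "rep E2b *v vec3 a b c = vec3 c b a"
  "rep E2c *v vec3 a b c = vec3 ((\<tau> - 1) * a + \<tau> * b + 2 * c) (\<tau> * a + 2 * b + (1 - \<tau>) * c) (2 * a + (1 - \<tau>) * b - \<tau> * c)"
  "rep E3a *v vec3 a b c = vec3 (- a + \<tau> * b + c) ((\<tau> - 1) * a + b) a"
  "rep E3b *v vec3 a b c = vec3 (- a + (\<tau> - 1) * b + c) (\<tau> * a + b) a"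
  "rep E3c *v vec3 a b c = vec3 (5 * a - 3 * i_sqrt7 * c) (- b) (- i_sqrt7 * a - 4 * c)"
  "rep E4a *v vec3 a b c = vec3 c (b + 2 * c) (a - 2 * b - 2 * c)"
  "rep E4b *v vec3 a b c = vec3 c (b + (2 - \<tau>) * c) (a - (1 + \<tau>) * b - 2 * c)"
  "rep E6 *v vec3 a b c = vec3 (- 5 * a + 3 * i_sqrt7 * c) (- b) (i_sqrt7 * a + 4 * c)"
  "rep E7 *v vec3 a b c = vec3 c (b + c) (a - b + (\<tau> - 1) * c)"
  by (simp_all add: rep_mv cnj_tau algebra_simps)

lemmas vec3_simps = herm_vec3 vec3_add vec3_minus vec3_diff vec3_scale vec3_eq_iff rep_vec3

lemma UO_rep: "rep i \<in> UO"
proof (rule UO_I)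
  show "hadj (rep i) ** J ** rep i = J"
    by (cases i; simp add: veq3 mm_nth vector_3 tau_simps algebra_simps)
  have "\<forall>k j. rep i $ k $ j \<in> O7"
    by (cases i; simp add: forall_3 vector_3)
  then show "rep i $ k $ j \<in> O7" for k j by blast
qed

lemma sim_from_bases:
  assumes "a1 \<in> O7v" "a2 \<in> O7v" "a3 \<in> O7v" "b1 \<in> O7v" "b2 \<in> O7v" "b3 \<in> O7v"
    and "cmod (det (cols a1 a2 a3)) = 1"
    and "herm a1 a1 = herm b1 b1" "herm a1 a2 = herm b1 b2" "herm a1 a3 = herm b1 b3"
      "herm a2 a2 = herm b2 b2" "herm a2 a3 = herm b2 b3" "herm a3 a3 = herm b3 b3"
    and "A *v a1 = c11 *s a1 + c21 *s a2 + c31 *s a3" "A' *v b1 = c11 *s b1 + c21 *s b2 + c31 *s b3"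
    and "A *v a2 = c12 *s a1 + c22 *s a2 + c32 *s a3" "A' *v b2 = c12 *s b1 + c22 *s b2 + c32 *s b3"
    and "A *v a3 = c13 *s a1 + c23 *s a2 + c33 *s a3" "A' *v b3 = c13 *s b1 + c23 *s b2 + c33 *s b3"
  shows "sim A A'"
  using conjugating_isometry_basis[OF assms] unfolding sim_def by metis

lemma det_cols_1I:
  assumes "herm a a * (herm b b * herm c c - herm b c * herm c b)
     - herm a b * (herm b a * herm c c - herm b c * herm c a)
     + herm a c * (herm b a * herm c b - herm b b * herm c a) = - 1"
  shows "cmod (det (cols a b c)) = 1"
proof -
  have "- complex_of_real ((cmod (det (cols a b c)))\<^sup>2) = - of_real 1"
    using det_cols_gram[of a b c] assms by simp
  then have "(cmod (det (cols a b c)))\<^sup>2 = 1" by (simp only: neg_equal_iff_equal of_real_eq_iff)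
  then show ?thesis using power2_eq_iff_nonneg[of "cmod (det (cols a b c))" 1] by simp
qed

lemma herm_sym0: "herm a b = 0 \<Longrightarrow> herm b a = 0"
  by (metis herm_cnj complex_cnj_zero)

text \<open>The vectors of the representatives below were found by computer search.\<close>

lemma sim_unimodular_complement:
  assumes A: "A \<in> UO" and O: "w \<in> O7v" "b \<in> O7v"
    and w: "A *v w = w" "herm w w = 1" "herm b w = 0"
    and b: "herm b b = of_int \<alpha>" "\<alpha> = 1 \<or> \<alpha> = - 1" "2 * herm b (A *v b) = of_int ((t - 1) * \<alpha>) + of_int s * i_sqrt7"
    and rel: "A *v (A *v b) = of_int (t - 1) *s (A *v b) - b"
    and t: "(t = 0 \<and> s = - 1 \<and> i = E3c) \<or> (t = 2 \<and> s = 1 \<and> i = E6)"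
  shows "sim A (- rep i)"
proof -
  have AU: "A \<in> U_J" "A \<in> mats_O7" using A(1) by (simp_all add: UO_def)
  define jb where "jb = A *v b"
  have jb: "herm jb jb = of_int \<alpha>" "herm jb w = 0" "jb \<in> O7v"
    using U_J_herm[OF AU(1), of b b] U_J_herm[OF AU(1), of b w] AU(2) O
    by (simp_all add: jb_def w b O7v_mv)
  define \<beta> where "\<beta> = herm b jb"
  have \<beta>: "\<beta> = (of_int ((t - 1) * \<alpha>) + of_int s * i_sqrt7) / 2" unfolding \<beta>_def jb_def b(3)[symmetric] by simp
  have "herm jb b = cnj \<beta>" by (simp add: \<beta>_def herm_cnj)
  \<comment> \<open>The binary Gram determinant is \<alpha>^2 - |\<beta>|^2 = 1 - 2 = -1, so b and A
    b generate the complement and w splits off.\<close>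
  have "\<beta> * cnj \<beta> = 2" using t b(2) unfolding \<beta> by (auto simp: tau_simps field_simps)
  have "complex_of_int \<alpha> * of_int \<alpha> = 1" using b(2) by auto
  then have det: "cmod (det (cols w b jb)) = 1"
    by (intro det_cols_1I) (use b(2) in \<open>auto simp: w herm_sym0 jb b \<open>herm jb b = cnj \<beta>\<close> \<beta>_def[symmetric] \<open>\<beta> * cnj \<beta> = 2\<close>\<close>)
  \<comment> \<open>A vector orthogonal to the fixed vector (0, 1, 0) of \<open>- rep i\<close>, of
    norm 1 or -1 as \<alpha> requires; its product with its image is again \<beta>.\<close>
  define x where "x = (if \<alpha> = 1 then vec3 \<tau> 0 1 else vec3 (1 - \<tau>) 0 (- 1))"
  define jx where "jx = - rep i *v x"
  show ?thesis
  proof (rule sim_from_bases[of w b jb "vec3 0 1 0" x jx A 1 0 0 "- rep i" 0 0 1 0 "- 1" "of_int (t - 1)"])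
    show xO: "x \<in> O7v" by (simp add: x_def)
    show "jx \<in> O7v" unfolding jx_def by (rule O7v_mv[OF mats_O7_minus[OF UO_D(2)[OF UO_rep]] xO])
    show "A *v jb = 0 *s w + (- 1) *s b + of_int (t - 1) *s jb"
      using rel by (simp add: jb_def veq3)
    show "herm b b = herm x x" using b(1,2) by (auto simp: x_def herm_expand tau_simps algebra_simps)
    show "herm b jb = herm x jx" unfolding \<beta>_def[symmetric] \<beta>
      using t b(2) by (auto simp: x_def jx_def herm_expand rep_mv tau_simps field_simps)
    show "herm jb jb = herm jx jx"
      unfolding jb(1) using t b(2) by (auto simp: x_def jx_def herm_expand rep_mv tau_simps field_simps)
    show "- rep i *v jx = 0 *s vec3 0 1 0 + (- 1) *s x + of_int (t - 1) *s jx"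
      using t b(2) by (auto simp: x_def jx_def rep_mv tau_simps field_simps)
    show "- rep i *v vec3 0 1 0 = 1 *s vec3 0 1 0 + 0 *s x + 0 *s jx"
      using t by (auto simp: rep_mv)
    show "herm w b = herm (vec3 0 1 0) x" "herm w jb = herm (vec3 0 1 0) jx"
      unfolding herm_sym0[OF w(3)] herm_sym0[OF jb(2)]
      using t by (auto simp: x_def jx_def herm_expand rep_mv)
  qed (use O jb w det in \<open>simp_all add: jx_def jb_def herm_expand\<close>)
qed

text \<open>The vectors w, b, A b are orthogonal of norms -1, 1, 1, so the lattice splits and no
  glue has to be matched.\<close>

lemma E4a_case:
  assumes A: "A \<in> UO" and O: "w \<in> O7v" "b \<in> O7v"
    and w: "A *v w = w" "herm w w = - 1" "herm b w = 0"
    and b: "herm b b = 1" "herm b (A *v b) = 0" and rel: "A *v (A *v b) = - b"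
  shows "sim A (- rep E4a)"
proof -
  have AU: "A \<in> U_J" "A \<in> mats_O7" using A(1) by (simp_all add: UO_def)
  define jb where "jb = A *v b"
  have jb: "herm jb jb = 1" "herm jb w = 0" "jb \<in> O7v" "herm b jb = 0"
    using U_J_herm[OF AU(1), of b b] U_J_herm[OF AU(1), of b w] AU(2) O
    by (simp_all add: jb_def w b O7v_mv)
  have det: "cmod (det (cols w b jb)) = 1"
    by (rule det_cols_1I) (simp add: w herm_sym0 jb b)
  show ?thesis
    by (rule sim_from_bases[of w b jb "vec3 (- 1) (- 1) 1" "vec3 (- 1) (- 1) 0" "vec3 0 1 (- 1)" A 1 0 0 "- rep E4a" 0 0 1 0 "- 1" 0])
      (use O jb w b det rel in \<open>simp_all add: jb_def[symmetric] herm_sym0 vec3_simps del: rep.simps\<close>)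
qed

lemma O7v_A: "A \<in> UO \<Longrightarrow> x \<in> O7v \<Longrightarrow> A *v x \<in> O7v"
  by (simp add: UO_def O7v_mv)

lemma fixed_perp: "A \<in> UO \<Longrightarrow> A *v w = w \<Longrightarrow> herm x w = 0 \<Longrightarrow> herm (A *v x) w = 0"
  by (metis U_J_herm UO_D(1))

text \<open>In the next two lemmas \<open>w + n x\<close> lies in the complement of \<open>w\<close>, where \<open>n = - \<langle>w,w\<rangle>\<close>;
  its class modulo \<open>n\<close> describes how the lattice is glued from \<open>w\<close> and its complement.\<close>

lemma E3_case:
  assumes A: "A \<in> UO" and O: "w \<in> O7v" "x \<in> O7v" "b \<in> O7v" "y \<in> O7v"
    and w: "A *v w = w" "herm w w = - 3" "herm x w = 1" "herm b w = 0" "herm y w = 0"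
    and det: "cmod (det (cols x b y)) = 1"
    and b: "herm b b = 2" "herm b (A *v b) = - 1" and rel: "A *v (A *v b) = - (A *v b) - b"
    and d: "A *v b = p *s b + d *s y" "d \<in> O7" "cmod d = 1" "p \<in> O7"
  shows "sim A (- rep E3a) \<or> sim A (- rep E3b)"
proof -
  have AU: "A \<in> U_J" "A \<in> mats_O7" using A(1) by (simp_all add: UO_def)
  define jb where "jb = A *v b"
  have jb: "herm jb jb = 2" "herm jb w = 0" "jb \<in> O7v" "herm b jb = - 1"
    using U_J_herm[OF AU(1), of b b] fixed_perp[OF A w(1,4)] A O
    by (simp_all add: jb_def w b O7v_A)
  have bj: "herm jb b = - 1" using jb(4) herm_cnj[of b jb] by simp
  have dt: "cmod (det (cols x b jb)) = 1"
    using det_cols_lin(2)[of x 1 b 0 y p d] det d(3) by (simp add: jb_def d(1) norm_mult)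
  have "w + 3 *s x \<in> O7v" "herm (w + 3 *s x) w = 0" using O w by simp_all
  from span_complement[OF O(2,3) jb(3) w(3,4) jb(2) dt this]
  obtain p1 p2 where p: "p1 \<in> O7" "p2 \<in> O7" "w + 3 *s x = p1 *s b + p2 *s jb" by metis
  define s where "s = herm x b"
  have sO: "s \<in> O7" using O by (simp add: s_def O7v_herm)
  have "herm (w + 3 *s x) b = 3 * s" using herm_sym0[OF w(4)] by (simp add: s_def)
  then have p2: "p2 = 2 * p1 - 3 * s" unfolding p(3) by (simp add: b bj algebra_simps)
  obtain q a where qa: "q \<in> O7" "a \<in> {0, 1, -1, \<tau>, -\<tau>, 1 - \<tau>, \<tau> - 1, 1 + \<tau>, - 1 - \<tau>}" "p1 = a + 3 * q"
    using O7_mod_3[OF p(1)] by blast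
  \<comment> \<open>Changing x by vectors of the complement changes the glue vector w + 3 x only
    modulo 3. Here it becomes a (b - A b) with a among the nine residues.\<close>
  define x' where "x' = x + (s - p1) *s jb - q *s (b - jb)"
  have x'O: "x' \<in> O7v" using O jb sO p qa(1) by (simp add: x'_def)
  have z: "w + 3 *s x' = a *s b - a *s jb"
    using p(3) unfolding p2 x'_def qa(3) by (simp add: veq3 algebra_simps)
  obtain n where n: "herm x' x' = of_int n" using herm_self_int[OF x'O] by blast
  have x'w: "herm x' w = 1" by (simp add: x'_def w jb)
  have wx': "herm w x' = 1" using x'w herm_cnj[of x' w] by simp
  have "herm (w + 3 *s x') (w + 3 *s x') = 3 + 9 * of_int n" by (simp add: w x'w wx' n)
  then have "6 * (a * cnj a) = 3 + 9 * of_int n"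
    unfolding z by (simp add: b jb bj algebra_simps)
  then have "3 * (2 * (a * cnj a)) = 3 * of_int (1 + 3 * n)" by (simp add: algebra_simps)
  then have n2: "2 * (a * cnj a) = of_int (1 + 3 * n)" unfolding mult_cancel_left by simp
  have nk: "2 * k = 1 + 3 * n" if "a * cnj a = of_int k" for k
    using n2 unfolding that by (metis of_int_eq_iff of_int_mult of_int_numeral)
  \<comment> \<open>The norm of a (b - A b) is 6 |a|^2 = 3 + 9 n, so |a|^2 is 2 modulo 3, which
    leaves the residues of norm 2.\<close>
  have a4: "a \<in> {\<tau>, -\<tau>, 1 - \<tau>, \<tau> - 1}"
  proof (rule ccontr)
    assume "a \<notin> {\<tau>, -\<tau>, 1 - \<tau>, \<tau> - 1}"
    then have "a \<in> {0, 1, -1, 1 + \<tau>, - 1 - \<tau>}" using qa(2) by blast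
    then have "a * cnj a = of_int 0 \<or> a * cnj a = of_int 1 \<or> a * cnj a = of_int 4"
      by (elim insertE emptyE; hypsubst; simp add: algebra_simps tau_simps)
    then have "2 * 0 = 1 + 3 * n \<or> 2 * 1 = 1 + 3 * n \<or> 2 * 4 = 1 + 3 * n" using nk by blast
    then show False by presburger
  qed
  then have "a * cnj a = of_int 2" by (elim insertE emptyE; hypsubst; simp add: algebra_simps tau_simps)
  from nk[OF this] have n1: "n = 1" by simp
  \<comment> \<open>The sign of a is absorbed into u; the remaining choice between \<tau> and its
    conjugate separates \<open>E3a\<close> from \<open>E3b\<close>.\<close>
  obtain \<epsilon> a0 where \<epsilon>: "\<epsilon> = 1 \<or> \<epsilon> = - 1" "a = \<epsilon> * a0" "a0 = \<tau> \<or> a0 = 1 - \<tau>"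
  proof -
    have "a = 1 * \<tau> \<or> a = (- 1) * \<tau> \<or> a = 1 * (1 - \<tau>) \<or> a = (- 1) * (1 - \<tau>)" using a4 by auto
    then show ?thesis using that by blast
  qed
  define u where "u = \<epsilon> *s x'"
  have uz: "3 *s u = a0 *s b - a0 *s jb - \<epsilon> *s w"
    using z \<epsilon>(1) unfolding u_def \<epsilon>(2) by (auto simp: veq3 algebra_simps)
  have u: "u \<in> O7v" "herm u u = 1" "herm u b = a0" "herm u jb = - a0"
  proof -
    show "u \<in> O7v" using \<epsilon>(1) x'O by (auto simp: u_def)
    show "herm u u = 1" using \<epsilon>(1) n n1 by (auto simp: u_def)
    have "3 * herm u b = 3 * a0" "3 * herm u jb = 3 * (- a0)"
      using arg_cong[OF uz, of "\<lambda>x. herm x b"] arg_cong[OF uz, of "\<lambda>x. herm x jb"] herm_sym0[OF w(4)] herm_sym0[OF jb(2)]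
      by (simp_all add: b jb bj)
    then show "herm u b = a0" "herm u jb = - a0" unfolding mult_cancel_left by simp_all
  qed
  have Au: "A *v u = 1 *s u + 0 *s b + a0 *s jb"
  proof -
    have "3 *s (A *v u) = a0 *s jb - a0 *s (A *v jb) - \<epsilon> *s w"
      using arg_cong[OF uz, of "\<lambda>x. A *v x"]
      by (simp add: mv_scale matrix_vector_mult_diff_distrib jb_def[symmetric] w(1))
    also have "\<dots> = 3 *s (u + a0 *s jb)"
      unfolding vector_add_ldistrib uz rel[folded jb_def] by (simp add: veq3 algebra_simps)
    finally show ?thesis unfolding vector_mul_lcancel by simp
  qed
  have "a0 * cnj a0 = 2" using \<epsilon>(3) by (elim disjE; hypsubst; simp add: tau_simps algebra_simps)
  then have dtu: "cmod (det (cols u b jb)) = 1"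
    by (intro det_cols_1I) (simp add: u b jb bj herm_cnj[symmetric, of b u]
      herm_cnj[symmetric, of jb u] algebra_simps)
  have Ab: "A *v b = 0 *s u + 0 *s b + 1 *s jb" by (simp add: jb_def)
  have Ajb: "A *v jb = 0 *s u + (- 1) *s b + (- 1) *s jb" using rel by (simp add: jb_def veq3)
  show ?thesis
  proof (cases "a0 = \<tau>")
    case True
    have "sim A (- rep E3a)"
      by (rule sim_from_bases[OF _ _ _ _ _ _ dtu _ _ _ _ _ _ Au _ Ab _ Ajb, where
            ?b1.0 = "vec3 (- \<tau>) (- 1) 0" and ?b2.0 = "vec3 (- 1) (\<tau> - 1) 0" and ?b3.0 = "vec3 1 0 1"])
        (use O jb u b in \<open>simp_all add: True vec3_simps tau_simps algebra_simps del: rep.simps\<close>)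
    then show ?thesis by blast
  next
    case False
    then have a0: "a0 = 1 - \<tau>" using \<epsilon>(3) by blast
    have "sim A (- rep E3b)"
      by (rule sim_from_bases[OF _ _ _ _ _ _ dtu _ _ _ _ _ _ Au _ Ab _ Ajb, where
            ?b1.0 = "vec3 0 (- 1) (\<tau> - 1)" and ?b2.0 = "vec3 (- 1) 0 (- 1)" and ?b3.0 = "vec3 0 \<tau> 1"])
        (use O jb u b in \<open>simp_all add: a0 vec3_simps tau_simps algebra_simps del: rep.simps\<close>)
    then show ?thesis by blast
  qed
qed

lemma glue_norm_2:
  assumes O: "w \<in> O7v" "x \<in> O7v" "b \<in> O7v" "y \<in> O7v"
    and w: "herm w w = - 2" "herm x w = 1" "herm b w = 0" "herm y w = 0"
    and det: "cmod (det (cols x b y)) = 1"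
    and b: "herm b b = 2" "herm y y = 2" "herm b y = - d" and d: "d \<in> {\<tau>, 1 - \<tau>}"
  obtains u where "u \<in> O7v" "2 *s u = cnj d *s b + d *s y - w"
    "herm u u = 1" "herm u b = - d" "herm u y = - cnj d" "cmod (det (cols u b y)) = 1"
proof -
  have ds: "cnj d = 1 - d" "d * d = d - 2" "d * (d * q) = d * q - 2 * q" for q
    using d by (elim insertE emptyE; hypsubst; simp add: tau_simps algebra_simps)+
  have dO: "d \<in> O7" and cd: "cnj d \<in> {\<tau>, 1 - \<tau>}" using d by (auto simp: cnj_tau)
  have d0: "d \<noteq> 0" "cnj d \<noteq> 0" using ds(2) by auto
  have yb: "herm y b = d - 1" using b(3) herm_cnj[of b y] by (simp add: ds)
  have "w + 2 *s x \<in> O7v" "herm (w + 2 *s x) w = 0" using O w by simp_all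
  from span_complement[OF O(2-4) w(2-4) det this]
  obtain p1 p2 where p: "p1 \<in> O7" "p2 \<in> O7" "w + 2 *s x = p1 *s b + p2 *s y" by metis
  define s1 s2 where "s1 = herm x b" and "s2 = herm x y"
  have sO: "s1 \<in> O7" "s2 \<in> O7" using O by (simp_all add: s1_def s2_def O7v_herm)
  have e1: "2 * p1 + p2 * (d - 1) = 2 * s1" "- d * p1 + 2 * p2 = 2 * s2"
    using arg_cong[OF p(3), of "\<lambda>x. herm x b"] arg_cong[OF p(3), of "\<lambda>x. herm x y"]
    by (simp_all add: herm_sym0[OF w(3)] herm_sym0[OF w(4)] s1_def s2_def b yb mult.commute)
  \<comment> \<open>As d cnj d = 2, multiplying the two relations by d and cnj d makes p2 a multiple
    of d and p1 a multiple of cnj d; what remains of the glue is one residue modulo each prime above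
    2.\<close>
  have "2 * p2 = 2 * (d * (p1 - s1))" using arg_cong[OF e1(1), of "\<lambda>x. d * x"] by (simp add: ds algebra_simps)
  then have p2: "p2 = d * (p1 - s1)" unfolding mult_cancel_left by simp
  have "2 * p1 = 2 * (cnj d * (p2 - s2))" using arg_cong[OF e1(2), of "\<lambda>x. cnj d * x"] by (simp add: ds algebra_simps)
  then have p1: "p1 = cnj d * (p2 - s2)" unfolding mult_cancel_left by simp
  have "p2 - s2 \<in> O7" "p1 - s1 \<in> O7" using p sO by simp_all
  then obtain r r' where r: "r \<in> O7" "p2 - s2 = d * r \<or> p2 - s2 = 1 + d * r"
    "r' \<in> O7" "p1 - s1 = cnj d * r' \<or> p1 - s1 = 1 + cnj d * r'"
    using O7_mod_tau[OF _ d, of "p2 - s2"] O7_mod_tau[OF _ cd, of "p1 - s1"] by metis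
  obtain a0 c0 :: complex where ac: "a0 = 0 \<or> a0 = 1" "c0 = 0 \<or> c0 = 1"
    "p2 - s2 = a0 + d * r" "p1 - s1 = c0 + cnj d * r'" using r(2,4) by (metis add.left_neutral)
  have pp: "p1 = cnj d * a0 + 2 * r" "p2 = d * c0 + 2 * r'"
    using p1 p2 unfolding ac(3,4) by (simp_all add: ds algebra_simps)
  define u where "u = x - r *s b - r' *s y"
  have uO: "u \<in> O7v" using O r by (simp add: u_def)
  have z: "w + 2 *s u = (cnj d * a0) *s b + (d * c0) *s y"
    using p(3) unfolding pp u_def by (simp add: veq3 algebra_simps)
  obtain n where n: "herm u u = of_int n" using herm_self_int[OF uO] by blast
  have uw: "herm u w = 1" by (simp add: u_def w)
  have wu: "herm w u = 1" using uw herm_cnj[of u w] by simp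
  have zz: "herm (w + 2 *s u) (w + 2 *s u) = 2 + 4 * of_int n" by (simp add: w uw wu n)
  \<comment> \<open>The norm of the glue vector is 2 + 4 n, and the four pairs of residues give 0,
    4, 4 and 6; only 6 is 2 modulo 4.\<close>
  have "a0 = 1 \<and> c0 = 1 \<and> n = 1"
  proof -
    have "of_int 0 = complex_of_int (2 + 4 * n)" if "a0 = 0" "c0 = 0"
      using zz unfolding z that by simp
    moreover have "of_int 4 = complex_of_int (2 + 4 * n)" if "a0 = 1" "c0 = 0"
      using zz unfolding z that by (simp add: b ds algebra_simps)
    moreover have "of_int 4 = complex_of_int (2 + 4 * n)" if "a0 = 0" "c0 = 1"
      using zz unfolding z that by (simp add: b ds algebra_simps)
    moreover have "of_int 6 = complex_of_int (2 + 4 * n)" if "a0 = 1" "c0 = 1"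
      using zz unfolding z that by (simp add: b yb ds algebra_simps)
    ultimately show ?thesis using ac(1,2) unfolding of_int_eq_iff by (elim disjE) (simp_all, presburger+)
  qed
  then have z': "w + 2 *s u = cnj d *s b + d *s y" and "n = 1" using z by simp_all
  show ?thesis
  proof (rule that[of u])
    show "2 *s u = cnj d *s b + d *s y - w" using z' by (simp add: veq3 algebra_simps)
    have "2 * herm u b = 2 * (- d)" "2 * herm u y = 2 * (- cnj d)"
      using arg_cong[OF z', of "\<lambda>x. herm x b"] arg_cong[OF z', of "\<lambda>x. herm x y"]
        herm_sym0[OF w(3)] herm_sym0[OF w(4)] by (simp_all add: b yb ds algebra_simps)
    then show ub: "herm u b = - d" "herm u y = - cnj d" unfolding mult_cancel_left by simp_all
    show "cmod (det (cols u b y)) = 1"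
    proof -
      have "u = 1 *s x + (- r) *s b + (- r') *s y" by (simp add: u_def veq3)
      then have "det (cols u b y) = det (cols x b y)" by (simp only: det_cols_lin(1) mult_1)
      then show ?thesis using det by simp
    qed
  qed (use uO n \<open>n = 1\<close> in simp_all)
qed

text \<open>The transition determinant has norm 2: A b = b + c y2 with c a prime above 2, and b, y2
  have the Gram matrix whose glue is unique. Either prime leads to \<open>E4b\<close>, whose lattice
  has bases adapted to both.\<close>

lemma E4b_case:
  assumes A: "A \<in> UO" and O: "w \<in> O7v" "x \<in> O7v" "b \<in> O7v" "y \<in> O7v"
    and w: "A *v w = w" "herm w w = - 2" "herm x w = 1" "herm b w = 0" "herm y w = 0"
    and det: "cmod (det (cols x b y)) = 1"
    and b: "herm b b = 2" "herm b (A *v b) = 0" and rel: "A *v (A *v b) = - b"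
    and d: "A *v b = p *s b + d *s y" "d \<in> O7" "(cmod d)\<^sup>2 = 2" "p \<in> O7"
  shows "sim A (- rep E4b)"
proof -
  have AU: "A \<in> U_J" using A(1) by (simp add: UO_def)
  have "d \<in> {\<tau>, -\<tau>, 1 - \<tau>, \<tau> - 1}" using O7_norm_2 d by blast
  then have "d = 1 * \<tau> \<or> d = (- 1) * \<tau> \<or> d = 1 * (1 - \<tau>) \<or> d = (- 1) * (1 - \<tau>)" by auto
  then obtain \<epsilon> c where \<epsilon>: "\<epsilon> = 1 \<or> \<epsilon> = - 1" "d = \<epsilon> * c" "c \<in> {\<tau>, 1 - \<tau>}" by blast
  have cs: "cnj c = 1 - c" "c * c = c - 2" "c * (c * q) = c * q - 2 * q" for q
    using \<epsilon>(3) by (elim insertE emptyE; hypsubst; simp add: tau_simps algebra_simps)+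
  have c0: "c \<noteq> 0" using cs(2) by auto
  have cO: "c \<in> O7" using \<epsilon>(3) by auto
  obtain q where q: "q \<in> O7" "p = c * q \<or> p = 1 + c * q" using O7_mod_tau[OF d(4) \<epsilon>(3)] by blast
  define y2 where "y2 = \<epsilon> *s y + q *s b"
  have y2O: "y2 \<in> O7v" using O q \<epsilon>(1) by (auto simp: y2_def)
  have y2w: "herm y2 w = 0" by (simp add: y2_def w)
  have "det (cols x b y2) = \<epsilon> * det (cols x b y)"
    using det_cols_lin(2)[of x 1 b 0 y q \<epsilon>] by (simp add: y2_def add.commute)
  then have det2: "cmod (det (cols x b y2)) = 1" using \<epsilon>(1) det by auto
  define jb where "jb = A *v b"
  have Ajb: "A *v jb = - b" using rel by (simp add: jb_def)
  have "jb = c *s y2 \<or> jb = b + c *s y2"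
    using q(2) unfolding jb_def d(1) y2_def \<epsilon>(2) by (auto simp: veq3 algebra_simps)
  \<comment> \<open>If A b were divisible by c, so would be b = - A (A b), but b belongs to a basis
    of the lattice.\<close>
  then have jb: "jb = b + c *s y2"
  proof
    assume j: "jb = c *s y2"
    have "b = (- c) *s (A *v y2)" using Ajb unfolding j mv_scale by (simp add: veq3)
    moreover have "uni b"
    proof (rule cols_uni)
      show "cols b x y \<in> mats_O7" using O by (simp add: cols_mats_O7)
      have "det (cols b x y) = - det (cols x b y)" by (simp add: det_3)
      then show "cmod (det (cols b x y)) = 1" using det by simp
    qed
    then obtain u where u: "u \<in> O7v" "herm u b = 1" unfolding uni_def by blast
    ultimately have "- cnj c * herm u (A *v y2) = 1" by (metis herm_scale_right complex_cnj_minus)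
    moreover have "herm u (A *v y2) \<in> O7" using u y2O A by (simp add: O7v_herm O7v_A)
    ultimately have "- cnj c = 1 \<or> - cnj c = - 1" using O7_unit_mult[of "- cnj c"] cO by simp
    then have "c = 1 \<or> c = - 1" by (metis complex_cnj_cnj complex_cnj_minus complex_cnj_one minus_minus)
    then show ?thesis using cs(2) by auto
  qed
  have c2: "c * cnj c = 2" "cnj c * c = 2" by (simp_all add: cs algebra_simps)
  have cj: "cnj c \<noteq> 0" using c0 by simp
  have by2: "herm b y2 = - c"
  proof -
    have "2 + cnj c * herm b y2 = 0" using b(2) unfolding jb_def[symmetric] jb by (simp add: b)
    then have "cnj c * herm b y2 = cnj c * (- c)" using c2 by (simp add: eq_neg_iff_add_eq_0 add.commute)
    then show ?thesis using cj unfolding mult_cancel_left by blast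
  qed
  have y2y2: "herm y2 y2 = 2"
  proof -
    have "herm jb jb = 2" using U_J_herm[OF AU, of b b] by (simp add: jb_def b)
    moreover have "herm jb b = 0" by (rule herm_sym0) (simp add: jb_def b)
    ultimately have "herm (jb - b) (jb - b) = 4" using b by (simp add: jb_def)
    then have "(c * cnj c) * herm y2 y2 = 4" unfolding jb by (simp add: algebra_simps)
    then show ?thesis unfolding c2 by simp
  qed
  have Ay2: "A *v y2 = 0 *s x + (- cnj c) *s b + (- 1) *s y2" for x
  proof -
    have "A *v (b + c *s y2) = - b" using Ajb jb by simp
    then have "jb + c *s (A *v y2) = - b" by (simp add: matrix_vector_right_distrib mv_scale jb_def)
    then have "c *s (A *v y2) = - b - jb" by (metis add_diff_cancel_left')
    also have "\<dots> = c *s (- cnj c *s b - y2)"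
      unfolding jb vector_ssub_ldistrib vector_smult_assoc using c2 by (simp add: veq3)
    finally show ?thesis using c0 unfolding vector_mul_lcancel by simp
  qed
  from glue_norm_2[OF O(1-3) y2O w(2-4) y2w det2 b(1) y2y2 by2 \<epsilon>(3)] obtain u where
    u: "u \<in> O7v" "2 *s u = cnj c *s b + c *s y2 - w"
    "herm u u = 1" "herm u b = - c" "herm u y2 = - cnj c" "cmod (det (cols u b y2)) = 1" by metis
  have Au: "A *v u = 1 *s u + (- 1) *s b + (1 - c) *s y2"
  proof -
    have "2 *s (A *v u) = cnj c *s jb + c *s (- cnj c *s b - y2) - w"
      using arg_cong[OF u(2), of "\<lambda>x. A *v x"]
      by (simp add: mv_scale matrix_vector_mult_diff_distrib matrix_vector_right_distrib jb_def[symmetric] w(1) Ay2[of 0])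
    also have "\<dots> = 2 *s (u - b + (1 - c) *s y2)"
      unfolding vector_add_ldistrib vector_ssub_ldistrib u(2) jb by (simp add: veq3 cs algebra_simps)
    finally show ?thesis unfolding vector_mul_lcancel by simp
  qed
  have Ab: "A *v b = 0 *s u + 1 *s b + c *s y2" using jb by (simp add: jb_def)
  show ?thesis
  proof (cases "c = \<tau>")
    case True
    show ?thesis
      by (rule sim_from_bases[OF _ _ _ _ _ _ u(6) _ _ _ _ _ _ Au _ Ab _ Ay2[of u], where
            ?b1.0 = "vec3 \<tau> 1 0" and ?b2.0 = "vec3 (- 1) 0 (- 1)" and ?b3.0 = "vec3 (1 - \<tau>) (- \<tau>) 0"])
        (simp_all add: O u(1,3-5) y2O b(1) by2 y2y2 True vec3_simps del: rep.simps, simp_all add: tau_simps, simp_all add: tau_simps algebra_simps)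
  next
    case False
    then have c1: "c = 1 - \<tau>" using \<epsilon>(3) by blast
    show ?thesis
      by (rule sim_from_bases[OF _ _ _ _ _ _ u(6) _ _ _ _ _ _ Au _ Ab _ Ay2[of u], where
            ?b1.0 = "vec3 (- 1) (- 1) 0" and ?b2.0 = "vec3 (\<tau> - 1) \<tau> 0" and ?b3.0 = "vec3 1 (2 - \<tau>) (- 1)"])
        (simp_all add: O u(1,3-5) y2O b(1) by2 y2y2 c1 vec3_simps del: rep.simps, simp_all add: tau_simps, simp_all add: tau_simps algebra_simps)
  qed
qed

lemma E2a_case:
  assumes O: "w \<in> O7v" "b \<in> O7v" "y \<in> O7v"
    and w: "A *v w = w" "herm w w = - 1" "herm b w = 0" "herm y w = 0"
    and b: "herm b b = 1" "herm y y = 1" "herm b y = 0" and A: "A *v b = - b" "A *v y = - y"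
  shows "sim A (- rep E2a)"
proof -
  have det: "cmod (det (cols w b y)) = 1"
    by (rule det_cols_1I) (simp add: w herm_sym0[OF w(3)] herm_sym0[OF w(4)] herm_sym0[OF b(3)] b)
  show ?thesis
    by (rule sim_from_bases[of w b y "vec3 (\<tau> - 1) 0 1" "vec3 \<tau> 0 1" "vec3 0 1 0" A 1 0 0 "- rep E2a" 0 "- 1" 0 0 0 "- 1"])
      (simp_all add: O w b det A herm_sym0[OF w(3)] herm_sym0[OF w(4)] vec3_simps del: rep.simps, simp_all add: tau_simps, simp_all add: tau_simps algebra_simps)
qed

lemma E2b_case:
  assumes O: "w \<in> O7v" "x \<in> O7v" "b \<in> O7v" "y \<in> O7v"
    and w: "A *v w = w" "herm w w = - 2" "herm x w = 1" "herm b w = 0" "herm y w = 0"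
    and det: "cmod (det (cols x b y)) = 1"
    and b: "herm b b = 1" "herm y y = 2" "herm b y = 0" and A: "A *v b = - b" "A *v y = - y"
  shows "sim A (- rep E2b)"
proof -
  have "w + 2 *s x \<in> O7v" "herm (w + 2 *s x) w = 0" using O w by simp_all
  from span_complement[OF O(2-4) w(3-5) det this]
  obtain p1 p2 where p: "p1 \<in> O7" "p2 \<in> O7" "w + 2 *s x = p1 *s b + p2 *s y" by metis
  note yb = herm_sym0[OF b(3)]
  have p1: "p1 = 2 * herm x b"
    using arg_cong[OF p(3), of "\<lambda>x. herm x b"] by (simp add: herm_sym0[OF w(4)] b yb)
  obtain q r where qr: "q \<in> O7" "r \<in> {0, 1, \<tau>, 1 + \<tau>}" "p2 = r + 2 * q" using O7_mod_2[OF p(2)] by blast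
  \<comment> \<open>Subtracting the projection to b, which has norm 1 and splits off, leaves glue
    along y only.\<close>
  define u where "u = x - herm x b *s b - q *s y"
  have uO: "u \<in> O7v" using O qr by (simp add: u_def O7v_herm)
  have z: "w + 2 *s u = r *s y"
    using p(3) unfolding p1 qr(3) u_def by (simp add: veq3 algebra_simps)
  obtain n where n: "herm u u = of_int n" using herm_self_int[OF uO] by blast
  have uw: "herm u w = 1" by (simp add: u_def w)
  have wu: "herm w u = 1" using uw herm_cnj[of u w] by simp
  have zz: "herm (w + 2 *s u) (w + 2 *s u) = of_int (2 + 4 * n)" by (simp add: w uw wu n)
  \<comment> \<open>Comparing norms, |r|^2 = 1 + 2 n is odd; among the residues 0, 1, \<tau>, 1 +
    \<tau> only 1 has odd norm.\<close>
  have rr: "2 * k = 2 + 4 * n" if "r * cnj r = of_int k" for k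
  proof -
    have "(r * cnj r) * 2 = of_int (2 + 4 * n)"
      using zz unfolding z by (simp add: b algebra_simps)
    then have "of_int (2 + 4 * n) = complex_of_int (2 * k)" unfolding that by (simp add: mult.commute)
    then show ?thesis by (simp only: of_int_eq_iff)
  qed
  have r1: "r = 1"
  proof (rule ccontr)
    assume "r \<noteq> 1"
    then have "r \<in> {0, \<tau>, 1 + \<tau>}" using qr(2) by blast
    then have "r * cnj r = of_int 0 \<or> r * cnj r = of_int 2 \<or> r * cnj r = of_int 4"
      by (elim insertE emptyE; hypsubst; simp add: algebra_simps tau_simps)
    then have "2 * 0 = 2 + 4 * n \<or> 2 * 2 = 2 + 4 * n \<or> 2 * 4 = 2 + 4 * n" using rr by blast
    then show False by presburger
  qed
  then have n0: "n = 0" using rr[of 1] by simp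
  have "2 * herm u b = 2 * 0" "2 * herm u y = 2 * 1"
    using arg_cong[OF z, of "\<lambda>x. herm x b"] arg_cong[OF z, of "\<lambda>x. herm x y"]
      herm_sym0[OF w(4)] herm_sym0[OF w(5)] by (simp_all add: b yb r1)
  then have ub: "herm u b = 0" "herm u y = 1" unfolding mult_cancel_left by simp_all
  have Au: "A *v u = 1 *s u + 0 *s b + (- 1) *s y"
  proof -
    have "w + 2 *s (A *v u) = - y"
      using arg_cong[OF z, of "\<lambda>x. A *v x"] by (simp add: r1 mv_scale matrix_vector_right_distrib w A)
    then have "2 *s (A *v u) = - y - w" by (metis add_diff_cancel_left')
    also have "w = y - 2 *s u" using z by (simp add: r1 eq_diff_eq)
    finally have "2 *s (A *v u) = 2 *s (u - y)" by (simp add: veq3 algebra_simps)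
    then show ?thesis unfolding vector_mul_lcancel by simp
  qed
  have detu: "cmod (det (cols u b y)) = 1"
    by (rule det_cols_1I) (simp add: n n0 ub b yb herm_cnj[symmetric, of y u] herm_cnj[symmetric, of b u])
  show ?thesis
    by (rule sim_from_bases[of u b y "vec3 1 0 0" "vec3 0 1 0" "vec3 1 0 1" A 1 0 "- 1" "- rep E2b" 0 "- 1" 0 0 0 "- 1"])
      (simp_all add: O uO n n0 ub b detu Au A vec3_simps del: rep.simps)
qed

lemma E2c_case:
  assumes O: "w \<in> O7v" "x \<in> O7v" "b \<in> O7v" "y \<in> O7v"
    and w: "A *v w = w" "herm w w = - 2" "herm x w = 1" "herm b w = 0" "herm y w = 0"
    and det: "cmod (det (cols x b y)) = 1"
    and b: "herm b b = 2" "herm y y = 2" "herm b y = - \<tau>" and A: "A *v b = - b" "A *v y = - y"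
  shows "sim A (- rep E2c)"
proof -
  from glue_norm_2[OF O w(2-5) det b(1,2,3)] obtain u where
    u: "u \<in> O7v" "2 *s u = cnj \<tau> *s b + \<tau> *s y - w"
    "herm u u = 1" "herm u b = - \<tau>" "herm u y = - cnj \<tau>" "cmod (det (cols u b y)) = 1" by blast
  have Au: "A *v u = 1 *s u + (\<tau> - 1) *s b + (- \<tau>) *s y"
  proof -
    have "2 *s (A *v u) = - cnj \<tau> *s b - \<tau> *s y - w"
      using arg_cong[OF u(2), of "\<lambda>x. A *v x"]
      by (simp add: mv_scale matrix_vector_mult_diff_distrib matrix_vector_right_distrib w A veq3)
    also have "\<dots> = 2 *s (u + (\<tau> - 1) *s b - \<tau> *s y)"
      unfolding vector_add_ldistrib vector_ssub_ldistrib u(2) by (simp add: veq3 cnj_tau algebra_simps)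
    finally show ?thesis unfolding vector_mul_lcancel by simp
  qed
  show ?thesis
    by (rule sim_from_bases[of u b y "vec3 0 1 0" "vec3 0 (\<tau> - 1) 1" "vec3 1 (- \<tau>) 0" A 1 "\<tau> - 1" "- \<tau>" "- rep E2c" 0 "- 1" 0 0 0 "- 1"])
      (simp_all add: O u(1,3-6) b Au A vec3_simps del: rep.simps, simp_all add: tau_simps, simp_all add: tau_simps algebra_simps)
qed

declare rep.simps [simp del]

lemma uinv_fixed: "A \<in> U_J \<Longrightarrow> A *v w = c *s w \<Longrightarrow> cmod c = 1 \<Longrightarrow> uinv A *v w = cnj c *s w"
proof -
  assume A: "A \<in> U_J" "A *v w = c *s w" "cmod c = 1"
  have "w = c *s (uinv A *v w)" using arg_cong[OF A(2), of "\<lambda>x. uinv A *v x"] by (simp add: uinv_vec A(1) mv_scale)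
  then have "cnj c *s w = (cnj c * c) *s (uinv A *v w)" by (metis vector_smult_assoc)
  then show ?thesis using unit_sq[OF A(3)] by (simp add: mult.commute)
qed

text \<open>Passing to the inverse conjugates \<open>herm b (A *v b)\<close> and so changes the sign
  of e. The sign realised directly is -1 for \<open>E3c\<close> and 1 for \<open>E6\<close>; the
  other one is reached through the inverse.\<close>

lemma sim_unimodular_E3c_E6:
  assumes A: "A \<in> UO" and O: "w \<in> O7v" "b \<in> O7v"
    and w: "A *v w = w" "herm w w = 1" "herm b w = 0"
    and b: "herm b b = of_int \<alpha>" "\<alpha> = 1 \<or> \<alpha> = - 1" "2 * herm b (A *v b) = of_int ((t - 1) * \<alpha>) + of_int e * i_sqrt7"
    and rel: "A *v (A *v b) = of_int (t - 1) *s (A *v b) - b"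
    and e: "e = 1 \<or> e = - 1" and t: "(t = 0 \<and> i = E3c) \<or> (t = 2 \<and> i = E6)"
  shows "sim A (- rep i) \<or> sim (uinv A) (- rep i)"
proof -
  have AU: "A \<in> U_J" using A by (simp add: UO_def)
  have w': "uinv A *v w = w" using uinv_vec(1)[OF AU, of w] w(1) by simp
  have "herm b (uinv A *v b) = cnj (herm b (A *v b))"
    using U_J_herm[OF AU, of b "uinv A *v b"] by (simp add: uinv_vec[OF AU] herm_cnj)
  then have "2 * herm b (uinv A *v b) = cnj (2 * herm b (A *v b))" by simp
  then have b': "2 * herm b (uinv A *v b) = of_int ((t - 1) * \<alpha>) + of_int (- e) * i_sqrt7"
    unfolding b(3) by (simp add: i_sqrt7_tau cnj_tau algebra_simps)
  have "b = of_int (t - 1) *s (uinv A *v b) - uinv A *v (uinv A *v b)"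
    using arg_cong[OF rel, of "\<lambda>x. uinv A *v (uinv A *v x)"]
    by (simp add: uinv_vec[OF AU] matrix_vector_mult_diff_distrib mv_scale)
  then have rel': "uinv A *v (uinv A *v b) = of_int (t - 1) *s (uinv A *v b) - b"
    by (simp add: eq_diff_eq add.commute)
  have "sim A (- rep i)" if "(t = 0 \<and> e = - 1) \<or> (t = 2 \<and> e = 1)"
    by (rule sim_unimodular_complement[OF A O w b rel]) (use that t in auto)
  moreover have "sim (uinv A) (- rep i)" if "(t = 0 \<and> e = 1) \<or> (t = 2 \<and> e = - 1)"
    by (rule sim_unimodular_complement[OF UO_uinv[OF A] O w' w(2,3) b(1,2) b' rel']) (use that t in auto)
  ultimately show ?thesis using e t by blast
qed

lemma dioph_order_3_6:
  fixes k \<alpha> e :: int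
  assumes "k \<in> {1, -1, 3, -3}" "\<alpha> \<in> {-2, -1, 0, 1, 2}" "e \<in> {-2, -1, 0, 1, 2}"
    "3 * (\<alpha> * \<alpha>) - 7 * (e * e) = - 4 * k" "k < 0 \<Longrightarrow> \<alpha> > 0"
  shows "(k = 1 \<and> (\<alpha> = 1 \<or> \<alpha> = - 1) \<and> (e = 1 \<or> e = - 1)) \<or> (k = - 3 \<and> \<alpha> = 2 \<and> e = 0)"
  using assms by (elim insertE emptyE; hypsubst; simp)

lemma dioph_order_4:
  fixes k \<alpha> e N :: int
  assumes "k \<in> {1, -1, 2, -2}" "N = 1 \<or> N = 2" "\<alpha> \<in> {-2, -1, 0, 1, 2}" "e \<in> {-2, -1, 0, 1, 2}"
    "4 * (\<alpha> * \<alpha>) - 7 * (e * e) = - 4 * (k * N)" "k < 0 \<Longrightarrow> \<alpha> > 0" "3 * (\<alpha> * \<alpha>) \<le> 7 * \<bar>k\<bar>"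
  shows "(k = - 1 \<and> \<alpha> = 1 \<and> e = 0) \<or> (k = - 2 \<and> N = 2 \<and> \<alpha> = 2 \<and> e = 0)"
  using assms by (elim insertE emptyE disjE; hypsubst; simp)

lemma classification_order_3_4_6:
  assumes A: "A \<in> UO" "det A = 1" and v: "v \<in> negative" "A *v v = c *s v" "cmod c = 1"
    and t: "trace A = of_int t" "t \<in> {0, 1, 2}"
  shows "\<exists>i. sim A (- rep i) \<or> sim (uinv A) (- rep i)"
proof -
  obtain v0 d where v0: "d \<noteq> 0" "v = d *s v0" "herm v0 v0 = - 2"
    using normalize_negative[OF v(1)] by metis
  have v0n: "v0 \<in> negative" by (simp add: negative_def v0(3))
  have Av0: "A *v v0 = c *s v0"
  proof -
    have "d *s (A *v v0) = d *s (c *s v0)" using v(2) unfolding v0(2) mv_scale by (simp add: mult.commute)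
    then show ?thesis using v0(1) unfolding vector_mul_lcancel by simp
  qed
  show ?thesis
  proof (rule elliptic_lattice[OF A v0n Av0 v(3) v0(3) t], goal_cases)
  case (1 w k x b y p d \<alpha> e N)
  note W = 1
  have wO: "w \<in> O7v" using W(1) by (rule uni_O7v)
  have AU: "A \<in> U_J" using A(1) by (simp add: UO_def)
  have kk: "k \<in> {1, -1, 2, -2, 3, -3}"
  proof -
    have "\<bar>k\<bar> \<le> 3" using dvd_imp_le_int[OF _ W(5)] t(2) by auto
    then show ?thesis using W(4) by auto
  qed
  have "\<alpha> * \<alpha> \<le> 7" using W(14) kk by auto
  then have \<alpha>r: "\<alpha> \<in> {-2, -1, 0, 1, 2}" using int_sq_le_cases[of \<alpha> 7 2] by auto
  have "7 * (e * e) \<le> 4 * (\<alpha> * \<alpha>) + 24"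
  proof -
    have "- 4 * (k * N) \<ge> - 24" using kk W(21) by auto
    moreover have "(t - 1) * (t - 1) * (\<alpha> * \<alpha>) \<ge> 0" by simp
    ultimately show ?thesis using W(22) by linarith
  qed
  then have "e * e \<le> 5" using \<alpha>r by auto
  then have er: "e \<in> {-2, -1, 0, 1, 2}" using int_sq_le_cases[of e 5 2] by auto
  have "t = 0 \<and> N = 1 \<or> t = 1 \<or> t = 2 \<and> N = 1" using t(2) W(21) by auto
  then consider (t0) "t = 0" "N = 1" | (t1) "t = 1" | (t2) "t = 2" "N = 1" by blast
  then show ?thesis
  proof cases
    case t1
    then have "k \<in> {1, -1, 2, -2}" "4 * (\<alpha> * \<alpha>) - 7 * (e * e) = - 4 * (k * N)" using W(5,22) kk by auto
    from dioph_order_4[OF this(1) _ \<alpha>r er this(2) W(15,14)] W(21)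
    have "(k = - 1 \<and> \<alpha> = 1 \<and> e = 0) \<or> (k = - 2 \<and> N = 2 \<and> \<alpha> = 2 \<and> e = 0)" by blast
    then show ?thesis
    proof
      assume k: "k = - 1 \<and> \<alpha> = 1 \<and> e = 0"
      have "sim A (- rep E4a)"
        by (rule E4a_case[OF A(1) wO W(7,2)]) (use W(3,10,13,16,23) k t1 in simp_all)
      then show ?thesis by blast
    next
      assume k: "k = - 2 \<and> N = 2 \<and> \<alpha> = 2 \<and> e = 0"
      have "sim A (- rep E4b)"
        by (rule E4b_case[OF A(1) wO W(6-8) W(2) _ W(9-12) _ _ _ W(19,18) _ W(17)]) (use W(3,13,16,20,23) k t1 in simp_all)
      then show ?thesis by blast
    qed
  next
    case t0
    then have "k \<in> {1, -1, 3, -3}" "3 * (\<alpha> * \<alpha>) - 7 * (e * e) = - 4 * k" using W(5,22) kk by auto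
    from dioph_order_3_6[OF this(1) \<alpha>r er this(2) W(15)]
    show ?thesis
    proof
      assume k: "k = - 3 \<and> \<alpha> = 2 \<and> e = 0"
      have "(cmod d)\<^sup>2 = 1" using W(20) t0 by simp
      then have "cmod d = 1" using power2_eq_iff_nonneg[of "cmod d" 1] by simp
      moreover have "2 * herm b (A *v b) = 2 * (- 1)" using W(16) k t0 by simp
      then have "herm b (A *v b) = - 1" unfolding mult_cancel_left by simp
      moreover have "A *v (A *v b) = - (A *v b) - b" using W(23) t0 by simp
      ultimately have "sim A (- rep E3a) \<or> sim A (- rep E3b)"
        using W(3,13) k by (intro E3_case[OF A(1) wO W(6-8) W(2) _ W(9-12) _ _ _ W(19,18) _ W(17)]) simp_all
      then show ?thesis by blast
    next
      assume k: "k = 1 \<and> (\<alpha> = 1 \<or> \<alpha> = - 1) \<and> (e = 1 \<or> e = - 1)"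
      then have "sim A (- rep E3c) \<or> sim (uinv A) (- rep E3c)"
        using W(3) t0 by (intro sim_unimodular_E3c_E6[OF A(1) wO W(7,2) _ W(10,13) _ W(16,23)]) auto
      then show ?thesis by blast
    qed
  next
    case t2
    then have k1: "k = 1 \<or> k = - 1" and "3 * (\<alpha> * \<alpha>) - 7 * (e * e) = - 4 * k" using W(5,22) by auto
    then have "(k = 1 \<and> (\<alpha> = 1 \<or> \<alpha> = - 1) \<and> (e = 1 \<or> e = - 1)) \<or> (k = - 3 \<and> \<alpha> = 2 \<and> e = 0)"
      by (intro dioph_order_3_6 \<alpha>r er W(15)) auto
    then have k: "k = 1 \<and> (\<alpha> = 1 \<or> \<alpha> = - 1) \<and> (e = 1 \<or> e = - 1)" using k1 by auto
    then have "sim A (- rep E6) \<or> sim (uinv A) (- rep E6)"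
        using W(3) t2 by (intro sim_unimodular_E3c_E6[OF A(1) wO W(7,2) _ W(10,13) _ W(16,23)]) auto
      then show ?thesis by blast
  qed
qed
qed

text \<open>If c = -1, the image of A - 1 lies in the eigenline, so A = 1 + v f for a linear form f
  with f(v) = trace A - 3 = -4; then A v = -3 v, a contradiction.\<close>

lemma square_one_fixed_line:
  assumes A: "A \<in> U_J" "A ** A = mat 1" "trace A = - 1" and v: "v \<in> negative" "A *v v = c *s v"
    and iso: "\<And>u. A *v u = c *s u \<Longrightarrow> \<exists>m. u = m *s v"
  shows "c = 1"
proof -
  have v0: "v \<noteq> 0" using v(1) by (rule negative_nonzero)
  have AA: "A *v (A *v x) = x" for x by (simp add: matrix_vector_mul_assoc A(2))
  have "(c * c) *s v = 1 *s v" using AA[of v] by (simp add: v(2) mv_scale)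
  then have "c * c = 1" unfolding vector_mul_rcancel using v0 by simp
  then have "c = 1 \<or> c = - 1" using square_eq_1_iff by blast
  moreover have "c \<noteq> - 1"
  proof
    assume c: "c = - 1"
    have "A *v (A *v x - x) = c *s (A *v x - x)" for x
      by (simp add: matrix_vector_mult_diff_distrib AA c)
    then have "\<exists>m. A *v axis i 1 - axis i 1 = m *s v" for i using iso by blast
    then obtain f where f: "\<And>i. A *v axis i 1 - axis i 1 = f i *s v" by metis
    have ent: "A $ j $ i = (if i = j then 1 else 0) + f i * v $ j" for i j
      using arg_cong[OF f[of i, unfolded mv_axis], of "\<lambda>x. x $ j"]
      by (cases "i = j") (simp_all add: column_def axis_def diff_eq_eq add.commute)
    have tr: "f 1 * v $ 1 + f 2 * v $ 2 + f 3 * v $ 3 = - 4"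
      using A(3) by (simp add: trace3 ent algebra_simps eq_diff_eq) (simp add: eq_neg_iff_add_eq_0 add_ac)
    have "A *v v = (1 + (f 1 * v $ 1 + f 2 * v $ 2 + f 3 * v $ 3)) *s v"
      by (simp add: veq3 mv_nth ent algebra_simps)
    then have "(- 3) *s v = (- 1) *s v" by (simp add: tr v(2) c)
    then show False unfolding vector_mul_rcancel using v0 by simp
  qed
  ultimately show ?thesis by blast
qed

text \<open>The trace of A^2 is 3, so A^2 = 1 and A is a point reflection: 1 on w, -1 on its
  complement. Only the lattice is left to determine. The map A + 1 shows that k divides 2, and the
  reduced bases of the positive definite complement have norms (1, 1), (1, 2) or (2, 2).\<close>

lemma classification_order_2:
  assumes A: "A \<in> UO" and v: "v \<in> negative" "A *v v = c *s v" "cmod c = 1"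
    and t: "trace A = - 1" "trace (A ** A) = 3"
    and iso: "\<And>u. A *v u = c *s u \<Longrightarrow> \<exists>m. u = m *s v"
  shows "\<exists>i. sim A (- rep i)"
proof -
  have AU: "A \<in> U_J" using A by (simp add: UO_def)
  have "(A ** A) *v v = (c * c) *s v" by (simp add: v(2) mv_scale flip: matrix_vector_mul_assoc)
  then have A2: "A ** A = mat 1"
    using elliptic_trace_3[OF U_J_mult[OF AU AU] v(1), of "c * c"] v(3) t(2) by (simp add: norm_mult)
  then have AA: "A *v (A *v x) = x" for x by (simp add: matrix_vector_mul_assoc)
  have c: "c = 1" by (rule square_one_fixed_line[OF AU A2 t(1) v(1,2) iso])
  define E where "E x = A *v x + x" for x
  have AE: "A *v E x = E x" for x by (simp add: E_def matrix_vector_right_distrib AA)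
  have Em: "\<exists>m. E x = m *s v" for x using iso[of "E x"] AE by (simp add: c)
  obtain i where i: "E (axis i 1) \<noteq> 0"
  proof -
    have "E (axis 1 1) $ 1 + E (axis 2 1) $ 2 + E (axis 3 1) $ 3 = trace A + 3"
      by (simp add: E_def mv_axis trace3 column_def)
    then show ?thesis using that t(1) by fastforce
  qed
  have "E (axis i 1) \<in> O7v" using A O7v_A[of A "axis i 1"] by (simp add: E_def) (simp add: O7v_def axis_def)
  then obtain g w where gw: "g \<in> O7" "uni w" "E (axis i 1) = g *s w"
    using exists_uni_multiple by metis
  have g0: "g \<noteq> 0" using gw(3) i by auto
  obtain m0 where m0: "g *s w = m0 *s v" using Em[of "axis i 1"] gw(3) by metis
  have "m0 \<noteq> 0" using m0 gw(3) i by auto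
  then have vw: "v = (g / m0) *s w"
  proof -
    have "(1 / m0) *s (g *s w) = (1 / m0) *s (m0 *s v)" by (simp only: m0)
    then show ?thesis using \<open>m0 \<noteq> 0\<close> by simp
  qed
  have Aw: "A *v w = w"
  proof -
    have "g *s (A *v w) = g *s w" using AE[of "axis i 1"] unfolding gw(3) mv_scale .
    then show ?thesis using g0 unfolding vector_mul_lcancel by simp
  qed
  have wO: "w \<in> O7v" using gw(2) by (rule uni_O7v)
  have mw: "\<exists>m. E x = m *s w" for x using Em[of x] unfolding vw by (metis vector_smult_assoc)
  have neg: "Re (herm w w) < 0"
  proof -
    have "(cmod (g / m0))\<^sup>2 * Re (herm w w) = Re (herm v v)"
    proof -
      have "herm v v = of_real ((cmod (g / m0))\<^sup>2) * herm w w"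
        unfolding complex_norm_square by (simp add: vw mult.commute mult.left_commute)
      then show ?thesis by (metis Re_complex_of_real herm_real of_real_mult)
    qed
    then show ?thesis using v(1) unfolding negative_def by (smt (verit) mem_Collect_eq mult_nonneg_nonneg zero_le_power2)
  qed
  have Ah: "herm (A *v y) w = herm y w" for y using U_J_herm[OF AU, of y w] by (simp add: Aw)
  have Am: "A *v y = - y" if "herm y w = 0" for y
  proof -
    obtain m where m: "E y = m *s w" using mw by blast
    have "herm (E y) w = 0" using that Ah by (simp add: E_def)
    then have "m = 0" unfolding m using neg by auto
    then show ?thesis using m by (simp add: E_def eq_neg_iff_add_eq_0)
  qed
  obtain k where k: "herm w w = of_int k" using herm_self_int wO by blast
  have k0: "k < 0" using neg k by simp
  have kd: "k dvd 2"
  proof -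
    obtain x where x: "x \<in> O7v" "herm x w = 1" using gw(2) by (auto simp: uni_def)
    obtain m where m: "E x = m *s w" using mw by blast
    have "E x \<in> O7v" using x(1) A by (simp add: E_def O7v_A)
    then have "m \<in> O7" using uni_scale_O7[OF gw(2)] m by simp
    moreover have "m * of_int k = of_int 2" using arg_cong[OF m, of "\<lambda>x. herm x w"] x(2) Ah k by (simp add: E_def)
    ultimately show ?thesis using O7_dvd_int k0 by blast
  qed
  have k12: "k = - 1 \<or> k = - 2"
  proof -
    have "\<bar>k\<bar> \<le> 2" using dvd_imp_le_int[OF _ kd] by simp
    then show ?thesis using k0 by auto
  qed
  obtain v0 d where v0: "d \<noteq> 0" "v = d *s v0" "herm v0 v0 = - 2"
    using normalize_negative[OF v(1)] by metis
  have v0n: "v0 \<in> negative" by (simp add: negative_def v0(3))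
  have v0w: "v0 = (g / m0 / d) *s w"
  proof -
    have "(1 / d) *s (d *s v0) = (1 / d) *s ((g / m0) *s w)" using vw v0(2) by simp
    then show ?thesis using v0(1) by simp
  qed
  have "herm w w \<noteq> 0" using neg by auto
  moreover have "herm w v0 = 0 \<or> (\<exists>d. v0 = d *s w)" using v0w by blast
  ultimately obtain x b y where
    b: "x \<in> O7v" "b \<in> O7v" "y \<in> O7v" "herm x w = 1" "herm b w = 0" "herm y w = 0" "cmod (det (cols x b y)) = 1"
    and red: "(cmod (maj v0 y b))\<^sup>2 \<le> 4/7 * (Re (maj v0 b b))\<^sup>2" "Re (maj v0 b b) \<le> Re (maj v0 y y)"
     "Re (maj v0 b b) > 0" "(Re (maj v0 b b))\<^sup>2 \<le> 7/3 * \<bar>Re (herm w w)\<bar>"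
    using reduced_complement_basis[OF gw(2) _ v0n v0(3)] by metis
  have maj: "maj v0 u u' = herm u u'" if "herm u w = 0" for u u' using that by (simp add: maj_def v0w)
  obtain m n where mn: "herm b b = of_int m" "herm y y = of_int n" using herm_self_int b by metis
  define \<beta> where "\<beta> = herm b y"
  have \<beta>O: "\<beta> \<in> O7" using b by (simp add: \<beta>_def O7v_herm)
  obtain l where l: "(cmod \<beta>)\<^sup>2 = of_int l" using O7_norm_int \<beta>O by blast
  have yb: "herm y b = cnj \<beta>" by (simp add: \<beta>_def herm_cnj)
  have "real_of_int (7 * l) \<le> of_int (4 * (m * m))" "real_of_int m \<le> of_int n" "real_of_int m > 0"
    "real_of_int (3 * (m * m)) \<le> of_int (7 * \<bar>k\<bar>)"
    using red l by (simp_all add: maj b mn yb k power2_eq_square)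
  then have I: "7 * l \<le> 4 * (m * m)" "m \<le> n" "m > 0" "3 * (m * m) \<le> 7 * \<bar>k\<bar>" by linarith+
  have "of_int m * of_int n - \<beta> * cnj \<beta> = - of_int k"
    using complement_gram[OF b(4-7)] k k0 by (simp add: mn yb \<beta>_def[symmetric])
  then have "complex_of_real (of_int (m * n - l)) = of_real (of_int (- k))"
    by (simp add: complex_norm_square[symmetric] l)
  then have D: "m * n - l = - k" by (simp only: of_real_eq_iff of_int_eq_iff)
  have l0: "l \<ge> 0" using l by (metis of_int_0_le_iff zero_le_power2)
  have "m * m \<le> 4" using I(4) k12 by auto
  then have m2: "m = 1 \<or> m = 2" using int_sq_le_cases[of m 4 2] I(3) by auto
  have \<beta>0: "\<beta> = 0" if "l = 0" using l that by simp
  show ?thesis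
  proof (cases "k = - 1")
    case True
    then have "m = 1" "l = 0" using I m2 l0 by auto
    then have "n = 1" using D True by simp
    have "sim A (- rep E2a)"
      by (rule E2a_case[OF wO b(2,3) Aw _ b(5,6)])
        (use mn k True \<open>m = 1\<close> \<open>n = 1\<close> \<beta>0[OF \<open>l = 0\<close>] Am b in \<open>simp_all add: \<beta>_def\<close>)
    then show ?thesis by blast
  next
    case False
    then have k2: "k = - 2" using k12 by blast
    from m2 show ?thesis
    proof
      assume m: "m = 1"
      then have "l = 0" using I(1) l0 by auto
      then have "n = 2" using D m k2 by simp
      have "sim A (- rep E2b)"
        by (rule E2b_case[OF wO b(1-3) Aw _ b(4-7)])
          (use mn k k2 m \<open>n = 2\<close> \<beta>0[OF \<open>l = 0\<close>] Am b in \<open>simp_all add: \<beta>_def\<close>)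
      then show ?thesis by blast
    next
      assume m: "m = 2"
      then have "l \<le> 2" "2 * n = 2 + l" using I(1) D k2 by auto
      then have ln: "l = 2" "n = 2" using I(2) m by auto
      then have "\<beta> \<in> {\<tau>, -\<tau>, 1 - \<tau>, \<tau> - 1}" using O7_norm_2[OF \<beta>O] l by simp
      then have "\<beta> = - \<tau> \<or> \<beta> = \<tau> \<or> cnj \<beta> = - \<tau> \<or> cnj \<beta> = \<tau>" by (auto simp: cnj_tau)
      \<comment> \<open>Swapping b and y conjugates \<beta>, and replacing one of them by its
        negative changes its sign; together they bring \<beta> to -\<tau>.\<close>
      then have "\<exists>b' y'. b' \<in> O7v \<and> y' \<in> O7v \<and> herm b' w = 0 \<and> herm y' w = 0 \<and> cmod (det (cols x b' y')) = 1
         \<and> herm b' b' = 2 \<and> herm y' y' = 2 \<and> herm b' y' = - \<tau>"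
      proof (elim disjE)
        assume "\<beta> = - \<tau>"
        then show ?thesis using b mn m ln by (intro exI[of _ b] exI[of _ y]) (simp add: \<beta>_def)
      next
        assume "\<beta> = \<tau>"
        moreover have "det (cols x b (- y)) = - det (cols x b y)" by (simp add: det_3 algebra_simps)
        ultimately show ?thesis using b mn m ln by (intro exI[of _ b] exI[of _ "- y"]) (simp add: \<beta>_def)
      next
        assume "cnj \<beta> = - \<tau>"
        moreover have "det (cols x y b) = - det (cols x b y)" by (simp add: det_3 algebra_simps)
        ultimately show ?thesis using b mn m ln by (intro exI[of _ y] exI[of _ b]) (simp add: yb)
      next
        assume "cnj \<beta> = \<tau>"
        moreover have "det (cols x y (- b)) = det (cols x b y)" by (simp add: det_3 algebra_simps)
        ultimately show ?thesis using b mn m ln by (intro exI[of _ y] exI[of _ "- b"]) (simp add: yb)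
      qed
      then obtain b' y' where "b' \<in> O7v" "y' \<in> O7v" "herm b' w = 0" "herm y' w = 0" "cmod (det (cols x b' y')) = 1"
         "herm b' b' = 2" "herm y' y' = 2" "herm b' y' = - \<tau>" by blast
      then have "sim A (- rep E2c)" using k k2 Am by (intro E2c_case[OF wO b(1) _ _ Aw _ b(4)]) simp_all
      then show ?thesis by blast
    qed
  qed
qed

section \<open>Classification of the elements of order 7\<close>

text \<open>For an isometry \<open>A\<close> of order 7 the Gram determinant of \<open>x, A x, A\<^sup>2 x\<close> is the
  following ternary cubic form in \<open>\<alpha> = \<langle>x,x\<rangle>\<close> and the coordinates of \<open>\<langle>x,A x\<rangle> = p + q \<tau>\<close>. It is a
  norm form of the cubic subfield of the seventh cyclotomic field, in which 2 is inert.\<close>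

definition cubic7 :: "int \<Rightarrow> int \<Rightarrow> int \<Rightarrow> int" where
  "cubic7 a p q = - (a*a*a) - 4*(a*a*p) + 5*(a*a*q) - 3*(a*p*p) + 11*(a*p*q) - 6*(a*q*q)
     + p*p*p + 5*(p*p*q) - 8*(p*q*q) + q*q*q"

text \<open>The form is anisotropic modulo 2. Hence it has no nontrivial zero, by descent, and its
  even values are multiples of 8.\<close>

lemma cubic7_even: "even (cubic7 a p q) \<Longrightarrow> even a \<and> even p \<and> even q"
  unfolding cubic7_def by (cases "even a"; cases "even p"; cases "even q"; simp)

lemma cubic7_double: "cubic7 (2*a) (2*p) (2*q) = 8 * cubic7 a p q"
  by (simp add: cubic7_def)

lemma cubic7_neq_2: "cubic7 a p q \<noteq> - 2"
proof
  assume *: "cubic7 a p q = - 2"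
  then have "even (cubic7 a p q)" by simp
  then obtain a' p' q' where "a = 2 * a'" "p = 2 * p'" "q = 2 * q'" using cubic7_even by (meson evenE)
  then have "8 * cubic7 a' p' q' = - 2" using * cubic7_double by simp
  then show False by presburger
qed

lemma cubic7_eq_0: "cubic7 a p q = 0 \<Longrightarrow> a = 0 \<and> p = 0 \<and> q = 0"
proof (induction "nat (\<bar>a\<bar> + \<bar>p\<bar> + \<bar>q\<bar>)" arbitrary: a p q rule: less_induct)
  case less
  then have "even (cubic7 a p q)" by simp
  then obtain a' p' q' where e: "a = 2 * a'" "p = 2 * p'" "q = 2 * q'" using cubic7_even by (meson evenE)
  then have 0: "cubic7 a' p' q' = 0" using less.prems cubic7_double by simp
  show ?case
  proof (cases "a = 0 \<and> p = 0 \<and> q = 0")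
    case False
    then have "nat (\<bar>a'\<bar> + \<bar>p'\<bar> + \<bar>q'\<bar>) < nat (\<bar>a\<bar> + \<bar>p\<bar> + \<bar>q\<bar>)" using e by auto
    from less.hyps[OF this 0] show ?thesis using e by simp
  qed simp
qed

text \<open>By invariance, \<open>herm x (A *v (A *v x))\<close> equals
  \<open>herm (A *v x) (A *v (A *v (A *v x)))\<close>, and the cubic relation for A expresses this
  through \<open>herm x x\<close> and \<open>herm x (A *v x)\<close>. The same holds for the
  positive definite form.\<close>

lemma order7_gram:
  assumes A: "A \<in> U_J" "det A = 1" "trace A = - \<tau>"
  shows "A *v (A *v (A *v x)) = - \<tau> *s (A *v (A *v x)) + (1 - \<tau>) *s (A *v x) + x"
    and "herm x (A *v (A *v x)) = (\<tau> - 1) * herm x (A *v x) + \<tau> * herm x x + herm (A *v x) x"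
    and "A *v v = c *s v \<Longrightarrow> cmod c = 1 \<Longrightarrow>
      maj v x (A *v (A *v x)) = (\<tau> - 1) * maj v x (A *v x) + \<tau> * maj v x x + maj v (A *v x) x"
proof -
  show rel: "A *v (A *v (A *v x)) = - \<tau> *s (A *v (A *v x)) + (1 - \<tau>) *s (A *v x) + x" for x
    using char_poly_unitary(1)[OF A(1,2), of x] unfolding A(3) by (simp add: cnj_tau veq3 algebra_simps)
  have "herm x (A *v (A *v x)) = herm (A *v x) (A *v (A *v (A *v x)))" by (simp add: U_J_herm[OF A(1)])
  then show "herm x (A *v (A *v x)) = (\<tau> - 1) * herm x (A *v x) + \<tau> * herm x x + herm (A *v x) x"
    unfolding rel by (simp add: U_J_herm[OF A(1)] cnj_tau algebra_simps)
  assume v: "A *v v = c *s v" "cmod c = 1"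
  note inv = maj_invariant[OF A(1) v]
  have "maj v x (A *v (A *v x)) = maj v (A *v x) (A *v (A *v (A *v x)))" by (simp add: inv)
  then show "maj v x (A *v (A *v x)) = (\<tau> - 1) * maj v x (A *v x) + \<tau> * maj v x x + maj v (A *v x) x"
    unfolding rel by (simp add: inv cnj_tau algebra_simps)
qed

lemma order7_gram_det:
  assumes A: "A \<in> U_J" "det A = 1" "trace A = - \<tau>"
    and x: "herm x x = of_int a" "herm x (A *v x) = of_int p + of_int q * \<tau>"
  shows "(cmod (det (cols x (A *v x) (A *v (A *v x)))))\<^sup>2 = of_int (- cubic7 a p q)"
proof -
  let ?b = "of_int p + of_int q * \<tau>"
  define g where "g = (\<tau> - 1) * ?b + \<tau> * of_int a + cnj ?b"
  have h: "herm (A *v x) (A *v y) = herm x y" for x y by (rule U_J_herm[OF A(1)])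
  have bc: "herm (A *v x) x = cnj ?b" using x(2) herm_cnj by metis
  have g: "herm x (A *v (A *v x)) = g" unfolding g_def order7_gram(2)[OF A] x bc by simp
  have gc: "herm (A *v (A *v x)) x = cnj g" using g herm_cnj by metis
  have "of_int a * (of_int a * of_int a - ?b * cnj ?b) - ?b * (cnj ?b * of_int a - ?b * cnj g)
     + g * (cnj ?b * cnj ?b - of_int a * cnj g) = complex_of_int (cubic7 a p q)"
    unfolding g_def cubic7_def by (simp add: cnj_tau) (simp add: algebra_simps tau_simps)
  then have "- complex_of_real ((cmod (det (cols x (A *v x) (A *v (A *v x)))))\<^sup>2) = of_int (cubic7 a p q)"
    unfolding det_cols_gram[symmetric] h bc g gc x by simp
  then have "complex_of_real ((cmod (det (cols x (A *v x) (A *v (A *v x)))))\<^sup>2) = of_real (of_int (- cubic7 a p q))"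
    by (simp add: minus_equation_iff)
  then show ?thesis by (simp only: of_real_eq_iff)
qed

text \<open>If x generates the lattice under A, then \<open>herm x x\<close> and
  \<open>herm x (A *v x)\<close> determine the Gram matrix of x, A x, A^2 x, on which A acts by the
  companion matrix. So these two numbers decide conjugacy.\<close>

lemma sim_order7:
  assumes A: "A \<in> UO" "det A = 1" "trace A = - \<tau>" and A': "A' \<in> UO" "det A' = 1" "trace A' = - \<tau>"
    and x: "x \<in> O7v" "cmod (det (cols x (A *v x) (A *v (A *v x)))) = 1" and x': "x' \<in> O7v"
    and eq: "herm x x = herm x' x'" "herm x (A *v x) = herm x' (A' *v x')"
  shows "sim A A'"
proof -
  have U: "A \<in> U_J" "A' \<in> U_J" using A(1) A'(1) by (simp_all add: UO_def)
  have s: "herm (A *v x) x = herm (A' *v x') x'" using eq(2) herm_cnj by metis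
  have "herm x (A *v (A *v x)) = herm x' (A' *v (A' *v x'))"
    unfolding order7_gram(2)[OF U(1) A(2,3)] order7_gram(2)[OF U(2) A'(2,3)] eq s ..
  then show ?thesis
    by (intro sim_from_bases[of x "A *v x" "A *v (A *v x)" x' "A' *v x'" "A' *v (A' *v x')" A 0 1 0 A' 0 0 1 1 "1 - \<tau>" "- \<tau>"])
      (use x x' A(1) A'(1) eq in \<open>simp_all add: O7v_A U_J_herm U order7_gram(1)[OF U(1) A(2,3)] order7_gram(1)[OF U(2) A'(2,3)]
        add_ac vector_smult_lneg\<close>)
qed

text \<open>A Cauchy-Schwarz inequality across the two forms: polarise with y rotated by the phase z
  of \<open>herm x y\<close>, and compare \<open>herm\<close> with \<open>maj\<close> on x + z y and
  on x - z y.\<close>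

lemma herm_le_maj:
  assumes v: "v \<in> negative" "herm v v = - 2" and "Re (maj v x x) = m" "Re (maj v y y) = m"
  shows "cmod (herm x y) \<le> m"
proof (cases "herm x y = 0")
  case True
  have "Re (maj v x x) \<ge> 0" using maj_pos[OF v, of x] by (cases "x = 0") (auto simp: maj_def)
  then show ?thesis using True assms(3) by simp
next
  case False
  define z where "z = herm x y / of_real (cmod (herm x y))"
  have zz: "z * cnj z = 1" using False by (simp add: z_def complex_norm_square[symmetric] power2_eq_square)
  have zh: "cnj z * herm x y = of_real (cmod (herm x y))"
    using False by (simp add: z_def mult.commute[of "cnj _"] complex_norm_square[symmetric] power2_eq_square)
  have hz: "z * herm y x = of_real (cmod (herm x y))" using arg_cong[OF zh, of cnj] by (simp add: herm_cnj)
  have 1: "Re (herm (x + z *s y) (x + z *s y)) - Re (herm (x - z *s y) (x - z *s y)) = 4 * cmod (herm x y)"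
  proof -
    have "herm (x + z *s y) (x + z *s y) - herm (x - z *s y) (x - z *s y) = 2 * (cnj z * herm x y) + 2 * (z * herm y x)"
      by (simp add: algebra_simps)
    also have "\<dots> = of_real (4 * cmod (herm x y))" unfolding zh hz by simp
    finally show ?thesis by (metis Re_complex_of_real minus_complex.simps(1))
  qed
  have "maj v (x + z *s y) (x + z *s y) + maj v (x - z *s y) (x - z *s y) = 2 * maj v x x + 2 * (z * cnj z) * maj v y y"
    by (simp add: algebra_simps)
  also have "\<dots> = of_real (4 * m)"
    using maj_real[of v x] maj_real[of v y] assms(3,4) zz by simp
  finally have 2: "Re (maj v (x + z *s y) (x + z *s y)) + Re (maj v (x - z *s y) (x - z *s y)) = 4 * m"
    by (metis Re_complex_of_real plus_complex.simps(1))
  show ?thesis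
    using 1 2 maj_ge_herm[OF v(2,1), of "x + z *s y"] maj_ge_herm[OF v(2,1), of "x - z *s y"] by linarith
qed

text \<open>For a short x the determinant D of x, A x, A^2 x has squared modulus below 4. The values
  0, 2 and 3 are excluded by the descent on the cubic form, by its even values, and because 3 is not
  a norm; so x is cyclic. The last inequality records that the span of x and A x meets the positive
  definite complement of v.\<close>

lemma order7_cyclic_vector:
  assumes A: "A \<in> UO" "det A = 1" "trace A = - \<tau>" and v: "v \<in> negative" "A *v v = c *s v" "cmod c = 1" "herm v v = - 2"
  obtains x a \<beta> where "x \<in> O7v" "herm x x = of_int a" "herm x (A *v x) = \<beta>" "\<beta> \<in> O7"
    "cmod (det (cols x (A *v x) (A *v (A *v x)))) = 1" "\<bar>a\<bar> \<le> 2" "(cmod \<beta>)\<^sup>2 \<le> 5" "- of_int a \<le> cmod \<beta>"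
proof -
  have U: "A \<in> U_J" using A(1) by (simp add: UO_def)
  obtain x where x: "uni x" "Re (maj v x x) \<le> 7/3" using hermite_rank3[OF v(1,4)] .
  have xO: "x \<in> O7v" using x(1) by (rule uni_O7v)
  define m where "m = Re (maj v x x)"
  have x0: "x \<noteq> 0" using x(1) by (auto simp: uni_def)
  have m: "m > 0" "m \<le> 7/3" using maj_pos[OF v(1,4) x0] x(2) by (simp_all add: m_def)
  have mx: "maj v x x = of_real m" unfolding m_def by (rule maj_real)
  define x1 x2 where "x1 = A *v x" and "x2 = A *v x1"
  have O: "x1 \<in> O7v" "x2 \<in> O7v" using A(1) xO by (simp_all add: x1_def x2_def O7v_A)
  note inv = maj_invariant[OF U v(2,3)]
  define B where "B = maj v x x1"
  have g1: "maj v x1 x1 = of_real m" "maj v x2 x2 = of_real m" "maj v x1 x2 = B" "maj v x1 x = cnj B"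
    by (simp_all add: x2_def inv B_def maj_cnj) (simp_all add: x1_def inv mx)
  have g2: "maj v x2 x1 = cnj B" using maj_cnj[of v x1 x2] g1(3) by simp
  have g3: "maj v x x2 = (\<tau> - 1) * B + \<tau> * of_real m + cnj B"
    using order7_gram(3)[OF U A(2,3) v(2,3), of x] unfolding x1_def[symmetric] x2_def[symmetric] mx g1(4) B_def .
  have g4: "maj v x2 x = cnj ((\<tau> - 1) * B + \<tau> * of_real m + cnj B)"
    unfolding g3[symmetric] by (simp add: maj_cnj)
  note g = g1 g2 g3 g4
  \<comment> \<open>Hadamard's inequality for x, A x, A^2 x themselves only gives |D|^2 <= m^3,
    about 12.7. The coefficients here make \<open>B\<close> cancel in
    \<open>7 * maj v f2 f2 + 3 * maj v f3 f3\<close>; with the inequality between the means the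
    bound drops below 4.\<close>
  define f2 f3 where "f2 = 3 *s x1 + \<tau> *s x" and "f3 = 7 *s x2 + (3 * \<tau> + 2) *s x1 + (4 * \<tau> - 2) *s x"
  have "7 * maj v f2 f2 + 3 * maj v f3 f3 = 98 * of_real m"
    unfolding f2_def f3_def by (simp add: g B_def[symmetric] mx cnj_tau) (simp add: algebra_simps tau_simps)
  then have s: "7 * Re (maj v f2 f2) + 3 * Re (maj v f3 f3) = 98 * m"
    by (metis (no_types, lifting) Re_complex_of_real maj_real of_real_add of_real_mult of_real_numeral)
  define D where "D = det (cols x x1 x2)"
  have "det (cols x f2 f3) = 21 * D"
    by (simp add: f2_def f3_def D_def det_3 algebra_simps)
  then have "441 * (cmod D)\<^sup>2 = (cmod (det (cols x f2 f3)))\<^sup>2" by (simp add: norm_mult power_mult_distrib)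
  also have "\<dots> \<le> m * Re (maj v f2 f2) * Re (maj v f3 f3)" unfolding m_def by (rule hadamard3[OF v(1,4) x0])
  also have "\<dots> \<le> m * (2401 * m\<^sup>2 / 21)"
  proof -
    have "0 \<le> (7 * Re (maj v f2 f2) - 3 * Re (maj v f3 f3))\<^sup>2" by simp
    then have "84 * (Re (maj v f2 f2) * Re (maj v f3 f3)) \<le> (7 * Re (maj v f2 f2) + 3 * Re (maj v f3 f3))\<^sup>2"
      by (simp add: power2_eq_square algebra_simps)
    then have "Re (maj v f2 f2) * Re (maj v f3 f3) \<le> 2401 * m\<^sup>2 / 21" unfolding s by (simp add: power2_eq_square)
    then show ?thesis using m(1) by (simp add: mult.assoc)
  qed
  also have "m * (2401 * m\<^sup>2 / 21) = 2401 / 21 * m ^ 3" by (simp add: power2_eq_square power3_eq_cube)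
  also have "\<dots> \<le> 2401 / 21 * (7/3) ^ 3" using m by (intro mult_left_mono power_mono) auto
  finally have "(cmod D)\<^sup>2 < 4" by (simp add: power3_eq_cube)
  moreover have DO: "D \<in> O7" unfolding D_def using xO O by (intro det_O7) (simp add: cols_mats_O7)
  obtain a where a: "herm x x = of_int a" using herm_self_int xO by blast
  define \<beta> where "\<beta> = herm x x1"
  have \<beta>O: "\<beta> \<in> O7" using xO O by (simp add: \<beta>_def O7v_herm)
  obtain p q where pq: "\<beta> = of_int p + of_int q * \<tau>" using \<beta>O by (rule O7E)
  have N: "(cmod D)\<^sup>2 = of_int (- cubic7 a p q)"
    unfolding D_def x1_def x2_def
    by (rule order7_gram_det[OF U A(2,3) a]) (simp add: pq[symmetric] \<beta>_def x1_def)
  have yv: "herm x1 v * herm v x1 = herm x v * herm v x"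
    using inv[of x x] U_J_herm[OF U, of x x] unfolding x1_def[symmetric] maj_def by simp
  \<comment> \<open>The combination of x and A x that is orthogonal to v; the form is positive on it
    unless it is 0.\<close>
  define y where "y = herm x1 v *s x - herm x v *s x1"
  have "herm y v = 0" by (simp add: y_def)
  then have ypos: "y = 0 \<or> Re (herm y y) > 0" using perp_negative_pos[OF v(1), of y] by (cases "y = 0") simp_all
  \<comment> \<open>A zero of the cubic form makes the Hermitian form vanish on the span of x and A
    x, so y = 0 and x is an eigenvector. Its eigenvalue would be a unit of \<open>O7\<close>, but
    neither 1 nor -1 satisfies the cubic relation.\<close>
  have "cubic7 a p q \<noteq> 0"
  proof
    assume "cubic7 a p q = 0"
    from cubic7_eq_0[OF this] have 0: "a = 0" "\<beta> = 0" unfolding pq by simp_all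
    have "herm x1 x = 0" using 0(2) herm_sym0 by (simp add: \<beta>_def)
    moreover have "herm x1 x1 = 0" using U_J_herm[OF U, of x x] a 0 by (simp add: x1_def)
    ultimately have "herm y y = 0" using a 0 by (simp add: y_def \<beta>_def)
    then have "y = 0" using ypos by auto
    have xv: "herm x v \<noteq> 0" using mx m(1) a 0(1) by (auto simp: maj_def)
    then have e: "x1 = (herm x1 v / herm x v) *s x"
    proof -
      have "herm x v *s x1 = herm x v *s ((herm x1 v / herm x v) *s x)" using \<open>y = 0\<close> xv by (simp add: y_def)
      then show ?thesis using xv unfolding vector_mul_lcancel by blast
    qed
    define r where "r = herm x1 v / herm x v"
    have x1r: "x1 = r *s x" using e by (simp add: r_def)
    have rO: "r \<in> O7" using uni_scale_O7[OF x(1)] O(1) x1r by simp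
    have "(r * r * r) *s x = (- \<tau> * (r * r) + (1 - \<tau>) * r + 1) *s x"
      using order7_gram(1)[OF U A(2,3), of x] x1r unfolding x1_def by (simp add: mv_scale veq3 algebra_simps)
    then have cub: "r * r * r = - \<tau> * (r * r) + (1 - \<tau>) * r + 1"
      unfolding vector_mul_rcancel using x0 by simp
    then have "r * (r * r + \<tau> * r - (1 - \<tau>)) = 1" by (simp add: algebra_simps)
    then have "r = 1 \<or> r = - 1" using O7_unit_mult[OF rO, of "r * r + \<tau> * r - (1 - \<tau>)"] rO by simp
    then show False using cub by (auto simp: complex_eq_iff)
  qed
  moreover have "cubic7 a p q \<noteq> - 2" by (rule cubic7_neq_2)
  moreover have "cubic7 a p q \<noteq> - 3" using O7_norm_neq_3[OF DO] N by auto
  moreover have "- cubic7 a p q \<ge> 0" "- cubic7 a p q < 4"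
    using \<open>(cmod D)\<^sup>2 < 4\<close> N by (metis of_int_0_le_iff zero_le_power2, simp)
  ultimately have "cubic7 a p q = - 1" by linarith
  then have "(cmod D)\<^sup>2 = 1" using N by simp
  then have D1: "cmod D = 1" using power2_eq_iff_nonneg[of "cmod D" 1] by simp
  have "\<bar>of_int a\<bar> \<le> m" using maj_ge_herm[OF v(4,1), of x] a by (simp add: m_def)
  then have "\<bar>a\<bar> \<le> 2" using m(2) by linarith
  have bm: "cmod \<beta> \<le> m" unfolding \<beta>_def by (rule herm_le_maj[OF v(1,4)]) (simp_all add: mx g)
  then have "(cmod \<beta>)\<^sup>2 \<le> (7/3)\<^sup>2" using m(2) by (intro power_mono) auto
  moreover obtain n :: int where n: "(cmod \<beta>)\<^sup>2 = of_int n" using O7_norm_int \<beta>O by blast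
  ultimately have "n \<le> 5" by (simp add: power2_eq_square)
  have "- of_int a \<le> cmod \<beta>"
  proof (cases "herm x v = 0")
    case True
    then have "Re (herm x x) > 0" using perp_negative_pos[OF v(1) True x0] by simp
    then have "- of_int a \<le> (0::real)" using a by simp
    then show ?thesis by (rule order_trans) simp
  next
    case False
    define k where "k = cmod (herm x v)"
    have k: "k > 0" using False by (simp add: k_def)
    have sq: "herm u v * herm v u = of_real ((cmod (herm u v))\<^sup>2)" for u
      by (simp only: complex_norm_square herm_cnj)
    have k1: "cmod (herm x1 v) = k"
    proof -
      have "(cmod (herm x1 v))\<^sup>2 = (cmod (herm x v))\<^sup>2" using yv unfolding sq by (simp only: of_real_eq_iff)
      then show ?thesis by (simp add: k_def)
    qed
    define Z where "Z = herm x1 v * herm v x * \<beta>"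
    \<comment> \<open>The products of x and A x with v have the same modulus k, since A preserves
      the line of v; then \<open>herm y y\<close> >= 0 gives a + |\<beta>| >= 0.\<close>
    have "herm y y = (herm x1 v * herm v x1) * of_int a + (herm x v * herm v x) * of_int a - (Z + cnj Z)"
      using U_J_herm[OF U, of x x] a by (simp add: Z_def y_def \<beta>_def herm_cnj x1_def[symmetric] algebra_simps)
    also have "\<dots> = of_real (2 * k\<^sup>2 * of_int a) - (Z + cnj Z)"
      unfolding sq k1 k_def[symmetric] by simp
    finally have "Re (herm y y) = 2 * k\<^sup>2 * of_int a - 2 * Re Z" by simp
    then have "Re (herm y y) = 2 * k\<^sup>2 * of_int a - 2 * Re (herm x1 v * herm v x * \<beta>)"
      unfolding Z_def .
    moreover have "Re (herm y y) \<ge> 0" using ypos by auto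
    moreover have "- Re (herm x1 v * herm v x * \<beta>) \<le> k\<^sup>2 * cmod \<beta>"
    proof -
      have "- Re (herm x1 v * herm v x * \<beta>) \<le> cmod (herm x1 v * herm v x * \<beta>)"
        using abs_Re_le_cmod[of "herm x1 v * herm v x * \<beta>"] by linarith
      also have "\<dots> = k\<^sup>2 * cmod \<beta>"
      proof -
        have "cmod (herm v x) = k" unfolding k_def by (metis herm_cnj complex_mod_cnj)
        then show ?thesis by (simp add: norm_mult k1 power2_eq_square)
      qed
      finally show ?thesis .
    qed
    ultimately have "0 \<le> k\<^sup>2 * (of_int a + cmod \<beta>)" by (simp add: algebra_simps)
    then show ?thesis using k by (simp add: zero_le_mult_iff)
  qed
  then show ?thesis
    using that[OF xO a _ \<beta>O] D1 \<open>\<bar>a\<bar> \<le> 2\<close> n \<open>n \<le> 5\<close> by (simp add: D_def x1_def x2_def \<beta>_def)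
qed

text \<open>A finite check of a against the thirteen values of \<beta>. For a = -2 the cubic
  equation has further solutions such as \<beta> = 1; the lower bound on |\<beta>| removes
  them.\<close>

lemma order7_gram_values:
  assumes "\<bar>a\<bar> \<le> 2" "\<beta> \<in> O7" "(cmod \<beta>)\<^sup>2 \<le> 5" "- of_int a \<le> cmod \<beta>"
    and c: "\<And>p q. \<beta> = of_int p + of_int q * \<tau> \<Longrightarrow> cubic7 a p q = - 1"
  shows "(a, \<beta>) \<in> {(- 1, - 1 - \<tau>), (- 1, 1 - \<tau>), (- 1, 1 + \<tau>), (- 1, 2 - \<tau>), (0, - 1), (0, - \<tau>), (0, 1 + \<tau>),
    (1, - 1), (1, 0), (1, \<tau>), (2, 1 + \<tau>)}"
proof -
  have a: "a \<in> {-2, -1, 0, 1, 2}" using assms(1) by auto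
  have a2: "(cmod \<beta>)\<^sup>2 \<ge> 4" if "a = - 2"
    using power_mono[of 2 "cmod \<beta>" 2] assms(4) that by simp
  have "\<beta> \<in> {0, 1, -1, \<tau>, -\<tau>, 1 - \<tau>, \<tau> - 1, 2, -2, \<tau> - 2, 2 - \<tau>, 1 + \<tau>, - 1 - \<tau>}"
    by (rule O7_norm_le_5[OF assms(2,3)])
  then show ?thesis
  proof (elim insertE emptyE)
    assume b: "\<beta> = 0"
    have "cubic7 a 0 0 = - 1" by (rule c) (simp add: b)
    from a this a2 show ?thesis unfolding b
      by (elim insertE emptyE; hypsubst; simp add: cubic7_def norm_minus_cancel cmod_sq_simps)
  next
    assume b: "\<beta> = 1"
    have "cubic7 a 1 0 = - 1" by (rule c) (simp add: b)
    from a this a2 show ?thesis unfolding b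
      by (elim insertE emptyE; hypsubst; simp add: cubic7_def norm_minus_cancel cmod_sq_simps)
  next
    assume b: "\<beta> = - 1"
    have "cubic7 a (- 1) 0 = - 1" by (rule c) (simp add: b)
    from a this a2 show ?thesis unfolding b
      by (elim insertE emptyE; hypsubst; simp add: cubic7_def norm_minus_cancel cmod_sq_simps)
  next
    assume b: "\<beta> = \<tau>"
    have "cubic7 a 0 1 = - 1" by (rule c) (simp add: b)
    from a this a2 show ?thesis unfolding b
      by (elim insertE emptyE; hypsubst; simp add: cubic7_def norm_minus_cancel cmod_sq_simps)
  next
    assume b: "\<beta> = - \<tau>"
    have "cubic7 a 0 (- 1) = - 1" by (rule c) (simp add: b)
    from a this a2 show ?thesis unfolding b
      by (elim insertE emptyE; hypsubst; simp add: cubic7_def norm_minus_cancel cmod_sq_simps)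
  next
    assume b: "\<beta> = 1 - \<tau>"
    have "cubic7 a 1 (- 1) = - 1" by (rule c) (simp add: b)
    from a this a2 show ?thesis unfolding b
      by (elim insertE emptyE; hypsubst; simp add: cubic7_def norm_minus_cancel cmod_sq_simps)
  next
    assume b: "\<beta> = \<tau> - 1"
    have "cubic7 a (- 1) 1 = - 1" by (rule c) (simp add: b)
    from a this a2 show ?thesis unfolding b
      by (elim insertE emptyE; hypsubst; simp add: cubic7_def norm_minus_cancel cmod_sq_simps)
  next
    assume b: "\<beta> = 2"
    have "cubic7 a 2 0 = - 1" by (rule c) (simp add: b)
    from a this a2 show ?thesis unfolding b
      by (elim insertE emptyE; hypsubst; simp add: cubic7_def norm_minus_cancel cmod_sq_simps)
  next
    assume b: "\<beta> = - 2"
    have "cubic7 a (- 2) 0 = - 1" by (rule c) (simp add: b)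
    from a this a2 show ?thesis unfolding b
      by (elim insertE emptyE; hypsubst; simp add: cubic7_def norm_minus_cancel cmod_sq_simps)
  next
    assume b: "\<beta> = \<tau> - 2"
    have "cubic7 a (- 2) 1 = - 1" by (rule c) (simp add: b)
    from a this a2 show ?thesis unfolding b
      by (elim insertE emptyE; hypsubst; simp add: cubic7_def norm_minus_cancel cmod_sq_simps)
  next
    assume b: "\<beta> = 2 - \<tau>"
    have "cubic7 a 2 (- 1) = - 1" by (rule c) (simp add: b)
    from a this a2 show ?thesis unfolding b
      by (elim insertE emptyE; hypsubst; simp add: cubic7_def norm_minus_cancel cmod_sq_simps)
  next
    assume b: "\<beta> = 1 + \<tau>"
    have "cubic7 a 1 1 = - 1" by (rule c) (simp add: b)
    from a this a2 show ?thesis unfolding b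
      by (elim insertE emptyE; hypsubst; simp add: cubic7_def norm_minus_cancel cmod_sq_simps)
  next
    assume b: "\<beta> = - 1 - \<tau>"
    have "cubic7 a (- 1) (- 1) = - 1" by (rule c) (simp add: b)
    from a this a2 show ?thesis unfolding b
      by (elim insertE emptyE; hypsubst; simp add: cubic7_def norm_minus_cancel cmod_sq_simps)
  qed
qed

lemma mpow_vec: "mpow A 1 *v x = A *v x" "mpow A 2 *v x = A *v (A *v x)"
  "mpow A 4 *v x = A *v (A *v (A *v (A *v x)))"
  by (simp_all add: numeral_eq_Suc matrix_vector_mul_assoc matrix_mul_assoc)

text \<open>The trace t = -\<tau> satisfies t^2 - 2 cnj t = t, so squaring preserves it. The
  exponents 1, 2, 4 are the squares modulo 7.\<close>

lemma order7_powers: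
  assumes "A \<in> UO" "det A = 1" "trace A = - \<tau>" "k \<in> {1, 2, 4::nat}"
  shows "mpow A k \<in> UO" "det (mpow A k) = 1" "trace (mpow A k) = - \<tau>"
proof -
  have sq: "B ** B \<in> UO \<and> det (B ** B) = 1 \<and> trace (B ** B) = - \<tau>"
    if "B \<in> UO" "det B = 1" "trace B = - \<tau>" for B
    using that char_poly_unitary(2)[of B] by (simp add: UO_mult det_mul UO_D(1) power2_eq_square tau_simps)
  have "mpow A 1 = A" "mpow A 2 = A ** A" "mpow A 4 = (A ** A) ** (A ** A)"
    by (simp_all add: numeral_eq_Suc matrix_mul_assoc)
  then show "mpow A k \<in> UO" "det (mpow A k) = 1" "trace (mpow A k) = - \<tau>"
    using assms sq[OF assms(1-3)] sq[of "A ** A"] by auto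
qed

lemma E7_data: "- rep E7 \<in> UO" "det (- rep E7) = 1" "trace (- rep E7) = - \<tau>"
  by (rule UO_minus[OF UO_rep]) (simp_all add: det_3 trace3 vector_3 rep.simps tau_simps algebra_simps)

text \<open>Each of the eleven Gram pairs is realised by an explicit vector for one of the powers 1,
  2, 4 of \<open>- rep E7\<close>, and equal pairs mean conjugacy.\<close>

lemma classification_order_7:
  assumes A: "A \<in> UO" "det A = 1" "trace A = - \<tau>" and v: "v \<in> negative" "A *v v = c *s v" "cmod c = 1"
  shows "\<exists>k\<in>{1, 2, 4}. sim A (mpow (- rep E7) k)"
proof -
  obtain v0 d where v0: "d \<noteq> 0" "v = d *s v0" "herm v0 v0 = - 2"
    using normalize_negative[OF v(1)] by metis
  have v0n: "v0 \<in> negative" by (simp add: negative_def v0(3))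
  have Av0: "A *v v0 = c *s v0"
  proof -
    have "d *s (A *v v0) = d *s (c *s v0)" using v(2) unfolding v0(2) mv_scale by (simp add: mult.commute)
    then show ?thesis using v0(1) unfolding vector_mul_lcancel by simp
  qed
  obtain x a \<beta> where x: "x \<in> O7v" "herm x x = of_int a" "herm x (A *v x) = \<beta>" "\<beta> \<in> O7"
    "cmod (det (cols x (A *v x) (A *v (A *v x)))) = 1" "\<bar>a\<bar> \<le> 2" "(cmod \<beta>)\<^sup>2 \<le> 5" "- of_int a \<le> cmod \<beta>"
    using order7_cyclic_vector[OF A v0n Av0 v(3) v0(3)] by metis
  have "cubic7 a p q = - 1" if "\<beta> = of_int p + of_int q * \<tau>" for p q
  proof -
    have "(cmod (det (cols x (A *v x) (A *v (A *v x)))))\<^sup>2 = of_int (- cubic7 a p q)"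
      using order7_gram_det[OF UO_D(1)[OF A(1)] A(2,3) x(2)] x(3) that by simp
    then show ?thesis unfolding x(5) by simp
  qed
  from order7_gram_values[OF x(6,4,7,8) this]
  have ab: "(a, \<beta>) \<in> {(- 1, - 1 - \<tau>), (- 1, 1 - \<tau>), (- 1, 1 + \<tau>), (- 1, 2 - \<tau>), (0, - 1), (0, - \<tau>), (0, 1 + \<tau>),
    (1, - 1), (1, 0), (1, \<tau>), (2, 1 + \<tau>)}" by blast
  have S: "\<exists>k\<in>{1, 2, 4}. sim A (mpow (- rep E7) k)"
    if "(a, \<beta>) = (a', \<beta>')" "k \<in> {1, 2, 4}" "x' \<in> O7v" "herm x' x' = of_int a'"
      "herm x' (mpow (- rep E7) k *v x') = \<beta>'" for a' \<beta>' k x'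
  proof -
    have "sim A (mpow (- rep E7) k)"
      by (rule sim_order7[OF A order7_powers[OF E7_data that(2)] x(1,5) that(3)])
        (use that x(2,3) in simp_all)
    then show ?thesis using that(2) by blast
  qed
  note e = mpow_vec vec3_simps minus_mv
  from ab show ?thesis
  proof (elim insertE emptyE)
    assume c: "(a, \<beta>) = (- 1, - 1 - \<tau>)"
    show ?thesis
      by (rule S[OF c, of 1 "vec3 (- 1) (- 1) 1"]) (simp_all add: e del: One_nat_def, (simp_all add: tau_simps)?, (simp_all add: tau_simps algebra_simps)?)
  next
    assume c: "(a, \<beta>) = (- 1, 1 - \<tau>)"
    show ?thesis
      by (rule S[OF c, of 2 "vec3 (- 1) (- 1) 1"]) (simp_all add: e del: One_nat_def, (simp_all add: tau_simps)?, (simp_all add: tau_simps algebra_simps)?)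
  next
    assume c: "(a, \<beta>) = (- 1, 1 + \<tau>)"
    show ?thesis
      by (rule S[OF c, of 4 "vec3 (- 1) (- 1) 1"]) (simp_all add: e del: One_nat_def, (simp_all add: tau_simps)?, (simp_all add: tau_simps algebra_simps)?)
  next
    assume c: "(a, \<beta>) = (- 1, 2 - \<tau>)"
    show ?thesis
      by (rule S[OF c, of 2 "vec3 (\<tau> - 2) (- 1) (- \<tau>)"]) (simp_all add: e del: One_nat_def, (simp_all add: tau_simps)?, (simp_all add: tau_simps algebra_simps)?)
  next
    assume c: "(a, \<beta>) = (0, - 1)"
    show ?thesis
      by (rule S[OF c, of 1 "vec3 (- 1) 0 0"]) (simp_all add: e del: One_nat_def, (simp_all add: tau_simps)?, (simp_all add: tau_simps algebra_simps)?)
  next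
    assume c: "(a, \<beta>) = (0, - \<tau>)"
    show ?thesis
      by (rule S[OF c, of 2 "vec3 (- 1) 0 0"]) (simp_all add: e del: One_nat_def, (simp_all add: tau_simps)?, (simp_all add: tau_simps algebra_simps)?)
  next
    assume c: "(a, \<beta>) = (0, 1 + \<tau>)"
    show ?thesis
      by (rule S[OF c, of 4 "vec3 (- 1) 0 0"]) (simp_all add: e del: One_nat_def, (simp_all add: tau_simps)?, (simp_all add: tau_simps algebra_simps)?)
  next
    assume c: "(a, \<beta>) = (1, - 1)"
    show ?thesis
      by (rule S[OF c, of 1 "vec3 0 (- 1) 0"]) (simp_all add: e del: One_nat_def, (simp_all add: tau_simps)?, (simp_all add: tau_simps algebra_simps)?)
  next
    assume c: "(a, \<beta>) = (1, 0)"
    show ?thesis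
      by (rule S[OF c, of 2 "vec3 0 (- 1) 0"]) (simp_all add: e del: One_nat_def, (simp_all add: tau_simps)?, (simp_all add: tau_simps algebra_simps)?)
  next
    assume c: "(a, \<beta>) = (1, \<tau>)"
    show ?thesis
      by (rule S[OF c, of 4 "vec3 0 (- 1) 0"]) (simp_all add: e del: One_nat_def, (simp_all add: tau_simps)?, (simp_all add: tau_simps algebra_simps)?)
  next
    assume c: "(a, \<beta>) = (2, 1 + \<tau>)"
    show ?thesis
      by (rule S[OF c, of 2 "vec3 (- 1) (- \<tau>) 0"]) (simp_all add: e del: One_nat_def, (simp_all add: tau_simps)?, (simp_all add: tau_simps algebra_simps)?)
  qed
qed

section \<open>Conjugacy in the projective group\<close>

definition conjg :: "(complex^3^3) set \<Rightarrow> (complex^3^3) set \<Rightarrow> (complex^3^3) set" where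
  "conjg H Z = H \<otimes>\<^bsub>\<Gamma>\<^esub> Z \<otimes>\<^bsub>\<Gamma>\<^esub> inv\<^bsub>\<Gamma>\<^esub> H"

lemma conj_elements_iff: "conj_elements X Y \<longleftrightarrow> (\<exists>H\<in>carrier \<Gamma>. conjg H X = Y)"
  by (simp add: conj_elements_def conjg_def)

lemma conj_cyclic_iff: "conj_cyclic X Y \<longleftrightarrow> (\<exists>H\<in>carrier \<Gamma>. conjg H ` generate \<Gamma> {X} = generate \<Gamma> {Y})"
  by (simp add: conj_cyclic_def conjg_def)

interpretation Gm: group \<Gamma> by (rule group_Gamma)

lemma conjg_closed [simp]: "H \<in> carrier \<Gamma> \<Longrightarrow> X \<in> carrier \<Gamma> \<Longrightarrow> conjg H X \<in> carrier \<Gamma>"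
  by (simp add: conjg_def)

lemma conjg_mult:
  "H \<in> carrier \<Gamma> \<Longrightarrow> X \<in> carrier \<Gamma> \<Longrightarrow> Y \<in> carrier \<Gamma> \<Longrightarrow>
    conjg H (X \<otimes>\<^bsub>\<Gamma>\<^esub> Y) = conjg H X \<otimes>\<^bsub>\<Gamma>\<^esub> conjg H Y"
  unfolding conjg_def by (simp add: Gm.m_assoc Gm.inv_solve_left Gm.inv_solve_left')

lemma conjg_hom: "H \<in> carrier \<Gamma> \<Longrightarrow> group_hom \<Gamma> \<Gamma> (conjg H)"
  by unfold_locales (auto intro!: homI simp: conjg_mult)

lemma conjg_compose:
  "G \<in> carrier \<Gamma> \<Longrightarrow> H \<in> carrier \<Gamma> \<Longrightarrow> X \<in> carrier \<Gamma> \<Longrightarrow> conjg G (conjg H X) = conjg (G \<otimes>\<^bsub>\<Gamma>\<^esub> H) X"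
  unfolding conjg_def by (simp add: Gm.m_assoc Gm.inv_mult_group)

lemma conjg_one: "X \<in> carrier \<Gamma> \<Longrightarrow> conjg \<one>\<^bsub>\<Gamma>\<^esub> X = X"
  by (simp add: conjg_def)

lemma generate_carrier: "X \<in> carrier \<Gamma> \<Longrightarrow> generate \<Gamma> {X} \<subseteq> carrier \<Gamma>"
  using Gm.generate_in_carrier[of "{X}"] by auto

lemma generate_conjg: "H \<in> carrier \<Gamma> \<Longrightarrow> X \<in> carrier \<Gamma> \<Longrightarrow> conjg H ` generate \<Gamma> {X} = generate \<Gamma> {conjg H X}"
  using group_hom.generate_img[OF conjg_hom, of H "{X}"] by simp

lemma conj_elements_imp_cyclic: "X \<in> carrier \<Gamma> \<Longrightarrow> conj_elements X Y \<Longrightarrow> conj_cyclic X Y"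
  unfolding conj_elements_iff conj_cyclic_iff using generate_conjg by metis

lemma conj_elements_trans:
  "X \<in> carrier \<Gamma> \<Longrightarrow> conj_elements X Y \<Longrightarrow> conj_elements Y Z \<Longrightarrow> conj_elements X Z"
  unfolding conj_elements_iff by (metis conjg_compose Gm.m_closed)

lemma conj_cyclic_sym:
  assumes "X \<in> carrier \<Gamma>" "conj_cyclic X Y" shows "conj_cyclic Y X"
proof -
  obtain H where H: "H \<in> carrier \<Gamma>" "conjg H ` generate \<Gamma> {X} = generate \<Gamma> {Y}"
    using assms(2) conj_cyclic_iff by blast
  have "conjg (inv\<^bsub>\<Gamma>\<^esub> H) (conjg H Z) = Z" if "Z \<in> generate \<Gamma> {X}" for Z
    using that generate_carrier[OF assms(1)] H(1) by (subst conjg_compose) (auto simp: conjg_one)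
  then have "conjg (inv\<^bsub>\<Gamma>\<^esub> H) ` generate \<Gamma> {Y} = generate \<Gamma> {X}"
    unfolding H(2)[symmetric] image_image by (simp cong: image_cong)
  then show ?thesis using H(1) conj_cyclic_iff by blast
qed

lemma conj_cyclic_trans:
  assumes "X \<in> carrier \<Gamma>" "conj_cyclic X Y" "conj_cyclic Y Z" shows "conj_cyclic X Z"
proof -
  obtain H G where H: "H \<in> carrier \<Gamma>" "conjg H ` generate \<Gamma> {X} = generate \<Gamma> {Y}"
    and G: "G \<in> carrier \<Gamma>" "conjg G ` generate \<Gamma> {Y} = generate \<Gamma> {Z}"
    using assms(2,3) conj_cyclic_iff by metis
  have "conjg (G \<otimes>\<^bsub>\<Gamma>\<^esub> H) W = conjg G (conjg H W)" if "W \<in> generate \<Gamma> {X}" for W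
    using that generate_carrier[OF assms(1)] H(1) G(1) conjg_compose by auto
  then have "conjg (G \<otimes>\<^bsub>\<Gamma>\<^esub> H) ` generate \<Gamma> {X} = generate \<Gamma> {Z}"
    unfolding G(2)[symmetric] H(2)[symmetric] image_image by (simp cong: image_cong)
  then show ?thesis using H(1) G(1) conj_cyclic_iff by blast
qed

lemma generate_eqI:
  assumes "X \<in> carrier \<Gamma>" "Y \<in> carrier \<Gamma>" "X \<in> generate \<Gamma> {Y}" "Y \<in> generate \<Gamma> {X}"
  shows "generate \<Gamma> {X} = generate \<Gamma> {Y}"
  using Gm.generate_subgroup_incl[of "{X}" "generate \<Gamma> {Y}"] Gm.generate_subgroup_incl[of "{Y}" "generate \<Gamma> {X}"]
    Gm.generate_is_subgroup[of "{X}"] Gm.generate_is_subgroup[of "{Y}"] assms by auto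

lemma generate_inv: "X \<in> carrier \<Gamma> \<Longrightarrow> generate \<Gamma> {inv\<^bsub>\<Gamma>\<^esub> X} = generate \<Gamma> {X}"
  using generate.inv[of X "{X}" \<Gamma>] generate.inv[of "inv\<^bsub>\<Gamma>\<^esub> X" "{inv\<^bsub>\<Gamma>\<^esub> X}" \<Gamma>] by (intro generate_eqI) simp_all

lemma generate_nat_pow: "X \<in> carrier \<Gamma> \<Longrightarrow> X [^]\<^bsub>\<Gamma>\<^esub> (n::nat) \<in> generate \<Gamma> {X}"
  using Gm.generate_pow[of X] by (auto intro!: exI[of _ "int n"] simp: int_pow_int)

lemma conj_cyclic_inv_left: "X \<in> carrier \<Gamma> \<Longrightarrow> conj_cyclic (inv\<^bsub>\<Gamma>\<^esub> X) Y \<Longrightarrow> conj_cyclic X Y"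
  unfolding conj_cyclic_iff by (simp add: generate_inv)

lemma conj_cyclic_pow_right:
  assumes "Y \<in> carrier \<Gamma>" "(Y [^]\<^bsub>\<Gamma>\<^esub> (k::nat)) [^]\<^bsub>\<Gamma>\<^esub> (l::nat) = Y" "conj_cyclic X (Y [^]\<^bsub>\<Gamma>\<^esub> k)"
  shows "conj_cyclic X Y"
proof -
  have "generate \<Gamma> {Y [^]\<^bsub>\<Gamma>\<^esub> k} = generate \<Gamma> {Y}"
    by (rule generate_eqI) (use assms generate_nat_pow[of "Y [^]\<^bsub>\<Gamma>\<^esub> k" l] generate_nat_pow[of Y k] in auto)
  then show ?thesis using assms(3) conj_cyclic_iff by simp
qed

lemma sim_imp_conj: "A \<in> UO \<Longrightarrow> B \<in> UO \<Longrightarrow> sim A B \<Longrightarrow> conj_elements (cls A) (cls B)"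
proof -
  assume A: "A \<in> UO" and B: "B \<in> UO" and "sim A B"
  then obtain H where H: "H \<in> UO" "H ** A = B ** H" unfolding sim_def by blast
  have "H ** A ** uinv H = B" unfolding H(2) using H(1)
    by (simp add: uinv_right UO_D flip: matrix_mul_assoc)
  then have "conjg (cls H) (cls A) = cls B"
    unfolding conjg_def using A H(1) by (simp add: cls_inv cls_mult UO_uinv UO_mult)
  then show ?thesis unfolding conj_elements_iff using H(1) by auto
qed

subsection \<open>Isolated fixed points\<close>

text \<open>If the eigenspace were larger, the lines of v + t u for small real t would be fixed
  points that accumulate at the line of v.\<close>

lemma isolated_eigenline:
  assumes A: "A \<in> UO" and v: "v \<in> negative" "A *v v = c *s v" and iso: "isolated_fixed_point (cls A) (cline v)"
    and u: "A *v u = c *s u"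
  shows "\<exists>m. u = m *s v"
proof (rule ccontr)
  assume nm: "\<not> ?thesis"
  have v0: "v \<noteq> 0" using v(1) by (rule negative_nonzero)
  have AU: "A \<in> U_J" using A by (simp add: UO_def)
  have c0: "c \<noteq> 0" using v(2) v0 uinv_vec(1)[OF AU, of v] by auto
  have "cline v \<in> H2_top derived_set_of fixed_points (cls A)"
    unfolding in_derived_set_of
  proof (intro conjI allI impI)
    have cont: "continuous_on UNIV (\<lambda>w::complex^3. Re (herm w w))"
      unfolding herm_expand by (intro continuous_intros)
    have "negative = (\<lambda>w. Re (herm w w)) -` {..<0}" by (auto simp: negative_def)
    then have opn: "open negative"
      using cont open_vimage[of "{..<0::real}"] by (metis open_lessThan)
    have "openin H2_top H2" unfolding openin_H2_top
    proof (intro conjI)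
      have "{v \<in> negative. cline v \<in> H2} = negative" by (auto simp: H2_def)
      then show "open {v \<in> negative. cline v \<in> H2}" using opn by simp
    qed simp
    then have "H2 \<subseteq> topspace H2_top" by (rule openin_subset)
    then show "cline v \<in> topspace H2_top" using v(1) by (auto simp: H2_def)
    fix T assume T: "cline v \<in> T \<and> openin H2_top T"
    define W where "W = {w \<in> negative. cline w \<in> T}"
    have "open W" "v \<in> W" using T v(1) by (auto simp: W_def openin_H2_top)
    define f where "f = (\<lambda>t::real. v + of_real t *s u)"
    have fc: "continuous_on UNIV f" unfolding f_def vector_scalar_mult_def
      by (intro continuous_intros)
    have "open (f -` W)" using open_vimage[OF \<open>open W\<close> fc] .
    moreover have "0 \<in> f -` W" using \<open>v \<in> W\<close> by (simp add: f_def)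
    ultimately obtain e where e: "e > 0" "ball 0 e \<subseteq> f -` W" using open_contains_ball by blast
    then have t: "f (e / 2) \<in> W" by (auto simp: subset_iff)
    define w where "w = f (e / 2)"
    have w: "w \<in> negative" "cline w \<in> T" using t by (simp_all add: w_def W_def)
    have "A *v w = c *s w" unfolding w_def f_def
      by (simp add: matrix_vector_right_distrib mv_scale v(2) u vector_add_ldistrib mult.commute)
    then have "act (cls A) (cline w) = cline w" using c0 by (simp add: act_cls cline_scale)
    then have "cline w \<in> fixed_points (cls A)" using w(1) by (simp add: fixed_points_def H2_def)
    moreover have "cline w \<noteq> cline v"
    proof
      assume "cline w = cline v"
      then obtain m where "w = m *s v" using cline_eq_iff[OF negative_nonzero[OF w(1)], of v] by metis
      then have "of_real (e / 2) *s u = (m - 1) *s v" by (simp add: w_def f_def veq3 algebra_simps)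
      moreover have "(1 / of_real (e / 2)) *s (of_real (e / 2) *s u) = u" using e(1) by simp
      ultimately have "u = ((1 / of_real (e / 2)) * (m - 1)) *s v" by (metis vector_smult_assoc)
      then show False using nm by blast
    qed
    ultimately show "\<exists>y. y \<noteq> cline v \<and> y \<in> fixed_points (cls A) \<and> y \<in> T" using w(2) by blast
  qed
  then show False using iso unfolding isolated_fixed_point_def by blast
qed

lemma cls_rep_minus: "cls (- rep i) = cls (rep i)"
  by (rule cls_minus)

lemma mat_eq_vec3I: "(\<And>a b c. A *v vec3 a b c = B *v vec3 a b c) \<Longrightarrow> A = B"
  by (metis matrix_eq vec3_eta)

lemma mpow_Suc_vec: "mpow A (Suc n) *v x = mpow A n *v (A *v x)"
  by (simp flip: matrix_vector_mul_assoc)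

lemma E7_pow_7: "mpow (rep E7) 7 = - mat 1"
  by (rule mat_eq_vec3I)
    (simp add: numeral_eq_Suc mpow_Suc_vec vec3_simps del: mpow.simps(2), simp add: tau_simps algebra_simps)

theorem classification_existence:
  assumes "torsion X" "isolated_fixed_point X p"
  shows "\<exists>i. conj_cyclic X (cls (rep i))"
proof -
  obtain A0 where A0: "A0 \<in> UO" "X = cls A0" using assms(1) by (auto simp: torsion_def carrier_Gamma)
  \<comment> \<open>In odd dimension A and -A have opposite determinants, so one of the two
    representatives has determinant 1.\<close>
  obtain A where A: "A \<in> UO" "X = cls A" "det A = 1"
    using A0 det_UO[OF A0(1)] UO_minus[OF A0(1)] cls_minus[of A0] det_minus3[of A0] that
    by (metis minus_minus)
  have "p \<in> H2" "act X p = p" using assms(2) by (auto simp: isolated_fixed_point_def fixed_points_def)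
  then obtain v where v: "v \<in> negative" "p = cline v" using H2_E by metis
  have AU: "A \<in> U_J" using A(1) by (simp add: UO_def)
  obtain c where c: "cmod c = 1" "A *v v = c *s v"
    using act_fixes_iff[OF v(1) AU] \<open>act X p = p\<close> v(2) A(2) by auto
  have iso: "\<exists>m. u = m *s v" if "A *v u = c *s u" for u
    using isolated_eigenline[OF A(1) v(1) c(2) _ that] assms(2) A(2) v(2) by simp
  have tr2: "trace (A ** A) = (trace A)\<^sup>2 - 2 * cnj (trace A)" by (rule char_poly_unitary(2)[OF AU A(3)])
  have "(A ** A) *v v = (c * c) *s v" by (simp add: c(2) mv_scale flip: matrix_vector_mul_assoc)
  then have "cmod (trace (A ** A)) \<le> 3"
    using elliptic_trace_le[OF U_J_mult[OF AU AU] v(1), of "c * c"] c(1) by (simp add: norm_mult)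
  moreover have "cmod (trace A) \<le> 3" by (rule elliptic_trace_le[OF AU v(1) c(2,1)])
  moreover have "trace A \<in> O7" using UO_D(2)[OF A(1)] by (simp add: trace3 mats_O7_def)
  ultimately have "trace A \<in> {3, - 1, 0, 1, 2, - \<tau>, \<tau> - 1}" unfolding tr2 by (intro trace_filter)
  \<comment> \<open>Trace 3 means the identity, whose fixed points are not isolated.\<close>
  moreover have "trace A \<noteq> 3"
  proof
    assume "trace A = 3"
    then have A1: "A = mat 1" using elliptic_trace_3[OF AU v(1) c(2,1)] by simp
    have "c *s v = 1 *s v" using c(2) by (simp add: A1)
    then have "c = 1" unfolding vector_mul_rcancel using negative_nonzero[OF v(1)] by simp
    then have "\<exists>m. u = m *s v" for u using iso[of u] by (simp add: A1)
    then obtain m1 m2 where "vec3 1 0 0 = m1 *s v" "vec3 0 1 0 = m2 *s v" by metis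
    then show False by (auto simp: veq3)
  qed
  moreover have conj: "conj_cyclic X (cls (rep i))" if "sim A (- rep i)" for i
    using conj_elements_imp_cyclic[OF _ sim_imp_conj[OF A(1) UO_minus[OF UO_rep] that]] A
    by (simp add: cls_rep_minus)
  have conj': "conj_cyclic X (cls (rep i))" if "sim (uinv A) (- rep i)" for i
    using conj_elements_imp_cyclic[OF _ sim_imp_conj[OF UO_uinv[OF A(1)] UO_minus[OF UO_rep] that]] A
      conj_cyclic_inv_left[of X "cls (rep i)"]
    by (simp add: cls_rep_minus UO_uinv cls_inv)
  \<comment> \<open>The powers with exponents 2 and 4 generate the same group as
    \<open>rep E7\<close>, since their product 8 is 1 modulo 7.\<close>
  have seven: "conj_cyclic (cls B) (cls (rep E7))" if "B \<in> UO" "k \<in> {1, 2, 4}" "sim B (mpow (- rep E7) k)" for B k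
  proof -
    let ?Y = "cls (rep E7)"
    have Y: "?Y \<in> carrier \<Gamma>" using UO_rep by simp
    have "cls (mpow (- rep E7) k) = ?Y [^]\<^bsub>\<Gamma>\<^esub> k"
      using cls_pow[OF UO_minus[OF UO_rep], of E7 k] by (simp add: cls_rep_minus)
    then have "conj_cyclic (cls B) (?Y [^]\<^bsub>\<Gamma>\<^esub> k)"
      using conj_elements_imp_cyclic[OF _ sim_imp_conj[OF that(1) mpow_UO[OF UO_minus[OF UO_rep]] that(3)]] that(1) by simp
    moreover have "\<exists>l::nat. (?Y [^]\<^bsub>\<Gamma>\<^esub> k) [^]\<^bsub>\<Gamma>\<^esub> l = ?Y"
    proof -
      have y7: "?Y [^]\<^bsub>\<Gamma>\<^esub> (7::nat) = \<one>\<^bsub>\<Gamma>\<^esub>"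
        using E7_pow_7 cls_pow[OF UO_rep, of E7 7] by (auto simp: cls_one cls_minus)
      have "?Y [^]\<^bsub>\<Gamma>\<^esub> (8::nat) = ?Y [^]\<^bsub>\<Gamma>\<^esub> (7::nat) \<otimes>\<^bsub>\<Gamma>\<^esub> ?Y"
        using Gm.nat_pow_Suc[of ?Y 7] by simp
      then have y8: "?Y [^]\<^bsub>\<Gamma>\<^esub> (8::nat) = ?Y" using y7 Y by simp
      have "(?Y [^]\<^bsub>\<Gamma>\<^esub> (1::nat)) [^]\<^bsub>\<Gamma>\<^esub> (1::nat) = ?Y" "(?Y [^]\<^bsub>\<Gamma>\<^esub> (2::nat)) [^]\<^bsub>\<Gamma>\<^esub> (4::nat) = ?Y"
        "(?Y [^]\<^bsub>\<Gamma>\<^esub> (4::nat)) [^]\<^bsub>\<Gamma>\<^esub> (2::nat) = ?Y"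
        using y8 Y by (simp_all add: Gm.nat_pow_pow)
      with that(2) show ?thesis by (elim insertE emptyE; hypsubst) (rule exI, assumption)+
    qed
    ultimately show ?thesis using conj_cyclic_pow_right[OF Y] by blast
  qed
  ultimately consider "trace A = - 1" | t where "trace A = of_int t" "t \<in> {0, 1, 2}" | "trace A = - \<tau>" | "trace A = \<tau> - 1"
    by (metis (no_types, lifting) empty_iff insert_iff of_int_0 of_int_1 of_int_numeral)
  then show ?thesis
  proof cases
    case 1
    then have "trace (A ** A) = 3" unfolding tr2 by simp
    from classification_order_2[OF A(1) v(1) c(2,1) 1 this iso] show ?thesis using conj by blast
  next
    case 2
    from classification_order_3_4_6[OF A(1,3) v(1) c(2,1) 2] show ?thesis using conj conj' by blast
  next
    case 3
    from classification_order_7[OF A(1,3) 3 v(1) c(2,1)] show ?thesis using seven[OF A(1)] A(2) by blast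
  next
    \<comment> \<open>The trace \<tau> - 1 is the conjugate of -\<tau>, so the inverse falls under
      the previous case.\<close>
    case 4
    have "trace (uinv A) = - \<tau>" by (simp add: trace_uinv 4 cnj_tau)
    moreover have "det (uinv A) = 1"
      using arg_cong[OF uinv_left[OF AU], of det] A(3) by (simp add: det_mul)
    moreover have "uinv A *v v = cnj c *s v" by (rule uinv_fixed[OF AU c(2,1)])
    ultimately obtain k where k: "k \<in> {1, 2, 4}" "sim (uinv A) (mpow (- rep E7) k)"
      using classification_order_7[OF UO_uinv[OF A(1)] _ _ v(1)] c(1) by (metis complex_mod_cnj)
    have "conj_cyclic (inv\<^bsub>\<Gamma>\<^esub> X) (cls (rep E7))" using seven[OF UO_uinv[OF A(1)] k] A by (simp add: cls_inv)
    moreover have "X \<in> carrier \<Gamma>" using A by simp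
    ultimately show ?thesis using conj_cyclic_inv_left by blast
  qed
qed

section \<open>Fixed points, stabilizers and lines\<close>

text \<open>The cross product adapted to \<open>J\<close>; it vanishes only for dependent vectors,
  which the hypotheses exclude.\<close>

lemma exists_complement:
  assumes "u \<noteq> 0" "herm u w = 0" "herm w w \<noteq> 0"
  obtains z where "z \<noteq> 0" "herm z u = 0" "herm z w = 0"
proof -
  define z where "z = vec3 (cnj (u$1) * cnj (w$2) - cnj (u$2) * cnj (w$1))
    (cnj (u$3) * cnj (w$1) - cnj (u$1) * cnj (w$3)) (cnj (u$2) * cnj (w$3) - cnj (u$3) * cnj (w$2))"
  have "herm z u = 0" "herm z w = 0" by (simp_all add: z_def herm_expand algebra_simps)
  moreover have "z \<noteq> 0"
  proof
    assume "z = 0"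
    then have 0: "u$2 * w$3 = u$3 * w$2" "u$3 * w$1 = u$1 * w$3" "u$1 * w$2 = u$2 * w$1"
      by (simp_all add: z_def veq3 flip: complex_cnj_mult)
    have "herm w w *s u = herm u w *s w"
    proof -
      have "(w$3 * a + w$2 * b + w$1 * c) * u$1 - (u$3 * a + u$2 * b + u$1 * c) * w$1
          = a * (u$1 * w$3 - u$3 * w$1) + b * (u$1 * w$2 - u$2 * w$1)"
        "(w$3 * a + w$2 * b + w$1 * c) * u$2 - (u$3 * a + u$2 * b + u$1 * c) * w$2
          = a * (u$2 * w$3 - u$3 * w$2) - c * (u$1 * w$2 - u$2 * w$1)"
        "(w$3 * a + w$2 * b + w$1 * c) * u$3 - (u$3 * a + u$2 * b + u$1 * c) * w$3
          = c * (u$3 * w$1 - u$1 * w$3) - b * (u$2 * w$3 - u$3 * w$2)" for a b c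
        by (simp_all add: algebra_simps)
      then have "(w$3 * a + w$2 * b + w$1 * c) * u$1 = (u$3 * a + u$2 * b + u$1 * c) * w$1"
        "(w$3 * a + w$2 * b + w$1 * c) * u$2 = (u$3 * a + u$2 * b + u$1 * c) * w$2"
        "(w$3 * a + w$2 * b + w$1 * c) * u$3 = (u$3 * a + u$2 * b + u$1 * c) * w$3" for a b c
        unfolding 0 by simp_all
      then show ?thesis by (simp only: veq3 herm_expand vector_smult_component simp_thms)
    qed
    then have "herm w w *s u = 0" by (simp add: assms(2))
    then show False using assms(1,3) by (auto simp: veq3)
  qed
  ultimately show ?thesis using that by blast
qed

lemma orthogonal_expansion:
  assumes "herm u u \<noteq> 0" "herm v v \<noteq> 0" "herm z z \<noteq> 0" "herm u v = 0" "herm z u = 0" "herm z v = 0"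
    "herm x u = 0" "herm x v = 0" "herm x z = 0"
  shows "x = 0"
proof -
  have "- of_real ((cmod (det (cols u v z)))\<^sup>2) \<noteq> (0::complex)"
    unfolding det_cols_gram[symmetric] using assms herm_sym0[OF assms(4)] herm_sym0[OF assms(5)] herm_sym0[OF assms(6)] by simp
  then have "det (cols u v z) \<noteq> 0" by auto
  then obtain p q r where x: "x = p *s u + q *s v + r *s z" using span_cols by metis
  have "p * herm u u = 0" "q * herm v v = 0" "r * herm z z = 0"
    using assms(7-9) herm_sym0[OF assms(4)] herm_sym0[OF assms(5)] herm_sym0[OF assms(6)] assms(4-6) unfolding x by simp_all
  then show ?thesis using assms(1-3) x by simp
qed

section \<open>Polar lines and their polar vectors\<close>

lemma cline_self: "v \<in> cline v"
  unfolding cline_def by (metis rangeI scalar_mult_eq_scaleR vector_smult_lid)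

lemma in_polar_line: "cline w \<in> polar_line u \<longleftrightarrow> cline w \<in> H2 \<and> herm w u = 0"
  unfolding polar_line_def using cline_self[of w] by (auto simp: cline_def)

lemma in_polar_line': "w \<in> negative \<Longrightarrow> cline w \<in> polar_line u \<longleftrightarrow> herm w u = 0"
  by (simp add: in_polar_line H2_def)

lemma polar_line_minus: "polar_line (- u) = polar_line u"
  by (simp add: polar_line_def)

text \<open>The polar line contains a second point besides v: for z orthogonal to u and v and small
  t the vector v + t z is also negative. So u' is orthogonal to v and z, hence a multiple of
  u.\<close>

lemma polar_line_inj:
  assumes v: "v \<in> negative" and u: "herm v u = 0" "herm u u \<noteq> 0" and eq: "polar_line u = polar_line u'"
  shows "\<exists>c. u' = c *s u"
proof -
  have u0: "u \<noteq> 0" using u(2) by auto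
  have vn: "herm v v \<noteq> 0" using v by (auto simp: negative_def)
  have uv: "herm u v = 0" using u(1) by (rule herm_sym0)
  obtain z where z: "z \<noteq> 0" "herm z u = 0" "herm z v = 0" using exists_complement[OF u0 uv vn] .
  have zz: "Re (herm z z) > 0" by (rule perp_negative_pos[OF v z(3,1)])
  have neg: "Re (herm v v) < 0" using v by (simp add: negative_def)
  \<comment> \<open>This t makes the norm of v + t z half of the norm of v, so the vector stays
    negative.\<close>
  define t where "t = sqrt (- Re (herm v v) / Re (herm z z) / 2)"
  have q: "- Re (herm v v) / Re (herm z z) / 2 > 0" using zz neg by (intro divide_pos_pos) auto
  then have "t\<^sup>2 = - Re (herm v v) / Re (herm z z) / 2" unfolding t_def by (intro real_sqrt_pow2) simp
  then have t: "t > 0" "t\<^sup>2 * Re (herm z z) = - Re (herm v v) / 2"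
    using zz q by (simp_all add: t_def del: divide_divide_eq_left)
  define y where "y = v + of_real t *s z"
  have "herm y y = herm v v + of_real (t\<^sup>2) * herm z z"
    by (simp add: y_def z(3) herm_sym0[OF z(3)] power2_eq_square)
  then have "Re (herm y y) = Re (herm v v) / 2" using t(2) by simp
  then have yn: "y \<in> negative" using neg by (simp add: negative_def)
  have "herm y u = 0" by (simp add: y_def u z)
  then have "herm y u' = 0" "herm v u' = 0" using eq in_polar_line'[OF yn] in_polar_line'[OF v] u(1) by metis+
  then have zu: "herm z u' = 0" "herm v u' = 0" using t(1) by (simp_all add: y_def)
  define x where "x = u' - (herm u' u / herm u u) *s u"
  have "x = 0"
  proof (rule orthogonal_expansion[OF u(2) vn _ uv z(2,3)])
    show "herm z z \<noteq> 0" using zz by auto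
    show "herm x u = 0" "herm x v = 0" "herm x z = 0"
      using u(2) uv herm_sym0[OF zu(1)] herm_sym0[OF zu(2)] herm_sym0[OF z(2)] by (simp_all add: x_def)
  qed
  then show ?thesis by (auto simp: x_def)
qed

lemma act_polar_line:
  assumes B: "B \<in> U_J" shows "act (cls B) ` polar_line u = polar_line (B *v u)"
proof -
  have sub: "act (cls B) ` polar_line u \<subseteq> polar_line (B *v u)" if "B \<in> U_J" for B u
  proof
    fix p assume "p \<in> act (cls B) ` polar_line u"
    then obtain q where q: "q \<in> polar_line u" "p = act (cls B) q" by blast
    then obtain w where w: "w \<in> negative" "q = cline w" unfolding polar_line_def using H2_E by blast
    have "herm (B *v w) (B *v u) = 0" using q(1) w in_polar_line'[of w u] U_J_herm[OF that] by simp
    moreover have "B *v w \<in> negative" using w(1) U_J_herm[OF that] by (simp add: negative_def)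
    ultimately show "p \<in> polar_line (B *v u)" using q(2) w in_polar_line'[of "B *v w"] by (simp add: act_cls)
  qed
  moreover have "polar_line (B *v u) \<subseteq> act (cls B) ` polar_line u"
  proof
    fix p assume p: "p \<in> polar_line (B *v u)"
    then obtain w where w: "w \<in> negative" "p = cline w" unfolding polar_line_def using H2_E by blast
    have "act (cls (uinv B)) p \<in> polar_line (uinv B *v (B *v u))" using sub[OF U_J_uinv[OF B], of "B *v u"] p by blast
    then have "act (cls (uinv B)) p \<in> polar_line u" by (simp add: uinv_vec[OF B])
    moreover have "act (cls B) (act (cls (uinv B)) p) = p" using w by (simp add: act_cls uinv_vec[OF B])
    ultimately show "p \<in> act (cls B) ` polar_line u" by (metis imageI)
  qed
  ultimately show ?thesis using sub[OF B] by blast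
qed

lemma j_lines_through_eq:
  assumes v: "v \<in> negative"
  shows "j_lines_through j (cline v) = polar_line ` {u. primitive u \<and> herm u u = of_nat j \<and> herm u v = 0}"
proof -
  have "cline v \<in> polar_line u \<longleftrightarrow> herm u v = 0" for u
    using in_polar_line'[OF v] herm_sym0 by metis
  then show ?thesis unfolding j_lines_through_def j_lines_def by auto
qed

text \<open>The units of \<open>O7\<close> are 1 and -1, so a j-line through the point has exactly
  two primitive polar vectors of norm j, which are negatives of each other; \<open>B\<close> holds
  one of each pair.\<close>

lemma lines_count:
  assumes v: "v \<in> negative" and j: "j > 0" and B: "finite B" "\<And>b. b \<in> B \<Longrightarrow> uni b \<and> herm b b = of_nat j \<and> herm b v = 0"
    "\<And>b. b \<in> B \<Longrightarrow> - b \<notin> B"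
    and all: "\<And>u. primitive u \<Longrightarrow> herm u u = of_nat j \<Longrightarrow> herm u v = 0 \<Longrightarrow> u \<in> B \<or> - u \<in> B"
  shows "j_lines_through j (cline v) = polar_line ` B" "inj_on polar_line B"
    "finite (j_lines_through j (cline v))" "card (j_lines_through j (cline v)) = card B"
proof -
  show eq: "j_lines_through j (cline v) = polar_line ` B"
  proof -
    have "polar_line ` {u. primitive u \<and> herm u u = of_nat j \<and> herm u v = 0} = polar_line ` B"
    proof (intro subset_antisym subsetI; elim imageE)
      fix L u assume "L = polar_line u" "u \<in> {u. primitive u \<and> herm u u = of_nat j \<and> herm u v = 0}"
      then show "L \<in> polar_line ` B" using all[of u] polar_line_minus[of u] by auto
    next
      fix L b assume "L = polar_line b" "b \<in> B"
      then show "L \<in> polar_line ` {u. primitive u \<and> herm u u = of_nat j \<and> herm u v = 0}"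
        using B(2) uni_imp_primitive by auto
    qed
    then show ?thesis using j_lines_through_eq[OF v] by simp
  qed
  show inj: "inj_on polar_line B"
  proof (rule inj_onI)
    fix b b' assume b: "b \<in> B" "b' \<in> B" "polar_line b = polar_line b'"
    have "herm b b \<noteq> 0" using B(2)[OF b(1)] j by simp
    then obtain c where c: "b' = c *s b"
      using polar_line_inj[OF v _ _ b(3)] B(2)[OF b(1)] herm_sym0 by blast
    then have cO: "c \<in> O7" using uni_scale_O7 B(2) b uni_O7v by metis
    have "(c * cnj c) * herm b b = 1 * herm b b" using B(2)[OF b(1)] B(2)[OF b(2)] unfolding c by (simp add: mult_ac)
    then have "c * cnj c = 1" using \<open>herm b b \<noteq> 0\<close> unfolding mult_cancel_right by blast
    then have "c = 1 \<or> c = - 1" using O7_unit_mult[OF cO O7_cnj[OF cO]] by simp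
    then show "b = b'" using B(3)[OF b(1)] b(2) by (auto simp: c)
  qed
  show "finite (j_lines_through j (cline v))" "card (j_lines_through j (cline v)) = card B"
    using B(1) inj eq by (simp_all add: card_image)
qed

text \<open>Two negative vectors are never orthogonal, so any other negative eigenvector has the
  same eigenvalue c as v and lies in its eigenspace, which is a line.\<close>

lemma fixed_point_unique:
  assumes A: "A \<in> UO" and v: "v \<in> negative" "A *v v = c *s v" "cmod c = 1"
    and u: "\<And>x. A *v x = c *s x \<Longrightarrow> \<exists>m. x = m *s v"
  shows "fixed_points (cls A) = {cline v}" "isolated_fixed_point (cls A) (cline v)"
proof -
  have AU: "A \<in> U_J" using A by (simp add: UO_def)
  have vH: "cline v \<in> H2" using v(1) by (simp add: H2_def)
  show fp: "fixed_points (cls A) = {cline v}"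
  proof (intro subset_antisym subsetI)
    fix p assume "p \<in> fixed_points (cls A)"
    then have p: "p \<in> H2" "act (cls A) p = p" by (auto simp: fixed_points_def)
    then obtain w where w: "w \<in> negative" "p = cline w" using H2_E by metis
    obtain d where d: "cmod d = 1" "A *v w = d *s w" using act_fixes_iff[OF w(1) AU] p(2) w(2) by auto
    have "d * cnj c * herm w v = herm w v" using U_J_herm[OF AU, of w v] by (simp add: d v(2) mult_ac)
    then have "d * cnj c = 1" using negative_not_perp[OF w(1) v(1)] by simp
    then have "d * (cnj c * c) = c" by (simp flip: mult.assoc)
    then have "d = c" using unit_sq[OF v(3)] by (simp add: mult.commute)
    then obtain m where m: "w = m *s v" using u[of w] d(2) by blast
    then have "m \<noteq> 0" using negative_nonzero[OF w(1)] by auto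
    then show "p \<in> {cline v}" using m w(2) by (simp add: cline_scale)
  next
    fix p assume "p \<in> {cline v}"
    moreover have "c \<noteq> 0" using v(3) by auto
    ultimately show "p \<in> fixed_points (cls A)" using vH v(2) by (simp add: fixed_points_def act_cls cline_scale)
  qed
  have "cline v \<notin> H2_top derived_set_of fixed_points (cls A)"
  proof
    assume "cline v \<in> H2_top derived_set_of fixed_points (cls A)"
    then have *: "cline v \<in> topspace H2_top" "\<And>T. cline v \<in> T \<Longrightarrow> openin H2_top T \<Longrightarrow> \<exists>y. y \<noteq> cline v \<and> y \<in> {cline v} \<and> y \<in> T"
      unfolding in_derived_set_of fp by auto
    from *(2)[OF *(1) openin_topspace] show False by blast
  qed
  then show "isolated_fixed_point (cls A) (cline v)" unfolding isolated_fixed_point_def fp by simp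
qed

text \<open>The eigenvalue on a unimodular v is a unit of \<open>O7\<close>, so exactly one of the
  two lifts of a stabilizer element fixes v itself.\<close>

lemma stabilizer_eq:
  assumes v: "v \<in> negative" "uni v"
  shows "stabilizer (cline v) = cls ` {B \<in> UO. B *v v = v}" "inj_on cls {B \<in> UO. B *v v = v}"
proof -
  have v0: "v \<noteq> 0" using v(1) by (rule negative_nonzero)
  show "stabilizer (cline v) = cls ` {B \<in> UO. B *v v = v}"
  proof (intro subset_antisym subsetI)
    fix X assume "X \<in> stabilizer (cline v)"
    then obtain B where B: "B \<in> UO" "X = cls B" "act (cls B) (cline v) = cline v"
      by (auto simp: stabilizer_def carrier_Gamma)
    then obtain c where c: "cmod c = 1" "B *v v = c *s v"
      using act_fixes_iff[OF v(1)] by (auto simp: UO_def)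
    have "c \<in> O7" using uni_scale_O7[OF v(2)] c(2) O7v_A[OF B(1) uni_O7v[OF v(2)]] by simp
    then have "c = 1 \<or> c = - 1" using O7_unit c(1) by blast
    then show "X \<in> cls ` {B \<in> UO. B *v v = v}"
    proof
      assume "c = 1"
      then show ?thesis using B c by auto
    next
      assume "c = - 1"
      then have "- B \<in> {B \<in> UO. B *v v = v}" "X = cls (- B)" using B c by (simp_all add: UO_minus cls_minus)
      then show ?thesis by blast
    qed
  next
    fix X assume "X \<in> cls ` {B \<in> UO. B *v v = v}"
    then show "X \<in> stabilizer (cline v)" by (auto simp: stabilizer_def act_cls)
  qed
  show "inj_on cls {B \<in> UO. B *v v = v}"
  proof (rule inj_onI)
    fix B C assume B: "B \<in> {B \<in> UO. B *v v = v}" and C: "C \<in> {B \<in> UO. B *v v = v}" and "cls B = cls C"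
    then have "B = C \<or> B = - C" by (simp add: cls_eq_iff)
    moreover have "B \<noteq> - C"
    proof
      assume "B = - C"
      then have "v = - v" using B C by simp
      then show False using v0 by (simp add: veq3)
    qed
    ultimately show "B = C" by blast
  qed
qed

lemma primitive_O7v: "primitive u \<Longrightarrow> u \<in> O7v"
  by (simp add: primitive_def O7v_def)

text \<open>The stabilizer of a negative primitive vector \<open>v\<close>, in terms of a basis \<open>b, y\<close> of its
  complement and the glue relation \<open>n x = p b + q y - v\<close>.\<close>

locale negative_vector =
  fixes v x b y :: "complex^3" and n p q :: complex
  assumes O: "v \<in> O7v" "x \<in> O7v" "b \<in> O7v" "y \<in> O7v"
    and vv: "herm v v = - n" and n: "Re n > 0" and xv: "herm x v = 1" and bv: "herm b v = 0" and yv: "herm y v = 0"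
    and det: "cmod (det (cols x b y)) = 1" and glue: "n *s x = p *s b + q *s y - v"
begin

lemma neg: "v \<in> negative" using vv n by (simp add: negative_def)

lemma uni_v: "uni v" using O xv by (auto simp: uni_def)

lemma n0: "n \<noteq> 0" using n by auto

lemma v_eq: "v = p *s b + q *s y - n *s x" using glue by simp

text \<open>The pairs (p1, q1) and (p2, q2) give the images of b and y. Elements k and l exist
  exactly when the isometry of the complement fixes the class of p b + q y modulo n, which is the
  condition for extending it to x.\<close>

definition coords :: "(complex \<times> complex \<times> complex \<times> complex) set" where
  "coords = {(p1, q1, p2, q2). p1 \<in> O7 \<and> q1 \<in> O7 \<and> p2 \<in> O7 \<and> q2 \<in> O7 \<and>
     herm (p1 *s b + q1 *s y) (p1 *s b + q1 *s y) = herm b b \<and>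
     herm (p2 *s b + q2 *s y) (p2 *s b + q2 *s y) = herm y y \<and>
     herm (p1 *s b + q1 *s y) (p2 *s b + q2 *s y) = herm b y \<and>
     (\<exists>k\<in>O7. \<exists>l\<in>O7. p * p1 + q * p2 = p + n * k \<and> p * q1 + q * q2 = q + n * l)}"

definition S :: "(complex^3^3) set" where "S = {B \<in> UO. B *v v = v}"

lemma span: "z \<in> O7v \<Longrightarrow> herm z v = 0 \<Longrightarrow> \<exists>r\<in>O7. \<exists>s\<in>O7. z = r *s b + s *s y"
  using span_complement[OF O(2-4) xv bv yv det] by metis

lemma coords_unique: "r *s b + s *s y = r' *s b + s' *s y \<Longrightarrow> r = r' \<and> s = s'"
proof -
  assume e: "r *s b + s *s y = r' *s b + s' *s y"
  have "det (cols x (r *s b + s *s y) y) = r * det (cols x b y)" "det (cols x b (r *s b + s *s y)) = s * det (cols x b y)"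
    for r s by (simp_all add: det_3 algebra_simps)
  then have "r * det (cols x b y) = r' * det (cols x b y)" "s * det (cols x b y) = s' * det (cols x b y)" using e by metis+
  moreover have "det (cols x b y) \<noteq> 0" using det by auto
  ultimately show ?thesis by simp
qed

lemma S_to_coords:
  assumes B: "B \<in> S"
  shows "\<exists>p1 q1 p2 q2. (p1, q1, p2, q2) \<in> coords \<and> B *v b = p1 *s b + q1 *s y \<and> B *v y = p2 *s b + q2 *s y"
proof -
  have BU: "B \<in> UO" "B *v v = v" "B \<in> U_J" using B by (auto simp: S_def UO_def)
  note h = U_J_herm[OF BU(3)]
  have "herm (B *v z) v = herm z v" for z using h[of z v] BU(2) by simp
  then obtain p1 q1 p2 q2 where c: "p1 \<in> O7" "q1 \<in> O7" "B *v b = p1 *s b + q1 *s y"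
    "p2 \<in> O7" "q2 \<in> O7" "B *v y = p2 *s b + q2 *s y"
    using span[OF O7v_A[OF BU(1) O(3)]] span[OF O7v_A[OF BU(1) O(4)]] bv yv by metis
  have "B *v x - x \<in> O7v" "herm (B *v x - x) v = 0"
    using O7v_A[OF BU(1) O(2)] O \<open>\<And>z. herm (B *v z) v = herm z v\<close> by simp_all
  then obtain k l where kl: "k \<in> O7" "l \<in> O7" "B *v x - x = k *s b + l *s y" using span by metis
  have "n *s (B *v x) = p *s (B *v b) + q *s (B *v y) - v"
    using arg_cong[OF glue, of "\<lambda>z. B *v z"] by (simp add: mv_scale matrix_vector_mult_diff_distrib matrix_vector_right_distrib BU(2))
  then have "n *s (B *v x - x) = (p * p1 + q * p2 - p) *s b + (p * q1 + q * q2 - q) *s y"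
    unfolding vector_ssub_ldistrib glue c(3,6) by (simp add: veq3 algebra_simps)
  moreover have "n *s (B *v x - x) = (n * k) *s b + (n * l) *s y" unfolding kl(3) by (simp add: veq3 algebra_simps)
  ultimately have "p * p1 + q * p2 - p = n * k" "p * q1 + q * q2 - q = n * l" using coords_unique by metis+
  then have "p * p1 + q * p2 = p + n * k" "p * q1 + q * q2 = q + n * l" by (simp_all add: diff_eq_eq add.commute)
  then have "(p1, q1, p2, q2) \<in> coords"
    unfolding coords_def using c kl(1,2) h[of b b] h[of y y] h[of b y] by (simp only: c(3,6) mem_Collect_eq prod.case) blast
  then show ?thesis using c by blast
qed

lemma coords_to_S:
  assumes "(p1, q1, p2, q2) \<in> coords"
  shows "\<exists>B\<in>S. B *v b = p1 *s b + q1 *s y \<and> B *v y = p2 *s b + q2 *s y"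
proof -
  define c1 c2 where "c1 = p1 *s b + q1 *s y" and "c2 = p2 *s b + q2 *s y"
  obtain k l where c: "p1 \<in> O7" "q1 \<in> O7" "p2 \<in> O7" "q2 \<in> O7" "herm c1 c1 = herm b b" "herm c2 c2 = herm y y" "herm c1 c2 = herm b y"
    and kl: "k \<in> O7" "l \<in> O7" "p * p1 + q * p2 = p + n * k" "p * q1 + q * q2 = q + n * l"
    using assms unfolding coords_def c1_def c2_def by blast
  \<comment> \<open>The glue relation forces the image of x, and k and l make it integral.\<close>
  define u where "u = x + k *s b + l *s y"
  have nu: "n *s u = p *s c1 + q *s c2 - v"
  proof -
    have "n *s u = p *s b + q *s y - v + (n * k) *s b + (n * l) *s y"
      unfolding u_def vector_add_ldistrib glue by (simp add: algebra_simps)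
    also have "\<dots> = (p + n * k) *s b + (q + n * l) *s y - v" by (simp add: veq3 algebra_simps)
    also have "\<dots> = p *s c1 + q *s c2 - v" unfolding kl(3,4)[symmetric] c1_def c2_def by (simp add: veq3 algebra_simps)
    finally show ?thesis .
  qed
  have c21: "herm c2 c1 = herm y b" using c(7) by (metis herm_cnj)
  have cv: "herm c1 v = 0" "herm c2 v = 0" by (simp_all add: c1_def c2_def bv yv)
  note vc = herm_sym0[OF cv(1)] herm_sym0[OF cv(2)] herm_sym0[OF bv] herm_sym0[OF yv]
  have g: "n * herm u c1 = n * herm x b" "n * herm u c2 = n * herm x y"
    using arg_cong[OF nu, of "\<lambda>z. herm z c1"] arg_cong[OF glue, of "\<lambda>z. herm z b"]
      arg_cong[OF nu, of "\<lambda>z. herm z c2"] arg_cong[OF glue, of "\<lambda>z. herm z y"]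
    by (simp_all add: vc c c21)
  then have uc: "herm x b = herm u c1" "herm x y = herm u c2" using n0 by simp_all
  then have cu: "herm b x = herm c1 u" "herm y x = herm c2 u" by (metis herm_cnj)+
  have uv: "herm u v = 1" by (simp add: u_def xv bv yv)
  then have vu: "herm v u = 1" "herm v x = 1" using xv by (metis herm_cnj complex_cnj_one)+
  have "n * herm u u = n * herm x x"
    using arg_cong[OF nu, of "\<lambda>z. herm z u"] arg_cong[OF glue, of "\<lambda>z. herm z x"] by (simp add: vu cu)
  then have uu: "herm x x = herm u u" using n0 by simp
  have uO: "u \<in> O7v" "c1 \<in> O7v" "c2 \<in> O7v" using O c kl by (simp_all add: u_def c1_def c2_def)
  obtain H where H: "H \<in> UO" "H *v x = u" "H *v b = c1" "H *v y = c2"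
    by (rule conjugating_isometry_basis[OF O(2-4) uO det uu uc c(5,7,6)[symmetric], of "mat 1" 1 0 0 "mat 1" 0 1 0 0 0 1]) simp_all
  have "H *v v = v"
    by (subst v_eq) (simp add: matrix_vector_mult_diff_distrib matrix_vector_right_distrib mv_scale H nu)
  then have "H \<in> S" using H(1) by (simp add: S_def)
  then show ?thesis using H(3,4) by (auto simp: c1_def c2_def)
qed

lemma S_eqI: "B \<in> S \<Longrightarrow> C \<in> S \<Longrightarrow> B *v b = C *v b \<Longrightarrow> B *v y = C *v y \<Longrightarrow> B = C"
proof -
  assume B: "B \<in> S" and C: "C \<in> S" and e: "B *v b = C *v b" "B *v y = C *v y"
  have "n *s (D *v x) = p *s (D *v b) + q *s (D *v y) - v" if "D \<in> S" for D
    using arg_cong[OF glue, of "\<lambda>z. D *v z"] that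
    by (simp add: S_def mv_scale matrix_vector_mult_diff_distrib matrix_vector_right_distrib)
  from this[OF B] this[OF C] have "n *s (B *v x) = n *s (C *v x)" using e by simp
  then have ex: "B *v x = C *v x" using n0 unfolding vector_mul_lcancel by blast
  have "B *v z = C *v z" for z
  proof -
    have "det (cols x b y) \<noteq> 0" using det by auto
    then obtain r s t where "z = r *s x + s *s b + t *s y" using span_cols by metis
    then show ?thesis using ex e by (simp add: matrix_vector_right_distrib mv_scale)
  qed
  then show ?thesis by (metis matrix_eq)
qed

lemma stabilizer_card:
  assumes "coords = C" "finite C"
  shows "finite (stabilizer (cline v))" "card (stabilizer (cline v)) = card C"
proof -
  define f where "f = (\<lambda>(p1, q1, p2, q2). THE B. B \<in> S \<and> B *v b = p1 *s b + q1 *s y \<and> B *v y = p2 *s b + q2 *s y)"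
  have f: "f (p1, q1, p2, q2) \<in> S \<and> f (p1, q1, p2, q2) *v b = p1 *s b + q1 *s y \<and> f (p1, q1, p2, q2) *v y = p2 *s b + q2 *s y"
    if c: "(p1, q1, p2, q2) \<in> coords" for p1 q1 p2 q2
  proof -
    obtain B where B: "B \<in> S \<and> B *v b = p1 *s b + q1 *s y \<and> B *v y = p2 *s b + q2 *s y" using coords_to_S[OF c] by blast
    show ?thesis unfolding f_def prod.case
      by (rule theI[where P = "\<lambda>B. B \<in> S \<and> B *v b = p1 *s b + q1 *s y \<and> B *v y = p2 *s b + q2 *s y" and a = B])
        (rule B, rule S_eqI, simp_all add: B)
  qed
  have "bij_betw f coords S"
  proof (rule bij_betwI')
    fix c c' assume c: "c \<in> coords" "c' \<in> coords"
    obtain p1 q1 p2 q2 p1' q1' p2' q2' where e: "c = (p1, q1, p2, q2)" "c' = (p1', q1', p2', q2')" by (metis prod_cases4)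
    show "f c = f c' \<longleftrightarrow> c = c'"
    proof
      assume "f c = f c'"
      then have "p1 *s b + q1 *s y = p1' *s b + q1' *s y" "p2 *s b + q2 *s y = p2' *s b + q2' *s y"
        using f[of p1 q1 p2 q2] f[of p1' q1' p2' q2'] c unfolding e by simp_all
      then show "c = c'" using coords_unique[of p1 q1 p1' q1'] coords_unique[of p2 q2 p2' q2'] unfolding e by simp
    qed simp
  next
    fix c assume "c \<in> coords"
    then show "f c \<in> S" using f by (cases c) simp
  next
    fix B assume B: "B \<in> S"
    then obtain p1 q1 p2 q2 where c: "(p1, q1, p2, q2) \<in> coords" "B *v b = p1 *s b + q1 *s y" "B *v y = p2 *s b + q2 *s y"
      using S_to_coords by blast
    have "B = f (p1, q1, p2, q2)" using f[OF c(1)] by (intro S_eqI[OF B]) (simp_all add: c(2,3))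
    then show "\<exists>c\<in>coords. B = f c" using c(1) by (rule bexI)
  qed
  then have S: "finite S" "card S = card C"
    using bij_betw_finite[of f coords S] bij_betw_same_card[of f coords S] assms by simp_all
  have st: "stabilizer (cline v) = cls ` S" "inj_on cls S" using stabilizer_eq[OF neg uni_v] by (simp_all only: S_def)
  show "finite (stabilizer (cline v))" unfolding st(1) using S(1) by (rule finite_imageI)
  show "card (stabilizer (cline v)) = card C" unfolding st(1) card_image[OF st(2)] by (rule S(2))
qed

lemma uni_comb: "r \<in> O7 \<Longrightarrow> s \<in> O7 \<Longrightarrow> r' \<in> O7 \<Longrightarrow> s' \<in> O7 \<Longrightarrow> r * s' - s * r' = 1 \<Longrightarrow> uni (r *s b + s *s y)"
proof (rule cols_uni)
  assume r: "r \<in> O7" "s \<in> O7" "r' \<in> O7" "s' \<in> O7" "r * s' - s * r' = 1"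
  show "cols (r *s b + s *s y) (r' *s b + s' *s y) x \<in> mats_O7" using O r by (simp add: cols_mats_O7)
  have "det (cols (r *s b + s *s y) (r' *s b + s' *s y) x) = (r * s' - s * r') * det (cols x b y)"
    by (simp add: det_3 algebra_simps)
  then show "cmod (det (cols (r *s b + s *s y) (r' *s b + s' *s y) x)) = 1" using det r(5) by simp
qed

lemma primitive_comb: "primitive (c *s w) \<Longrightarrow> w \<in> O7v \<Longrightarrow> c \<in> O7 \<Longrightarrow> c = 1 \<or> c = - 1"
proof -
  assume p: "primitive (c *s w)" and w: "w \<in> O7v" and c: "c \<in> O7"
  have "\<forall>i. \<exists>d\<in>O7. (c *s w) $ i = c * d" using O7v_nth[OF w] by auto
  then obtain d where "d \<in> O7" "c * d = 1" using p c unfolding primitive_def by blast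
  then show ?thesis using O7_unit_mult c by blast
qed

text \<open>The pair (r', s') completes (r, s) to a matrix of determinant 1, which makes r b + s y
  unimodular.\<close>

lemma lines_from_coords:
  assumes j: "j > 0" and C: "finite C" "\<And>r s. (r, s) \<in> C \<Longrightarrow> r \<in> O7 \<and> s \<in> O7 \<and> (\<exists>r'\<in>O7. \<exists>s'\<in>O7. r * s' - s * r' = 1) \<and>
      herm (r *s b + s *s y) (r *s b + s *s y) = of_nat j \<and> (- r, - s) \<notin> C"
    and all: "\<And>r s. r \<in> O7 \<Longrightarrow> s \<in> O7 \<Longrightarrow> primitive (r *s b + s *s y) \<Longrightarrow>
      herm (r *s b + s *s y) (r *s b + s *s y) = of_nat j \<Longrightarrow> (r, s) \<in> C \<or> (- r, - s) \<in> C"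
  defines "B \<equiv> (\<lambda>(r, s). r *s b + s *s y) ` C"
  shows "j_lines_through j (cline v) = polar_line ` B" "inj_on polar_line B"
    "finite (j_lines_through j (cline v))" "card (j_lines_through j (cline v)) = card C"
proof -
  have mi: "- (r *s b + s *s y) = (- r) *s b + (- s) *s y" for r s by (simp add: veq3)
  have inj: "inj_on (\<lambda>(r, s). r *s b + s *s y) C"
    by (rule inj_onI) (simp add: split_paired_all, metis coords_unique)
  have 1: "finite B" using C(1) by (simp add: B_def)
  have 2: "uni u \<and> herm u u = of_nat j \<and> herm u v = 0" if uB: "u \<in> B" for u
  proof -
    obtain r s where r: "(r, s) \<in> C" "u = r *s b + s *s y" using uB unfolding B_def by auto
    have "herm u v = 0" unfolding r(2) by (simp add: bv yv)
    moreover obtain r' s' where s: "r' \<in> O7" "s' \<in> O7" "r * s' - s * r' = 1" using C(2)[OF r(1)] by blast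
    then have "uni u" unfolding r(2) using C(2)[OF r(1)] by (intro uni_comb) simp_all
    moreover have "herm u u = of_nat j" using C(2)[OF r(1)] unfolding r(2) by (elim conjE)
    ultimately show ?thesis by (intro conjI)
  qed
  have 3: "- u \<notin> B" if uB: "u \<in> B" for u
  proof
    assume "- u \<in> B"
    then obtain r' s' where r': "(r', s') \<in> C" "- u = r' *s b + s' *s y" unfolding B_def by auto
    obtain r s where r: "(r, s) \<in> C" "u = r *s b + s *s y" using uB unfolding B_def by auto
    have "r' = - r \<and> s' = - s" using coords_unique[of r' s' "- r" "- s"] r'(2) unfolding r(2) mi by simp
    then show False using C(2)[OF r(1)] r'(1) by simp
  qed
  have 4: "u \<in> B \<or> - u \<in> B" if u: "primitive u" "herm u u = of_nat j" "herm u v = 0" for u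
  proof -
    obtain r s where r: "r \<in> O7" "s \<in> O7" "u = r *s b + s *s y" using span[OF primitive_O7v[OF u(1)] u(3)] by blast
    have "(r, s) \<in> C \<or> (- r, - s) \<in> C" using all[OF r(1,2)] u(1,2) unfolding r(3) by blast
    moreover have "(\<lambda>(r, s). r *s b + s *s y) (r, s) = u" "(\<lambda>(r, s). r *s b + s *s y) (- r, - s) = - u"
      unfolding r(3) prod.case mi by simp_all
    ultimately show ?thesis unfolding B_def using imageI[of "(r, s)" C "\<lambda>(r, s). r *s b + s *s y"]
        imageI[of "(- r, - s)" C "\<lambda>(r, s). r *s b + s *s y"] by (elim disjE) simp_all
  qed
  have "card B = card C" unfolding B_def by (rule card_image[OF inj])
  then show "card (j_lines_through j (cline v)) = card C" by (subst lines_count(4)[OF neg j 1 2 3 4])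
  show "j_lines_through j (cline v) = polar_line ` B" by (rule lines_count(1)[OF neg j 1 2 3 4])
  show "inj_on polar_line B" by (rule lines_count(2)[OF neg j 1 2 3 4])
  show "finite (j_lines_through j (cline v))" by (rule lines_count(3)[OF neg j 1 2 3 4])
qed

end

lemma O7_norm_cases:
  assumes "a \<in> O7"
  obtains m :: int where "a * cnj a = of_int m" "m \<ge> 0" "m = 0 \<Longrightarrow> a = 0" "m = 1 \<Longrightarrow> a = 1 \<or> a = - 1"
    "m = 2 \<Longrightarrow> a \<in> {\<tau>, -\<tau>, 1 - \<tau>, \<tau> - 1}"
proof -
  obtain m :: int where m: "(cmod a)\<^sup>2 = of_int m" using O7_norm_int assms by blast
  have "a * cnj a = of_real (of_int m)" unfolding m[symmetric] by (rule complex_norm_square[symmetric])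
  moreover have "m \<ge> 0" using m by (metis of_int_0_le_iff zero_le_power2)
  moreover have "m = 0 \<Longrightarrow> a = 0" using m by simp
  ultimately show ?thesis using that[of m] m O7_norm_1[OF assms] O7_norm_2[OF assms] by simp
qed

section \<open>Orders of the representatives\<close>

lemma ord_cls:
  assumes A: "A \<in> UO" and r: "r > 0" "mpow A r = mat 1 \<or> mpow A r = - mat 1"
    and d: "\<And>d. 0 < d \<Longrightarrow> d < r \<Longrightarrow> d dvd r \<Longrightarrow> \<exists>x. mpow A d *v x \<noteq> x \<and> mpow A d *v x \<noteq> - x"
  shows "group.ord \<Gamma> (cls A) = r"
proof -
  have pow: "cls A [^]\<^bsub>\<Gamma>\<^esub> n = \<one>\<^bsub>\<Gamma>\<^esub> \<longleftrightarrow> mpow A n = mat 1 \<or> mpow A n = - mat 1" for n :: nat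
    by (simp add: cls_pow[OF A] cls_one cls_eq_iff)
  have C: "cls A \<in> carrier \<Gamma>" using A by simp
  have dv: "Gm.ord (cls A) dvd n \<longleftrightarrow> mpow A n = mat 1 \<or> mpow A n = - mat 1" for n
    using Gm.pow_eq_id[OF C] pow by simp
  have 1: "Gm.ord (cls A) dvd r" using dv r(2) by simp
  have pos: "0 < Gm.ord (cls A)" using 1 r(1) by (rule dvd_pos_nat[rotated])
  have le: "Gm.ord (cls A) \<le> r" using 1 r(1) by (rule dvd_imp_le)
  have "mpow A (Gm.ord (cls A)) = mat 1 \<or> mpow A (Gm.ord (cls A)) = - mat 1" by (rule dv[THEN iffD1]) simp
  then have "mpow A (Gm.ord (cls A)) *v x = x \<or> mpow A (Gm.ord (cls A)) *v x = - x" for x by (elim disjE) simp_all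
  then have "\<not> Gm.ord (cls A) < r" using d[OF pos _ 1] by blast
  then show ?thesis using le by simp
qed

lemma divisor_cases:
  "0 < d \<Longrightarrow> d < 2 \<Longrightarrow> d dvd 2 \<Longrightarrow> d = (1::nat)"
  "0 < d \<Longrightarrow> d < 3 \<Longrightarrow> d dvd 3 \<Longrightarrow> d = (1::nat)"
  "0 < d \<Longrightarrow> d < 4 \<Longrightarrow> d dvd 4 \<Longrightarrow> d = (1::nat) \<or> d = 2"
  "0 < d \<Longrightarrow> d < 6 \<Longrightarrow> d dvd 6 \<Longrightarrow> d = (1::nat) \<or> d = 2 \<or> d = 3"
  "0 < d \<Longrightarrow> d < 7 \<Longrightarrow> d dvd 7 \<Longrightarrow> d = (1::nat)"
proof -
  show "d = 1" if "0 < d" "d < 2" "d dvd 2" using that by simp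
  show "d = 1" if d: "0 < d" "d < 3" "d dvd 3"
  proof -
    have "d = 1 \<or> d = 2" using d(1,2) by presburger
    then show ?thesis using d(3) by (elim disjE; simp)
  qed
  show "d = 1 \<or> d = 2" if d: "0 < d" "d < 4" "d dvd 4"
  proof -
    have "d = 1 \<or> d = 2 \<or> d = 3" using d(1,2) by presburger
    then show ?thesis using d(3) by (elim disjE; simp)
  qed
  show "d = 1 \<or> d = 2 \<or> d = 3" if d: "0 < d" "d < 6" "d dvd 6"
  proof -
    have "d = 1 \<or> d = 2 \<or> d = 3 \<or> d = 4 \<or> d = 5" using d(1,2) by presburger
    then show ?thesis using d(3) by (elim disjE; simp)
  qed
  show "d = 1" if d: "0 < d" "d < 7" "d dvd 7"
  proof -
    have "d = 1 \<or> d = 2 \<or> d = 3 \<or> d = 4 \<or> d = 5 \<or> d = 6" using d(1,2) by presburger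
    then show ?thesis using d(3) by (elim disjE; simp)
  qed
qed

lemma E6_sq: "rep E6 *v (rep E6 *v vec3 x y z) = vec3 (4 * x - 3 * i_sqrt7 * z) y (- i_sqrt7 * x - 5 * z)"
  by (simp add: vec3_simps) (simp add: tau_simps algebra_simps)

lemma E6_cube: "rep E6 *v (rep E6 *v (rep E6 *v vec3 x y z)) = vec3 x (- y) z"
  unfolding E6_sq by (simp add: vec3_simps) (simp add: tau_simps algebra_simps)

lemma E6_pow_vec:
  "mpow (rep E6) 0 *v vec3 x y z = vec3 x y z"
  "mpow (rep E6) 1 *v vec3 x y z = vec3 (- 5 * x + 3 * i_sqrt7 * z) (- y) (i_sqrt7 * x + 4 * z)"
  "mpow (rep E6) 2 *v vec3 x y z = vec3 (4 * x - 3 * i_sqrt7 * z) y (- i_sqrt7 * x - 5 * z)"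
  "mpow (rep E6) 3 *v vec3 x y z = vec3 x (- y) z"
  "mpow (rep E6) 4 *v vec3 x y z = vec3 (- 5 * x + 3 * i_sqrt7 * z) y (i_sqrt7 * x + 4 * z)"
  "mpow (rep E6) 5 *v vec3 x y z = vec3 (4 * x - 3 * i_sqrt7 * z) (- y) (- i_sqrt7 * x - 5 * z)"
  "mpow (rep E6) 6 *v vec3 x y z = vec3 x y z"
proof -
  have S: "1 = Suc 0" "2 = Suc (Suc 0)" "3 = Suc 2" "4 = Suc 3" "5 = Suc 4" "6 = Suc 5" by simp_all
  have m: "mpow A (Suc n) *v w = A *v (mpow A n *v w)" for A :: "complex^3^3" and n w
    by (induction n arbitrary: w) (simp_all only: mpow_Suc_vec mpow.simps(1) matrix_vector_mul_lid)
  show 0: "mpow (rep E6) 0 *v vec3 x y z = vec3 x y z" by simp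
  show 1: "mpow (rep E6) 1 *v vec3 x y z = vec3 (- 5 * x + 3 * i_sqrt7 * z) (- y) (i_sqrt7 * x + 4 * z)"
    unfolding S(1) m 0 rep_vec3 ..
  show 2: "mpow (rep E6) 2 *v vec3 x y z = vec3 (4 * x - 3 * i_sqrt7 * z) y (- i_sqrt7 * x - 5 * z)"
    unfolding S(2) m 0 E6_sq ..
  show 3: "mpow (rep E6) 3 *v vec3 x y z = vec3 x (- y) z"
    unfolding S(3) m unfolding S(2) m 0 E6_cube ..
  show 4: "mpow (rep E6) 4 *v vec3 x y z = vec3 (- 5 * x + 3 * i_sqrt7 * z) y (i_sqrt7 * x + 4 * z)"
    unfolding S(4) m 3 rep_vec3 by simp
  show 5: "mpow (rep E6) 5 *v vec3 x y z = vec3 (4 * x - 3 * i_sqrt7 * z) (- y) (- i_sqrt7 * x - 5 * z)"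
    unfolding S(5) m unfolding S(4) m 3 E6_sq ..
  show "mpow (rep E6) 6 *v vec3 x y z = vec3 x y z"
    unfolding S(6) m unfolding S(5) m unfolding S(4) m 3 E6_cube by simp
qed

lemma rep_pow:
  "mpow (rep E2a) 2 = mat 1" "mpow (rep E2b) 2 = mat 1" "mpow (rep E2c) 2 = mat 1"
  "mpow (rep E3a) 3 = - mat 1" "mpow (rep E3b) 3 = - mat 1" "mpow (rep E3c) 3 = - mat 1"
  "mpow (rep E4a) 4 = mat 1" "mpow (rep E4b) 4 = mat 1" "mpow (rep E6) 6 = mat 1"
proof -
  show "mpow (rep E6) 6 = mat 1" by (rule mat_eq_vec3I) (simp only: E6_pow_vec matrix_vector_mul_lid)
qed (rule mat_eq_vec3I;
    (simp add: numeral_eq_Suc mpow_Suc_vec vec3_simps del: mpow.simps(2))?; (simp add: tau_simps algebra_simps)?)+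

lemma i_sqrt7_nonzero: "i_sqrt7 \<noteq> 0"
  using i_sqrt7_sq by auto

lemma mpow_3_vec: "mpow A 3 *v x = A *v (A *v (A *v x))"
  by (simp add: numeral_eq_Suc mpow_Suc_vec del: mpow.simps(2))

lemma ord_rep:
  "group.ord \<Gamma> (cls (rep E2a)) = 2" "group.ord \<Gamma> (cls (rep E2b)) = 2" "group.ord \<Gamma> (cls (rep E2c)) = 2"
  "group.ord \<Gamma> (cls (rep E3a)) = 3" "group.ord \<Gamma> (cls (rep E3b)) = 3" "group.ord \<Gamma> (cls (rep E3c)) = 3"
  "group.ord \<Gamma> (cls (rep E4a)) = 4" "group.ord \<Gamma> (cls (rep E4b)) = 4"
  "group.ord \<Gamma> (cls (rep E6)) = 6" "group.ord \<Gamma> (cls (rep E7)) = 7"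
proof -
  have 1: "\<exists>x. mpow (rep i) 1 *v x \<noteq> x \<and> mpow (rep i) 1 *v x \<noteq> - x" for i
    by (rule exI[of _ "vec3 0 0 1"], unfold mpow_vec, cases i) (simp_all add: vec3_simps i_sqrt7_nonzero)
  have 2: "\<exists>x. mpow (rep i) 2 *v x \<noteq> x \<and> mpow (rep i) 2 *v x \<noteq> - x" if "i = E4a \<or> i = E4b \<or> i = E6" for i
    by (rule exI[of _ "vec3 0 0 1"], unfold mpow_vec, insert that, elim disjE; hypsubst)
      (simp_all add: vec3_simps i_sqrt7_nonzero)
  have 3: "\<exists>x. mpow (rep E6) 3 *v x \<noteq> x \<and> mpow (rep E6) 3 *v x \<noteq> - x"
    by (rule exI[of _ "vec3 1 1 0"], unfold mpow_3_vec) (simp add: vec3_simps tau_simps algebra_simps)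
  have p: "group.ord \<Gamma> (cls (rep i)) = r" if r: "r = 2 \<or> r = 3 \<or> r = 7" "mpow (rep i) r = mat 1 \<or> mpow (rep i) r = - mat 1" for i r
  proof (rule ord_cls[OF UO_rep _ r(2)])
    show "0 < r" using r(1) by auto
    fix d assume d: "0 < d" "d < r" "d dvd r"
    have "d = 1" using r(1)
    proof (elim disjE)
      assume "r = 2"
      then show ?thesis using d divisor_cases(1) by blast
    next
      assume "r = 3"
      then show ?thesis using d divisor_cases(2) by blast
    next
      assume "r = 7"
      then show ?thesis using d divisor_cases(5) by blast
    qed
    then show "\<exists>x. mpow (rep i) d *v x \<noteq> x \<and> mpow (rep i) d *v x \<noteq> - x" using 1 by blast
  qed
  show "group.ord \<Gamma> (cls (rep E2a)) = 2" by (rule p) (simp_all only: rep_pow simp_thms)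
  show "group.ord \<Gamma> (cls (rep E2b)) = 2" by (rule p) (simp_all only: rep_pow simp_thms)
  show "group.ord \<Gamma> (cls (rep E2c)) = 2" by (rule p) (simp_all only: rep_pow simp_thms)
  show "group.ord \<Gamma> (cls (rep E3a)) = 3" by (rule p) (simp_all only: rep_pow simp_thms)
  show "group.ord \<Gamma> (cls (rep E3b)) = 3" by (rule p) (simp_all only: rep_pow simp_thms)
  show "group.ord \<Gamma> (cls (rep E3c)) = 3" by (rule p) (simp_all only: rep_pow simp_thms)
  show "group.ord \<Gamma> (cls (rep E4a)) = 4"
  proof (rule ord_cls[OF UO_rep])
    fix d :: nat assume "0 < d" "d < 4" "d dvd 4"
    from divisor_cases(3)[OF this] show "\<exists>x. mpow (rep E4a) d *v x \<noteq> x \<and> mpow (rep E4a) d *v x \<noteq> - x"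
      by (elim disjE; hypsubst) (rule 1, rule 2, simp)
  qed (simp_all add: rep_pow)
  show "group.ord \<Gamma> (cls (rep E4b)) = 4"
  proof (rule ord_cls[OF UO_rep])
    fix d :: nat assume "0 < d" "d < 4" "d dvd 4"
    from divisor_cases(3)[OF this] show "\<exists>x. mpow (rep E4b) d *v x \<noteq> x \<and> mpow (rep E4b) d *v x \<noteq> - x"
      by (elim disjE; hypsubst) (rule 1, rule 2, simp)
  qed (simp_all add: rep_pow)
  show "group.ord \<Gamma> (cls (rep E6)) = 6"
  proof (rule ord_cls[OF UO_rep])
    fix d :: nat assume "0 < d" "d < 6" "d dvd 6"
    from divisor_cases(4)[OF this] show "\<exists>x. mpow (rep E6) d *v x \<noteq> x \<and> mpow (rep E6) d *v x \<noteq> - x"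
      by (elim disjE; hypsubst) (rule 1, rule 2, simp, rule 3)
  qed (simp_all add: rep_pow)
  show "group.ord \<Gamma> (cls (rep E7)) = 7" by (rule p) (simp_all only: E7_pow_7 simp_thms)
qed

lemma ord_rep_pos: "group.ord \<Gamma> (cls (rep i)) > 0"
  by (cases i) (simp_all add: ord_rep)

lemma torsion_rep: "torsion (cls (rep i))"
proof -
  have "cls (rep i) \<in> carrier \<Gamma>" by (simp add: UO_rep)
  then show ?thesis unfolding torsion_def using Gm.pow_ord_eq_1 ord_rep_pos by blast
qed

section \<open>Conjugacy of elements\<close>

text \<open>The units modulo 2, 3 and 4 are 1 and -1, so a cyclic group of such an order has no
  generators besides Y and its inverse.\<close>

lemma generator_small_order:
  assumes Y: "Y \<in> carrier \<Gamma>" "Z \<in> carrier \<Gamma>" and gen: "generate \<Gamma> {Z} = generate \<Gamma> {Y}"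
    and r: "group.ord \<Gamma> Y = r" "r \<in> {2, 3, 4}"
  shows "Z = Y \<or> Z = inv\<^bsub>\<Gamma>\<^esub> Y"
proof -
  have oZ: "Gm.ord Z = r" using Gm.generate_pow_card[OF Y(2)] Gm.generate_pow_card[OF Y(1)] gen r(1) by simp
  have "Z \<in> generate \<Gamma> {Y}" using gen generate.incl[of Z "{Z}" \<Gamma>] by simp
  then obtain k :: int where k: "Z = Y [^]\<^bsub>\<Gamma>\<^esub> k" using Gm.generate_pow[OF Y(1)] by auto
  have Yr: "Y [^]\<^bsub>\<Gamma>\<^esub> (int r) = \<one>\<^bsub>\<Gamma>\<^esub>" using Gm.pow_ord_eq_1[OF Y(1)] r(1) by (simp add: int_pow_int)
  have red: "Z = Y [^]\<^bsub>\<Gamma>\<^esub> (k - int r * q)" for q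
  proof -
    have "Z = Y [^]\<^bsub>\<Gamma>\<^esub> (int r * q + (k - int r * q))" using k by simp
    also have "\<dots> = Y [^]\<^bsub>\<Gamma>\<^esub> (int r * q) \<otimes>\<^bsub>\<Gamma>\<^esub> Y [^]\<^bsub>\<Gamma>\<^esub> (k - int r * q)"
      by (rule Gm.int_pow_mult[OF Y(1)])
    also have "Y [^]\<^bsub>\<Gamma>\<^esub> (int r * q) = \<one>\<^bsub>\<Gamma>\<^esub>" using Gm.int_pow_pow[OF Y(1), of "int r" q] Yr by simp
    finally show ?thesis using Y(1) by simp
  qed
  have Y1: "Y [^]\<^bsub>\<Gamma>\<^esub> (1::int) = Y" "Y [^]\<^bsub>\<Gamma>\<^esub> (- 1::int) = inv\<^bsub>\<Gamma>\<^esub> Y"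
    using Y(1) by (simp_all add: Gm.int_pow_neg)
  have one: "Z \<noteq> \<one>\<^bsub>\<Gamma>\<^esub>"
  proof
    assume "Z = \<one>\<^bsub>\<Gamma>\<^esub>"
    then have "Z [^]\<^bsub>\<Gamma>\<^esub> (1::nat) = \<one>\<^bsub>\<Gamma>\<^esub>" by simp
    then have "Gm.ord Z dvd 1" using Gm.pow_eq_id[OF Y(2)] by blast
    then show False using oZ r(2) by auto
  qed
  have "(\<exists>q. k - int r * q = 0) \<or> (\<exists>q. k - int r * q = 1) \<or> (\<exists>q. k - int r * q = - 1) \<or> (r = 4 \<and> (\<exists>q. k - int r * q = 2))"
  proof -
    define m where "m = k mod int r"
    have m: "k - int r * (k div int r) = m" by (simp add: m_def minus_mult_div_eq_mod)
    have m': "k - int r * (k div int r + 1) = m - int r" using m by (simp add: distrib_left)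
    have "0 \<le> m" "m < int r" using r(2) by (auto simp: m_def)
    then have "m = 0 \<or> m = 1 \<or> m - int r = - 1 \<or> (r = 4 \<and> m = 2)" using r(2) by auto
    then show ?thesis using m m' by metis
  qed
  then show ?thesis
  proof (elim disjE conjE exE)
    fix q assume "k - int r * q = 0"
    then show ?thesis using red[of q] one by simp
  next
    fix q assume "k - int r * q = 1"
    then show ?thesis using red[of q] Y1 by simp
  next
    fix q assume "k - int r * q = - 1"
    then show ?thesis using red[of q] Y1 by simp
  next
    \<comment> \<open>The square of Y has order at most 2 and does not generate.\<close>
    fix q assume r4: "r = 4" "k - int r * q = 2"
    have "Z [^]\<^bsub>\<Gamma>\<^esub> (2::int) = Y [^]\<^bsub>\<Gamma>\<^esub> (int r)" using red[of q] r4 Gm.int_pow_pow[OF Y(1), of 2 2] by simp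
    then have "Z [^]\<^bsub>\<Gamma>\<^esub> (2::nat) = \<one>\<^bsub>\<Gamma>\<^esub>" using Yr int_pow_int[of \<Gamma> Z 2] by simp
    then have "Gm.ord Z dvd 2" using Gm.pow_eq_id[OF Y(2)] by simp
    then have "(4::nat) dvd 2" using oZ r4 by simp
    then show ?thesis by simp
  qed
qed

lemma sim_uinvI: "A \<in> UO \<Longrightarrow> H \<in> UO \<Longrightarrow> A ** H ** A = H \<Longrightarrow> sim (uinv A) A"
proof -
  assume A: "A \<in> UO" and H: "H \<in> UO" and e: "A ** H ** A = H"
  have "H ** uinv A = A ** H ** (A ** uinv A)" by (metis e matrix_mul_assoc)
  then have "H ** uinv A = A ** H" using A by (simp add: uinv_right UO_def)
  then show ?thesis unfolding sim_def using H by blast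
qed

text \<open>An isometry H with A H A = H conjugates the inverse of A to A. For these four classes
  this turns conjugacy of cyclic groups into conjugacy of elements.\<close>

lemma sim_uinv_rep:
  assumes "i \<in> {E3a, E3b, E4a, E4b}" shows "sim (uinv (rep i)) (rep i)"
proof -
  have vec: "H ** A = B" if "\<And>a b c. H *v (A *v vec3 a b c) = B *v vec3 a b c" for H A B :: "complex^3^3"
    by (rule mat_eq_vec3I) (use that in \<open>simp flip: matrix_vector_mul_assoc\<close>)
  have H: "\<exists>H\<in>UO. rep i ** H ** rep i = H"
    if "H \<in> mats_O7" "hadj H ** J ** H = J"
      "\<And>x y z. rep i *v (H *v (rep i *v vec3 x y z)) = H *v vec3 x y z" for H
  proof -
    have "H \<in> UO" using that(1,2) by (intro UO_I) (auto simp: mats_O7_def)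
    moreover have "rep i ** H ** rep i = H"
      by (rule vec) (simp add: that(3) flip: matrix_vector_mul_assoc)
    ultimately show ?thesis by blast
  qed
  have cv: "cols (vec3 a1 a2 a3) (vec3 b1 b2 b3) (vec3 c1 c2 c3) *v vec3 x y z =
      vec3 (x * a1 + y * b1 + z * c1) (x * a2 + y * b2 + z * c2) (x * a3 + y * b3 + z * c3)" for a1 a2 a3 b1 b2 b3 c1 c2 c3 x y z
    by (simp add: cols_vec vec3_simps)
  from assms have "\<exists>H\<in>UO. rep i ** H ** rep i = H"
  proof (elim insertE emptyE)
    assume "i = E3a"
    then show ?thesis
      by (intro H[of "cols (vec3 (- 1) 0 0) (vec3 \<tau> 1 0) (vec3 1 (1 - \<tau>) (- 1))"]; (simp add: cols_mats_O7; fail)?)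
        (simp_all add: cv vec3_simps veq3 mm_nth tau_simps algebra_simps)
  next
    assume "i = E3b"
    then show ?thesis
      by (intro H[of "cols (vec3 0 0 1) (vec3 0 (- 1) 0) (vec3 1 0 0)"]; (simp add: cols_mats_O7; fail)?)
        (simp_all add: cv vec3_simps veq3 mm_nth tau_simps algebra_simps)
  next
    assume "i = E4a"
    then show ?thesis
      by (intro H[of "cols (vec3 1 2 (- 2)) (vec3 0 (- 1) 2) (vec3 0 0 1)"]; (simp add: cols_mats_O7; fail)?)
        (simp_all add: cv vec3_simps veq3 mm_nth tau_simps algebra_simps)
  next
    assume "i = E4b"
    then show ?thesis
      by (intro H[of "cols (vec3 2 (2 - \<tau>) (- 1)) (vec3 (- 1 - \<tau>) (- 3) (1 + \<tau>)) (vec3 (- 1) (\<tau> - 2) 2)"]; (simp add: cols_mats_O7; fail)?)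
        (simp_all add: cv vec3_simps veq3 mm_nth tau_simps algebra_simps)
  qed
  then show ?thesis using sim_uinvI UO_rep by blast
qed

lemma conj_elements_of_cyclic:
  assumes X: "X \<in> carrier \<Gamma>" and i: "i \<notin> {E3c, E6, E7}" and c: "conj_cyclic X (cls (rep i))"
  shows "conj_elements X (cls (rep i))"
proof -
  let ?Y = "cls (rep i)"
  have Y: "?Y \<in> carrier \<Gamma>" by (simp add: UO_rep)
  obtain H where H: "H \<in> carrier \<Gamma>" "conjg H ` generate \<Gamma> {X} = generate \<Gamma> {?Y}" using c conj_cyclic_iff by blast
  define Z where "Z = conjg H X"
  have Z: "Z \<in> carrier \<Gamma>" "conj_elements X Z" using H(1) X by (auto simp: Z_def conj_elements_iff)
  have gen: "generate \<Gamma> {Z} = generate \<Gamma> {?Y}" using H generate_conjg[OF H(1) X] by (simp add: Z_def)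
  have "Gm.ord ?Y \<in> {2, 3, 4}" using i by (cases i) (simp_all add: ord_rep)
  then have "Z = ?Y \<or> Z = inv\<^bsub>\<Gamma>\<^esub> ?Y" using generator_small_order[OF Y Z(1) gen refl] by blast
  moreover have "conj_elements (inv\<^bsub>\<Gamma>\<^esub> ?Y) ?Y"
  proof (cases "i \<in> {E3a, E3b, E4a, E4b}")
    case True
    then show ?thesis
      using sim_imp_conj[OF UO_uinv[OF UO_rep] UO_rep sim_uinv_rep] by (simp add: cls_inv[OF UO_rep])
  next
    case False
    then have "Gm.ord ?Y = 2" using i by (cases i) (simp_all add: ord_rep)
    then have "?Y [^]\<^bsub>\<Gamma>\<^esub> (2::nat) = \<one>\<^bsub>\<Gamma>\<^esub>" using Gm.pow_ord_eq_1[OF Y] by simp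
    then have "?Y \<otimes>\<^bsub>\<Gamma>\<^esub> ?Y = \<one>\<^bsub>\<Gamma>\<^esub>" using Y by (simp add: numeral_2_eq_2)
    then have "inv\<^bsub>\<Gamma>\<^esub> ?Y = ?Y" using Gm.inv_equality[OF _ Y Y] by simp
    then show ?thesis unfolding conj_elements_iff using conjg_one[OF Y] Gm.one_closed by metis
  qed
  ultimately show ?thesis using conj_elements_trans[OF X Z(2)] Z(2) by blast
qed

section \<open>Fixed points that are not defined over \<open>K\<close>\<close>

text \<open>The Hermitian form with Gram matrix (2, -1; -1, 2), written as a sum of three norms of
  which two can vanish only together with the third. As in the hexagonal root lattice, there are six
  vectors of norm 2 and none of norm 1.\<close>

lemma O7_hexagonal_norm:
  assumes rs: "r \<in> O7" "s \<in> O7"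
  shows "r * cnj r + s * cnj s + (r - s) * cnj (r - s) \<noteq> 1"
    "r * cnj r + s * cnj s + (r - s) * cnj (r - s) = 2 \<Longrightarrow>
      (r, s) \<in> {(1, 0), (0, 1), (1, 1), (- 1, 0), (0, - 1), (- 1, - 1)}"
proof -
  obtain m where m: "r * cnj r = of_int m" "m \<ge> 0" "m = 0 \<Longrightarrow> r = 0" "m = 1 \<Longrightarrow> r = 1 \<or> r = - 1"
    by (rule O7_norm_cases[OF rs(1)]) blast
  obtain l where l: "s * cnj s = of_int l" "l \<ge> 0" "l = 0 \<Longrightarrow> s = 0" "l = 1 \<Longrightarrow> s = 1 \<or> s = - 1"
    by (rule O7_norm_cases[OF rs(2)]) blast
  obtain k where k: "(r - s) * cnj (r - s) = of_int k" "k \<ge> 0" "k = 0 \<Longrightarrow> r - s = 0"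
    by (rule O7_norm_cases[OF O7_diff[OF rs]]) blast
  have e: "r * cnj r + s * cnj s + (r - s) * cnj (r - s) = complex_of_int (m + l + k)"
    unfolding m(1) l(1) k(1) by simp
  have two: "m = 0 \<Longrightarrow> l = 0 \<Longrightarrow> k = 0" "m = 0 \<Longrightarrow> k = 0 \<Longrightarrow> l = 0" "l = 0 \<Longrightarrow> k = 0 \<Longrightarrow> m = 0"
    using m l k by auto
  have "m + l + k \<noteq> 1"
  proof
    assume "m + l + k = 1"
    then show False using two m(2) l(2) k(2) by linarith
  qed
  then show "r * cnj r + s * cnj s + (r - s) * cnj (r - s) \<noteq> 1" unfolding e by (metis of_int_1 of_int_eq_iff)
  assume "r * cnj r + s * cnj s + (r - s) * cnj (r - s) = 2"
  then have "complex_of_int (m + l + k) = complex_of_int 2" unfolding e by simp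
  then have "m + l + k = 2" by (simp only: of_int_eq_iff)
  then consider "m = 1 \<and> l = 0" | "m = 0 \<and> l = 1" | "m = 1 \<and> k = 0" using two m(2) l(2) k(2) by linarith
  then show "(r, s) \<in> {(1, 0), (0, 1), (1, 1), (- 1, 0), (0, - 1), (- 1, - 1)}"
  proof cases
    case 1
    then show ?thesis using m(4) l(3) by auto
  next
    case 2
    then show ?thesis using m(3) l(4) by auto
  next
    case 3
    then show ?thesis using m(4) k(3) by auto
  qed
qed

text \<open>After division by its content the integral vector shows that the eigenvalue lies in
  \<open>O7\<close>, where modulus 1 means a unit. Hence a fixed point with any other eigenvalue is
  not defined over \<open>K\<close>.\<close>

lemma O7_eigenvalue:
  assumes A: "A \<in> UO" and w: "w \<in> O7v" "w \<noteq> 0" "A *v w = c *s w" "cmod c = 1"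
  shows "c = 1 \<or> c = - 1"
proof -
  obtain g u where u: "g \<in> O7" "uni u" "w = g *s u" by (rule exists_uni_multiple[OF w(1)])
  have g: "g \<noteq> 0" using w(2) u(3) by auto
  have "g *s (A *v u) = g *s (c *s u)" using w(3) unfolding u(3) mv_scale by (simp add: mult.commute)
  then have "A *v u = c *s u" using g unfolding vector_mul_lcancel by blast
  then have "c *s u \<in> O7v" using O7v_A[OF A uni_O7v[OF u(2)]] by simp
  then show ?thesis using O7_unit uni_scale_O7[OF u(2)] w(4) by blast
qed

lemma K_integral_multiple:
  assumes "\<forall>k. w $ k \<in> K"
  obtains D :: int where "D \<noteq> 0" "of_int D *s w \<in> O7v"
proof -
  have o: "z \<in> O7" if "z \<in> ord7" for z using that unfolding ord7_def by auto
  obtain d e f :: int where d: "d > 0" "of_int d * w$1 \<in> O7" "e > 0" "of_int e * w$2 \<in> O7" "f > 0" "of_int f * w$3 \<in> O7"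
    using K_denominator assms o by metis
  have "of_int (d * e * f) * w$1 = of_int (e * f) * (of_int d * w$1)"
    "of_int (d * e * f) * w$2 = of_int (d * f) * (of_int e * w$2)"
    "of_int (d * e * f) * w$3 = of_int (d * e) * (of_int f * w$3)" by simp_all
  then have "of_int (d * e * f) *s w \<in> O7v"
    using d(2,4,6) unfolding O7v_iff vector_smult_component by (metis O7_mult O7_of_int)
  moreover have "d * e * f \<noteq> 0" using d(1,3,5) by simp
  ultimately show ?thesis using that by blast
qed

lemma not_over_K:
  assumes A: "A \<in> UO" and v: "v \<in> negative" "A *v v = c *s v" "cmod c = 1" "c \<noteq> 1" "c \<noteq> - 1"
  shows "\<not> (\<exists>w. (\<forall>k. w $ k \<in> K) \<and> cline v = cline w)"
proof
  assume "\<exists>w. (\<forall>k. w $ k \<in> K) \<and> cline v = cline w"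
  then obtain w where w: "\<forall>k. w $ k \<in> K" "cline v = cline w" by blast
  have v0: "v \<noteq> 0" using v(1) by (rule negative_nonzero)
  obtain m where m: "m \<noteq> 0" "v = m *s w" using w(2) cline_eq_iff[OF v0, of w] by metis
  then have w0: "w \<noteq> 0" using v0 by auto
  obtain D :: int where D: "D \<noteq> 0" "of_int D *s w \<in> O7v" by (rule K_integral_multiple[OF w(1)])
  have "m *s (A *v w) = m *s (c *s w)" using v(2) unfolding m(2) mv_scale by (simp add: mult.commute)
  then have "A *v w = c *s w" using m(1) unfolding vector_mul_lcancel by blast
  then have "A *v (of_int D *s w) = c *s (of_int D *s w)" by (simp add: mv_scale mult.commute)
  moreover have "of_int D *s w \<noteq> 0" using D(1) w0 by simp
  ultimately show False using O7_eigenvalue[OF A D(2)] v(3-5) by blast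
qed

lemma mpow_eigenvector: "A *v v = c *s v \<Longrightarrow> mpow A k *v v = c ^ k *s v"
proof (induction k)
  case (Suc k)
  then show ?case by (simp only: mpow_Suc_vec mv_scale) (simp add: mult.commute)
qed simp

lemma cyclic_stabilizer:
  assumes A: "A \<in> UO" and v: "v \<in> negative" "A *v v = c *s v" "cmod c = 1"
    and r: "group.ord \<Gamma> (cls A) = r" "r > 0"
    and B: "\<And>B d. B \<in> UO \<Longrightarrow> B *v v = d *s v \<Longrightarrow> cmod d = 1 \<Longrightarrow> \<exists>k<r. cls B = cls (mpow A k)"
  shows "finite (stabilizer (cline v)) \<and> card (stabilizer (cline v)) = r"
proof -
  have C: "cls A \<in> carrier \<Gamma>" using A by simp
  have "stabilizer (cline v) = (\<lambda>k. cls A [^]\<^bsub>\<Gamma>\<^esub> k) ` {0..r - 1}"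
  proof (intro subset_antisym subsetI)
    fix X assume "X \<in> stabilizer (cline v)"
    then obtain B where B1: "B \<in> UO" "X = cls B" "act (cls B) (cline v) = cline v"
      by (auto simp: stabilizer_def carrier_Gamma)
    then obtain d where "cmod d = 1" "B *v v = d *s v" using act_fixes_iff[OF v(1)] by (auto simp: UO_def)
    then obtain k where "k < r" "cls B = cls (mpow A k)" using B[OF B1(1)] by blast
    then show "X \<in> (\<lambda>k. cls A [^]\<^bsub>\<Gamma>\<^esub> k) ` {0..r - 1}" using B1(2) by (auto simp: cls_pow[OF A])
  next
    fix X assume "X \<in> (\<lambda>k. cls A [^]\<^bsub>\<Gamma>\<^esub> k) ` {0..r - 1}"
    then obtain k where "X = cls (mpow A k)" by (auto simp: cls_pow[OF A])
    moreover have "c ^ k \<noteq> 0" using v(3) by auto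
    then have "act (cls (mpow A k)) (cline v) = cline v"
      by (simp add: act_cls mpow_eigenvector[OF v(2)] cline_scale)
    ultimately show "X \<in> stabilizer (cline v)" by (simp add: stabilizer_def mpow_UO[OF A])
  qed
  moreover have "inj_on (\<lambda>k. cls A [^]\<^bsub>\<Gamma>\<^esub> k) {0..r - 1}" using Gm.ord_inj[OF C] unfolding r(1) .
  ultimately show ?thesis using r(2) by (simp add: card_image)
qed

lemma no_lines:
  assumes v: "v \<in> negative" and j: "j > 0"
    and u: "\<And>u. primitive u \<Longrightarrow> herm u v = 0 \<Longrightarrow> herm u u \<noteq> of_nat j"
  shows "finite (j_lines_through j (cline v)) \<and> card (j_lines_through j (cline v)) = 0"
proof -
  have "j_lines_through j (cline v) = {}" unfolding j_lines_through_eq[OF v] using u by blast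
  then show ?thesis by simp
qed

subsection \<open>Orders 3 and 6\<close>

text \<open>\<open>E3c\<close> and \<open>E6\<close> fix the same point: \<open>E3c\<close> is inverse to the square of \<open>E6\<close> in \<open>\<Gamma>\<close>. On \<open>v6\<close>
  they have the eigenvalues \<open>mu6\<close> and \<open>- mu6\<close>.\<close>

definition mu6 :: complex where "mu6 = Complex (1/2) (sqrt 3 / 2)"
definition z6 :: complex where "z6 = (4 + mu6) * i_sqrt7 / 7"
definition v6 :: "complex^3" where "v6 = vec3 z6 0 1"

lemma mu6_sq: "mu6 * mu6 = mu6 - 1"
  by (simp add: mu6_def complex_eq_iff)

lemma cmod_mu6: "cmod mu6 = 1"
  by (simp add: mu6_def cmod_def power_divide)

lemma mu6_neq: "mu6 \<noteq> 1" "mu6 \<noteq> - 1"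
  by (simp_all add: mu6_def complex_eq_iff)

lemma s_z6: "i_sqrt7 * z6 = - 4 - mu6"
proof -
  have "i_sqrt7 * z6 = (4 + mu6) * (i_sqrt7 * i_sqrt7) / 7" by (simp add: z6_def)
  also have "\<dots> = - 4 - mu6" unfolding i_sqrt7_sq by (simp add: field_simps)
  finally show ?thesis .
qed

lemma z6_eigen: "5 * z6 - 3 * i_sqrt7 = mu6 * z6"
proof -
  have "5 * z6 - mu6 * z6 = (20 + mu6 - mu6 * mu6) * i_sqrt7 / 7" by (simp add: z6_def field_simps)
  then have "5 * z6 - mu6 * z6 = 3 * i_sqrt7" unfolding mu6_sq by simp
  then show ?thesis by (simp add: diff_eq_eq)
qed

lemma z6_sq: "7 * (z6 * z6) = 21 + 9 * i_sqrt7 * z6"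
proof -
  have k: "i_sqrt7 * (mu6 * z6) = 5 * (i_sqrt7 * z6) - 3 * (i_sqrt7 * i_sqrt7)"
    unfolding z6_eigen[symmetric] by (simp add: algebra_simps)
  have "7 * (z6 * z6) = - (i_sqrt7 * (i_sqrt7 * z6) * z6)" using i_sqrt7_sq by (simp flip: mult.assoc)
  also have "\<dots> = - (i_sqrt7 * ((- 4 - mu6) * z6))" by (simp only: s_z6 mult.assoc)
  also have "\<dots> = 4 * (i_sqrt7 * z6) + i_sqrt7 * (mu6 * z6)" by (simp add: algebra_simps)
  also have "\<dots> = 9 * (i_sqrt7 * z6) - 3 * (i_sqrt7 * i_sqrt7)" unfolding k by simp
  finally show ?thesis unfolding i_sqrt7_sq by simp
qed

lemma v6_eigen: "rep E3c *v v6 = mu6 *s v6" "rep E6 *v v6 = (- mu6) *s v6"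
  using s_z6 z6_eigen by (simp_all add: v6_def vec3_simps) (simp add: diff_eq_eq add.commute)?

lemma v6_neg: "v6 \<in> negative"
proof -
  have "Re z6 = - (sqrt 7 * (sqrt 3 / 2)) / 7" by (simp add: z6_def i_sqrt7_def mu6_def)
  then have "Re z6 < 0" by simp
  then show ?thesis by (simp add: negative_def v6_def vec3_simps)
qed

text \<open>A nontrivial relation would make \<open>v6\<close> proportional to an integral
  eigenvector with eigenvalue \<open>mu6\<close>, which is neither 1 nor -1.\<close>

lemma z6_independent:
  assumes "a \<in> O7" "b \<in> O7" "a * z6 = b" shows "a = 0" "b = 0"
proof -
  have w: "a *s v6 = vec3 b 0 a" using assms(3) by (simp add: v6_def vec3_simps)
  show "a = 0"
  proof (rule ccontr)
    assume "a \<noteq> 0"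
    then have "vec3 b 0 a \<noteq> 0" by (simp add: veq3)
    moreover have "rep E3c *v (vec3 b 0 a) = mu6 *s vec3 b 0 a"
      unfolding w[symmetric] mv_scale v6_eigen by (simp add: mult.commute)
    ultimately show False using O7_eigenvalue[OF UO_rep, of "vec3 b 0 a"] assms(1,2) cmod_mu6 mu6_neq by auto
  qed
  then show "b = 0" using assms(3) by simp
qed

lemma perp_v6:
  assumes "u \<in> O7v" "herm u v6 = 0" obtains t where "t \<in> O7" "u = vec3 0 t 0"
proof -
  have O: "u $ 1 \<in> O7" "u $ 2 \<in> O7" "u $ 3 \<in> O7" using assms(1) by (simp_all add: O7v_iff)
  have e: "u $ 3 * cnj z6 + u $ 1 = 0" using assms(2) by (simp add: herm_expand v6_def)
  have "cnj (u $ 3) * z6 + cnj (u $ 1) = 0" using arg_cong[OF e, of cnj] by simp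
  then have "cnj (u $ 3) * z6 = - cnj (u $ 1)" by (simp add: eq_neg_iff_add_eq_0)
  from z6_independent[OF _ _ this] have "u $ 3 = 0" "u $ 1 = 0" using O by simp_all
  then have "u = vec3 0 (u $ 2) 0" by (simp add: veq3)
  then show ?thesis using that O(2) by blast
qed

lemma lines_v6:
  "finite (j_lines_through 1 (cline v6)) \<and> card (j_lines_through 1 (cline v6)) = 1"
  "finite (j_lines_through 2 (cline v6)) \<and> card (j_lines_through 2 (cline v6)) = 0"
proof -
  have unit: "u = vec3 0 1 0 \<or> u = - vec3 0 1 0" if u: "primitive u" "herm u v6 = 0" for u
  proof -
    obtain t where t: "t \<in> O7" "u = vec3 0 t 0" using perp_v6[OF _ u(2)] u(1) by (auto simp: primitive_def O7v_def)
    have "u $ 1 = t * 0" "u $ 2 = t * 1" "u $ 3 = t * 0" by (simp_all add: t(2))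
    then have "\<forall>i. \<exists>c\<in>O7. u $ i = t * c" unfolding forall_3 using O7_0 O7_1 by blast
    then obtain c where "c \<in> O7" "t * c = 1" using u(1) t(1) unfolding primitive_def by blast
    then have "t = 1 \<or> t = - 1" using O7_unit_mult[OF t(1)] by blast
    then show ?thesis by (auto simp: t(2) vec3_simps)
  qed
  have pr: "uni (vec3 0 1 0)" unfolding uni_def by (auto simp: vec3_simps intro!: bexI[of _ "vec3 0 1 0"])
  have 1: "j_lines_through 1 (cline v6) = {polar_line (vec3 0 1 0)}"
  proof -
    have "polar_line ` {u. primitive u \<and> herm u u = of_nat 1 \<and> herm u v6 = 0} = {polar_line (vec3 0 1 0)}"
    proof (intro subset_antisym subsetI)
      fix L assume "L \<in> polar_line ` {u. primitive u \<and> herm u u = of_nat 1 \<and> herm u v6 = 0}"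
      then show "L \<in> {polar_line (vec3 0 1 0)}" using unit polar_line_minus by auto
    next
      have "vec3 0 1 0 \<in> {u. primitive u \<and> herm u u = of_nat 1 \<and> herm u v6 = 0}"
        using uni_imp_primitive[OF pr] by (simp add: v6_def vec3_simps)
      moreover fix L assume "L \<in> {polar_line (vec3 0 1 0)}"
      ultimately show "L \<in> polar_line ` {u. primitive u \<and> herm u u = of_nat 1 \<and> herm u v6 = 0}" by blast
    qed
    then show ?thesis unfolding j_lines_through_eq[OF v6_neg] .
  qed
  show "finite (j_lines_through 1 (cline v6)) \<and> card (j_lines_through 1 (cline v6)) = 1" unfolding 1 by simp
  show "finite (j_lines_through 2 (cline v6)) \<and> card (j_lines_through 2 (cline v6)) = 0"
  proof (rule no_lines[OF v6_neg])
    fix u assume "primitive u" "herm u v6 = 0"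
    from unit[OF this] have "herm u u = 1" by (elim disjE) (simp_all add: vec3_simps)
    then show "herm u u \<noteq> of_nat 2" by simp
  qed simp
qed

text \<open>B maps (0, 1, 0) to itself up to the sign t and acts on the other two coordinates as a +
  b M, where M is the corresponding block of \<open>rep E3c\<close>, a root of X^2 - X + 1.
  Unitarity leaves six pairs (a, b), so twelve matrices with the sign t and six classes.\<close>

lemma stabilizer_v6:
  assumes B: "B \<in> UO" "B *v v6 = c *s v6" "cmod c = 1"
  shows "\<exists>k<6. cls B = cls (mpow (rep E6) k)"
proof -
  have BU: "B \<in> U_J" using B(1) by (simp add: UO_def)
  note h = U_J_herm[OF BU]
  have c0: "c \<noteq> 0" using B(3) by auto
  define e1 e2 e3 :: "complex^3" where "e1 = vec3 1 0 0" and "e2 = vec3 0 1 0" and "e3 = vec3 0 0 1"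
  have eO: "B *v e1 \<in> O7v" "B *v e2 \<in> O7v" "B *v e3 \<in> O7v" using O7v_A[OF B(1)] by (simp_all add: e1_def e2_def e3_def)
  have "cnj c * herm (B *v e2) v6 = 0" using h[of e2 v6] by (simp add: B(2)) (simp add: e2_def v6_def vec3_simps)
  then have "herm (B *v e2) v6 = 0" using c0 by simp
  then obtain t where t: "t \<in> O7" "B *v e2 = vec3 0 t 0" using perp_v6[OF eO(2)] by blast
  have "t * cnj t = 1" using h[of e2 e2] unfolding t(2) by (simp add: e2_def vec3_simps)
  then have t1: "t = 1 \<or> t = - 1" using O7_unit_mult t(1) O7_cnj by blast
  obtain p q r w where e1: "B *v e1 = vec3 p 0 r" and e3: "B *v e3 = vec3 q 0 w" and O: "p \<in> O7" "q \<in> O7" "r \<in> O7" "w \<in> O7"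
  proof -
    have "(B *v e1) $ 2 * cnj t = 0" "(B *v e3) $ 2 * cnj t = 0"
      using h[of e1 e2] h[of e3 e2] unfolding t(2) by (simp_all add: herm_expand) (simp_all add: e1_def e2_def e3_def)
    then have "(B *v e1) $ 2 = 0" "(B *v e3) $ 2 = 0" using t1 by auto
    then show ?thesis using that vec3_eta[of "B *v e1"] vec3_eta[of "B *v e3"] eO by (simp add: O7v_iff)
  qed
  have Bv: "B *v vec3 x y z = vec3 (p * x + q * z) (t * y) (r * x + w * z)" for x y z
  proof -
    have "vec3 x y z = x *s e1 + y *s e2 + z *s e3" by (simp add: e1_def e2_def e3_def vec3_simps)
    then show ?thesis by (simp add: matrix_vector_right_distrib mv_scale e1 e3 t(2) vec3_simps mult.commute)
  qed
  have ev: "p * z6 + q = c * z6" "r * z6 + w = c" using B(2) unfolding v6_def Bv by (simp_all add: vec3_simps)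
  \<comment> \<open>Eliminating c and reducing with the quadratic equation of \<open>z6\<close>
    leaves a relation linear in \<open>z6\<close> with integral coefficients, so both of its sides
    vanish.\<close>
  have "7 * (p * z6 + q) = 7 * ((r * z6 + w) * z6)" using ev by simp
  also have "\<dots> = r * (7 * (z6 * z6)) + 7 * w * z6" by (simp add: algebra_simps)
  finally have "(7 * p - 9 * r * i_sqrt7 - 7 * w) * z6 = 21 * r - 7 * q" unfolding z6_sq by (simp add: algebra_simps)
  from z6_independent[OF _ _ this] have rel: "7 * p - 9 * r * i_sqrt7 - 7 * w = 0" "21 * r - 7 * q = 0" using O by simp_all
  \<comment> \<open>The expected relations p - w = 9 b and r \<open>i_sqrt7\<close> = 7 b are
    combined as 28 b - 27 b = b, which makes b visibly integral.\<close>
  define b a where "b = 4 * (r * i_sqrt7) - 3 * (p - w)" and "a = p - 5 * b"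
  have ab: "a \<in> O7" "b \<in> O7" using O by (simp_all add: a_def b_def)
  have pw: "7 * (p - w) = 9 * (r * i_sqrt7)" using rel(1) by (simp add: algebra_simps)
  have "7 * b = 28 * (r * i_sqrt7) - 3 * (7 * (p - w))" unfolding b_def by (simp add: algebra_simps)
  then have b7: "7 * b = r * i_sqrt7" unfolding pw by simp
  have "7 * (p - w) = 7 * (9 * b)" using pw b7 by simp
  then have "7 = (0::complex) \<or> p - w = 9 * b" by (simp only: mult_cancel_left)
  then have w: "p - w = 9 * b" by simp
  have "7 * (i_sqrt7 * b) = r * (i_sqrt7 * i_sqrt7)" using b7 by (simp add: mult_ac)
  then have r: "r = - (i_sqrt7 * b)" unfolding i_sqrt7_sq by simp
  have q: "q = - 3 * (i_sqrt7 * b)" using rel(2) r by simp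
  have p: "p = a + 5 * b" "w = a - 4 * b" using w by (simp_all add: a_def algebra_simps)
  have cs: "cnj i_sqrt7 = - i_sqrt7" by (simp add: i_sqrt7_tau cnj_tau)
  have "r * cnj p + p * cnj r = 0" using h[of e1 e1] unfolding e1 by (simp add: e1_def vec3_simps)
  then have "i_sqrt7 * (a * cnj b - b * cnj a) = 0" unfolding r p by (simp add: cs algebra_simps)
  then have sym: "a * cnj b = b * cnj a" using i_sqrt7_nonzero by simp
  have "r * cnj q + p * cnj w = 1" using h[of e1 e3] unfolding e1 e3 by (simp add: e1_def e3_def vec3_simps)
  then have e: "- 3 * (i_sqrt7 * i_sqrt7) * (b * cnj b) + (a + 5 * b) * cnj (a - 4 * b) = 1"
    unfolding r q p by (simp add: cs mult_ac)
  have e': "(a + 5 * b) * cnj (a - 4 * b) = a * cnj a - 4 * (a * cnj b) + 5 * (b * cnj a) - 20 * (b * cnj b)"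
    by (simp add: algebra_simps)
  have "21 * (b * cnj b) + (a * cnj a - 4 * (a * cnj b) + 5 * (b * cnj a) - 20 * (b * cnj b)) = 1"
    using e unfolding e' i_sqrt7_sq by simp
  then have "21 * (b * cnj b) + (a * cnj a - 4 * (a * cnj b) + 5 * (a * cnj b) - 20 * (b * cnj b)) = 1" by (simp only: sym)
  then have "a * cnj a + b * cnj b + a * cnj b = 1" by (simp add: algebra_simps)
  \<comment> \<open>Doubling turns the condition into the hexagonal form at (a, -b).\<close>
  then have "2 * (a * cnj a + b * cnj b + a * cnj b) = 2" by simp
  then have "a * cnj a + (- b) * cnj (- b) + (a - (- b)) * cnj (a - (- b)) = 2" using sym by (simp add: algebra_simps)
  from O7_hexagonal_norm(2)[OF ab(1) O7_uminus[OF ab(2)] this]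
  have "(a, b) \<in> {(1, 0), (0, - 1), (1, - 1), (- 1, 0), (0, 1), (- 1, 1)}"
    by (auto simp: minus_equation_iff[of b])
  note cases = this t1
  have Bab: "B *v vec3 x y z = vec3 ((a + 5 * b) * x - 3 * (i_sqrt7 * b) * z) (t * y) ((a - 4 * b) * z - i_sqrt7 * b * x)" for x y z
    unfolding Bv r q p by (simp add: algebra_simps)
  have P: "\<exists>k<6. cls B = cls (mpow (rep E6) k)" if "k < 6" "\<And>x y z. B *v vec3 x y z = mpow (rep E6) k *v vec3 x y z" for k
    using that mat_eq_vec3I[of B "mpow (rep E6) k"] by blast
  have N: "\<exists>k<6. cls B = cls (mpow (rep E6) k)" if "k < 6" "\<And>x y z. B *v vec3 x y z = - (mpow (rep E6) k *v vec3 x y z)" for k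
  proof -
    have "B = - mpow (rep E6) k" by (rule mat_eq_vec3I) (simp add: that(2))
    then show ?thesis using that(1) cls_minus by blast
  qed
  have f0: "\<exists>k<6. cls B = cls (mpow (rep E6) k)" if "a = 1" "b = 0" "t = 1"
    by (rule P[of 0]) (simp_all only: E6_pow_vec Bab that, simp_all add: vec3_simps)
  have f1: "\<exists>k<6. cls B = cls (mpow (rep E6) k)" if "a = 1" "b = 0" "t = - 1"
    by (rule P[of 3]) (simp_all only: E6_pow_vec Bab that, simp_all add: vec3_simps)
  have f2: "\<exists>k<6. cls B = cls (mpow (rep E6) k)" if "a = - 1" "b = 0" "t = - 1"
    by (rule N[of 0]) (simp_all only: E6_pow_vec Bab that, simp_all add: vec3_simps)
  have f3: "\<exists>k<6. cls B = cls (mpow (rep E6) k)" if "a = - 1" "b = 0" "t = 1"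
    by (rule N[of 3]) (simp_all only: E6_pow_vec Bab that, simp_all add: vec3_simps)
  have f4: "\<exists>k<6. cls B = cls (mpow (rep E6) k)" if "a = 0" "b = 1" "t = 1"
    by (rule N[of 1]) (simp_all only: E6_pow_vec Bab that, simp_all add: vec3_simps)
  have f5: "\<exists>k<6. cls B = cls (mpow (rep E6) k)" if "a = 0" "b = 1" "t = - 1"
    by (rule N[of 4]) (simp_all only: E6_pow_vec Bab that, simp_all add: vec3_simps)
  have f6: "\<exists>k<6. cls B = cls (mpow (rep E6) k)" if "a = 0" "b = - 1" "t = - 1"
    by (rule P[of 1]) (simp_all only: E6_pow_vec Bab that, simp_all add: vec3_simps)
  have f7: "\<exists>k<6. cls B = cls (mpow (rep E6) k)" if "a = 0" "b = - 1" "t = 1"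
    by (rule P[of 4]) (simp_all only: E6_pow_vec Bab that, simp_all add: vec3_simps)
  have f8: "\<exists>k<6. cls B = cls (mpow (rep E6) k)" if "a = 1" "b = - 1" "t = 1"
    by (rule N[of 5]) (simp_all only: E6_pow_vec Bab that, simp_all add: vec3_simps)
  have f9: "\<exists>k<6. cls B = cls (mpow (rep E6) k)" if "a = 1" "b = - 1" "t = - 1"
    by (rule N[of 2]) (simp_all only: E6_pow_vec Bab that, simp_all add: vec3_simps)
  have f10: "\<exists>k<6. cls B = cls (mpow (rep E6) k)" if "a = - 1" "b = 1" "t = 1"
    by (rule P[of 2]) (simp_all only: E6_pow_vec Bab that, simp_all add: vec3_simps)
  have f11: "\<exists>k<6. cls B = cls (mpow (rep E6) k)" if "a = - 1" "b = 1" "t = - 1"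
    by (rule P[of 5]) (simp_all only: E6_pow_vec Bab that, simp_all add: vec3_simps)
  from cases show ?thesis
    by (elim insertE emptyE disjE; unfold prod.inject; elim conjE)
      (erule (2) f0 | erule (2) f1 | erule (2) f2 | erule (2) f3 | erule (2) f4 | erule (2) f5 | erule (2) f6 | erule (2) f7 | erule (2) f8 | erule (2) f9 | erule (2) f10 | erule (2) f11)+
qed

lemma eigenvectors_v6: "rep E3c *v x = mu6 *s x \<Longrightarrow> \<exists>m. x = m *s v6" "rep E6 *v x = (- mu6) *s x \<Longrightarrow> \<exists>m. x = m *s v6"
proof -
  have *: "\<exists>m. vec3 a b c = m *s v6" if b: "b = mu6 * b \<or> b = - mu6 * b" and a: "- i_sqrt7 * a - 4 * c = mu6 * c" for a b c
  proof -
    have "mu6 * b = 1 * b \<or> mu6 * b = (- 1) * b" using b by (metis minus_minus mult_1 mult_minus_left)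
    then have b0: "b = 0" using mu6_neq unfolding mult_cancel_right by blast
    have "i_sqrt7 * a + 4 * c = - (mu6 * c)" using arg_cong[OF a, of uminus] by (simp add: add.commute)
    then have "i_sqrt7 * a = - (mu6 * c) - 4 * c" by (simp only: eq_diff_eq)
    then have "i_sqrt7 * a = c * (- 4 - mu6)" by (simp only: right_diff_distrib mult_minus_right) (simp add: mult.commute)
    then have "i_sqrt7 * a = i_sqrt7 * (c * z6)" unfolding s_z6[symmetric] by (simp add: mult_ac)
    then have "a = c * z6" using i_sqrt7_nonzero by simp
    then have "vec3 a b c = c *s v6" using b0 by (simp add: v6_def vec3_simps)
    then show ?thesis by blast
  qed
  show "\<exists>m. x = m *s v6" if "rep E3c *v x = mu6 *s x"
  proof -
    have "rep E3c *v vec3 (x$1) (x$2) (x$3) = mu6 *s vec3 (x$1) (x$2) (x$3)" using that vec3_eta[of x] by simp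
    then have "- x$2 = mu6 * x$2" "- i_sqrt7 * x$1 - 4 * x$3 = mu6 * x$3" by (simp_all add: vec3_simps)
    then show ?thesis using *[of "x$2" "x$1" "x$3"] vec3_eta[of x] by (simp add: minus_equation_iff[of "x$2"])
  qed
  show "\<exists>m. x = m *s v6" if "rep E6 *v x = (- mu6) *s x"
  proof -
    have "rep E6 *v vec3 (x$1) (x$2) (x$3) = (- mu6) *s vec3 (x$1) (x$2) (x$3)" using that vec3_eta[of x] by simp
    then have "- x$2 = - mu6 * x$2" and e: "i_sqrt7 * x$1 + 4 * x$3 = - mu6 * x$3" by (simp_all add: vec3_simps)
    then have "x$2 = mu6 * x$2" by simp
    moreover have "- i_sqrt7 * x$1 - 4 * x$3 = mu6 * x$3" using arg_cong[OF e, of uminus] by simp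
    ultimately show ?thesis using *[of "x$2" "x$1" "x$3"] vec3_eta[of x] by simp
  qed
qed

lemma row_E3c_E6: "non_K_row E3c 3 6 1 0" "non_K_row E6 6 6 1 0"
proof -
  have st: "finite (stabilizer (cline v6)) \<and> card (stabilizer (cline v6)) = 6"
    by (rule cyclic_stabilizer[OF UO_rep v6_neg v6_eigen(2) _ ord_rep(9)]) (use stabilizer_v6 cmod_mu6 in auto)
  have nK: "\<not> (\<exists>w. (\<forall>k. w $ k \<in> K) \<and> cline v6 = cline w)"
    by (rule not_over_K[OF UO_rep v6_neg v6_eigen(1) cmod_mu6 mu6_neq])
  have m: "cmod (- mu6) = 1" using cmod_mu6 by simp
  note fp3 = fixed_point_unique[OF UO_rep v6_neg v6_eigen(1) cmod_mu6 eigenvectors_v6(1)]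
  note fp6 = fixed_point_unique[OF UO_rep v6_neg v6_eigen(2) m eigenvectors_v6(2)]
  have "fixed_point_data E3c 3 (cline v6) 6 1 0"
    unfolding fixed_point_data_def by (intro conjI ord_rep(6) fp3 st[THEN conjunct1] st[THEN conjunct2]
      lines_v6[THEN conjunct1] lines_v6[THEN conjunct2])
  then show "non_K_row E3c 3 6 1 0" unfolding non_K_row_def using nK by blast
  have "fixed_point_data E6 6 (cline v6) 6 1 0"
    unfolding fixed_point_data_def by (intro conjI ord_rep(9) fp6 st[THEN conjunct1] st[THEN conjunct2]
      lines_v6[THEN conjunct1] lines_v6[THEN conjunct2])
  then show "non_K_row E6 6 6 1 0" unfolding non_K_row_def using nK by blast
qed

subsection \<open>Order 7\<close>

text \<open>The eigenvalue of \<open>- rep E7\<close> on its fixed point; it is a root of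
  \<open>X^3 + \<tau> X^2 + (\<tau> - 1) X - 1\<close>, whose roots are \<open>lam7\<close>, \<open>lam7^2\<close> and \<open>lam7^4\<close>.\<close>

definition lam7 :: complex where "lam7 = cis (- (2 * pi / 7))"
definition v7 :: "complex^3" where "v7 = vec3 (lam7 + 1) lam7 (- (lam7 * (lam7 + 1)))"

lemma lam7_power: "lam7 ^ n = cis (- (real n * (2 * pi / 7)))"
  by (simp only: lam7_def Complex.DeMoivre mult_minus_right)

lemma cmod_lam7: "cmod lam7 = 1"
  by (simp add: lam7_def)

text \<open>The angle 2 pi / 7 is below pi / 3. The bound makes the norm of \<open>v7\<close>, which
  is 1 - 2 Re lam7 (2 + 2 Re lam7), negative.\<close>

lemma Re_lam7: "Re lam7 > 1 / 2"
proof -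
  have "cos (pi / 3) < cos (2 * pi / 7)" by (rule cos_monotone_0_pi) (use pi_gt_zero in \<open>simp_all add: field_simps\<close>)
  then show ?thesis by (simp add: lam7_def cos_60)
qed

lemma lam7_neq: "lam7 \<noteq> 1" "lam7 \<noteq> - 1"
proof -
  have "sin (2 * pi / 7) > 0" by (rule sin_gt_zero) (use pi_gt_zero in \<open>simp_all add: field_simps\<close>)
  then show "lam7 \<noteq> 1" "lam7 \<noteq> - 1" by (auto simp: lam7_def complex_eq_iff)
qed

text \<open>Gauss periods: e and f, the sums over squares and nonsquares modulo 7, satisfy e + f =
  -1 and e f = 2, so e is -\<tau> or \<tau> - 1. The negative angle of \<open>lam7\<close> gives e a
  negative imaginary part and selects -\<tau>.\<close>

lemma lam7_cubic: "lam7 ^ 3 + \<tau> * lam7 ^ 2 + (\<tau> - 1) * lam7 - 1 = 0"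
proof -
  let ?l = lam7
  have l7: "?l ^ 7 = 1" by (simp add: lam7_power complex_eq_iff)
  define e f where "e = ?l + ?l^2 + ?l^4" and "f = ?l^3 + ?l^5 + ?l^6"
  have "(?l - 1) * (1 + e + f) = ?l ^ 7 - 1"
    by (simp add: e_def f_def algebra_simps power_numeral_reduce)
  then have ef: "f = - 1 - e" using lam7_neq(1) l7 by (simp add: eq_diff_eq add.commute add.left_commute eq_neg_iff_add_eq_0)
  have "e * f = ?l^4 + ?l^6 + ?l^5 + 3 * ?l^7 + ?l^7 * ?l^3 + ?l^7 * ?l + ?l^7 * ?l^2"
    by (simp add: e_def f_def algebra_simps power_numeral_reduce)
  then have "e * f = 3 + e + f" unfolding l7 by (simp add: e_def f_def)
  then have h: "e * (- 1 - e) = 2" unfolding ef by simp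
  have "e * e + e + 2 = 2 - e * (- 1 - e)" by (simp add: algebra_simps)
  then have "e * e + e + 2 = 0" using h by simp
  moreover have "(e + \<tau>) * (e + 1 - \<tau>) = e * e + e + 2" by (simp add: algebra_simps tau_sq)
  ultimately have roots: "e + \<tau> = 0 \<or> e + 1 - \<tau> = 0" by auto
  have "Im e < 0"
  proof -
    have s: "Im e = - (sin (2 * pi / 7) + sin (4 * pi / 7) + sin (8 * pi / 7))"
      using lam7_power[of 2] lam7_power[of 4] by (simp add: e_def) (simp add: lam7_def)
    have "sin (4 * pi / 7) > 0" by (rule sin_gt_zero) (use pi_gt_zero in \<open>simp_all add: field_simps\<close>)
    moreover have "sin (8 * pi / 7) = - sin (pi / 7)"
      using sin_periodic_pi[of "pi / 7"] by (simp add: field_simps)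
    moreover have "sin (pi / 7) < sin (2 * pi / 7)"
      by (rule sin_monotone_2pi) (use pi_gt_zero in \<open>simp_all add: field_simps\<close>)
    ultimately show ?thesis unfolding s by simp
  qed
  moreover have "Im (e + 1 - \<tau>) = Im e - sqrt 7 / 2" by simp
  ultimately have "Im (e + 1 - \<tau>) < 0" using sqrt7_bounds(1) by linarith
  then have "e + 1 - \<tau> \<noteq> 0" by (metis less_irrefl zero_complex.sel(2))
  then have "e + \<tau> = 0" using roots by blast
  then have t1: "\<tau> = - e" by (simp only: add_eq_0_iff)
  have t: "\<tau> = - e" "\<tau> - 1 = f" unfolding ef by (rule t1) (simp add: t1)
  have "?l ^ 3 + (- e) * ?l ^ 2 + f * ?l - 1 = ?l ^ 7 - 1"
    by (simp add: e_def f_def algebra_simps power_numeral_reduce)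
  then show ?thesis unfolding t(2) unfolding t(1) l7 by simp
qed

lemma v7_eigen: "- rep E7 *v v7 = lam7 *s v7" "rep E7 *v v7 = (- lam7) *s v7"
proof -
  have "lam7 ^ 3 + lam7 ^ 2 = 1 - (\<tau> - 1) * lam7 ^ 2 - (\<tau> - 1) * lam7 + (lam7 ^ 3 + \<tau> * lam7 ^ 2 + (\<tau> - 1) * lam7 - 1)"
    by (simp add: algebra_simps)
  then have c: "lam7 ^ 3 + lam7 ^ 2 = 1 - (\<tau> - 1) * lam7 ^ 2 - (\<tau> - 1) * lam7" unfolding lam7_cubic by simp
  have "lam7 * (lam7 * (lam7 + 1)) = lam7 ^ 3 + lam7 ^ 2" by (simp add: algebra_simps power2_eq_square power3_eq_cube)
  then have c': "lam7 * (lam7 * (lam7 + 1)) = 1 + (\<tau> - 1) * (- (lam7 * (lam7 + 1)))"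
    unfolding c by (simp add: algebra_simps power2_eq_square)
  show "rep E7 *v v7 = (- lam7) *s v7" unfolding v7_def vec3_simps by (simp add: c') (simp add: algebra_simps)
  then show "- rep E7 *v v7 = lam7 *s v7" by (simp add: vector_sneg_minus1[symmetric])
qed

lemma v7_neg: "v7 \<in> negative"
proof -
  have u: "lam7 * cnj lam7 = 1" "cnj lam7 * lam7 = 1" using unit_sq[OF cmod_lam7] by (simp_all add: mult.commute)
  have "herm v7 v7 = 1 - (lam7 + cnj lam7) * ((lam7 + 1) * cnj (lam7 + 1))"
    unfolding v7_def vec3_simps using u by (simp add: algebra_simps)
  also have "(lam7 + 1) * cnj (lam7 + 1) = 2 + (lam7 + cnj lam7)" using u by (simp add: algebra_simps)
  also have "lam7 + cnj lam7 = of_real (2 * Re lam7)" by (simp add: complex_eq_iff)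
  finally have "Re (herm v7 v7) = 1 - 2 * Re lam7 * (2 + 2 * Re lam7)" by simp
  moreover have "1 * 3 < 2 * Re lam7 * (2 + 2 * Re lam7)" using Re_lam7 by (intro mult_strict_mono) simp_all
  ultimately show ?thesis by (simp add: negative_def)
qed

lemma eigenvectors_v7: "rep E7 *v x = (- lam7) *s x \<Longrightarrow> \<exists>m. x = m *s v7"
proof -
  assume "rep E7 *v x = (- lam7) *s x"
  then have "rep E7 *v vec3 (x$1) (x$2) (x$3) = (- lam7) *s vec3 (x$1) (x$2) (x$3)" using vec3_eta[of x] by simp
  then have h: "x$3 = - lam7 * x$1 \<and> x$2 + x$3 = - lam7 * x$2 \<and> x$1 - x$2 + (\<tau> - 1) * x$3 = - lam7 * x$3"
    unfolding vec3_simps .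
  note e = h[THEN conjunct1] h[THEN conjunct2, THEN conjunct1]
  have l1: "lam7 + 1 \<noteq> 0" using lam7_neq(2) by (simp add: eq_neg_iff_add_eq_0)
  define m where "m = x$1 / (lam7 + 1)"
  have m: "x$1 = m * (lam7 + 1)" using l1 by (simp add: m_def)
  have "(lam7 + 1) * x$2 = lam7 * x$1"
  proof -
    have "(lam7 + 1) * x$2 = (x$2 + x$3) + lam7 * x$2 - x$3" by (simp add: algebra_simps)
    also have "\<dots> = lam7 * x$1" unfolding e(2) unfolding e(1) by simp
    finally show ?thesis .
  qed
  then have "(lam7 + 1) * x$2 = (lam7 + 1) * (m * lam7)" unfolding m by (simp add: mult_ac)
  then have "x$2 = m * lam7" using l1 unfolding mult_cancel_left by blast
  then have "x = m *s v7" using e(1) m by (simp add: veq3 v7_def mult_ac)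
  then show ?thesis by blast
qed

text \<open>The orbit of u stays orthogonal to \<open>v7\<close>, so u, A u, A^2 u are dependent and
  the cubic form vanishes; being anisotropic, it forces \<open>herm u u\<close> to be 0.\<close>

lemma perp_v7:
  assumes u: "u \<in> O7v" "herm u v7 = 0" shows "herm u u = 0"
proof -
  let ?A = "- rep E7"
  have AU: "?A \<in> U_J" using E7_data(1) by (simp add: UO_def)
  have p: "herm (?A *v w) v7 = 0" if "herm w v7 = 0" for w
  proof -
    have "cnj lam7 * herm (?A *v w) v7 = 0" using U_J_herm[OF AU, of w v7] that unfolding v7_eigen(1) by simp
    then show ?thesis using cmod_lam7 by auto
  qed
  have det0: "det (cols u (?A *v u) (?A *v (?A *v u))) = 0"
  proof (rule ccontr)
    assume "det (cols u (?A *v u) (?A *v (?A *v u))) \<noteq> 0"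
    then obtain a b c where v: "v7 = a *s u + b *s (?A *v u) + c *s (?A *v (?A *v u))" by (rule span_cols)
    have "herm v7 v7 = a * herm u v7 + b * herm (?A *v u) v7 + c * herm (?A *v (?A *v u)) v7"
      by (subst (1) v) (simp only: herm_simps)
    then have "herm v7 v7 = 0" using p[OF u(2)] p[OF p[OF u(2)]] u(2) by simp
    then show False using v7_neg by (simp add: negative_def)
  qed
  obtain a where a: "herm u u = of_int a" using herm_self_int[OF u(1)] by blast
  have "herm u (?A *v u) \<in> O7" using O7v_herm[OF u(1) O7v_A[OF E7_data(1) u(1)]] .
  then obtain p q :: int where pq: "herm u (?A *v u) = of_int p + of_int q * \<tau>" by (rule O7E)
  have "real_of_int (- cubic7 a p q) = 0" using order7_gram_det[OF AU E7_data(2,3) a pq] unfolding det0 by simp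
  then have "cubic7 a p q = 0" by simp
  then have "a = 0" using cubic7_eq_0 by blast
  then show ?thesis using a by simp
qed

text \<open>The recurrence t_(n+3) = -\<tau> t_(n+2) + (1 - \<tau>) t_(n+1) + t_n in coordinates
  with respect to 1 and \<tau>, oldest value first.\<close>

fun order7_step :: "int \<times> int \<Rightarrow> int \<times> int \<Rightarrow> int \<times> int \<Rightarrow> int \<times> int" where
  "order7_step (a, b) (c, d) (e, f) = (a + c + 2 * d + 2 * f, b - c - e - f)"

text \<open>The pairs in \<open>S\<close> are the coordinates of -1, -\<tau> and \<tau> - 1. None of
  the 27 starting triples stays in \<open>S\<close> for four steps.\<close>

lemma order7_step_escapes:
  defines "S \<equiv> {(-1, 0), (0, -1), (-1, 1)}"
  assumes "p \<in> S" "q \<in> S" "r \<in> S" "u = order7_step p q r" "u \<in> S" "v = order7_step q r u" "v \<in> S"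
    "w = order7_step r u v" "w \<in> S"
  shows "order7_step u v w \<notin> S"
proof -
  have "\<forall>p\<in>S. \<forall>q\<in>S. \<forall>r\<in>S. let u = order7_step p q r in u \<in> S \<longrightarrow> (let v = order7_step q r u in v \<in> S \<longrightarrow>
      (let w = order7_step r u v in w \<in> S \<longrightarrow> order7_step u v w \<notin> S))"
    unfolding S_def by (simp add: Let_def)
  then have "let u = order7_step p q r in u \<in> S \<longrightarrow> (let v = order7_step q r u in v \<in> S \<longrightarrow>
      (let w = order7_step r u v in w \<in> S \<longrightarrow> order7_step u v w \<notin> S))"
    using assms(2-4) by blast
  then show ?thesis unfolding Let_def assms(5)[symmetric] unfolding assms(7)[symmetric] unfolding assms(9)[symmetric]
    using assms(6,8,10) by (elim impE)
qed

text \<open>A trace 0, 1 or 2 would provide a lattice vector of nonzero norm that is orthogonal to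
  \<open>v7\<close> or spans its line. The first is impossible because lattice vectors orthogonal to
  \<open>v7\<close> are isotropic, the second because the eigenvalue there is not a unit of
  \<open>O7\<close>.\<close>

lemma stabilizer_v7_trace:
  assumes B: "B \<in> UO" "B *v v7 = d *s v7" "cmod d = 1" and det: "det B = 1"
  shows "trace B \<in> {3, - 1, - \<tau>, \<tau> - 1}"
proof -
  have BU: "B \<in> U_J" using B(1) by (simp add: UO_def)
  have tr2: "trace (B ** B) = (trace B)\<^sup>2 - 2 * cnj (trace B)" by (rule char_poly_unitary(2)[OF BU det])
  have "(B ** B) *v v7 = (d * d) *s v7" by (simp add: B(2) mv_scale flip: matrix_vector_mul_assoc)
  then have "cmod (trace (B ** B)) \<le> 3"
    using elliptic_trace_le[OF U_J_mult[OF BU BU] v7_neg, of "d * d"] B(3) by (simp add: norm_mult)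
  moreover have "cmod (trace B) \<le> 3" by (rule elliptic_trace_le[OF BU v7_neg B(2,3)])
  moreover have "trace B \<in> O7" using UO_D(2)[OF B(1)] by (simp add: trace3 mats_O7_def)
  ultimately have "trace B \<in> {3, - 1, 0, 1, 2, - \<tau>, \<tau> - 1}" unfolding tr2 by (intro trace_filter)
  moreover have "trace B \<noteq> of_int t" if t: "t \<in> {0, 1, 2}" for t
  proof
    assume tr: "trace B = of_int t"
    obtain w k where w: "uni w" "herm w w = of_int k" "k \<noteq> 0" "herm w v7 = 0 \<or> (\<exists>d. v7 = d *s w)"
      by (rule elliptic_fixed_vector[OF B(1) det v7_neg B(2) tr t]) (rule that; assumption)
    have wO: "w \<in> O7v" using w(1) by (rule uni_O7v)
    show False using w(4)
    proof
      assume "herm w v7 = 0"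
      then show False using perp_v7[OF wO] w(2,3) by simp
    next
      assume "\<exists>d. v7 = d *s w"
      then obtain g where g: "v7 = g *s w" by blast
      have v0: "v7 \<noteq> 0" using v7_neg by (rule negative_nonzero)
      then have g0: "g \<noteq> 0" "w \<noteq> 0" using g by auto
      have "g *s (rep E7 *v w) = g *s ((- lam7) *s w)" using v7_eigen(2) unfolding g mv_scale by (simp add: mult.commute)
      then have "rep E7 *v w = (- lam7) *s w" using g0 unfolding vector_mul_lcancel by blast
      then have "- lam7 = 1 \<or> - lam7 = - 1" by (rule O7_eigenvalue[OF UO_rep wO g0(2)]) (simp add: cmod_lam7)
      then show False using lam7_neq by (auto simp: minus_equation_iff)
    qed
  qed
  from this[of 0] this[of 1] this[of 2] have "trace B \<noteq> 0" "trace B \<noteq> 1" "trace B \<noteq> 2" by simp_all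
  ultimately show ?thesis by blast
qed

text \<open>With A = \<open>- rep E7\<close> and B of determinant 1, the traces of A^k B for k < 7
  satisfy a linear recurrence and take only four values. If none of them were 3, they would stay
  among three values for too long; so some A^k B is the identity.\<close>

lemma stabilizer_v7:
  assumes B: "B \<in> UO" "B *v v7 = d *s v7" "cmod d = 1"
  shows "\<exists>k<7. cls B = cls (mpow (rep E7) k)"
proof -
  let ?A = "- rep E7"
  have key: "\<exists>k<7. mpow ?A k ** B = mat 1" if B: "B \<in> UO" "B *v v7 = d *s v7" "cmod d = 1" and det: "det B = 1" for B d
  proof (rule ccontr)
    assume none: "\<not> ?thesis"
    have AU: "?A \<in> U_J" using E7_data(1) by (simp add: UO_def)
    define t where "t = (\<lambda>n. trace (mpow ?A n ** B))"
    have tin: "t k \<in> {- 1, - \<tau>, \<tau> - 1}" if "k < 7" for k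
    proof -
      have 1: "mpow ?A k ** B \<in> UO" by (rule UO_mult[OF mpow_UO[OF E7_data(1)] B(1)])
      have 2: "(mpow ?A k ** B) *v v7 = (d * lam7 ^ k) *s v7"
        by (simp add: B(2) mv_scale mpow_eigenvector[OF v7_eigen(1)] flip: matrix_vector_mul_assoc)
      have 3: "cmod (d * lam7 ^ k) = 1" by (simp add: norm_mult norm_power B(3) cmod_lam7)
      have "det (mpow ?A k) = 1" for k by (induction k) (simp_all only: mpow.simps det_mul E7_data(2) det_I mult_1)
      then have 4: "det (mpow ?A k ** B) = 1" by (simp add: det_mul det)
      have "t k \<noteq> 3"
      proof
        assume "t k = 3"
        then have "mpow ?A k ** B = mat 1" unfolding t_def using elliptic_trace_3[OF UO_D(1)[OF 1] v7_neg 2 3] by blast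
        then show False using none that by blast
      qed
      then show ?thesis using stabilizer_v7_trace[OF 1 2 3 4] unfolding t_def by blast
    qed
    have rec: "t (n + 3) = - \<tau> * t (n + 2) + (1 - \<tau>) * t (n + 1) + t n" for n
    proof -
      have A3: "?A *v (?A *v (?A *v x)) = (- \<tau>) *s (?A *v (?A *v x)) + (1 - \<tau>) *s (?A *v x) + x" for x
        using char_poly_unitary(1)[OF AU E7_data(2), of x] unfolding E7_data(3) by (simp add: cnj_tau veq3 algebra_simps)
      have S: "n + 3 = Suc (Suc (Suc n))" "n + 2 = Suc (Suc n)" "n + 1 = Suc n" by simp_all
      have M: "mpow ?A (n + 3) *v x = (- \<tau>) *s (mpow ?A (n + 2) *v x) + (1 - \<tau>) *s (mpow ?A (n + 1) *v x) + mpow ?A n *v x" for x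
        unfolding S mpow_Suc_vec A3 by (simp only: matrix_vector_right_distrib mv_scale)
      have T: "trace (M ** B) = (M *v column 1 B) $ 1 + (M *v column 2 B) $ 2 + (M *v column 3 B) $ 3" for M :: "complex^3^3"
        by (simp add: trace3 mm_nth mv_nth column_def)
      show ?thesis unfolding t_def T M by (simp add: algebra_simps)
    qed
    define x y :: "nat \<Rightarrow> int" where "x = (\<lambda>k. if t k = - \<tau> then 0 else - 1)"
      and "y = (\<lambda>k. if t k = - \<tau> then - 1 else if t k = - 1 then 0 else 1)"
    have n: "- 1 \<noteq> - \<tau>" "\<tau> - 1 \<noteq> - \<tau>" "\<tau> - 1 \<noteq> - 1" by (auto simp: complex_eq_iff)
    have xy: "t k = of_int (x k) + of_int (y k) * \<tau>" "(x k, y k) \<in> {(-1, 0), (0, -1), (-1, 1)}" if "k < 7" for k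
      using tin[OF that] n by (auto simp: x_def y_def)
    have r: "x (n + 3) = x n + x (n + 1) + 2 * y (n + 1) + 2 * y (n + 2) \<and> y (n + 3) = y n - x (n + 1) - x (n + 2) - y (n + 2)"
      if "n + 3 < 7" for n
    proof -
      have lt: "n + 2 < 7" "n + 1 < 7" "n < 7" using that by simp_all
      have "of_int (x (n + 3)) + of_int (y (n + 3)) * \<tau> = t (n + 3)" using xy(1)[OF that] by simp
      also have "\<dots> = of_int (x n + x (n + 1) + 2 * y (n + 1) + 2 * y (n + 2)) + of_int (y n - x (n + 1) - x (n + 2) - y (n + 2)) * \<tau>"
        unfolding rec xy(1)[OF lt(1)] xy(1)[OF lt(2)] xy(1)[OF lt(3)] by (simp add: algebra_simps tau_sq tau_sq')
      finally have "of_int (x (n + 3)) + of_int (y (n + 3)) * \<tau> = of_int (x n + x (n + 1) + 2 * y (n + 1) + 2 * y (n + 2))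
          + of_int (y n - x (n + 1) - x (n + 2) - y (n + 2)) * \<tau>" .
      from lin_tau_eq_iff[of "real_of_int (x (n + 3))" "real_of_int (y (n + 3))"
          "real_of_int (x n + x (n + 1) + 2 * y (n + 1) + 2 * y (n + 2))" "real_of_int (y n - x (n + 1) - x (n + 2) - y (n + 2))",
          unfolded of_real_of_int_eq of_int_eq_iff, THEN iffD1, OF this]
      show ?thesis .
    qed
    define z where "z = (\<lambda>k. (x k, y k))"
    have zs: "order7_step (z n) (z (n + 1)) (z (n + 2)) = z (n + 3)" if "n + 3 < 7" for n
      using r[OF that] unfolding z_def order7_step.simps by simp
    have z: "z k \<in> {(-1, 0), (0, -1), (-1, 1)}" if "k < 7" for k unfolding z_def by (rule xy(2)[OF that])
    have st: "order7_step (z 0) (z 1) (z 2) = z 3" "order7_step (z 1) (z 2) (z 3) = z 4" "order7_step (z 2) (z 3) (z 4) = z 5"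
      using zs[of 0] zs[of 1] zs[of 2] by (simp_all add: eval_nat_numeral)
    have "order7_step (z 3) (z 4) (z 5) \<notin> {(-1, 0), (0, -1), (-1, 1)}"
      by (rule order7_step_escapes[OF z z z st(1)[symmetric] z st(2)[symmetric] z st(3)[symmetric] z]) simp_all
    moreover have "order7_step (z 3) (z 4) (z 5) = z 6" using zs[of 3] by (simp add: eval_nat_numeral)
    ultimately show False using z[of 6] by simp
  qed
  have "\<exists>B' d'. B' \<in> UO \<and> B' *v v7 = d' *s v7 \<and> cmod d' = 1 \<and> det B' = 1 \<and> cls B' = cls B"
  proof (cases "det B = 1")
    case True
    then show ?thesis using B by blast
  next
    case False
    then have "det (- B) = 1" using det_UO[OF B(1)] det_minus3[of B] by auto
    moreover have "- B *v v7 = (- d) *s v7" by (simp add: B(2))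
    ultimately show ?thesis
      by (intro exI[of _ "- B"] exI[of _ "- d"]) (simp add: UO_minus[OF B(1)] B(3) cls_minus)
  qed
  then obtain B' d' where B': "B' \<in> UO" "B' *v v7 = d' *s v7" "cmod d' = 1" "det B' = 1" "cls B' = cls B" by blast
  obtain k where k: "k < 7" "mpow ?A k ** B' = mat 1" using key[OF B'(1-4)] by blast
  let ?Y = "cls (rep E7)" and ?Z = "cls B"
  have Y: "?Y \<in> carrier \<Gamma>" "?Z \<in> carrier \<Gamma>" using UO_rep B(1) by simp_all
  have y7: "?Y [^]\<^bsub>\<Gamma>\<^esub> (7::nat) = \<one>\<^bsub>\<Gamma>\<^esub>" using Gm.pow_ord_eq_1[OF Y(1)] ord_rep(10) by simp
  have "?Y [^]\<^bsub>\<Gamma>\<^esub> k = cls (mpow ?A k)" using cls_pow[OF E7_data(1), of k] by (simp add: cls_rep_minus)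
  then have 1: "?Y [^]\<^bsub>\<Gamma>\<^esub> k \<otimes>\<^bsub>\<Gamma>\<^esub> ?Z = \<one>\<^bsub>\<Gamma>\<^esub>"
    unfolding B'(5)[symmetric] using cls_mult[OF mpow_UO[OF E7_data(1)] B'(1), of k] k(2) by (simp add: cls_one)
  show ?thesis
  proof (cases "k = 0")
    case True
    then have "?Z = \<one>\<^bsub>\<Gamma>\<^esub>" using 1 Y by simp
    then show ?thesis by (intro exI[of _ 0]) (simp add: cls_one)
  next
    case False
    have "?Y [^]\<^bsub>\<Gamma>\<^esub> (7 - k) \<otimes>\<^bsub>\<Gamma>\<^esub> ?Y [^]\<^bsub>\<Gamma>\<^esub> k = \<one>\<^bsub>\<Gamma>\<^esub>"
      using Gm.nat_pow_mult[OF Y(1), of "7 - k" k] k(1) y7 by simp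
    then have "?Z = ?Y [^]\<^bsub>\<Gamma>\<^esub> (7 - k) \<otimes>\<^bsub>\<Gamma>\<^esub> (?Y [^]\<^bsub>\<Gamma>\<^esub> k \<otimes>\<^bsub>\<Gamma>\<^esub> ?Z)"
      using Y by (simp flip: Gm.m_assoc)
    also have "\<dots> = ?Y [^]\<^bsub>\<Gamma>\<^esub> (7 - k)" unfolding 1 using Y by simp
    also have "\<dots> = cls (mpow (rep E7) (7 - k))" by (rule cls_pow[OF UO_rep])
    finally have "?Z = cls (mpow (rep E7) (7 - k))" .
    moreover have "7 - k < 7" using False by simp
    ultimately show ?thesis by blast
  qed
qed

lemma row_E7: "non_K_row E7 7 7 0 0"
proof -
  have c: "cmod (- lam7) = 1" using cmod_lam7 by simp
  have st: "finite (stabilizer (cline v7)) \<and> card (stabilizer (cline v7)) = 7"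
    by (rule cyclic_stabilizer[OF UO_rep v7_neg v7_eigen(2) c ord_rep(10)]) (use stabilizer_v7 in auto)
  have ne: "- lam7 \<noteq> 1" "- lam7 \<noteq> - 1" using lam7_neq by (auto simp: minus_equation_iff)
  have nK: "\<not> (\<exists>w. (\<forall>k. w $ k \<in> K) \<and> cline v7 = cline w)"
    by (rule not_over_K[OF UO_rep v7_neg v7_eigen(2) c ne])
  have li: "finite (j_lines_through j (cline v7)) \<and> card (j_lines_through j (cline v7)) = 0" if "j > 0" for j
  proof (rule no_lines[OF v7_neg that])
    fix u assume u: "primitive u" "herm u v7 = 0"
    have "herm u u = 0" by (rule perp_v7[OF primitive_O7v[OF u(1)] u(2)])
    then show "herm u u \<noteq> of_nat j" using that by simp
  qed
  note l1 = li[OF zero_less_one] and l2 = li[OF zero_less_numeral[of "num.Bit0 num.One"]]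
  note fp = fixed_point_unique[OF UO_rep v7_neg v7_eigen(2) c eigenvectors_v7]
  have "fixed_point_data E7 7 (cline v7) 7 0 0"
    unfolding fixed_point_data_def by (intro conjI ord_rep(10) fp st[THEN conjunct1] st[THEN conjunct2]
      l1[THEN conjunct1] l1[THEN conjunct2] l2[THEN conjunct1] l2[THEN conjunct2])
  then show ?thesis unfolding non_K_row_def using nK by blast
qed

section \<open>Stabilizers and lines for the possible complements of a fixed vector over
  \<open>K\<close>\<close>

context negative_vector
begin

lemma lines_list:
  assumes j: "j > 0" and fin: "finite C"
    and C: "\<And>r s. (r, s) \<in> C \<Longrightarrow> r \<in> O7 \<and> s \<in> O7 \<and> (r = 1 \<or> s = 1) \<and>
      herm (r *s b + s *s y) (r *s b + s *s y) = of_nat j \<and> (- r, - s) \<notin> C"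
    and all: "\<And>r s. r \<in> O7 \<Longrightarrow> s \<in> O7 \<Longrightarrow> primitive (r *s b + s *s y) \<Longrightarrow>
      herm (r *s b + s *s y) (r *s b + s *s y) = of_nat j \<Longrightarrow> (r, s) \<in> C \<or> (- r, - s) \<in> C"
  shows "j_lines_through j (cline v) = polar_line ` (\<lambda>(r, s). r *s b + s *s y) ` C"
    "inj_on polar_line ((\<lambda>(r, s). r *s b + s *s y) ` C)"
    "finite (j_lines_through j (cline v))" "card (j_lines_through j (cline v)) = card C"
proof -
  have 1: "r \<in> O7 \<and> s \<in> O7 \<and> (\<exists>r'\<in>O7. \<exists>s'\<in>O7. r * s' - s * r' = 1) \<and>
      herm (r *s b + s *s y) (r *s b + s *s y) = of_nat j \<and> (- r, - s) \<notin> C" if rs: "(r, s) \<in> C" for r s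
  proof -
    have O: "(0::complex) \<in> O7" "(1::complex) \<in> O7" "(- 1::complex) \<in> O7" by simp_all
    have "r * 1 - s * 0 = 1 \<or> r * 0 - s * (- 1) = 1" using C[OF rs] by auto
    then have "\<exists>r'\<in>O7. \<exists>s'\<in>O7. r * s' - s * r' = 1" using O by blast
    then show ?thesis using C[OF rs] by blast
  qed
  show "j_lines_through j (cline v) = polar_line ` (\<lambda>(r, s). r *s b + s *s y) ` C"
    by (rule lines_from_coords(1)[OF j fin 1 all])
  show "inj_on polar_line ((\<lambda>(r, s). r *s b + s *s y) ` C)" by (rule lines_from_coords(2)[OF j fin 1 all])
  show "finite (j_lines_through j (cline v))" by (rule lines_from_coords(3)[OF j fin 1 all])
  show "card (j_lines_through j (cline v)) = card C" by (rule lines_from_coords(4)[OF j fin 1 all])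
qed

lemma coordsI:
  assumes "p1 \<in> O7" "q1 \<in> O7" "p2 \<in> O7" "q2 \<in> O7"
    "herm (p1 *s b + q1 *s y) (p1 *s b + q1 *s y) = herm b b"
    "herm (p2 *s b + q2 *s y) (p2 *s b + q2 *s y) = herm y y"
    "herm (p1 *s b + q1 *s y) (p2 *s b + q2 *s y) = herm b y"
    "k \<in> O7" "l \<in> O7" "p * p1 + q * p2 = p + n * k" "p * q1 + q * q2 = q + n * l"
  shows "(p1, q1, p2, q2) \<in> coords"
  unfolding coords_def using assms by blast

lemma coordsE:
  assumes "c \<in> coords"
  obtains p1 q1 p2 q2 k l where "c = (p1, q1, p2, q2)" "p1 \<in> O7" "q1 \<in> O7" "p2 \<in> O7" "q2 \<in> O7"
    "herm (p1 *s b + q1 *s y) (p1 *s b + q1 *s y) = herm b b"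
    "herm (p2 *s b + q2 *s y) (p2 *s b + q2 *s y) = herm y y"
    "herm (p1 *s b + q1 *s y) (p2 *s b + q2 *s y) = herm b y"
    "k \<in> O7" "l \<in> O7" "p * p1 + q * p2 = p + n * k" "p * q1 + q * q2 = q + n * l"
  using assms unfolding coords_def by blast

end

text \<open>Here x = -v, so v splits off, and the complement is the standard lattice of rank 2,
  whose isometries are the eight signed permutation matrices.\<close>

locale vector_norm_1 = negative_vector v x b y 1 0 0 for v x b y +
  assumes gram: "herm b b = 1" "herm y y = 1" "herm b y = 0"
begin

lemma yb: "herm y b = 0" using gram(3) by (rule herm_sym0)

lemma nrm: "herm (r *s b + s *s y) (r *s b + s *s y) = r * cnj r + s * cnj s"
  by (simp add: gram yb mult.commute)

lemma inner: "herm (r *s b + s *s y) (r' *s b + s' *s y) = r * cnj r' + s * cnj s'"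
  by (simp add: gram yb mult.commute)

lemma norm_1_cases:
  assumes "r \<in> O7" "s \<in> O7" "r * cnj r + s * cnj s = 1"
  shows "(r, s) \<in> {(1, 0), (- 1, 0), (0, 1), (0, - 1)}"
proof -
  obtain m where m: "r * cnj r = of_int m" "m \<ge> 0" "m = 0 \<Longrightarrow> r = 0" "m = 1 \<Longrightarrow> r = 1 \<or> r = - 1"
    by (rule O7_norm_cases[OF assms(1)]) blast
  obtain l where l: "s * cnj s = of_int l" "l \<ge> 0" "l = 0 \<Longrightarrow> s = 0" "l = 1 \<Longrightarrow> s = 1 \<or> s = - 1"
    by (rule O7_norm_cases[OF assms(2)]) blast
  have "of_int (m + l) = complex_of_int 1" using assms(3) m(1) l(1) by simp
  then have "m + l = 1" by (simp only: of_int_eq_iff)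
  then have "(m = 0 \<and> l = 1) \<or> (m = 1 \<and> l = 0)" using m(2) l(2) by linarith
  then show ?thesis using m(3,4) l(3,4) by auto
qed

lemma coords_eq: "coords = {(1,0,0,1), (1,0,0,-1), (-1,0,0,1), (-1,0,0,-1), (0,1,1,0), (0,1,-1,0), (0,-1,1,0), (0,-1,-1,0)}"
    (is "_ = ?C")
proof (intro subset_antisym subsetI)
  fix c assume "c \<in> coords"
  then show "c \<in> ?C"
  proof (cases rule: coordsE)
    case (1 p1 q1 p2 q2 k l)
    note n = 1(6,7,8)[unfolded nrm inner gram]
    show ?thesis using norm_1_cases[OF 1(2,3) n(1)] norm_1_cases[OF 1(4,5) n(2)] n(3) unfolding 1(1)
      by (elim insertE emptyE; simp)
  qed
next
  fix c assume "c \<in> ?C"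
  moreover have "(p1, q1, p2, q2) \<in> coords" if "p1 \<in> O7" "q1 \<in> O7" "p2 \<in> O7" "q2 \<in> O7"
    "p1 * cnj p1 + q1 * cnj q1 = 1" "p2 * cnj p2 + q2 * cnj q2 = 1" "p1 * cnj p2 + q1 * cnj q2 = 0" for p1 q1 p2 q2
    by (rule coordsI[OF that(1-4) _ _ _ O7_0 O7_0]) (simp_all only: inner gram that(5-7), simp_all)
  ultimately show "c \<in> coords" by (elim insertE emptyE; simp)
qed

lemma lines_1: "finite (j_lines_through 1 (cline v))" "card (j_lines_through 1 (cline v)) = 2"
proof -
  have f: "finite {(1::complex, 0::complex), (0, 1)}" by simp
  have 1: "r \<in> O7 \<and> s \<in> O7 \<and> (r = 1 \<or> s = 1) \<and> herm (r *s b + s *s y) (r *s b + s *s y) = of_nat 1 \<and>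
      (- r, - s) \<notin> {(1::complex, 0::complex), (0, 1)}"
    if "(r, s) \<in> {(1::complex, 0::complex), (0, 1)}" for r s
    using that unfolding nrm by auto
  have 2: "(r, s) \<in> {(1, 0), (0, 1)} \<or> (- r, - s) \<in> {(1, 0), (0, 1)}"
    if r: "r \<in> O7" "s \<in> O7" "primitive (r *s b + s *s y)" "herm (r *s b + s *s y) (r *s b + s *s y) = of_nat 1" for r s
    using norm_1_cases[OF r(1,2)] r(4) unfolding nrm by auto
  show "finite (j_lines_through 1 (cline v))" by (rule lines_list(3)[OF zero_less_one f 1 2])
  have "card (j_lines_through 1 (cline v)) = card {(1::complex, 0::complex), (0, 1)}"
    by (rule lines_list(4)[OF zero_less_one f 1 2])
  then show "card (j_lines_through 1 (cline v)) = 2" by simp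
qed

lemma lines_2: "finite (j_lines_through 2 (cline v))" "card (j_lines_through 2 (cline v)) = 2"
proof -
  have f: "finite {(1::complex, 1::complex), (1, - 1)}" by simp
  have 1: "r \<in> O7 \<and> s \<in> O7 \<and> (r = 1 \<or> s = 1) \<and> herm (r *s b + s *s y) (r *s b + s *s y) = of_nat 2 \<and>
      (- r, - s) \<notin> {(1::complex, 1::complex), (1, - 1)}"
    if "(r, s) \<in> {(1::complex, 1::complex), (1, - 1)}" for r s
    using that unfolding nrm by auto
  have 2: "(r, s) \<in> {(1, 1), (1, - 1)} \<or> (- r, - s) \<in> {(1, 1), (1, - 1)}"
    if r: "r \<in> O7" "s \<in> O7" "primitive (r *s b + s *s y)" "herm (r *s b + s *s y) (r *s b + s *s y) = of_nat 2" for r s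
  proof -
    obtain m where m: "r * cnj r = of_int m" "m \<ge> 0" "m = 0 \<Longrightarrow> r = 0" "m = 1 \<Longrightarrow> r = 1 \<or> r = - 1"
      by (rule O7_norm_cases[OF r(1)]) blast
    obtain l where l: "s * cnj s = of_int l" "l \<ge> 0" "l = 0 \<Longrightarrow> s = 0" "l = 1 \<Longrightarrow> s = 1 \<or> s = - 1"
      by (rule O7_norm_cases[OF r(2)]) blast
    have "of_int (m + l) = complex_of_int 2" using r(4) m(1) l(1) unfolding nrm by simp
    then have "m + l = 2" by (simp only: of_int_eq_iff)
    then consider "m = 1 \<and> l = 1" | "m = 0" "l = 2" | "l = 0" "m = 2" using m(2) l(2) by linarith
    then show ?thesis
    proof cases
      case 1
      then show ?thesis using m(4) l(4) by auto
    next
      case 2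
      then have "primitive (s *s y)" using m(3) r(3) by simp
      then have "s = 1 \<or> s = - 1" using primitive_comb O(4) r(2) by blast
      then show ?thesis using l(1) 2 by auto
    next
      case 3
      then have "primitive (r *s b)" using l(3) r(3) by simp
      then have "r = 1 \<or> r = - 1" using primitive_comb O(3) r(1) by blast
      then show ?thesis using m(1) 3 by auto
    qed
  qed
  show "finite (j_lines_through 2 (cline v))" by (rule lines_list(3)[OF zero_less_numeral f 1 2])
  have "card (j_lines_through 2 (cline v)) = card {(1::complex, 1::complex), (1, - 1)}"
    by (rule lines_list(4)[OF zero_less_numeral f 1 2])
  then show "card (j_lines_through 2 (cline v)) = 2" by simp
qed

lemma data:
  "finite (stabilizer (cline v)) \<and> card (stabilizer (cline v)) = 8 \<and>
   finite (j_lines_through 1 (cline v)) \<and> card (j_lines_through 1 (cline v)) = 2 \<and>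
   finite (j_lines_through 2 (cline v)) \<and> card (j_lines_through 2 (cline v)) = 2"
proof -
  have f: "finite coords" "card coords = 8" unfolding coords_eq by simp_all
  show ?thesis
    by (intro conjI stabilizer_card(1)[OF refl f(1)] stabilizer_card(2)[OF refl f(1), unfolded f(2)] lines_1 lines_2)
qed

end

text \<open>The glue is 2 x = y - v. Vectors r b with |r|^2 = 2 also have norm 2, but they are not
  primitive and give no 2-line.\<close>

locale vector_norm_2_split = negative_vector v x b y 2 0 1 for v x b y +
  assumes gram: "herm b b = 1" "herm y y = 2" "herm b y = 0"
begin

lemma yb: "herm y b = 0" using gram(3) by (rule herm_sym0)

lemma nrm: "herm (r *s b + s *s y) (r *s b + s *s y) = r * cnj r + 2 * (s * cnj s)"
  by (simp add: gram yb mult.commute)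

lemma inner: "herm (r *s b + s *s y) (r' *s b + s' *s y) = r * cnj r' + 2 * (s * cnj s')"
  by (simp add: gram yb mult.commute)

lemma norm_1_cases:
  assumes "r \<in> O7" "s \<in> O7" "r * cnj r + 2 * (s * cnj s) = 1"
  shows "(r, s) \<in> {(1, 0), (- 1, 0)}"
proof -
  obtain m where m: "r * cnj r = of_int m" "m \<ge> 0" "m = 1 \<Longrightarrow> r = 1 \<or> r = - 1"
    by (rule O7_norm_cases[OF assms(1)]) blast
  obtain l where l: "s * cnj s = of_int l" "l \<ge> 0" "l = 0 \<Longrightarrow> s = 0"
    by (rule O7_norm_cases[OF assms(2)]) blast
  have "of_int (m + 2 * l) = complex_of_int 1" using assms(3) m(1) l(1) by simp
  then have "m + 2 * l = 1" by (simp only: of_int_eq_iff)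
  then have "m = 1 \<and> l = 0" using m(2) l(2) by presburger
  then show ?thesis using m(3) l(3) by auto
qed

lemma norm_2_cases:
  assumes "r \<in> O7" "s \<in> O7" "r * cnj r + 2 * (s * cnj s) = 2"
  shows "(r, s) \<in> {(0, 1), (0, - 1)} \<or> s = 0 \<and> r * cnj r = 2"
proof -
  obtain m where m: "r * cnj r = of_int m" "m \<ge> 0" "m = 0 \<Longrightarrow> r = 0"
    by (rule O7_norm_cases[OF assms(1)]) blast
  obtain l where l: "s * cnj s = of_int l" "l \<ge> 0" "l = 0 \<Longrightarrow> s = 0" "l = 1 \<Longrightarrow> s = 1 \<or> s = - 1"
    by (rule O7_norm_cases[OF assms(2)]) blast
  have "of_int (m + 2 * l) = complex_of_int 2" using assms(3) m(1) l(1) by simp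
  then have "m + 2 * l = 2" by (simp only: of_int_eq_iff)
  then have "(m = 0 \<and> l = 1) \<or> (m = 2 \<and> l = 0)" using m(2) l(2) by presburger
  then show ?thesis using m(1,3) l(3,4) by auto
qed

lemma coords_eq: "coords = {(1,0,0,1), (1,0,0,-1), (-1,0,0,1), (-1,0,0,-1)}" (is "_ = ?C")
proof (intro subset_antisym subsetI)
  fix c assume "c \<in> coords"
  then show "c \<in> ?C"
  proof (cases rule: coordsE)
    case (1 p1 q1 p2 q2 k l)
    note n = 1(6,7,8)[unfolded nrm inner gram]
    show ?thesis using norm_1_cases[OF 1(2,3) n(1)] norm_2_cases[OF 1(4,5) n(2)] n(3) unfolding 1(1)
      by (elim insertE emptyE disjE conjE; simp)
  qed
next
  fix c assume "c \<in> ?C"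
  then show "c \<in> coords"
    using coordsI[of "1" 0 0 1 0 0] coordsI[of "- 1" 0 0 1 0 0] coordsI[of "1" 0 0 "- 1" 0 "- 1"] coordsI[of "- 1" 0 0 "- 1" 0 "- 1"]
    by (elim insertE emptyE) (simp_all add: gram)
qed

lemma lines_1: "finite (j_lines_through 1 (cline v))" "card (j_lines_through 1 (cline v)) = 1"
proof -
  have f: "finite {(1::complex, 0::complex)}" by simp
  have 1: "r \<in> O7 \<and> s \<in> O7 \<and> (r = 1 \<or> s = 1) \<and> herm (r *s b + s *s y) (r *s b + s *s y) = of_nat 1 \<and>
      (- r, - s) \<notin> {(1::complex, 0::complex)}"
    if "(r, s) \<in> {(1::complex, 0::complex)}" for r s
    using that unfolding nrm by auto
  have 2: "(r, s) \<in> {(1, 0)} \<or> (- r, - s) \<in> {(1, 0)}"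
    if r: "r \<in> O7" "s \<in> O7" "primitive (r *s b + s *s y)" "herm (r *s b + s *s y) (r *s b + s *s y) = of_nat 1" for r s
    using norm_1_cases[OF r(1,2)] r(4) unfolding nrm by auto
  show "finite (j_lines_through 1 (cline v))" by (rule lines_list(3)[OF zero_less_one f 1 2])
  have "card (j_lines_through 1 (cline v)) = card {(1::complex, 0::complex)}"
    by (rule lines_list(4)[OF zero_less_one f 1 2])
  then show "card (j_lines_through 1 (cline v)) = 1" by simp
qed

lemma lines_2: "finite (j_lines_through 2 (cline v))" "card (j_lines_through 2 (cline v)) = 1"
proof -
  have f: "finite {(0::complex, 1::complex)}" by simp
  have 1: "r \<in> O7 \<and> s \<in> O7 \<and> (r = 1 \<or> s = 1) \<and> herm (r *s b + s *s y) (r *s b + s *s y) = of_nat 2 \<and>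
      (- r, - s) \<notin> {(0::complex, 1::complex)}"
    if "(r, s) \<in> {(0::complex, 1::complex)}" for r s
    using that unfolding nrm by auto
  have 2: "(r, s) \<in> {(0, 1)} \<or> (- r, - s) \<in> {(0, 1)}"
    if r: "r \<in> O7" "s \<in> O7" "primitive (r *s b + s *s y)" "herm (r *s b + s *s y) (r *s b + s *s y) = of_nat 2" for r s
  proof -
    have "\<not> (s = 0 \<and> r * cnj r = 2)"
    proof
      assume s: "s = 0 \<and> r * cnj r = 2"
      then have "primitive (r *s b)" using r(3) by simp
      then have "r = 1 \<or> r = - 1" using primitive_comb O(3) r(1) by blast
      then show False using s by auto
    qed
    then show ?thesis using norm_2_cases[OF r(1,2)] r(4) unfolding nrm by auto
  qed
  show "finite (j_lines_through 2 (cline v))" by (rule lines_list(3)[OF zero_less_numeral f 1 2])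
  have "card (j_lines_through 2 (cline v)) = card {(0::complex, 1::complex)}"
    by (rule lines_list(4)[OF zero_less_numeral f 1 2])
  then show "card (j_lines_through 2 (cline v)) = 1" by simp
qed

lemma data:
  "finite (stabilizer (cline v)) \<and> card (stabilizer (cline v)) = 4 \<and>
   finite (j_lines_through 1 (cline v)) \<and> card (j_lines_through 1 (cline v)) = 1 \<and>
   finite (j_lines_through 2 (cline v)) \<and> card (j_lines_through 2 (cline v)) = 1"
proof -
  have f: "finite coords" "card coords = 4" unfolding coords_eq by simp_all
  show ?thesis
    by (intro conjI stabilizer_card(1)[OF refl f(1)] stabilizer_card(2)[OF refl f(1), unfolded f(2)] lines_1 lines_2)
qed

end

text \<open>The complement is the hexagonal lattice, with glue 3 x = a (b - y) - v. Of its twelve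
  isometries six fix the glue class.\<close>

locale vector_norm_3 = negative_vector v x b y 3 a "- a" for v x b y a +
  assumes gram: "herm b b = 2" "herm y y = 2" "herm b y = - 1" and a: "a \<in> O7" "a * cnj a = 2"
begin

lemma yb: "herm y b = - 1" using gram(3) herm_cnj[of b y] by simp

lemma nrm: "herm (r *s b + s *s y) (r *s b + s *s y) = r * cnj r + s * cnj s + (r - s) * cnj (r - s)"
  by (simp add: gram yb algebra_simps)

lemma inner: "herm (r *s b + s *s y) (r' *s b + s' *s y) = 2 * (r * cnj r') + 2 * (s * cnj s') - r * cnj s' - s * cnj r'"
  by (simp add: gram yb algebra_simps)

text \<open>The norm 2 of a is invertible modulo 3, so a can be cancelled.\<close>

lemma mod_3:
  assumes "k \<in> O7" "a * of_int t = 3 * k" shows "3 dvd t"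
proof -
  have "complex_of_int (2 * t) = (a * cnj a) * of_int t" using a(2) by simp
  also have "\<dots> = cnj a * (a * of_int t)" by (simp only: mult_ac)
  also have "\<dots> = (cnj a * k) * of_int 3" unfolding assms(2) by simp
  finally have "(cnj a * k) * of_int 3 = of_int (2 * t)" by (rule sym)
  from O7_dvd_int[OF _ this] have "3 dvd 2 * t" using a(1) assms(1) by simp
  then show ?thesis by presburger
qed

lemma coordsI':
  assumes "p1 \<in> O7" "q1 \<in> O7" "p2 \<in> O7" "q2 \<in> O7" "k \<in> O7" "l \<in> O7"
    "p1 * cnj p1 + q1 * cnj q1 + (p1 - q1) * cnj (p1 - q1) = 2"
    "p2 * cnj p2 + q2 * cnj q2 + (p2 - q2) * cnj (p2 - q2) = 2"
    "2 * (p1 * cnj p2) + 2 * (q1 * cnj q2) - p1 * cnj q2 - q1 * cnj p2 = - 1"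
    "p1 - p2 = 1 + 3 * k" "q1 - q2 = - 1 + 3 * l"
  shows "(p1, q1, p2, q2) \<in> coords"
proof -
  have "p1 = p2 + 1 + 3 * k" "q1 = q2 - 1 + 3 * l" using assms(10,11) by (simp_all add: diff_eq_eq)
  then have "a * p1 + - a * p2 = a + 3 * (a * k)" "a * q1 + - a * q2 = - a + 3 * (a * l)"
    by (simp_all only: distrib_left right_diff_distrib mult_minus_left) (simp_all add: mult.left_commute)
  then show ?thesis
    by (intro coordsI[OF assms(1-4) _ _ _ O7_mult[OF a(1) assms(5)] O7_mult[OF a(1) assms(6)]])
      (simp_all only: nrm inner gram assms(7-9))
qed

lemma coords_eq: "coords = {(1,0,0,1), (0,1,-1,-1), (-1,-1,1,0), (-1,0,1,1), (0,-1,-1,0), (1,1,0,-1)}" (is "_ = ?C")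
proof (intro subset_antisym subsetI)
  fix c assume "c \<in> coords"
  then show "c \<in> ?C"
  proof (cases rule: coordsE)
    case (1 p1 q1 p2 q2 k l)
    note n = 1(6,7,8)[unfolded nrm inner gram]
    note c = O7_hexagonal_norm(2)[OF 1(2,3) n(1)] O7_hexagonal_norm(2)[OF 1(4,5) n(2)]
    \<comment> \<open>The short vectors have coordinates 0, 1 and -1, so the glue condition becomes
      the integer congruence p1 - p2 = 1 modulo 3.\<close>
    obtain i1 i2 where i: "p1 = of_int i1" "p2 = of_int i2"
      using c by (elim insertE emptyE; simp) (metis of_int_0 of_int_1 of_int_minus)+
    have "a * of_int (i1 - i2 - 1) = 3 * k" using 1(11) by (simp add: i algebra_simps)
    then have "3 dvd i1 - i2 - 1" by (rule mod_3[OF 1(9)])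
    then have "i1 - i2 \<noteq> 0" "i1 - i2 \<noteq> - 1" "i1 - i2 \<noteq> 2" by auto
    then have "complex_of_int (i1 - i2) \<noteq> of_int 0" "complex_of_int (i1 - i2) \<noteq> of_int (- 1)" "complex_of_int (i1 - i2) \<noteq> of_int 2"
      unfolding of_int_eq_iff by simp_all
    then have *: "p1 - p2 \<noteq> 0" "p1 - p2 \<noteq> - 1" "p1 - p2 \<noteq> 2" by (simp_all add: i)
    show ?thesis using c n(3) * unfolding 1(1) by (elim insertE emptyE; simp)
  qed
next
  fix c assume "c \<in> ?C"
  then show "c \<in> coords"
  proof (elim insertE emptyE; hypsubst)
    show "(1, 0, 0, 1) \<in> coords" by (rule coordsI'[of 1 0 0 1 0 0]) simp_all
    show "(0, - 1, - 1, 0) \<in> coords" by (rule coordsI'[of 0 "- 1" "- 1" 0 0 0]) simp_all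
    show "(0, 1, - 1, - 1) \<in> coords" by (rule coordsI'[of 0 1 "- 1" "- 1" 0 1]) simp_all
    show "(1, 1, 0, - 1) \<in> coords" by (rule coordsI'[of 1 1 0 "- 1" 0 1]) simp_all
    show "(- 1, - 1, 1, 0) \<in> coords" by (rule coordsI'[of "- 1" "- 1" 1 0 "- 1" 0]) simp_all
    show "(- 1, 0, 1, 1) \<in> coords" by (rule coordsI'[of "- 1" 0 1 1 "- 1" 0]) simp_all
  qed
qed

lemma lines_1: "finite (j_lines_through 1 (cline v))" "card (j_lines_through 1 (cline v)) = 0"
proof -
  have f: "finite ({} :: (complex \<times> complex) set)" by simp
  have 1: "r \<in> O7 \<and> s \<in> O7 \<and> (r = 1 \<or> s = 1) \<and> herm (r *s b + s *s y) (r *s b + s *s y) = of_nat 1 \<and>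
      (- r, - s) \<notin> {}" if "(r, s) \<in> {}" for r s
    using that by simp
  have 2: "(r, s) \<in> {} \<or> (- r, - s) \<in> {}"
    if r: "r \<in> O7" "s \<in> O7" "primitive (r *s b + s *s y)" "herm (r *s b + s *s y) (r *s b + s *s y) = of_nat 1" for r s
    using O7_hexagonal_norm(1)[OF r(1,2)] r(4) unfolding nrm by simp
  show "finite (j_lines_through 1 (cline v))" by (rule lines_list(3)[OF zero_less_one f 1 2])
  have "card (j_lines_through 1 (cline v)) = card ({} :: (complex \<times> complex) set)"
    by (rule lines_list(4)[OF zero_less_one f 1 2])
  then show "card (j_lines_through 1 (cline v)) = 0" by simp
qed

lemma lines_2: "finite (j_lines_through 2 (cline v))" "card (j_lines_through 2 (cline v)) = 3"
proof -
  have f: "finite {(1::complex, 0::complex), (0, 1), (1, 1)}" by simp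
  have 1: "r \<in> O7 \<and> s \<in> O7 \<and> (r = 1 \<or> s = 1) \<and> herm (r *s b + s *s y) (r *s b + s *s y) = of_nat 2 \<and>
      (- r, - s) \<notin> {(1::complex, 0::complex), (0, 1), (1, 1)}"
    if "(r, s) \<in> {(1::complex, 0::complex), (0, 1), (1, 1)}" for r s
    using that unfolding nrm by auto
  have 2: "(r, s) \<in> {(1, 0), (0, 1), (1, 1)} \<or> (- r, - s) \<in> {(1, 0), (0, 1), (1, 1)}"
    if r: "r \<in> O7" "s \<in> O7" "primitive (r *s b + s *s y)" "herm (r *s b + s *s y) (r *s b + s *s y) = of_nat 2" for r s
    using O7_hexagonal_norm(2)[OF r(1,2)] r(4) unfolding nrm of_nat_numeral by auto
  show "finite (j_lines_through 2 (cline v))" by (rule lines_list(3)[OF zero_less_numeral f 1 2])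
  have "card (j_lines_through 2 (cline v)) = card {(1::complex, 0::complex), (0, 1), (1, 1)}"
    by (rule lines_list(4)[OF zero_less_numeral f 1 2])
  then show "card (j_lines_through 2 (cline v)) = 3" by simp
qed

lemma data:
  "finite (stabilizer (cline v)) \<and> card (stabilizer (cline v)) = 6 \<and>
   finite (j_lines_through 1 (cline v)) \<and> card (j_lines_through 1 (cline v)) = 0 \<and>
   finite (j_lines_through 2 (cline v)) \<and> card (j_lines_through 2 (cline v)) = 3"
proof -
  have f: "finite coords" "card coords = 6" unfolding coords_eq by simp_all
  show ?thesis
    by (intro conjI stabilizer_card(1)[OF refl f(1)] stabilizer_card(2)[OF refl f(1), unfolded f(2)] lines_1 lines_2)
qed

end

text \<open>The complement has determinant 2, no vector of norm 1 and eight of norm 2; its glue is 2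
  x = cnj d b + d y - v. Both primes d above 2 are allowed.\<close>

locale vector_norm_2_tau = negative_vector v x b y 2 "cnj d" d for v x b y d +
  assumes gram: "herm b b = 2" "herm y y = 2" "herm b y = - d" and d: "d = \<tau> \<or> d = 1 - \<tau>"
begin

lemma dO: "d \<in> O7" "cnj d \<in> O7" using d by (auto simp: cnj_tau)

lemma dd: "d * cnj d = 2" "cnj d * d = 2"
  using d by (elim disjE; hypsubst; simp add: cnj_tau tau_sq algebra_simps)+

lemma Re_d: "Re d = 1/2" and Im_d: "Im d * Im d = 7/4" using d by (auto simp: sqrt7_sq)

lemma d_neq: "d \<noteq> 0" "d \<noteq> 1" "d \<noteq> - 1" "- d \<noteq> 1" "cnj d \<noteq> - 1" "- cnj d \<noteq> 1"
  using Re_d by (auto simp: complex_eq_iff)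

lemma yb: "herm y b = - cnj d" using gram(3) herm_cnj[of b y] by simp

lemma inner: "herm (r *s b + s *s y) (r' *s b + s' *s y) = 2 * (r * cnj r') + 2 * (s * cnj s') - d * (r * cnj s') - cnj d * (s * cnj r')"
  by (simp add: gram yb algebra_simps)

text \<open>Completing the square in either variable writes 2 N as the norm of an element of
  \<open>O7\<close> plus twice the norm of s or of r, which bounds both norms by N.\<close>

lemma norm_cases:
  assumes rs: "r \<in> O7" "s \<in> O7"
  defines "N \<equiv> herm (r *s b + s *s y) (r *s b + s *s y)"
  shows "N \<noteq> 1"
    "N = 2 \<Longrightarrow> (r, s) \<in> {(1, 0), (- 1, 0), (0, 1), (0, - 1), (1, d), (- 1, - d), (cnj d, 1), (- cnj d, - 1)}"
proof -
  obtain m where m: "r * cnj r = of_int m" "m \<ge> 0" "m = 0 \<Longrightarrow> r = 0" "m = 1 \<Longrightarrow> r = 1 \<or> r = - 1"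
    by (rule O7_norm_cases[OF rs(1)]) blast
  obtain l where l: "s * cnj s = of_int l" "l \<ge> 0" "l = 0 \<Longrightarrow> s = 0" "l = 1 \<Longrightarrow> s = 1 \<or> s = - 1"
    by (rule O7_norm_cases[OF rs(2)]) blast
  have O: "2 * r - cnj d * s \<in> O7" "2 * s - d * r \<in> O7" using rs dO by simp_all
  obtain k where k: "(2 * r - cnj d * s) * cnj (2 * r - cnj d * s) = of_int k" "k \<ge> 0" "k = 0 \<Longrightarrow> 2 * r - cnj d * s = 0"
    by (rule O7_norm_cases[OF O(1)]) blast
  obtain h where h: "(2 * s - d * r) * cnj (2 * s - d * r) = of_int h" "h \<ge> 0" "h = 0 \<Longrightarrow> 2 * s - d * r = 0"
    by (rule O7_norm_cases[OF O(2)]) blast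
  have N: "N = 2 * (r * cnj r) + 2 * (s * cnj s) - d * (r * cnj s) - cnj d * (s * cnj r)" unfolding N_def by (rule inner)
  have "(2 * r - cnj d * s) * cnj (2 * r - cnj d * s) = 4 * (r * cnj r) + d * cnj d * (s * cnj s) - 2 * (d * (r * cnj s) + cnj d * (s * cnj r))"
    "(2 * s - d * r) * cnj (2 * s - d * r) = 4 * (s * cnj s) + d * cnj d * (r * cnj r) - 2 * (d * (r * cnj s) + cnj d * (s * cnj r))"
    by (simp_all add: algebra_simps)
  then have "2 * N = (2 * r - cnj d * s) * cnj (2 * r - cnj d * s) + 2 * (s * cnj s)"
    "2 * N = (2 * s - d * r) * cnj (2 * s - d * r) + 2 * (r * cnj r)"
    unfolding N dd by (simp_all add: algebra_simps)
  then have N2: "2 * N = of_int (k + 2 * l)" "2 * N = of_int (h + 2 * m)" unfolding k(1) h(1) m(1) l(1) by simp_all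
  have zero: "m = 0 \<Longrightarrow> N = of_int (2 * l)" "l = 0 \<Longrightarrow> N = of_int (2 * m)"
    using m(1,3) l(1,3) by (auto simp: N)
  have kk: "k = 0 \<Longrightarrow> s = d * r" "h = 0 \<Longrightarrow> r = cnj d * s"
  proof -
    assume "k = 0"
    then have "d * (2 * r) = d * cnj d * s" using k(3) by simp
    then show "s = d * r" unfolding dd by simp
  next
    assume "h = 0"
    then have "cnj d * (2 * s) = cnj d * d * r" using h(3) by simp
    then show "r = cnj d * s" unfolding dd by simp
  qed
  have kl: "k = 0 \<Longrightarrow> l = 2 * m"
  proof -
    assume "k = 0"
    then have "s * cnj s = d * cnj d * (r * cnj r)" using kk(1) by (simp add: mult_ac)
    then have "complex_of_int l = of_int (2 * m)" unfolding dd m(1) l(1) by simp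
    then show "l = 2 * m" by (simp only: of_int_eq_iff)
  qed
  have one: "m = 1 \<Longrightarrow> l = 1 \<Longrightarrow> N \<noteq> 1 \<and> N \<noteq> 2"
  proof -
    assume ml: "m = 1" "l = 1"
    have "Re N = 3 \<or> Re N = 5" using m(4)[OF ml(1)] l(4)[OF ml(2)] by (auto simp: N Re_d)
    then show "N \<noteq> 1 \<and> N \<noteq> 2" by auto
  qed
  show "N \<noteq> 1"
  proof
    assume N1: "N = 1"
    then have "complex_of_int (k + 2 * l) = of_int 2" "complex_of_int (h + 2 * m) = of_int 2" using N2 by simp_all
    then have kh: "k + 2 * l = 2" "h + 2 * m = 2" by (simp_all only: of_int_eq_iff)
    have z: "m \<noteq> 0" "l \<noteq> 0"
    proof -
      have "complex_of_int (2 * j) \<noteq> of_int 1" for j unfolding of_int_eq_iff by presburger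
      then show "m \<noteq> 0" "l \<noteq> 0" using zero N1 by auto
    qed
    then have "m = 1" "l = 1" using kh k(2) h(2) m(2) l(2) by linarith+
    then show False using one N1 by blast
  qed
  assume N2': "N = 2"
  then have "complex_of_int (k + 2 * l) = of_int 4" "complex_of_int (h + 2 * m) = of_int 4" using N2 by simp_all
  then have kh: "k + 2 * l = 4" "h + 2 * m = 4" by (simp_all only: of_int_eq_iff)
  have z: "m = 0 \<Longrightarrow> l = 1" "l = 0 \<Longrightarrow> m = 1"
  proof -
    have "complex_of_int (2 * j) = of_int 2 \<Longrightarrow> j = 1" for j unfolding of_int_eq_iff by presburger
    then show "m = 0 \<Longrightarrow> l = 1" "l = 0 \<Longrightarrow> m = 1" using zero N2' by auto
  qed
  have b: "m \<le> 2" "l \<le> 2" "0 \<le> m" "0 \<le> l" using kh k(2) h(2) m(2) l(2) by linarith+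
  have "\<not> (m = 1 \<and> l = 1)" using one N2' by blast
  moreover have "\<not> (m = 2 \<and> l = 2)" using kh kl by auto
  moreover have "m = 0 \<or> m = 1 \<or> m = 2" "l = 0 \<or> l = 1 \<or> l = 2" using b by presburger+
  ultimately consider "m = 0" "l = 1" | "l = 0" "m = 1" | "m = 1" "l = 2" "k = 0" | "m = 2" "l = 1" "h = 0"
    using z kh by auto
  then show "(r, s) \<in> {(1, 0), (- 1, 0), (0, 1), (0, - 1), (1, d), (- 1, - d), (cnj d, 1), (- cnj d, - 1)}"
  proof cases
    case 1
    then show ?thesis using m(3) l(4) by auto
  next
    case 2
    then show ?thesis using m(4) l(3) by auto
  next
    case 3
    then show ?thesis using m(4) kk(1) by auto
  next
    case 4
    then show ?thesis using l(4) kk(2) by auto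
  qed
qed

text \<open>The two primes above 2 are not associated: their quotient would be a unit, hence 1 or
  -1.\<close>

lemma not_dvd: "l \<in> O7 \<Longrightarrow> cnj d \<noteq> d * l"
proof
  assume l: "l \<in> O7" and e: "cnj d = d * l"
  have "cmod d = cmod d * cmod l" using arg_cong[OF e, of cmod] by (simp add: norm_mult)
  then have "cmod l = 1" using d_neq by simp
  then have "l = 1 \<or> l = - 1" using O7_unit l by blast
  then show False using e Re_d Im_d by (auto simp: complex_eq_iff)
qed

lemma coords_eq: "coords = {(1, 0, 0, 1), (- 1, 0, 0, - 1), (1, 0, - cnj d, - 1), (- 1, 0, cnj d, 1),
    (1, d, - cnj d, - 1), (- 1, - d, cnj d, 1), (1, d, 0, - 1), (- 1, - d, 0, 1)}" (is "_ = ?C")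
proof (intro subset_antisym subsetI)
  fix c assume "c \<in> coords"
  then show "c \<in> ?C"
  proof (cases rule: coordsE)
    case (1 p1 q1 p2 q2 k l)
    note c1 = norm_cases(2)[OF 1(2,3), unfolded 1(6) gram, OF refl]
    note c2 = norm_cases(2)[OF 1(4,5), unfolded 1(7) gram, OF refl]
    \<comment> \<open>Modulo d the glue condition makes d divide cnj d q1, so q1 is not a unit: up
      to sign, b is never sent to y or to cnj d b + y.\<close>
    have q1: "q1 \<noteq> 1" "q1 \<noteq> - 1"
    proof -
      have "d * (1 + cnj d * l - q2) = d + d * cnj d * l - d * q2" by (simp add: algebra_simps)
      also have "\<dots> = cnj d * q1" using 1(12) unfolding dd by (simp add: algebra_simps)
      finally have *: "cnj d * q1 = d * (1 + cnj d * l - q2)" by simp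
      have TO: "1 + cnj d * l - q2 \<in> O7" using 1(5,10) dO by simp
      obtain T where T: "T \<in> O7" "cnj d * q1 = d * T" by (rule that[OF TO *])
      show "q1 \<noteq> 1" using not_dvd[OF T(1)] T(2) by auto
      show "q1 \<noteq> - 1"
      proof
        assume "q1 = - 1"
        then have "cnj d = d * - T" using T(2) by (metis minus_minus mult_minus1_right mult_minus_right)
        then show False using not_dvd[OF O7_uminus[OF T(1)]] by blast
      qed
    qed
    have i: "Re (2 * (p1 * cnj p2) + 2 * (q1 * cnj q2) - d * (p1 * cnj q2) - cnj d * (q1 * cnj p2)) = Re (- d)"
      by (rule arg_cong[OF 1(8)[unfolded inner gram]])
    have dx: "d * (cnj d * x) = 2 * x" "cnj d * (d * x) = 2 * x" for x by (simp_all add: dd flip: mult.assoc)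
    have c1': "(p1, q1) = (1, 0) \<or> (p1, q1) = (- 1, 0) \<or> (p1, q1) = (1, d) \<or> (p1, q1) = (- 1, - d)"
      using c1 q1 by auto
    show ?thesis unfolding 1(1) using c1' c2 i
      by (elim disjE insertE emptyE; simp add: Re_d dd dx)
  qed
next
  fix c assume "c \<in> ?C"
  have I: "(p1, q1, p2, q2) \<in> coords" if "p1 \<in> O7" "q1 \<in> O7" "p2 \<in> O7" "q2 \<in> O7"
    "2 * (p1 * cnj p1) + 2 * (q1 * cnj q1) - d * (p1 * cnj q1) - cnj d * (q1 * cnj p1) = 2"
    "2 * (p2 * cnj p2) + 2 * (q2 * cnj q2) - d * (p2 * cnj q2) - cnj d * (q2 * cnj p2) = 2"
    "2 * (p1 * cnj p2) + 2 * (q1 * cnj q2) - d * (p1 * cnj q2) - cnj d * (q1 * cnj p2) = - d"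
    "k \<in> O7" "l \<in> O7" "cnj d * p1 + d * p2 = cnj d + 2 * k" "cnj d * q1 + d * q2 = d + 2 * l" for p1 q1 p2 q2 k l
    by (rule coordsI[OF that(1-4) _ _ _ that(8-11)]) (simp_all only: inner gram that(5-7))
  have dx: "d * (cnj d * x) = 2 * x" "cnj d * (d * x) = 2 * x" for x by (simp_all add: dd flip: mult.assoc)
  have k0: "(0::complex) \<in> O7" "(- 1::complex) \<in> O7" "1 - cnj d \<in> O7" "- cnj d \<in> O7" "- d \<in> O7" "1 - d \<in> O7"
    using dO by simp_all
  from \<open>c \<in> ?C\<close> show "c \<in> coords"
  proof (elim insertE emptyE; hypsubst)
    show "(1, 0, 0, 1) \<in> coords" by (rule I[of _ _ _ _ 0 0]) (simp_all add: dO dd dx algebra_simps)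
    show "(- 1, 0, 0, - 1) \<in> coords" by (rule I[of _ _ _ _ "- cnj d" "- d"]) (simp_all add: dO dd dx algebra_simps)
    show "(1, 0, - cnj d, - 1) \<in> coords" by (rule I[of _ _ _ _ "- 1" "- d"]) (simp_all add: dO dd dx algebra_simps)
    show "(- 1, 0, cnj d, 1) \<in> coords" by (rule I[of _ _ _ _ "1 - cnj d" 0]) (simp_all add: dO dd dx algebra_simps)
    show "(1, d, - cnj d, - 1) \<in> coords" by (rule I[of _ _ _ _ "- 1" "1 - d"]) (simp_all add: dO dd dx algebra_simps)
    show "(- 1, - d, cnj d, 1) \<in> coords" by (rule I[of _ _ _ _ "1 - cnj d" "- 1"]) (simp_all add: dO dd dx algebra_simps)
    show "(1, d, 0, - 1) \<in> coords" by (rule I[of _ _ _ _ 0 "1 - d"]) (simp_all add: dO dd dx algebra_simps)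
    show "(- 1, - d, 0, 1) \<in> coords" by (rule I[of _ _ _ _ "- cnj d" "- 1"]) (simp_all add: dO dd dx algebra_simps)
  qed
qed

lemma lines_1: "finite (j_lines_through 1 (cline v))" "card (j_lines_through 1 (cline v)) = 0"
proof -
  have f: "finite ({} :: (complex \<times> complex) set)" by simp
  have 1: "r \<in> O7 \<and> s \<in> O7 \<and> (r = 1 \<or> s = 1) \<and> herm (r *s b + s *s y) (r *s b + s *s y) = of_nat 1 \<and>
      (- r, - s) \<notin> {}" if "(r, s) \<in> {}" for r s
    using that by simp
  have 2: "(r, s) \<in> {} \<or> (- r, - s) \<in> {}"
    if r: "r \<in> O7" "s \<in> O7" "primitive (r *s b + s *s y)" "herm (r *s b + s *s y) (r *s b + s *s y) = of_nat 1" for r s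
    using norm_cases(1)[OF r(1,2)] r(4) unfolding of_nat_1 by blast
  show "finite (j_lines_through 1 (cline v))" by (rule lines_list(3)[OF zero_less_one f 1 2])
  have "card (j_lines_through 1 (cline v)) = card ({} :: (complex \<times> complex) set)"
    by (rule lines_list(4)[OF zero_less_one f 1 2])
  then show "card (j_lines_through 1 (cline v)) = 0" by simp
qed

lemma lines_2:
  defines "P \<equiv> \<lambda>r s. polar_line (r *s b + s *s y)"
  shows "j_lines_through 2 (cline v) = {P 1 0, P 0 1, P 1 d, P (cnj d) 1}" "card {P 1 0, P 0 1, P 1 d, P (cnj d) 1} = 4"
proof -
  let ?C = "{(1, 0), (0, 1), (1, d), (cnj d, 1)}"
  have f: "finite ?C" by simp
  have 1: "r \<in> O7 \<and> s \<in> O7 \<and> (r = 1 \<or> s = 1) \<and> herm (r *s b + s *s y) (r *s b + s *s y) = of_nat 2 \<and> (- r, - s) \<notin> ?C"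
    if "(r, s) \<in> ?C" for r s
  proof -
    have dx: "d * (cnj d * x) = 2 * x" "cnj d * (d * x) = 2 * x" for x by (simp_all add: dd flip: mult.assoc)
    have "2 * (r * cnj r) + 2 * (s * cnj s) - d * (r * cnj s) - cnj d * (s * cnj r) = of_nat 2"
      using that by (elim insertE emptyE; simp add: dd dx)
    moreover have "r \<in> O7 \<and> s \<in> O7 \<and> (r = 1 \<or> s = 1)" using that dO by auto
    moreover have "(- r, - s) \<notin> ?C" using that d_neq by (elim insertE emptyE; simp)
    ultimately show ?thesis unfolding inner by blast
  qed
  have 2: "(r, s) \<in> ?C \<or> (- r, - s) \<in> ?C"
    if r: "r \<in> O7" "s \<in> O7" "primitive (r *s b + s *s y)" "herm (r *s b + s *s y) (r *s b + s *s y) = of_nat 2" for r s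
    using norm_cases(2)[OF r(1,2)] r(4) unfolding of_nat_numeral by auto
  have L: "j_lines_through 2 (cline v) = polar_line ` (\<lambda>(r, s). r *s b + s *s y) ` ?C"
    by (rule lines_list(1)[OF zero_less_numeral f 1 2])
  show e: "j_lines_through 2 (cline v) = {P 1 0, P 0 1, P 1 d, P (cnj d) 1}"
    unfolding L image_insert image_empty prod.case P_def by (rule refl)
  have "card (j_lines_through 2 (cline v)) = card ?C" by (rule lines_list(4)[OF zero_less_numeral f 1 2])
  then show "card {P 1 0, P 0 1, P 1 d, P (cnj d) 1} = 4" unfolding e using d_neq by simp
qed

lemma data:
  "finite (stabilizer (cline v)) \<and> card (stabilizer (cline v)) = 8 \<and>
   finite (j_lines_through 1 (cline v)) \<and> card (j_lines_through 1 (cline v)) = 0 \<and>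
   finite (j_lines_through 2 (cline v)) \<and> card (j_lines_through 2 (cline v)) = 4"
proof -
  have f: "finite coords" "card coords = 8" unfolding coords_eq using d_neq by simp_all
  have "finite (j_lines_through 2 (cline v))" unfolding lines_2(1) by simp
  moreover have "card (j_lines_through 2 (cline v)) = 4" unfolding lines_2(1) by (rule lines_2(2))
  moreover note l = calculation
  show ?thesis
    by (intro conjI stabilizer_card(1)[OF refl f(1)] stabilizer_card(2)[OF refl f(1), unfolded f(2)] lines_1 l)
qed

text \<open>The glue keeps b and b + d y apart from y and cnj d b + y. The eight isometries permute
  the lines of each pair transitively, so each pair is an orbit.\<close>

lemma line_orbits: "card (j_line_orbits 2 (cline v)) = 2" "\<forall>B\<in>j_line_orbits 2 (cline v). card B = 2"
proof -
  define P where "P = (\<lambda>r s. polar_line (r *s b + s *s y))"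
  have orb: "(\<lambda>X. act X ` P r s) ` stabilizer (cline v) =
      (\<lambda>(p1, q1, p2, q2). P (r * p1 + s * p2) (r * q1 + s * q2)) ` coords" for r s
  proof -
    have B: "act (cls B) ` P r s = P (r * p1 + s * p2) (r * q1 + s * q2)"
      if "B \<in> S" "B *v b = p1 *s b + q1 *s y" "B *v y = p2 *s b + q2 *s y" for B p1 q1 p2 q2
    proof -
      have "B *v (r *s b + s *s y) = (r * p1 + s * p2) *s b + (r * q1 + s * q2) *s y"
        by (simp add: matrix_vector_right_distrib mv_scale that(2,3) veq3 algebra_simps)
      moreover have "B \<in> U_J" using that(1) by (simp add: S_def UO_def)
      ultimately show ?thesis unfolding P_def using act_polar_line by simp
    qed
    have "stabilizer (cline v) = cls ` S" using stabilizer_eq(1)[OF neg uni_v] by (simp only: S_def)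
    then have e: "(\<lambda>X. act X ` P r s) ` stabilizer (cline v) = (\<lambda>B. act (cls B) ` P r s) ` S" by (simp only: image_image)
    show ?thesis unfolding e
    proof (intro subset_antisym subsetI)
      fix L assume "L \<in> (\<lambda>B. act (cls B) ` P r s) ` S"
      then obtain B where L: "B \<in> S" "L = act (cls B) ` P r s" by blast
      obtain p1 q1 p2 q2 where c: "(p1, q1, p2, q2) \<in> coords" "B *v b = p1 *s b + q1 *s y" "B *v y = p2 *s b + q2 *s y"
        using S_to_coords[OF L(1)] by blast
      show "L \<in> (\<lambda>(p1, q1, p2, q2). P (r * p1 + s * p2) (r * q1 + s * q2)) ` coords"
        by (rule image_eqI[OF _ c(1)]) (simp add: L(2) B[OF L(1) c(2,3)])
    next
      fix L assume "L \<in> (\<lambda>(p1, q1, p2, q2). P (r * p1 + s * p2) (r * q1 + s * q2)) ` coords"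
      then obtain p1 q1 p2 q2 where c: "(p1, q1, p2, q2) \<in> coords" "L = P (r * p1 + s * p2) (r * q1 + s * q2)" by auto
      obtain B where "B \<in> S" "B *v b = p1 *s b + q1 *s y" "B *v y = p2 *s b + q2 *s y" using coords_to_S[OF c(1)] by blast
      then show "L \<in> (\<lambda>B. act (cls B) ` P r s) ` S" using B[of B] c(2) by blast
    qed
  qed
  have "P (- r) (- s) = P r s" for r s
  proof -
    have "(- r) *s b + (- s) *s y = - (r *s b + s *s y)" by (simp add: veq3)
    then show ?thesis unfolding P_def by (simp only: polar_line_minus)
  qed
  from this[of 1 0] this[of 0 1] this[of 1 d] this[of "cnj d" 1]
  have Pm: "P (- 1) 0 = P 1 0" "P 0 (- 1) = P 0 1" "P (- 1) (- d) = P 1 d" "P (- cnj d) (- 1) = P (cnj d) 1" by simp_all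
  have o1: "(\<lambda>X. act X ` P 1 0) ` stabilizer (cline v) = {P 1 0, P 1 d}"
    unfolding orb coords_eq by (auto simp: Pm)
  have o2: "(\<lambda>X. act X ` P 0 1) ` stabilizer (cline v) = {P 0 1, P (cnj d) 1}"
    unfolding orb coords_eq by (auto simp: Pm)
  have o3: "(\<lambda>X. act X ` P 1 d) ` stabilizer (cline v) = {P 1 0, P 1 d}"
    unfolding orb coords_eq by (auto simp: Pm dd)
  have o4: "(\<lambda>X. act X ` P (cnj d) 1) ` stabilizer (cline v) = {P 0 1, P (cnj d) 1}"
    unfolding orb coords_eq by (auto simp: Pm dd)
  have c4: "card {P 1 0, P 0 1, P 1 d, P (cnj d) 1} = 4" using lines_2(2) by (simp only: P_def)
  then have ne: "P 1 0 \<noteq> P 0 1" "P 1 0 \<noteq> P 1 d" "P 1 0 \<noteq> P (cnj d) 1" "P 0 1 \<noteq> P 1 d" "P 0 1 \<noteq> P (cnj d) 1" "P 1 d \<noteq> P (cnj d) 1"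
    by (simp_all add: card_insert_if split: if_splits)
  have jl: "j_lines_through 2 (cline v) = {P 1 0, P 0 1, P 1 d, P (cnj d) 1}" unfolding P_def by (rule lines_2(1))
  have J: "j_line_orbits 2 (cline v) = {{P 1 0, P 1 d}, {P 0 1, P (cnj d) 1}}"
    unfolding j_line_orbits_def jl image_insert image_empty o1 o2 o3 o4 by blast
  show "\<forall>B\<in>j_line_orbits 2 (cline v). card B = 2" unfolding J using ne by simp
  have "{P 1 0, P 1 d} \<noteq> {P 0 1, P (cnj d) 1}" using ne by (simp add: doubleton_eq_iff)
  then show "card (j_line_orbits 2 (cline v)) = 2" unfolding J by simp
qed

end

section \<open>The fixed points of the representatives\<close>

fun rep_vec :: "label \<Rightarrow> complex^3" where
  "rep_vec E2a = vector [- cnj \<tau>, 0, 1]"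
| "rep_vec E2b = vector [-1, 0, 1]"
| "rep_vec E2c = vector [\<tau>, 1, cnj \<tau>]"
| "rep_vec E3a = vector [\<tau>, 1, - \<tau>]"
| "rep_vec E3b = vector [- cnj \<tau>, 1, cnj \<tau>]"
| "rep_vec E3c = v6"
| "rep_vec E4a = vector [-1, -1, 1]"
| "rep_vec E4b = vector [cnj \<tau>, - \<tau>, - cnj \<tau>]"
| "rep_vec E6 = v6"
| "rep_vec E7 = v7"

lemma rep_vec_vec3:
  "rep_vec E2a = vec3 (\<tau> - 1) 0 1" "rep_vec E2b = vec3 (- 1) 0 1" "rep_vec E2c = vec3 \<tau> 1 (1 - \<tau>)"
  "rep_vec E3a = vec3 \<tau> 1 (- \<tau>)" "rep_vec E3b = vec3 (\<tau> - 1) 1 (1 - \<tau>)"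
  "rep_vec E4a = vec3 (- 1) (- 1) 1" "rep_vec E4b = vec3 (1 - \<tau>) (- \<tau>) (\<tau> - 1)"
  by (simp_all add: vec3_def cnj_tau)

fun rep_ev :: "label \<Rightarrow> complex" where
  "rep_ev E3c = mu6" | "rep_ev E6 = - mu6" | "rep_ev E7 = - lam7" | "rep_ev _ = - 1"

lemma cmod_rep_ev: "cmod (rep_ev i) = 1"
  by (cases i) (simp_all add: cmod_mu6 cmod_lam7)

text \<open>In this and the following instances the basis of the complement and the vector x are
  those with which the classification compares an arbitrary element.\<close>

lemma basis_E2a: "vector_norm_1 (rep_vec E2a) (- rep_vec E2a) (vec3 \<tau> 0 1) (vec3 0 1 0)"
  unfolding rep_vec_vec3
  by unfold_locales ((simp add: vec3_simps det_3 tau_simps)?; (simp add: tau_simps algebra_simps; fail)?)+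

lemma basis_E4a: "vector_norm_1 (rep_vec E4a) (- rep_vec E4a) (vec3 (- 1) (- 1) 0) (vec3 0 1 (- 1))"
  unfolding rep_vec_vec3
  by unfold_locales ((simp add: vec3_simps det_3 tau_simps)?; (simp add: tau_simps algebra_simps; fail)?)+

lemma basis_E2b: "vector_norm_2_split (rep_vec E2b) (vec3 1 0 0) (vec3 0 1 0) (vec3 1 0 1)"
  unfolding rep_vec_vec3
  by unfold_locales ((simp add: vec3_simps det_3 tau_simps)?; (simp add: tau_simps algebra_simps; fail)?)+

lemma basis_E2c: "vector_norm_2_tau (rep_vec E2c) (vec3 0 1 0) (vec3 0 (\<tau> - 1) 1) (vec3 1 (- \<tau>) 0) \<tau>"
  unfolding rep_vec_vec3
  by unfold_locales ((simp add: vec3_simps det_3 tau_simps)?; (simp add: tau_simps algebra_simps; fail)?)+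

lemma basis_E4b: "vector_norm_2_tau (rep_vec E4b) (vec3 \<tau> 1 0) (vec3 (- 1) 0 (- 1)) (vec3 (1 - \<tau>) (- \<tau>) 0) \<tau>"
  unfolding rep_vec_vec3
  by unfold_locales ((simp add: vec3_simps det_3 tau_simps)?; (simp add: tau_simps algebra_simps; fail)?)+

lemma basis_E3a: "vector_norm_3 (rep_vec E3a) (vec3 (- \<tau>) (- 1) 0) (vec3 (- 1) (\<tau> - 1) 0) (vec3 1 0 1) \<tau>"
  unfolding rep_vec_vec3
  by unfold_locales ((simp add: vec3_simps det_3 tau_simps)?; (simp add: tau_simps algebra_simps; fail)?)+

lemma basis_E3b: "vector_norm_3 (rep_vec E3b) (vec3 0 (- 1) (\<tau> - 1)) (vec3 (- 1) 0 (- 1)) (vec3 0 \<tau> 1) (1 - \<tau>)"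
  unfolding rep_vec_vec3
  by unfold_locales ((simp add: vec3_simps det_3 tau_simps)?; (simp add: tau_simps algebra_simps; fail)?)+

lemmas complement_bases = basis_E2a[THEN vector_norm_1.axioms(1)] basis_E4a[THEN vector_norm_1.axioms(1)]
  basis_E2b[THEN vector_norm_2_split.axioms(1)] basis_E2c[THEN vector_norm_2_tau.axioms(1)]
  basis_E4b[THEN vector_norm_2_tau.axioms(1)] basis_E3a[THEN vector_norm_3.axioms(1)]
  basis_E3b[THEN vector_norm_3.axioms(1)]

lemma rep_vec_neg: "rep_vec i \<in> negative"
  using complement_bases[THEN negative_vector.neg] v6_neg v7_neg by (cases i) (simp_all only: rep_vec.simps)

lemma uni_rep_vec: "i \<notin> {E3c, E6, E7} \<Longrightarrow> uni (rep_vec i)"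
  using complement_bases[THEN negative_vector.uni_v] by (cases i) simp_all

lemma rep_vec_norm:
  "herm (rep_vec E2a) (rep_vec E2a) = - 1" "herm (rep_vec E2b) (rep_vec E2b) = - 2" "herm (rep_vec E2c) (rep_vec E2c) = - 2"
  "herm (rep_vec E3a) (rep_vec E3a) = - 3" "herm (rep_vec E3b) (rep_vec E3b) = - 3"
  "herm (rep_vec E4a) (rep_vec E4a) = - 1" "herm (rep_vec E4b) (rep_vec E4b) = - 2"
  using complement_bases[THEN negative_vector.vv] by (simp_all only:)

lemma rep_vec_eigen: "rep i *v rep_vec i = rep_ev i *s rep_vec i"
  using v6_eigen v7_eigen(2)
  by (cases i) (simp_all only: rep_vec.simps(6,9,10) rep_ev.simps rep_vec_vec3 vec3_simps, simp_all add: tau_simps algebra_simps)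

lemma rep_eigenspace:
  assumes "rep i *v vec3 a b c = (- 1) *s vec3 a b c"
  shows "i = E2a \<Longrightarrow> vec3 a b c = c *s vec3 (\<tau> - 1) 0 1"
    "i = E2b \<Longrightarrow> vec3 a b c = c *s vec3 (- 1) 0 1"
    "i = E2c \<Longrightarrow> vec3 a b c = b *s vec3 \<tau> 1 (1 - \<tau>)"
    "i = E3a \<Longrightarrow> vec3 a b c = b *s vec3 \<tau> 1 (- \<tau>)"
    "i = E3b \<Longrightarrow> vec3 a b c = b *s vec3 (\<tau> - 1) 1 (1 - \<tau>)"
    "i = E4a \<Longrightarrow> vec3 a b c = c *s vec3 (- 1) (- 1) 1"
    "i = E4b \<Longrightarrow> 2 * m = \<tau> * a \<Longrightarrow> vec3 a b c = m *s vec3 (1 - \<tau>) (- \<tau>) (\<tau> - 1)"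
proof -
  \<comment> \<open>Each coordinate follows from the three equations of an eigenvector by an
    explicit linear combination; k, m1, m2, m3 are its coefficients.\<close>
  have lin: "L = R" if "l1 = r1" "l2 = r2" "l3 = r3" "k \<noteq> 0" "k * (L - R) = m1 * (l1 - r1) + m2 * (l2 - r2) + m3 * (l3 - r3)"
    for l1 r1 l2 r2 l3 r3 k L R m1 m2 m3 :: complex
    using that by simp
  show "vec3 a b c = c *s vec3 (\<tau> - 1) 0 1" if i: "i = E2a"
  proof -
    note h = assms[unfolded i vec3_simps]
    note e = h[THEN conjunct1] h[THEN conjunct2, THEN conjunct1] h[THEN conjunct2, THEN conjunct2]
    show ?thesis unfolding vec3_simps
    proof (intro conjI)
      show "a = c * (\<tau> - 1)" by (rule lin[OF e, of 2 _ _ 0 0 1]) (simp_all add: tau_simps algebra_simps)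
      show "b = c * 0" by (rule lin[OF e, of 2 _ _ 0 1 0]) (simp_all add: tau_simps algebra_simps)
      show "c = c * 1" by simp
    qed
  qed
  show "vec3 a b c = c *s vec3 (- 1) 0 1" if i: "i = E2b"
  proof -
    note h = assms[unfolded i vec3_simps]
    note e = h[THEN conjunct1] h[THEN conjunct2, THEN conjunct1] h[THEN conjunct2, THEN conjunct2]
    show ?thesis unfolding vec3_simps
    proof (intro conjI)
      show "a = c * (- 1)" by (rule lin[OF e, of 1 _ _ 1 0 0]) (simp_all add: tau_simps algebra_simps)
      show "b = c * 0" by (rule lin[OF e, of 2 _ _ 0 1 0]) (simp_all add: tau_simps algebra_simps)
      show "c = c * 1" by simp
    qed
  qed
  show "vec3 a b c = b *s vec3 \<tau> 1 (1 - \<tau>)" if i: "i = E2c"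
  proof -
    note h = assms[unfolded i vec3_simps]
    note e = h[THEN conjunct1] h[THEN conjunct2, THEN conjunct1] h[THEN conjunct2, THEN conjunct2]
    show ?thesis unfolding vec3_simps
    proof (intro conjI)
      show "a = b * \<tau>" by (rule lin[OF e, of 2 _ _ 1 "- \<tau>" 0]) (simp_all add: tau_simps algebra_simps)
      show "b = b * 1" by simp
      show "c = b * (1 - \<tau>)" by (rule lin[OF e, of 4 _ _ "2 - \<tau>" "\<tau> - 2" 0]) (simp_all add: tau_simps algebra_simps)
    qed
  qed
  show "vec3 a b c = b *s vec3 \<tau> 1 (- \<tau>)" if i: "i = E3a"
  proof -
    note h = assms[unfolded i vec3_simps]
    note e = h[THEN conjunct1] h[THEN conjunct2, THEN conjunct1] h[THEN conjunct2, THEN conjunct2]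
    show ?thesis unfolding vec3_simps
    proof (intro conjI)
      show "a = b * \<tau>" by (rule lin[OF e, of 1 _ _ "- 1" 0 1]) (simp_all add: tau_simps algebra_simps)
      show "b = b * 1" by simp
      show "c = b * (- \<tau>)" by (rule lin[OF e, of 1 _ _ 1 0 0]) (simp_all add: tau_simps algebra_simps)
    qed
  qed
  show "vec3 a b c = b *s vec3 (\<tau> - 1) 1 (1 - \<tau>)" if i: "i = E3b"
  proof -
    note h = assms[unfolded i vec3_simps]
    note e = h[THEN conjunct1] h[THEN conjunct2, THEN conjunct1] h[THEN conjunct2, THEN conjunct2]
    show ?thesis unfolding vec3_simps
    proof (intro conjI)
      show "a = b * (\<tau> - 1)" by (rule lin[OF e, of 1 _ _ "- 1" 0 1]) (simp_all add: tau_simps algebra_simps)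
      show "b = b * 1" by simp
      show "c = b * (1 - \<tau>)" by (rule lin[OF e, of 1 _ _ 1 0 0]) (simp_all add: tau_simps algebra_simps)
    qed
  qed
  show "vec3 a b c = c *s vec3 (- 1) (- 1) 1" if i: "i = E4a"
  proof -
    note h = assms[unfolded i vec3_simps]
    note e = h[THEN conjunct1] h[THEN conjunct2, THEN conjunct1] h[THEN conjunct2, THEN conjunct2]
    show ?thesis unfolding vec3_simps
    proof (intro conjI)
      show "a = c * (- 1)" by (rule lin[OF e, of 1 _ _ 1 0 0]) (simp_all add: tau_simps algebra_simps)
      show "b = c * (- 1)" by (rule lin[OF e, of 2 _ _ 0 1 0]) (simp_all add: tau_simps algebra_simps)
      show "c = c * 1" by simp
    qed
  qed
  show "vec3 a b c = m *s vec3 (1 - \<tau>) (- \<tau>) (\<tau> - 1)" if i: "i = E4b" and m: "2 * m = \<tau> * a"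
  proof -
    note h = assms[unfolded i vec3_simps]
    note e = h[THEN conjunct1] h[THEN conjunct2, THEN conjunct1] m
    show ?thesis unfolding vec3_simps
    proof (intro conjI)
      show "a = m * (1 - \<tau>)" by (rule lin[OF e, of 2 _ _ 0 0 "\<tau> - 1"]) (simp_all add: tau_simps algebra_simps)
      show "b = m * (- \<tau>)" by (rule lin[OF e, of 2 _ _ "\<tau> - 2" 1 \<tau>]) (simp_all add: tau_simps algebra_simps)
      show "c = m * (\<tau> - 1)" by (rule lin[OF e, of 2 _ _ 2 0 "1 - \<tau>"]) (simp_all add: tau_simps algebra_simps)
    qed
  qed
qed

lemma rep_eigenvectors:
  assumes "rep i *v x = rep_ev i *s x" shows "\<exists>m. x = m *s rep_vec i"
proof -
  obtain a b c where x: "x = vec3 a b c" using vec3_eta by blast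
  have m: "2 * (\<tau> * a / 2) = \<tau> * a" by simp
  note e = rep_eigenspace[of i a b c, folded x rep_vec_vec3]
  show ?thesis
  proof (cases i)
    case E3c
    then show ?thesis using eigenvectors_v6(1)[of x] assms by simp
  next
    case E6
    then show ?thesis using eigenvectors_v6(2)[of x] assms by simp
  next
    case E7
    then show ?thesis using eigenvectors_v7[of x] assms by simp
  next
    case E2a
    then show ?thesis using e(1) assms by auto
  next
    case E2b
    then show ?thesis using e(2) assms by auto
  next
    case E2c
    then show ?thesis using e(3) assms by auto
  next
    case E3a
    then show ?thesis using e(4) assms by auto
  next
    case E3b
    then show ?thesis using e(5) assms by auto
  next
    case E4a
    then show ?thesis using e(6) assms by auto
  next
    case E4b
    have "rep i *v x = (- 1) *s x" using assms unfolding E4b by simp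
    from e(7)[OF this E4b m] show ?thesis unfolding E4b by blast
  qed
qed

lemma rep_fixed_point:
  "fixed_points (cls (rep i)) = {cline (rep_vec i)}" "isolated_fixed_point (cls (rep i)) (cline (rep_vec i))"
  using fixed_point_unique[OF UO_rep rep_vec_neg rep_vec_eigen cmod_rep_ev rep_eigenvectors] by blast+

lemma K_rowI:
  assumes "i \<notin> {E3c, E6, E7}" "herm (rep_vec i) (rep_vec i) = q" "group.ord \<Gamma> (cls (rep i)) = r"
    and "finite (stabilizer (cline (rep_vec i))) \<and> card (stabilizer (cline (rep_vec i))) = s \<and>
      finite (j_lines_through 1 (cline (rep_vec i))) \<and> card (j_lines_through 1 (cline (rep_vec i))) = n1 \<and>
      finite (j_lines_through 2 (cline (rep_vec i))) \<and> card (j_lines_through 2 (cline (rep_vec i))) = n2"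
  shows "K_row i r (rep_vec i) q s n1 n2"
  unfolding K_row_def fixed_point_data_def
  using assms(2-4) rep_fixed_point[of i] uni_imp_primitive[OF uni_rep_vec[OF assms(1)]] by simp

lemma K_rows:
  "K_row E2a 2 (rep_vec E2a) (-1) 8 2 2" "K_row E2b 2 (rep_vec E2b) (-2) 4 1 1" "K_row E2c 2 (rep_vec E2c) (-2) 8 0 4"
  "K_row E3a 3 (rep_vec E3a) (-3) 6 0 3" "K_row E3b 3 (rep_vec E3b) (-3) 6 0 3"
  "K_row E4a 4 (rep_vec E4a) (-1) 8 2 2" "K_row E4b 4 (rep_vec E4b) (-2) 8 0 4"
  by (rule K_rowI[OF _ rep_vec_norm(1) ord_rep(1) vector_norm_1.data[OF basis_E2a]], simp)
    (rule K_rowI[OF _ rep_vec_norm(2) ord_rep(2) vector_norm_2_split.data[OF basis_E2b]], simp,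
     rule K_rowI[OF _ rep_vec_norm(3) ord_rep(3) vector_norm_2_tau.data[OF basis_E2c]], simp,
     rule K_rowI[OF _ rep_vec_norm(4) ord_rep(4) vector_norm_3.data[OF basis_E3a]], simp,
     rule K_rowI[OF _ rep_vec_norm(5) ord_rep(5) vector_norm_3.data[OF basis_E3b]], simp,
     rule K_rowI[OF _ rep_vec_norm(6) ord_rep(7) vector_norm_1.data[OF basis_E4a]], simp,
     rule K_rowI[OF _ rep_vec_norm(7) ord_rep(8) vector_norm_2_tau.data[OF basis_E4b]], simp)

section \<open>The representatives are pairwise not conjugate\<close>

lemma eigenline_generate:
  assumes M: "M \<in> UO" "M *v w = c *s w" "cmod c = 1" and X: "X \<in> generate \<Gamma> {cls M}"
  shows "\<exists>N\<in>UO. \<exists>d. cmod d = 1 \<and> N *v w = d *s w \<and> X = cls N"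
  using X
proof (induction rule: generate.induct)
  case one
  show ?case by (rule bexI[of _ "mat 1"], rule exI[of _ 1]) (simp_all add: cls_one)
next
  case (incl h)
  then show ?case using M by auto
next
  case (inv h)
  have "inv\<^bsub>\<Gamma>\<^esub> h = cls (uinv M)" using inv cls_inv[OF M(1)] by simp
  moreover have "uinv M *v w = cnj c *s w" by (rule uinv_fixed[OF UO_D(1)[OF M(1)] M(2,3)])
  moreover have "cmod (cnj c) = 1" using M(3) by simp
  ultimately show ?case using UO_uinv[OF M(1)] by blast
next
  case (eng h1 h2)
  obtain N1 d1 where 1: "N1 \<in> UO" "cmod d1 = 1" "N1 *v w = d1 *s w" "h1 = cls N1" using eng.IH(1) by blast
  obtain N2 d2 where 2: "N2 \<in> UO" "cmod d2 = 1" "N2 *v w = d2 *s w" "h2 = cls N2" using eng.IH(2) by blast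
  have "h1 \<otimes>\<^bsub>\<Gamma>\<^esub> h2 = cls (N1 ** N2)" using 1 2 by (simp add: cls_mult)
  moreover have "(N1 ** N2) *v w = (d2 * d1) *s w" by (simp add: 1(3) 2(3) mv_scale flip: matrix_vector_mul_assoc)
  moreover have "cmod (d2 * d1) = 1" using 1(2) 2(2) by (simp add: norm_mult)
  ultimately show ?case using UO_mult[OF 1(1) 2(1)] by blast
qed

text \<open>Conjugate cyclic groups have equal order, and the conjugating isometry carries the
  unique fixed point of the first generator to that of the second.\<close>

lemma conj_cyclic_rep:
  assumes "conj_cyclic (cls (rep i)) (cls (rep j))"
  shows "group.ord \<Gamma> (cls (rep i)) = group.ord \<Gamma> (cls (rep j))"
    and "\<exists>H\<in>UO. cline (H *v rep_vec i) = cline (rep_vec j)"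
proof -
  let ?Y = "cls (rep i)" and ?Z = "cls (rep j)"
  have Y: "?Y \<in> carrier \<Gamma>" "?Z \<in> carrier \<Gamma>" by (simp_all add: UO_rep)
  obtain G where G: "G \<in> carrier \<Gamma>" "conjg G ` generate \<Gamma> {?Y} = generate \<Gamma> {?Z}"
    using assms conj_cyclic_iff by blast
  have inj: "inj_on (conjg G) (generate \<Gamma> {?Y})"
  proof (rule inj_on_inverseI[where g = "conjg (inv\<^bsub>\<Gamma>\<^esub> G)"])
    fix X assume "X \<in> generate \<Gamma> {?Y}"
    then have "X \<in> carrier \<Gamma>" using generate_carrier[OF Y(1)] by blast
    then show "conjg (inv\<^bsub>\<Gamma>\<^esub> G) (conjg G X) = X" using G(1) by (subst conjg_compose) (auto simp: conjg_one)
  qed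
  have "card (generate \<Gamma> {?Y}) = card (generate \<Gamma> {?Z})" unfolding G(2)[symmetric] by (rule card_image[OF inj, symmetric])
  then show "Gm.ord ?Y = Gm.ord ?Z" unfolding Gm.generate_pow_card[OF Y(1)] Gm.generate_pow_card[OF Y(2)] .
  obtain H where H: "H \<in> UO" "G = cls H" using G(1) by (auto simp: carrier_Gamma)
  define M where "M = H ** rep i ** uinv H"
  have M: "M \<in> UO" unfolding M_def by (intro UO_mult H(1) UO_rep UO_uinv)
  have "conjg G ?Y = cls M" unfolding conjg_def H(2) M_def
    using H(1) by (simp add: cls_inv cls_mult UO_rep UO_uinv UO_mult)
  then have gen: "generate \<Gamma> {cls M} = generate \<Gamma> {?Z}" using generate_conjg[OF G(1) Y(1)] G(2) by simp
  let ?w = "H *v rep_vec i"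
  have HU: "H \<in> U_J" using H(1) by (rule UO_D(1))
  have Mw: "M *v ?w = rep_ev i *s ?w"
    unfolding M_def by (simp add: uinv_vec[OF HU] rep_vec_eigen mv_scale flip: matrix_vector_mul_assoc)
  have "?Z \<in> generate \<Gamma> {cls M}" unfolding gen by (rule generate.incl) simp
  then obtain N d where N: "N \<in> UO" "cmod d = 1" "N *v ?w = d *s ?w" "?Z = cls N"
    using eigenline_generate[OF M Mw cmod_rep_ev] by blast
  have wn: "?w \<in> negative" using rep_vec_neg[of i] U_J_herm[OF HU] by (simp add: negative_def)
  have "d \<noteq> 0" using N(2) by auto
  then have "act ?Z (cline ?w) = cline ?w" unfolding N(4) act_cls N(3) by (rule cline_scale)
  then have "cline ?w \<in> fixed_points ?Z" using wn by (simp add: fixed_points_def H2_def)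
  then show "\<exists>H\<in>UO. cline (H *v rep_vec i) = cline (rep_vec j)" using H(1) unfolding rep_fixed_point by blast
qed

text \<open>The scalar between two unimodular vectors on the same line is a unit of
  \<open>O7\<close>, and its sign can be moved into H. Thus norm, complement and glue of the fixed
  vector become invariants of the class.\<close>

lemma conj_cyclic_rep_uni:
  assumes c: "conj_cyclic (cls (rep i)) (cls (rep j))" and u: "uni (rep_vec i)" "uni (rep_vec j)"
  shows "\<exists>H\<in>UO. H *v rep_vec i = rep_vec j"
proof -
  obtain H where H: "H \<in> UO" "cline (H *v rep_vec i) = cline (rep_vec j)" using conj_cyclic_rep(2)[OF c] by blast
  have HU: "H \<in> U_J" using H(1) by (rule UO_D(1))
  obtain g where g: "g \<noteq> 0" "rep_vec j = g *s (H *v rep_vec i)"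
    using cline_eq_iff[OF negative_nonzero[OF rep_vec_neg]] H(2) by metis
  have "uinv H *v rep_vec j = g *s rep_vec i" unfolding g(2) mv_scale uinv_vec[OF HU] ..
  then have "g *s rep_vec i \<in> O7v" using O7v_A[OF UO_uinv[OF H(1)] uni_O7v[OF u(2)]] by simp
  then have gO: "g \<in> O7" by (rule uni_scale_O7[OF u(1)])
  have "(1 / g) *s rep_vec j = H *v rep_vec i" unfolding g(2) using g(1) by simp
  then have "(1 / g) *s rep_vec j \<in> O7v" using O7v_A[OF H(1) uni_O7v[OF u(1)]] by simp
  then have "1 / g \<in> O7" by (rule uni_scale_O7[OF u(2)])
  moreover have "g * (1 / g) = 1" using g(1) by simp
  ultimately have "g = 1 \<or> g = - 1" using O7_unit_mult[OF gO] by blast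
  then show ?thesis
  proof
    assume "g = 1"
    then show ?thesis using H(1) g(2) by auto
  next
    assume "g = - 1"
    then have "(- H) *v rep_vec i = rep_vec j" using g(2) by simp
    then show ?thesis using UO_minus[OF H(1)] by blast
  qed
qed

text \<open>An isometry between two vectors of norm \<open>- 3\<close> maps the norm 2 vectors of one complement to those of
  the other, so it can only identify the glue coefficients \<open>a\<close> and \<open>a'\<close> modulo 3 up to an integer factor.\<close>

lemma norm_3_invariant:
  assumes L: "vector_norm_3 v x b y a" and L': "vector_norm_3 v' x' b' y' a'" and H: "H \<in> UO" "H *v v = v'"
  shows "\<exists>m::int. \<exists>k\<in>O7. 3 * k = a * of_int m - a'"
proof -
  interpret L: vector_norm_3 v x b y a by (rule L)
  interpret L': vector_norm_3 v' x' b' y' a' by (rule L')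
  note h = U_J_herm[OF UO_D(1)[OF H(1)]]
  have perp: "herm (H *v z) v' = herm z v" for z unfolding H(2)[symmetric] by (rule h)
  have *: "\<exists>i::int. \<exists>q. H *v z = of_int i *s b' + q *s y'" if z: "z \<in> O7v" "herm z v = 0" "herm z z = 2" for z
  proof -
    obtain r s where r: "r \<in> O7" "s \<in> O7" "H *v z = r *s b' + s *s y'"
      using L'.span[OF O7v_A[OF H(1) z(1)]] perp[of z] z(2) by auto
    have "herm (r *s b' + s *s y') (r *s b' + s *s y') = 2" unfolding r(3)[symmetric] h by (rule z(3))
    from O7_hexagonal_norm(2)[OF r(1,2) this[unfolded L'.nrm]]
    have "r = of_int 0 \<or> r = of_int 1 \<or> r = of_int (- 1)" by auto
    then show ?thesis using r(3) by blast
  qed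
  obtain i q where i: "H *v b = of_int i *s b' + q *s y'" using *[OF L.O(3) L.bv L.gram(1)] by blast
  obtain j s where j: "H *v y = of_int j *s b' + s *s y'" using *[OF L.O(4) L.yv L.gram(2)] by blast
  have d: "H *v x - x' \<in> O7v" "herm (H *v x - x') v' = 0"
    using O7v_A[OF H(1) L.O(2)] L'.O(2) by (simp_all add: perp L.xv L'.xv)
  obtain k l where k: "k \<in> O7" "H *v x - x' = k *s b' + l *s y'" using L'.span[OF d] by blast
  have "3 *s (H *v x) = a *s (H *v b) + (- a) *s (H *v y) - v'"
    using arg_cong[OF L.glue, of "\<lambda>z. H *v z"]
    by (simp only: mv_scale matrix_vector_mult_diff_distrib matrix_vector_right_distrib H(2))
  then have "3 *s (H *v x - x') = (a * of_int i - a * of_int j - a') *s b' + (a * q - a * s + a') *s y'"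
    unfolding vector_ssub_ldistrib L'.glue i j by (simp add: veq3 algebra_simps)
  moreover have "3 *s (H *v x - x') = (3 * k) *s b' + (3 * l) *s y'" unfolding k(2) by (simp add: veq3 algebra_simps)
  ultimately have "3 * k = a * of_int i - a * of_int j - a'" using L'.coords_unique by metis
  then have "3 * k = a * of_int (i - j) - a'" by (simp add: right_diff_distrib)
  then show ?thesis using k(1) by blast
qed

text \<open>The separating invariants are the order, the norm of the fixed vector, a vector of norm
  1 in its complement for \<open>E2b\<close> against \<open>E2c\<close>, the field of definition of
  the fixed point for \<open>E3c\<close>, and the glue modulo 3 for \<open>E3a\<close> against
  \<open>E3b\<close>.\<close>

lemma rep_unique: "conj_cyclic (cls (rep i)) (cls (rep j)) \<Longrightarrow> i = j"
proof -
  assume c: "conj_cyclic (cls (rep i)) (cls (rep j))"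
  have nrm: "herm (rep_vec i) (rep_vec i) = herm (rep_vec j) (rep_vec j)"
    if c: "conj_cyclic (cls (rep i)) (cls (rep j))" and u: "i \<notin> {E3c, E6, E7}" "j \<notin> {E3c, E6, E7}" for i j
  proof -
    obtain H where "H \<in> UO" "H *v rep_vec i = rep_vec j"
      using conj_cyclic_rep_uni[OF c uni_rep_vec[OF u(1)] uni_rep_vec[OF u(2)]] by blast
    then show ?thesis using U_J_herm[OF UO_D(1), of H "rep_vec i" "rep_vec i"] by simp
  qed
  have n1: "\<not> conj_cyclic (cls (rep E2a)) (cls (rep E2b))" "\<not> conj_cyclic (cls (rep E2a)) (cls (rep E2c))"
    "\<not> conj_cyclic (cls (rep E4a)) (cls (rep E4b))"
    using nrm[of E2a E2b] nrm[of E2a E2c] nrm[of E4a E4b] unfolding rep_vec_norm by auto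
  have n2: "\<not> conj_cyclic (cls (rep E2b)) (cls (rep E2c))"
  proof
    assume "conj_cyclic (cls (rep E2b)) (cls (rep E2c))"
    then obtain H where H: "H \<in> UO" "H *v rep_vec E2b = rep_vec E2c"
      using conj_cyclic_rep_uni[of E2b E2c] uni_rep_vec by blast
    interpret L: vector_norm_2_split "rep_vec E2b" "vec3 1 0 0" "vec3 0 1 0" "vec3 1 0 1" by (rule basis_E2b)
    interpret L': vector_norm_2_tau "rep_vec E2c" "vec3 0 1 0" "vec3 0 (\<tau> - 1) 1" "vec3 1 (- \<tau>) 0" \<tau> by (rule basis_E2c)
    note h = U_J_herm[OF UO_D(1)[OF H(1)]]
    have 0: "herm (H *v vec3 0 1 0) (rep_vec E2c) = 0" unfolding H(2)[symmetric] h by (rule L.bv)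
    obtain r s where r: "r \<in> O7" "s \<in> O7" "H *v vec3 0 1 0 = r *s vec3 0 (\<tau> - 1) 1 + s *s vec3 1 (- \<tau>) 0"
      using L'.span[OF O7v_A[OF H(1) L.O(3)] 0] by blast
    have "herm (H *v vec3 0 1 0) (H *v vec3 0 1 0) = 1" unfolding h by (rule L.gram(1))
    then show False using L'.norm_cases(1)[OF r(1,2)] unfolding r(3) by blast
  qed
  have n3: "\<not> conj_cyclic (cls (rep i)) (cls (rep E3c))" if "i \<notin> {E3c, E6, E7}" for i
  proof
    assume "conj_cyclic (cls (rep i)) (cls (rep E3c))"
    then obtain H where H: "H \<in> UO" "cline (H *v rep_vec i) = cline (rep_vec E3c)" using conj_cyclic_rep(2) by blast
    have "\<forall>k. (H *v rep_vec i) $ k \<in> K"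
      using O7v_nth[OF O7v_A[OF H(1) uni_O7v[OF uni_rep_vec[OF that]]]] by (simp add: O7_def)
    then have "\<exists>w. (\<forall>k. w $ k \<in> K) \<and> cline v6 = cline w" using H(2) unfolding rep_vec.simps by metis
    then show False using not_over_K[OF UO_rep v6_neg v6_eigen(1) cmod_mu6 mu6_neq] by blast
  qed
  have n4: "\<not> conj_cyclic (cls (rep E3a)) (cls (rep E3b))"
  proof
    assume "conj_cyclic (cls (rep E3a)) (cls (rep E3b))"
    then obtain H where H: "H \<in> UO" "H *v rep_vec E3a = rep_vec E3b"
      using conj_cyclic_rep_uni[of E3a E3b] uni_rep_vec by blast
    obtain m :: int and k where k: "k \<in> O7" "3 * k = \<tau> * of_int m - (1 - \<tau>)"
      using norm_3_invariant[OF basis_E3a basis_E3b H] by blast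
    \<comment> \<open>No integer multiple of \<tau> is congruent to 1 - \<tau> modulo 3: the
      coefficient of 1 would give 3 p = -1.\<close>
    obtain p q :: int where "k = of_int p + of_int q * \<tau>" using k(1) by (rule O7E)
    then have "of_real (of_int (3 * p)) + of_real (of_int (3 * q)) * \<tau> = of_real (of_int (- 1)) + of_real (of_int (m + 1)) * \<tau>"
      using k(2) by (simp add: algebra_simps)
    then have "real_of_int (3 * p) = of_int (- 1)" unfolding lin_tau_eq_iff by blast
    then have "3 * p = - 1" by (simp only: of_int_eq_iff)
    then show False by presburger
  qed
  have sym: "conj_cyclic (cls (rep j)) (cls (rep i))" if "conj_cyclic (cls (rep i)) (cls (rep j))" for i j
    by (rule conj_cyclic_sym[OF _ that]) (simp add: UO_rep)
  note n = n1 n2 n3[of E3a] n3[of E3b] n4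
  show "i = j"
    using c sym[OF c] conj_cyclic_rep(1)[OF c] n by (cases i; cases j; simp add: ord_rep)
qed

theorem mainTheorem2:
  shows "(\<forall>i. rep i \<in> carrier UJO7 \<and> torsion (cls (rep i))) \<and>
    (\<forall>X. torsion X \<and> (\<exists>p. isolated_fixed_point X p) \<longrightarrow>
       (\<exists>!i. conj_cyclic X (cls (rep i)))) \<and>
    (\<forall>X i. torsion X \<and> (\<exists>p. isolated_fixed_point X p) \<and>
       i \<notin> {E3c, E6, E7} \<and> conj_cyclic X (cls (rep i)) \<longrightarrow> conj_elements X (cls (rep i))) \<and>
    K_row E2a 2 (vector [- cnj \<tau>, 0, 1]) (-1) 8 2 2 \<and>
    K_row E2b 2 (vector [-1, 0, 1]) (-2) 4 1 1 \<and>
    K_row E2c 2 (vector [\<tau>, 1, cnj \<tau>]) (-2) 8 0 4 \<and>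
    K_row E3a 3 (vector [\<tau>, 1, - \<tau>]) (-3) 6 0 3 \<and>
    K_row E3b 3 (vector [- cnj \<tau>, 1, cnj \<tau>]) (-3) 6 0 3 \<and>
    non_K_row E3c 3 6 1 0 \<and>
    K_row E4a 4 (vector [-1, -1, 1]) (-1) 8 2 2 \<and>
    K_row E4b 4 (vector [cnj \<tau>, - \<tau>, - cnj \<tau>]) (-2) 8 0 4 \<and>
    card (j_line_orbits 2 (cline (vector [cnj \<tau>, - \<tau>, - cnj \<tau>]))) = 2 \<and>
    (\<forall>B \<in> j_line_orbits 2 (cline (vector [cnj \<tau>, - \<tau>, - cnj \<tau>])). card B = 2) \<and>
    non_K_row E6 6 6 1 0 \<and>
    non_K_row E7 7 7 0 0"
proof (intro conjI)
  show "\<forall>i. rep i \<in> carrier UJO7 \<and> torsion (cls (rep i))"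
    by (simp add: carrier_UJO7 UO_rep torsion_rep)
  show "\<forall>X. torsion X \<and> (\<exists>p. isolated_fixed_point X p) \<longrightarrow> (\<exists>!i. conj_cyclic X (cls (rep i)))"
  proof (intro allI impI, elim conjE exE)
    fix X p assume X: "torsion X" "isolated_fixed_point X p"
    have C: "X \<in> carrier \<Gamma>" using X(1) by (simp add: torsion_def)
    obtain i where i: "conj_cyclic X (cls (rep i))" using classification_existence[OF X] by blast
    show "\<exists>!i. conj_cyclic X (cls (rep i))"
    proof (rule ex1I)
      show "conj_cyclic X (cls (rep i))" by (rule i)
      fix j assume "conj_cyclic X (cls (rep j))"
      then have "conj_cyclic (cls (rep j)) (cls (rep i))"
        using conj_cyclic_trans[OF _ conj_cyclic_sym[OF C] i, of "cls (rep j)"] by (simp add: UO_rep)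
      then show "j = i" by (rule rep_unique)
    qed
  qed
  show "\<forall>X i. torsion X \<and> (\<exists>p. isolated_fixed_point X p) \<and> i \<notin> {E3c, E6, E7} \<and> conj_cyclic X (cls (rep i))
      \<longrightarrow> conj_elements X (cls (rep i))"
    using conj_elements_of_cyclic by (simp add: torsion_def)
  note orbits = vector_norm_2_tau.line_orbits[OF basis_E4b, unfolded rep_vec.simps]
  show "card (j_line_orbits 2 (cline (vector [cnj \<tau>, - \<tau>, - cnj \<tau>]))) = 2"
    "\<forall>B \<in> j_line_orbits 2 (cline (vector [cnj \<tau>, - \<tau>, - cnj \<tau>])). card B = 2"
    by (rule orbits(1)) (rule orbits(2))
qed (rule K_rows[unfolded rep_vec.simps] row_E3c_E6 row_E7)+

end
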